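(* Let $2\le k<\infty$ and let the regularized system near the fold line $l^-$ be as in the context. If $\beta>0$ (the visible fold), then the continuation $M_{a,2}(\epsilon)$ of the attracting slow manifold intersects $y=0$ (corresponding to $y=-1$ before the shift $y\mapsto 1+y$) in a curve, parametrized by $z<0$, $$x=\epsilon^{k/(2k-1)}\left(\eta+\mathcal O\big(\epsilon^{1/(2(2k-1))}\big)\right)=\mathcal O\left(\epsilon^{k/(2k-1)}(-\phi^{[k]}z)^{-1/(2k-1)}\right),$$ where $$\eta=\eta(z,k,\phi^{[k]})=2^{1/(2k-1)}\left(|b|^{-1/(2k-1)}|\beta|^{-(k-1)/(2k-1)}+\mathcal O(z)\right)(-\phi^{[k]}z)^{-1/(2k-1)}\,\tilde\eta(k).$$
   Context: Setting. In coordinates $(x,y,z)$ near $0\in\mathbb R^3$ a piecewise smooth vector field equals $X^+$ for $y>0$ and $X^-$ for $y<0$, with $$X^+=\big(|\beta|^{-1}c+\mathcal O(x+y+z),\ ay+|b|z+\mathcal O((y+z)(x+y+z)),\ \operatorname{sign}(b)+\mathcal O(x+y+z)\big),$$ $$X^-=\big(\operatorname{sign}(\beta)+\mathcal O(x+y+z),\ \alpha y-|\beta|x+\mathcal O((x+y)(x+y+z)),\ |b|^{-1}\gamma+\mathcal O(x+y+z)\big),$$ $b,\beta\ne0$, all remainders smooth ($\mathcal O(x+y+z)$: vanishing at the origin; higher-order terms of $X_2^+$ at least quadratic and vanishing on $y=z=0$, those of $X_2^-$ at least quadratic and vanishing on $x=y=0$). The line $l^-=\{x=y=0\}$ is a fold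 line for $X^-$, visible if $\beta>0$. Regularizing function: $\phi(y)=\pm1$ for $\pm y\ge1$, $\phi(y)\in(-1,1)$ and $\phi'>0$ on $(-1,1)$; $\phi$ is $C^\infty$ on $\mathbb R\setminus\{-1,1\}$, $C^{k-1}$ but not $C^n$ for any $n\ge k$ on $\mathbb R$, and $\phi^{[k]}:=\frac1{k!}\lim_{y\to-1^+}\phi^{(k)}(y)>0$. The regularization $\frac12X^+(1+\phi(\epsilon^{-1}y))+\frac12X^-(1-\phi(\epsilon^{-1}y))$, after replacing $y$ by $\epsilon y$ and rescaling time, is the slow-fast system $x'=\epsilon(X_1^+(1+\phi)+X_1^-(1-\phi))$, $y'=X_2^+(1+\phi)+X_2^-(1-\phi)$, $z'=\epsilon(X_3^+(1+\phi)+X_3^-(1-\phi))$ with $\phi=\phi(y)$ and $X_i^\pm$ evaluated at $(x,\epsilon y,z)$. Its attracting critical manifold $S_a$ (over $x<0,z<0$) loses normal hyperbolicity along $\{x=0,y=-1\}$. Shift $y$ by $1$ (new $y$ equals old $y$ plus $1$), so the degenerate line becomes $\{x=0,y=0\}$ and $\phi=-1+\phi^{[k]}y^k+\mathcal O(y^{k+1})$ for small $y>0$. Throughout, $z$ is negative, in the neighborhood considered and bounded away from $0$ uniformly in $\epsilon$ ($z\le-C^{-1}$ with $C$ large, independent of $\epsilon$). Slow manifold and its continuation. Chart $\kappa_1$: $x=-r_1^{2k}$, $y=r_1^2y_1$, $\epsilon=r_1^{2(2k-1)}\epsilon_1$. After division of the vector field by the common factor $r_1^{2(k-1)}$ (and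 a positive factor $1+\mathcal O(r_1^2)$), the line of equilibria $L_{a,1}=\{r_1=\epsilon_1=0,\ y_1=(\frac{2(|\beta|+\mathcal O(z))}{\phi^{[k]}(|b|+\mathcal O(z))(-z)})^{1/k}\}$ has an attracting $3$-dimensional center manifold $M_{a,1}$, a graph of $y_1$ over $(r_1,z,\epsilon_1)$, containing $S_a$ (in $\epsilon_1=0$) and foliated by the invariant sets $M_{a,1}(\epsilon)=M_{a,1}\cap\{r_1^{2(2k-1)}\epsilon_1=\epsilon\}$; $M_{a,1}(\epsilon)$ corresponds to Fenichel's attracting slow manifold $S_{a,\epsilon}$ where the latter is defined. Chart $\kappa_2$: $x=r_2^{2k}x_2$, $y=r_2^2y_2$, $\epsilon=r_2^{2(2k-1)}$. $M_{a,2}(\epsilon)$ is the continuation by the forward flow of $M_{a,1}(\epsilon)$ into chart $\kappa_2$, for $\epsilon$ sufficiently small. The constants. After division by $r_2^{2(k-1)}$, the system in chart $\kappa_2$ at $r_2=0$ with $\beta>0$ is $\dot x_2=2(1+\mathcal O(z))$, $\dot y_2=(|b|+\mathcal O(z))z\phi^{[k]}y_2^k-2(|\beta|+\mathcal O(z))x_2$, $\dot z=0$. For each $z<0$ it has a unique trajectory with $y_2=\big(\frac{2(|\beta|+\mathcal O(z))x_2}{\phi^{[k]}(|b|+\mathcal O(z))z}\big)^{1/k}+\mathcal O(1)$ as $x_2\to-\infty$; $\eta\neq0$ is the value of $x_2$ at which it intersects $y_2=0$. Correspondingly $\tilde\eta(k)$ is the value of $\tilde x$ at which the unique trajectory of $\dot{\tilde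 x}=1$, $\dot{\tilde y}=-\tilde y^k-\tilde x$ with $\tilde y=(-\tilde x)^{1/k}+\mathcal O(1)$ as $\tilde x\to-\infty$ intersects $\tilde y=0$; it depends only on $k$. *)

theory Defs
  imports "HOL-Analysis.Analysis" "HOL-Library.Landau_Symbols"
begin

type_synonym r3 = "real \<times> real \<times> real"

text \<open>Class \<open>C\<^sup>n\<close> on an open subset of a finite-dimensional space, by recursion over all
  directional derivatives.\<close>

primrec Cn_on :: "nat \<Rightarrow> ('a::real_normed_vector \<Rightarrow> 'b::real_normed_vector) \<Rightarrow> 'a set \<Rightarrow> bool" where
  "Cn_on 0 f S \<longleftrightarrow> continuous_on S f"
| "Cn_on (Suc n) f S \<longleftrightarrow>
     (\<forall>x\<in>S. f differentiable (at x)) \<and> (\<forall>v. Cn_on n (\<lambda>x. frechet_derivative f (at x) v) S)"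

definition smooth_on :: "('a::real_normed_vector \<Rightarrow> 'b::real_normed_vector) \<Rightarrow> 'a set \<Rightarrow> bool" where
  "smooth_on f S \<longleftrightarrow> (\<forall>n. Cn_on n f S)"

text \<open>A smooth remainder is \<open>O((y+z)(x+y+z))\<close> iff it is at least quadratic and vanishes on
  \<open>y = z = 0\<close>; likewise for \<open>O((x+y)(x+y+z))\<close> and the fold line \<open>x = y = 0\<close>.\<close>

definition two_fold_normal_form ::
  "real \<Rightarrow> real \<Rightarrow> real \<Rightarrow> real \<Rightarrow> real \<Rightarrow> real \<Rightarrow> (r3 \<Rightarrow> r3) \<Rightarrow> (r3 \<Rightarrow> r3) \<Rightarrow> bool" where
  "two_fold_normal_form a b c \<alpha> \<beta> \<gamma> Xp Xm \<longleftrightarrow>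
     (\<exists>U P1 P2 P3 Q1 Q2 Q3.
        open U \<and> (0, 0, 0) \<in> U \<and>
        smooth_on P1 U \<and> smooth_on P2 U \<and> smooth_on P3 U \<and>
        smooth_on Q1 U \<and> smooth_on Q2 U \<and> smooth_on Q3 U \<and>
        (\<forall>x y z. (x, y, z) \<in> U \<longrightarrow>
           Xp (x, y, z) =
             (c / \<bar>\<beta>\<bar> + P1 (x, y, z), a * y + \<bar>b\<bar> * z + P2 (x, y, z), sgn b + P3 (x, y, z)) \<and>
           Xm (x, y, z) =
             (sgn \<beta> + Q1 (x, y, z), \<alpha> * y - \<bar>\<beta>\<bar> * x + Q2 (x, y, z), \<gamma> / \<bar>b\<bar> + Q3 (x, y, z))) \<and>
        P1 (0, 0, 0) = 0 \<and> P3 (0, 0, 0) = 0 \<and> Q1 (0, 0, 0) = 0 \<and> Q3 (0, 0, 0) = (0::real) \<and>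
        (P2 has_derivative (\<lambda>_. 0)) (at (0, 0, 0)) \<and>
        (\<forall>x. (x, 0, 0) \<in> U \<longrightarrow> P2 (x, 0, 0) = 0) \<and>
        (Q2 has_derivative (\<lambda>_. 0)) (at (0, 0, 0)) \<and>
        (\<forall>z. (0, 0, z) \<in> U \<longrightarrow> Q2 (0, 0, z) = 0))"

definition phi_lead :: "nat \<Rightarrow> (real \<Rightarrow> real) \<Rightarrow> real" where
  "phi_lead k \<phi> = Lim (at_right (-1)) ((deriv ^^ k) \<phi>) / fact k"

text \<open>The last condition is the one-sided Taylor expansion of order \<open>k\<close> at \<open>-1\<close>. Its error term
  \<open>O(y\<^sup>k\<^sup>+\<^sup>1)\<close> is a genuine requirement: convergence of the \<open>k\<close>-th derivative alone only gives
  \<open>o(y\<^sup>k)\<close>.\<close>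

definition regularizing_function :: "nat \<Rightarrow> (real \<Rightarrow> real) \<Rightarrow> bool" where
  "regularizing_function k \<phi> \<longleftrightarrow>
     (\<forall>y\<ge>1. \<phi> y = 1) \<and> (\<forall>y\<le>-1. \<phi> y = -1) \<and>
     (\<forall>y\<in>{-1<..<1}. \<phi> y \<in> {-1<..<1} \<and> deriv \<phi> y > 0) \<and>
     smooth_on \<phi> (UNIV - {-1, 1}) \<and>
     Cn_on (k - 1) \<phi> UNIV \<and> (\<forall>n\<ge>k. \<not> Cn_on n \<phi> UNIV) \<and>
     (\<exists>l. ((deriv ^^ k) \<phi> \<longlongrightarrow> l) (at_right (-1))) \<and> phi_lead k \<phi> > 0 \<and>
     (\<lambda>y. \<phi> (y - 1) - (-1 + phi_lead k \<phi> * y ^ k)) \<in> O[at_right 0](\<lambda>y. y ^ (k + 1))"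

text \<open>From here on \<open>y\<close> is the rescaled and shifted coordinate: the coordinate of the piecewise
  smooth system is \<open>\<epsilon> * (y - 1)\<close>, and the degenerate line is \<open>x = y = 0\<close>.\<close>

definition regularized_field :: "(real \<Rightarrow> real) \<Rightarrow> (r3 \<Rightarrow> r3) \<Rightarrow> (r3 \<Rightarrow> r3) \<Rightarrow> real \<Rightarrow> r3 \<Rightarrow> r3" where
  "regularized_field \<phi> Xp Xm \<epsilon> = (\<lambda>(x, y, z).
     (1 + \<phi> (y - 1)) *\<^sub>R Xp (x, \<epsilon> * (y - 1), z) + (1 - \<phi> (y - 1)) *\<^sub>R Xm (x, \<epsilon> * (y - 1), z))"

definition slow_fast_field :: "(real \<Rightarrow> real) \<Rightarrow> (r3 \<Rightarrow> r3) \<Rightarrow> (r3 \<Rightarrow> r3) \<Rightarrow> real \<Rightarrow> r3 \<Rightarrow> r3" where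
  "slow_fast_field \<phi> Xp Xm \<epsilon> p =
     (case regularized_field \<phi> Xp Xm \<epsilon> p of (F1, F2, F3) \<Rightarrow> (\<epsilon> * F1, F2, \<epsilon> * F3))"

definition critical_manifold :: "(real \<Rightarrow> real) \<Rightarrow> (r3 \<Rightarrow> r3) \<Rightarrow> (r3 \<Rightarrow> r3) \<Rightarrow> r3 set" where
  "critical_manifold \<phi> Xp Xm =
     {(x, y, z). x < 0 \<and> z < 0 \<and> 0 < y \<and> y < 2 \<and> slow_fast_field \<phi> Xp Xm 0 (x, y, z) = 0}"

text \<open>The coefficients along \<open>x = y = 0\<close> that survive the blow-up:
  \<open>fold_A z = sgn \<beta> + O(z)\<close>, \<open>fold_B z = (\<bar>b\<bar> + O(z)) * z\<close> and \<open>fold_G z = \<bar>\<beta>\<bar> + O(z)\<close>.\<close>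

definition fold_A :: "(r3 \<Rightarrow> r3) \<Rightarrow> real \<Rightarrow> real" where
  "fold_A Xm z = fst (Xm (0, 0, z))"

definition fold_B :: "(r3 \<Rightarrow> r3) \<Rightarrow> real \<Rightarrow> real" where
  "fold_B Xp z = fst (snd (Xp (0, 0, z)))"

definition fold_G :: "(r3 \<Rightarrow> r3) \<Rightarrow> real \<Rightarrow> real" where
  "fold_G Xm z = - deriv (\<lambda>x. fst (snd (Xm (x, 0, z)))) 0"

text \<open>The extended system (\<open>\<epsilon>' = 0\<close>) in the chart
  \<open>x = - r\<^sup>2\<^sup>k\<close>, \<open>y = r\<^sup>2 * y1\<close>, \<open>\<epsilon> = r ^ (2 * (2 * k - 1)) * e\<close>, divided by \<open>r ^ (2 * (k - 1))\<close>; the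
  variables are \<open>(r, y1, z, e)\<close>. The value at \<open>r = 0\<close> is the limit \<open>r \<rightarrow> 0+\<close> for \<open>y1 > 0\<close>. A further
  division by a positive function would not change invariant sets and is left out.\<close>

definition chart1_field ::
  "nat \<Rightarrow> (real \<Rightarrow> real) \<Rightarrow> (r3 \<Rightarrow> r3) \<Rightarrow> (r3 \<Rightarrow> r3) \<Rightarrow> real \<times> real \<times> real \<times> real \<Rightarrow>
   real \<times> real \<times> real \<times> real" where
  "chart1_field k \<phi> Xp Xm = (\<lambda>(r, y1, z, e).
     (case regularized_field \<phi> Xp Xm (r ^ (2 * (2 * k - 1)) * e) (- (r ^ (2 * k)), r\<^sup>2 * y1, z) of
        (F1, F2, F3) \<Rightarrow>
          (- (r * e * F1) / (2 * real k),
           (if r = 0 then phi_lead k \<phi> * fold_B Xp z * y1 ^ k + 2 * fold_G Xm z else F2 / r ^ (2 * k))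
             + y1 * e * F1 / real k,
           r ^ (2 * k) * e * F3,
           (2 * real k - 1) / real k * e\<^sup>2 * F1)))"

text \<open>The line of equilibria \<open>L\<^sub>a\<^sub>,\<^sub>1\<close> is \<open>r = e = 0\<close>, \<open>y1 = equilibrium_y1 z\<close>.\<close>

definition equilibrium_y1 ::
  "nat \<Rightarrow> (real \<Rightarrow> real) \<Rightarrow> (r3 \<Rightarrow> r3) \<Rightarrow> (r3 \<Rightarrow> r3) \<Rightarrow> real \<Rightarrow> real" where
  "equilibrium_y1 k \<phi> Xp Xm z = root k (2 * fold_G Xm z / (phi_lead k \<phi> * (- fold_B Xp z)))"

text \<open>\<open>y1 = m (r, z, e)\<close> is a \<open>C\<^sup>1\<close> (up to the faces of the box), locally invariant graph through
  \<open>L\<^sub>a\<^sub>,\<^sub>1\<close>. The only nonzero eigenvalue of the linearization along \<open>L\<^sub>a\<^sub>,\<^sub>1\<close> is negative, with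
  eigenvector along \<open>y1\<close>, so such a graph is automatically tangent to the centre directions.
  The manifold need not be unique.\<close>

definition center_manifold ::
  "nat \<Rightarrow> (real \<Rightarrow> real) \<Rightarrow> (r3 \<Rightarrow> r3) \<Rightarrow> (r3 \<Rightarrow> r3) \<Rightarrow> real set \<Rightarrow> real \<Rightarrow> real \<Rightarrow>
   (r3 \<Rightarrow> real) \<Rightarrow> bool" where
  "center_manifold k \<phi> Xp Xm Z rmax emax m \<longleftrightarrow>
     (let D = {0..rmax} \<times> Z \<times> {0..emax} in
      (\<exists>m' :: r3 \<Rightarrow> r3 \<Rightarrow>\<^sub>L real.
         continuous_on D m' \<and>
         (\<forall>p\<in>D. (m has_derivative blinfun_apply (m' p)) (at p within D)) \<and>
         (\<forall>(r, z, e)\<in>D.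
            case chart1_field k \<phi> Xp Xm (r, m (r, z, e), z, e) of
              (dr, dy, dz, de) \<Rightarrow> dy = blinfun_apply (m' (r, z, e)) (dr, dz, de))) \<and>
      (\<forall>z\<in>Z. m (0, z, 0) = equilibrium_y1 k \<phi> Xp Xm z) \<and>
      (\<forall>r\<in>{0<..rmax}. \<forall>z\<in>Z.
         (- (r ^ (2 * k)), r\<^sup>2 * m (r, z, 0), z) \<in> critical_manifold \<phi> Xp Xm))"

text \<open>The leaf \<open>M\<^sub>a\<^sub>,\<^sub>1(\<epsilon>)\<close>, for \<open>\<epsilon> > 0\<close>, in the coordinates \<open>(x, y, z)\<close>.\<close>

definition slow_manifold ::
  "nat \<Rightarrow> real set \<Rightarrow> real \<Rightarrow> real \<Rightarrow> (r3 \<Rightarrow> real) \<Rightarrow> real \<Rightarrow> r3 set" where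
  "slow_manifold k Z rmax emax m \<epsilon> =
     {(- (r ^ (2 * k)), r\<^sup>2 * m (r, z, e), z) | r z e.
        r \<in> {0<..rmax} \<and> z \<in> Z \<and> e \<in> {0..emax} \<and> r ^ (2 * (2 * k - 1)) * e = \<epsilon>}"

text \<open>The continuation \<open>M\<^sub>a\<^sub>,\<^sub>2(\<epsilon>)\<close> by the forward flow, inside the neighbourhood of the origin of
  radius \<open>\<rho>\<close> (in the coordinates of the piecewise smooth system) and over the \<open>z\<close>-range \<open>Z\<close>. It is
  written in \<open>(x, y, z)\<close>; for fixed \<open>\<epsilon> > 0\<close> the chart
  \<open>x = r\<^sup>2\<^sup>k * x2\<close>, \<open>y = r\<^sup>2 * y2\<close>, \<open>r = \<epsilon> powr (1 / (2 * (2 * k - 1)))\<close> is a linear rescaling of these.\<close>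

definition forward_continuation ::
  "(real \<Rightarrow> real) \<Rightarrow> (r3 \<Rightarrow> r3) \<Rightarrow> (r3 \<Rightarrow> r3) \<Rightarrow> real set \<Rightarrow> real \<Rightarrow> real \<Rightarrow> r3 set \<Rightarrow> r3 set" where
  "forward_continuation \<phi> Xp Xm Z \<rho> \<epsilon> S =
     {u T | u T. 0 \<le> T \<and> u 0 \<in> S \<and>
        (\<forall>t\<in>{0..T}. (u has_vector_derivative slow_fast_field \<phi> Xp Xm \<epsilon> (u t)) (at t within {0..T}) \<and>
           (case u t of (x, y, z) \<Rightarrow> \<bar>x\<bar> \<le> \<rho> \<and> \<bar>\<epsilon> * (y - 1)\<bar> \<le> \<rho> \<and> z \<in> Z))}"

text \<open>\<open>crossing_value k p q s\<close>, for \<open>p, q, s > 0\<close>, is the value of \<open>x\<close> at which the trajectory of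
  \<open>x' = p\<close>, \<open>y' = - q * y\<^sup>k - s * x\<close> with \<open>y = (- s * x / q)\<^sup>1\<^sup>/\<^sup>k + O(1)\<close> as \<open>x \<rightarrow> -\<infinity>\<close>
  meets \<open>y = 0\<close>. As \<open>p > 0\<close>, \<open>x \<rightarrow> -\<infinity>\<close> is the same as \<open>t \<rightarrow> -\<infinity>\<close>.\<close>

definition crossing_value :: "nat \<Rightarrow> real \<Rightarrow> real \<Rightarrow> real \<Rightarrow> real" where
  "crossing_value k p q s = (THE \<xi>. \<exists>x y T.
     (\<forall>t\<le>T. (x has_real_derivative p) (at t within {..T}) \<and>
             (y has_real_derivative - q * y t ^ k - s * x t) (at t within {..T})) \<and>
     (\<lambda>t. y t - root k (- s * x t / q)) \<in> O[at_bot](\<lambda>_. 1) \<and>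
     x T = \<xi> \<and> y T = 0)"

text \<open>The system in the chart \<open>x = r\<^sup>2\<^sup>k * x2\<close>, \<open>y = r\<^sup>2 * y2\<close>, \<open>\<epsilon> = r ^ (2 * (2 * k - 1))\<close>, divided by
  \<open>r ^ (2 * (k - 1))\<close>, is at \<open>r = 0\<close> given by \<open>x2' = 2 * fold_A z\<close>,
  \<open>y2' = phi_lead * fold_B z * y2\<^sup>k - 2 * fold_G z * x2\<close>, \<open>z' = 0\<close>.\<close>

definition eta :: "nat \<Rightarrow> (real \<Rightarrow> real) \<Rightarrow> (r3 \<Rightarrow> r3) \<Rightarrow> (r3 \<Rightarrow> r3) \<Rightarrow> real \<Rightarrow> real" where
  "eta k \<phi> Xp Xm z =
     crossing_value k (2 * fold_A Xm z) (- (phi_lead k \<phi> * fold_B Xp z)) (2 * fold_G Xm z)"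

definition eta_tilde :: "nat \<Rightarrow> real" where
  "eta_tilde k = crossing_value k 1 1 1"

end

theory Submission
  imports Defs
begin

text \<open>In the chart \<open>x = r\<^sup>2\<^sup>k * x2\<close>, \<open>y = r\<^sup>2 * y2\<close>, \<open>\<epsilon> = r ^ (2 * (2 * k - 1))\<close> the field tends, as \<open>r \<rightarrow> 0\<close>, to
  \<open>x2' = 2 * fold_A z\<close>, \<open>y2' = phi_lead k \<phi> * fold_B z * (max 0 y2)\<^sup>k - 2 * fold_G z * x2\<close>, \<open>z' = 0\<close>.
  On \<open>r = 0\<close> the invariance equation of the centre manifold says that, in this chart, its graph is a solution of the limit
  system with the prescribed growth at \<open>x2 \<rightarrow> -\<infinity>\<close>; as there is only one, the graph is the special
  trajectory that defines \<open>\<eta>\<close>. For \<open>\<epsilon> > 0\<close> every orbit that starts on the leaf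
  and reaches \<open>y = 0\<close> stays on the leaf up to the section \<open>e = emax\<close>, which is \<open>x2 = const\<close>,
  and from there follows the limit trajectory up to an error \<open>O(r)\<close>. The limit trajectory
  crosses \<open>y2 = 0\<close> transversally and below \<open>y2 = 0\<close> only the visible fold acts, which prevents a
  return. As a function of the starting value on the section, the \<open>z\<close>-value at the crossing is a small
  Lipschitz perturbation of the identity, so the crossing points form a graph over \<open>z\<close>.\<close>

section \<open>Differential inequalities and initial value problems\<close>

text \<open>Only the values of \<open>\<phi>\<close> near -1 are expanded, not its derivative. Hence
  \<open>V r\<close> is uniformly close to \<open>V0\<close>, but its Lipschitz constant is only
  bounded by a multiple of r to the power -2k. Closeness to the limit orbit therefore rests on the
  Lipschitz constant of \<open>V0\<close>; the comparison of two orbits with the same r, on which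
  the graph property depends, rests on a one-sided bound. The centre manifold is given, not
  constructed. Information about it comes from its invariance equation, which on the face r = 0 is
  an equation in e with parameter z, and from the critical manifold on the face e = 0; compactness
  carries positivity of y and of the drift in x from these two faces to every leaf with small
  \<open>\<epsilon>\<close>. All limit systems are rescalings of y' = - y^k - x. Solving the two
  scaling equations produces the powers 1/(2k-1) in \<open>\<eta>\<close>, and the singular factor
  in z comes from \<open>fold_B\<close>, which vanishes at z = 0. Until the crossing z drifts by at
  most r, and the distance of \<open>z1\<close>, \<open>z2\<close> to the ends of the z-range
  absorbs this drift.\<close>

text \<open>Barrier argument. The sign of the derivative is required only at zeros before which
  \<open>f\<close> was never positive; this history is what later applications use to know where the
  orbit has been so far.\<close>

lemma derivative_neg_at_zeros_imp_neg:
  fixes f f' :: "real \<Rightarrow> real"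
  assumes der: "\<And>t. t \<in> {a..b} \<Longrightarrow> (f has_real_derivative f' t) (at t within {a..b})"
    and start: "f a \<le> 0"
    and neg: "\<And>t. \<lbrakk>t \<in> {a..b}; f t = 0; \<And>s. s \<in> {a..t} \<Longrightarrow> f s \<le> 0\<rbrakk> \<Longrightarrow> f' t < 0"
    and t: "t \<in> {a<..b}"
  shows "f t < 0"
proof (rule ccontr)
  assume "\<not> f t < 0"
  define W where "W = {s \<in> {a<..b}. f s \<ge> 0}"
  have tW: "t \<in> W" using t \<open>\<not> f t < 0\<close> by (auto simp: W_def)
  define c where "c = Inf W"
  have bdd: "bdd_below W" by (auto simp: W_def bdd_below_def intro!: exI[of _ a])
  have cle: "c \<le> w" if "w \<in> W" for w using that bdd by (simp add: c_def cInf_lower)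
  have ac: "a \<le> c" unfolding c_def using tW by (intro cInf_greatest) (auto simp: W_def)
  have cb: "c \<le> b" using cle[OF tW] t by auto
  have cont: "continuous_on {a..b} f"
    using der by (meson DERIV_continuous continuous_on_eq_continuous_within)
  have before: "f s < 0" if "a < s" "s < c" for s
    using cle[of s] that cb by (force simp: W_def)
  have before': "f s \<le> 0" if "a \<le> s" "s < c" for s
    using before[of s] that start by (cases "s = a") auto
  have near: "\<exists>w\<in>W. w < c + h" if "h > 0" for h
    using that tW cInf_lessD[of W "c + h"] by (auto simp: c_def)
  have fc0: "f c \<le> 0"
  proof (cases "c = a")
    case False
    then have "a < c" using ac by simp
    show ?thesis
    proof (rule ccontr)
      assume "\<not> f c \<le> 0"
      then have "f c > 0" by simp
      obtain d where d: "d > 0" "\<And>s. s \<in> {a..b} \<Longrightarrow> dist s c < d \<Longrightarrow> dist (f s) (f c) < f c"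
        using cont \<open>f c > 0\<close> ac cb unfolding continuous_on_iff by (metis atLeastAtMost_iff)
      define s where "s = max ((a + c) / 2) (c - d / 2)"
      have "f s < 0" using \<open>a < c\<close> d(1) by (intro before) (auto simp: s_def max_def)
      moreover have "dist (f s) (f c) < f c"
        using \<open>a < c\<close> d(1) cb by (intro d(2)) (auto simp: s_def max_def dist_real_def abs_if field_simps)
      ultimately show False by (auto simp: dist_real_def)
    qed
  qed (use start in auto)
  have fc1: "f c \<ge> 0"
  proof (rule ccontr)
    assume "\<not> f c \<ge> 0"
    then have "- f c > 0" by simp
    obtain d where d: "d > 0" "\<And>s. s \<in> {a..b} \<Longrightarrow> dist s c < d \<Longrightarrow> dist (f s) (f c) < - f c"
      using cont \<open>- f c > 0\<close> ac cb unfolding continuous_on_iff by (metis atLeastAtMost_iff)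
    obtain w where w: "w \<in> W" "w < c + d" using near[OF d(1)] by auto
    have "dist (f w) (f c) < - f c"
      using w cle[OF w(1)] by (intro d(2)) (auto simp: W_def dist_real_def)
    then show False using w(1) by (auto simp: W_def dist_real_def)
  qed
  have fc: "f c = 0" using fc0 fc1 by simp
  have neg_c: "f' c < 0"
    using ac cb fc before' by (intro neg) (auto simp: less_eq_real_def)
  have derc: "(f has_real_derivative f' c) (at c within {a..b})" using der ac cb by simp
  \<comment> \<open>If \<open>c\<close> lies in \<open>W\<close>, the negative slope makes
    \<open>f\<close> positive just to the left of \<open>c\<close>, where it is negative. Otherwise
    points of \<open>W\<close> accumulate at \<open>c\<close> from the right, where the slope makes
    \<open>f\<close> negative.\<close>
  show False
  proof (cases "c \<in> W")
    case True
    then have "a < c" by (auto simp: W_def)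
    obtain d where d: "d > 0" "\<And>h. h > 0 \<Longrightarrow> c - h \<in> {a..b} \<Longrightarrow> h < d \<Longrightarrow> f c < f (c - h)"
      using has_real_derivative_neg_dec_left[OF derc neg_c] by auto
    define h where "h = min (d / 2) ((c - a) / 2)"
    have "f c < f (c - h)" using d(1) \<open>a < c\<close> cb
      by (intro d(2)) (auto simp: h_def min_def field_simps)
    moreover have "f (c - h) < 0"
      using d(1) \<open>a < c\<close> by (intro before) (auto simp: h_def min_def field_simps)
    ultimately show False using fc by simp
  next
    case False
    obtain d where d: "d > 0" "\<And>h. h > 0 \<Longrightarrow> c + h \<in> {a..b} \<Longrightarrow> h < d \<Longrightarrow> f (c + h) < f c"
      using has_real_derivative_neg_dec_right[OF derc neg_c] by auto
    obtain w where w: "w \<in> W" "w < c + d" using near[OF d(1)] by auto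
    have "w > c" using cle[OF w(1)] False w(1) by (cases "w = c") auto
    then have "f (c + (w - c)) < f c"
      using w by (intro d(2)) (auto simp: W_def)
    then show False using w fc by (auto simp: W_def)
  qed
qed

lemma derivative_nonpos_within_imp_le:
  fixes f :: "real \<Rightarrow> real"
  assumes "a \<le> b"
    and der: "\<And>t. t \<in> {a..b} \<Longrightarrow> (f has_real_derivative f' t) (at t within {a..b})"
    and le: "\<And>t. t \<in> {a..b} \<Longrightarrow> f' t \<le> 0"
  shows "f b \<le> f a"
proof -
  obtain x where "x \<in> {a..b}" "f b - f a = f' x * (b - a)"
    using mvt_very_simple[of a b f "\<lambda>x h. f' x * h"] assms(1) der
    by (auto simp: has_field_derivative_def)
  then show ?thesis using le[of x] assms(1)
    by (smt (verit, best) mult_nonpos_nonneg)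
qed

text \<open>The weight \<open>exp (- L * (t - a))\<close> turns the inequality into monotonicity.
  The inhomogeneity is integrated without the weight, so the bound is cruder than the sharp one but
  covers \<open>L = 0\<close> as well.\<close>

lemma gronwall_affine:
  fixes f :: "real \<Rightarrow> real"
  assumes "a \<le> b" "L \<ge> 0" "c \<ge> 0"
    and der: "\<And>t. t \<in> {a..b} \<Longrightarrow> (f has_real_derivative f' t) (at t within {a..b})"
    and le: "\<And>t. t \<in> {a..b} \<Longrightarrow> f' t \<le> L * f t + c"
  shows "f b \<le> exp (L * (b - a)) * (f a + c * (b - a))"
proof -
  define h where "h t = f t * exp (- L * (t - a)) - c * (t - a)" for t
  have "h b \<le> h a"
  proof (rule derivative_nonpos_within_imp_le[OF \<open>a \<le> b\<close>])
    fix t assume t: "t \<in> {a..b}"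
    show "(h has_real_derivative (f' t - L * f t) * exp (- L * (t - a)) - c) (at t within {a..b})"
      unfolding h_def using der[OF t]
      by (auto intro!: derivative_eq_intros simp: algebra_simps)
    have "(f' t - L * f t) * exp (- L * (t - a)) \<le> c * exp (- L * (t - a))"
      using le[OF t] by (intro mult_right_mono) auto
    also have "\<dots> \<le> c * 1" using assms t by (intro mult_left_mono) (auto)
    finally show "(f' t - L * f t) * exp (- L * (t - a)) - c \<le> 0" by simp
  qed
  then have "f b * exp (- L * (b - a)) \<le> f a + c * (b - a)" by (simp add: h_def)
  then have "exp (L * (b - a)) * (f b * exp (- L * (b - a))) \<le> exp (L * (b - a)) * (f a + c * (b - a))"
    by (intro mult_left_mono) auto
  moreover have "exp (L * (b - a)) * (f b * exp (- L * (b - a))) = f b"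
    by (simp add: exp_minus)
  ultimately show ?thesis by linarith
qed

lemma ode_compare_basic:
  fixes u v :: "real \<Rightarrow> 'a::real_inner"
  assumes "a \<le> b" "L \<ge> 0" "\<delta> \<ge> 0"
    and u: "\<And>t. t \<in> {a..b} \<Longrightarrow> (u has_vector_derivative u' t) (at t within {a..b})"
    and v: "\<And>t. t \<in> {a..b} \<Longrightarrow> (v has_vector_derivative v' t) (at t within {a..b})"
    and le: "\<And>t. t \<in> {a..b} \<Longrightarrow>
      (u t - v t) \<bullet> (u' t - v' t) \<le> L * (norm (u t - v t))\<^sup>2 + \<delta> * norm (u t - v t)"
  shows "norm (u b - v b) \<le> exp ((2 * L + 1) * (b - a)) * (1 + (b - a)) * (norm (u a - v a) + \<delta>)"
proof -
  define N where "N t = (u t - v t) \<bullet> (u t - v t)" for t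
  define E where "E = exp ((2 * L + 1) * (b - a))"
  have E1: "E \<ge> 1" using assms by (simp add: E_def)
  have Nn: "N t = (norm (u t - v t))\<^sup>2" for t by (simp add: N_def power2_norm_eq_inner)
  have "N b \<le> E * (N a + \<delta>\<^sup>2 * (b - a))"
    unfolding E_def
  proof (rule gronwall_affine)
    fix t assume t: "t \<in> {a..b}"
    have "(N has_vector_derivative (u t - v t) \<bullet> (u' t - v' t) + (u' t - v' t) \<bullet> (u t - v t)) (at t within {a..b})"
      unfolding N_def
      by (rule bounded_bilinear.has_vector_derivative[OF bounded_bilinear_inner])
         (auto intro!: derivative_intros u v t)
    then show "(N has_real_derivative 2 * ((u t - v t) \<bullet> (u' t - v' t))) (at t within {a..b})"
      by (simp add: has_real_derivative_iff_has_vector_derivative inner_commute)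
    \<comment> \<open>Young's inequality moves the defect into a quadratic term; this is the origin
      of the \<open>+ 1\<close> in the exponent.\<close>
    have "2 * \<delta> * norm (u t - v t) \<le> (norm (u t - v t))\<^sup>2 + \<delta>\<^sup>2"
      using sum_squares_bound[of \<delta> "norm (u t - v t)"] by (simp add: power2_eq_square algebra_simps)
    then show "2 * ((u t - v t) \<bullet> (u' t - v' t)) \<le> (2 * L + 1) * N t + \<delta>\<^sup>2"
      using le[OF t] by (simp add: Nn algebra_simps)
  qed (use assms in auto)
  also have "\<dots> \<le> E * ((1 + (b - a)) * (norm (u a - v a) + \<delta>)\<^sup>2)"
  proof (rule mult_left_mono)
    have "N a + \<delta>\<^sup>2 * (b - a) \<le> (1 + (b - a)) * (N a + \<delta>\<^sup>2)"
      using mult_nonneg_nonneg[of "b - a" "N a"] \<open>a \<le> b\<close> Nn[of a]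
      by (simp add: algebra_simps add_increasing)
    also have "\<dots> \<le> (1 + (b - a)) * (norm (u a - v a) + \<delta>)\<^sup>2"
      using \<open>a \<le> b\<close> \<open>\<delta> \<ge> 0\<close> by (intro mult_left_mono) (auto simp: Nn power2_sum)
    finally show "N a + \<delta>\<^sup>2 * (b - a) \<le> (1 + (b - a)) * (norm (u a - v a) + \<delta>)\<^sup>2" .
  qed (use E1 in auto)
  also have "\<dots> \<le> (E * (1 + (b - a)) * (norm (u a - v a) + \<delta>))\<^sup>2"
  proof -
    have "1 \<le> E * (1 + (b - a))" using E1 \<open>a \<le> b\<close> mult_mono[of 1 E 1 "1 + (b - a)"] by simp
    then have "E * (1 + (b - a)) \<le> (E * (1 + (b - a)))\<^sup>2" by (simp add: self_le_power)
    then show ?thesis by (simp add: power_mult_distrib mult.assoc[symmetric] mult_right_mono)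
  qed
  finally have "(norm (u b - v b))\<^sup>2 \<le> (E * (1 + (b - a)) * (norm (u a - v a) + \<delta>))\<^sup>2"
    by (simp add: Nn)
  then show ?thesis unfolding E_def
    by (rule power2_le_imp_le) (use assms in auto)
qed

text \<open>Bootstrap: the hypothesis on the fields is available only while the distance is at most
  1. At the first time at which the distance reaches 1 the estimate already gives a value below 1,
  so that time does not exist.\<close>

lemma ode_compare:
  fixes u v :: "real \<Rightarrow> 'a::real_inner"
  assumes "L \<ge> 0" "\<delta> \<ge> 0"
    and u: "\<And>t. t \<in> {0..T} \<Longrightarrow> (u has_vector_derivative u' t) (at t within {0..T})"
    and v: "\<And>t. t \<in> {0..T} \<Longrightarrow> (v has_vector_derivative v' t) (at t within {0..T})"
    and le: "\<And>t. t \<in> {0..T} \<Longrightarrow> norm (u t - v t) \<le> 1 \<Longrightarrow>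
      (u t - v t) \<bullet> (u' t - v' t) \<le> L * (norm (u t - v t))\<^sup>2 + \<delta> * norm (u t - v t)"
    and small: "exp ((2 * L + 1) * T) * (1 + T) * (norm (u 0 - v 0) + \<delta>) < 1"
    and t: "t \<in> {0..T}"
  shows "norm (u t - v t) \<le> exp ((2 * L + 1) * T) * (1 + T) * (norm (u 0 - v 0) + \<delta>)"
proof -
  let ?K = "exp ((2 * L + 1) * T) * (1 + T) * (norm (u 0 - v 0) + \<delta>)"
  have T: "T \<ge> 0" using t by auto
  have *: "norm (u s - v s) \<le> ?K"
    if s: "s \<in> {0..T}" and lt: "\<And>q. q \<in> {0..s} \<Longrightarrow> norm (u q - v q) \<le> 1" for s
  proof -
    have "norm (u s - v s) \<le> exp ((2 * L + 1) * (s - 0)) * (1 + (s - 0)) * (norm (u 0 - v 0) + \<delta>)"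
    proof (rule ode_compare_basic)
      fix q assume q: "q \<in> {0..s}"
      show "(u has_vector_derivative u' q) (at q within {0..s})"
        "(v has_vector_derivative v' q) (at q within {0..s})"
        using q s by (auto intro!: has_vector_derivative_within_subset[OF u] has_vector_derivative_within_subset[OF v])
      show "(u q - v q) \<bullet> (u' q - v' q) \<le> L * (norm (u q - v q))\<^sup>2 + \<delta> * norm (u q - v q)"
        using q s lt by (intro le) auto
    qed (use assms s in auto)
    also have "\<dots> \<le> ?K"
      using s assms(1,2) by (intro mult_right_mono mult_mono) auto
    finally show ?thesis .
  qed
  have cont: "continuous_on {0..T} (\<lambda>t. norm (u t - v t))"
    using u v by (intro continuous_intros)
      (meson continuous_on_eq_continuous_within has_vector_derivative_continuous)+
  have "norm (u q - v q) \<le> 1" if "q \<in> {0..T}" for q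
  proof (rule ccontr)
    assume "\<not> norm (u q - v q) \<le> 1"
    define W where "W = {s \<in> {0..T}. 1 \<le> norm (u s - v s)}"
    have "closed W" unfolding W_def
      using continuous_closed_preimage[OF cont, of "{1..}"]
      by (simp add: vimage_def Int_def)
    then have "compact W" by (auto simp: compact_eq_bounded_closed W_def intro: bounded_subset[of "{0..T}"])
    moreover have "q \<in> W" using that \<open>\<not> _\<close> by (auto simp: W_def)
    ultimately obtain s where s: "s \<in> W" "\<And>w. w \<in> W \<Longrightarrow> s \<le> w"
      using compact_attains_inf[of W] by blast
    have le1: "norm (u p - v p) < 1" if "p \<in> {0..<s}" for p
      using s that by (force simp: W_def)
    have "norm (u s - v s) \<le> 1"
    proof (cases "s = 0")
      case True
      have "1 * norm (u 0 - v 0) \<le> ?K"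
        using T assms(1,2) mult_mono[of 1 "exp ((2 * L + 1) * T)" 1 "1 + T"]
        by (intro mult_mono) auto
      then show ?thesis using small True by simp
    next
      case False
      then have "0 < s" using s(1) by (auto simp: W_def)
      show ?thesis
      proof (rule continuous_le_on_closure[of "{0..<s}" "\<lambda>t. norm (u t - v t)" s 1])
        show "continuous_on (closure {0..<s}) (\<lambda>t. norm (u t - v t))"
          using \<open>0 < s\<close> s(1) by (auto intro!: continuous_on_subset[OF cont] simp: W_def)
      qed (use \<open>0 < s\<close> le1 in \<open>auto intro: less_imp_le\<close>)
    qed
    then have "norm (u s - v s) \<le> ?K"
      using le1 s(1) by (intro *) (auto simp: W_def le_less)
    then show False using small s(1) by (auto simp: W_def)
  qed
  then show ?thesis using t by (intro *) auto
qed

lemma ode_unique: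
  fixes u v :: "real \<Rightarrow> 'a::real_inner"
  assumes "L \<ge> 0"
    and u: "\<And>t. t \<in> {a..b} \<Longrightarrow> (u has_vector_derivative u' t) (at t within {a..b})"
    and v: "\<And>t. t \<in> {a..b} \<Longrightarrow> (v has_vector_derivative v' t) (at t within {a..b})"
    and le: "\<And>t. t \<in> {a..b} \<Longrightarrow> norm (u' t - v' t) \<le> L * norm (u t - v t)"
    and "u a = v a" "t \<in> {a..b}"
  shows "u t = v t"
proof -
  have "norm (u t - v t) \<le> exp ((2 * L + 1) * (t - a)) * (1 + (t - a)) * (norm (u a - v a) + 0)"
  proof (rule ode_compare_basic)
    fix q assume q: "q \<in> {a..t}"
    show "(u has_vector_derivative u' q) (at q within {a..t})"
      "(v has_vector_derivative v' q) (at q within {a..t})"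
      using q assms(6) by (auto intro!: has_vector_derivative_within_subset[OF u] has_vector_derivative_within_subset[OF v])
    have "(u q - v q) \<bullet> (u' q - v' q) \<le> norm (u q - v q) * norm (u' q - v' q)"
      by (rule norm_cauchy_schwarz)
    also have "\<dots> \<le> norm (u q - v q) * (L * norm (u q - v q))"
      using le q assms(6) by (intro mult_left_mono) auto
    finally show "(u q - v q) \<bullet> (u' q - v' q) \<le> L * (norm (u q - v q))\<^sup>2 + 0 * norm (u q - v q)"
      by (simp add: power2_eq_square algebra_simps)
  qed (use assms in auto)
  then show ?thesis using assms by simp
qed

section \<open>Picard iteration for globally Lipschitz fields\<close>

lemma has_vector_derivative_uniform_limit:
  fixes U D :: "nat \<Rightarrow> real \<Rightarrow> 'a::banach"
  assumes der: "\<And>n t. t \<in> {a..b} \<Longrightarrow> (U n has_vector_derivative D n t) (at t within {a..b})"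
    and lim: "uniform_limit {a..b} D g sequentially"
    and ptw: "\<And>t. t \<in> {a..b} \<Longrightarrow> (\<lambda>n. U n t) \<longlonglongrightarrow> u t"
    and t: "t \<in> {a..b}"
  shows "(u has_vector_derivative g t) (at t within {a..b})"
proof -
  have "\<exists>w. \<forall>x\<in>{a..b}. (\<lambda>n. U n x) \<longlonglongrightarrow> w x \<and> (w has_derivative (\<lambda>h. h *\<^sub>R g x)) (at x within {a..b})"
  proof (rule has_derivative_sequence)
    show "(U n has_derivative (\<lambda>h. h *\<^sub>R D n x)) (at x within {a..b})" if "x \<in> {a..b}" for n x
      using der[OF that] by (simp add: has_vector_derivative_def)
    show "\<forall>\<^sub>F n in sequentially. \<forall>x\<in>{a..b}. \<forall>h. norm (h *\<^sub>R D n x - h *\<^sub>R g x) \<le> e * norm h" if "0 < e" for e :: real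
      using uniform_limitD[OF lim that]
    proof (eventually_elim)
      case (elim n)
      show ?case
      proof (intro ballI allI)
        fix x h :: real assume "x \<in> {a..b}"
        then have "norm (D n x - g x) \<le> e" using elim by (auto simp: dist_norm less_imp_le)
        then have "\<bar>h\<bar> * norm (D n x - g x) \<le> \<bar>h\<bar> * e" by (intro mult_left_mono) auto
        then show "norm (h *\<^sub>R D n x - h *\<^sub>R g x) \<le> e * norm h"
          by (simp add: scaleR_diff_right[symmetric] mult.commute)
      qed
    qed
  qed (use t ptw in auto)
  then obtain w where w: "\<And>x. x \<in> {a..b} \<Longrightarrow> (\<lambda>n. U n x) \<longlonglongrightarrow> w x"
      "\<And>x. x \<in> {a..b} \<Longrightarrow> (w has_derivative (\<lambda>h. h *\<^sub>R g x)) (at x within {a..b})" by blast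
  have "w x = u x" if "x \<in> {a..b}" for x using w(1)[OF that] ptw[OF that] LIMSEQ_unique by blast
  then show ?thesis using w(2)[OF t] t has_derivative_transform[of t "{a..b}" u w]
    by (auto simp: has_vector_derivative_def)
qed

text \<open>The Lipschitz bound is global, so the iterates converge on the whole interval at once,
  without gluing local solutions. Continuity of the field is asked for only along continuous
  curves.\<close>

lemma picard_lindelof_global:
  fixes f :: "real \<Rightarrow> 'a::banach \<Rightarrow> 'a"
  assumes "a \<le> b" "L > 0"
    and lip: "\<And>t x y. t \<in> {a..b} \<Longrightarrow> norm (f t x - f t y) \<le> L * norm (x - y)"
    and cont: "\<And>Y. continuous_on {a..b} Y \<Longrightarrow> continuous_on {a..b} (\<lambda>t. f t (Y t))"
  obtains u where "u a = u0" "\<And>t. t \<in> {a..b} \<Longrightarrow> (u has_vector_derivative f t (u t)) (at t within {a..b})"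
proof -
  define Y where "Y = rec_nat (\<lambda>_. u0) (\<lambda>_ y t. u0 + integral {a..t} (\<lambda>s. f s (y s)))"
  have Y0: "Y 0 = (\<lambda>_. u0)" and YS: "Y (Suc n) = (\<lambda>t. u0 + integral {a..t} (\<lambda>s. f s (Y n s)))" for n
    by (auto simp: Y_def)
  have Yd: "(Y (Suc n) has_vector_derivative f t (Y n t)) (at t within {a..b})"
    if "continuous_on {a..b} (Y n)" "t \<in> {a..b}" for n t
    unfolding YS using integral_has_vector_derivative[OF cont[OF that(1)] that(2)]
    by (auto intro!: derivative_eq_intros)
  have Yc: "continuous_on {a..b} (Y n)" for n
  proof (induction n)
    case (Suc n)
    then show ?case using Yd[OF Suc]
      by (meson continuous_on_eq_continuous_within has_vector_derivative_continuous)
  qed (auto simp: Y0)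
  have fc: "continuous_on {a..b} (\<lambda>t. f t (Y n t))" for n by (rule cont[OF Yc])
  have "continuous_on {a..b} (\<lambda>t. norm (Y 1 t - Y 0 t))" by (intro continuous_intros Yc)
  then have "bounded ((\<lambda>t. norm (Y 1 t - Y 0 t)) ` {a..b})"
    by (intro compact_imp_bounded compact_continuous_image) auto
  then obtain M where M: "\<And>t. t \<in> {a..b} \<Longrightarrow> norm (Y 1 t - Y 0 t) \<le> M"
    unfolding bounded_iff by force
  have M0: "M \<ge> 0" using M[of a] \<open>a \<le> b\<close> norm_ge_zero order_trans by (metis atLeastAtMost_iff order_refl)
  \<comment> \<open>With the weight \<open>exp (2 * L * (t - a))\<close> the integral operator
    contracts by the factor 1/2.\<close>
  have step: "norm (Y (Suc n) t - Y n t) \<le> M * exp (2 * L * (t - a)) * (1 / 2) ^ n" if "t \<in> {a..b}" for n t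
    using that
  proof (induction n arbitrary: t)
    case 0
    have "M * 1 \<le> M * exp (2 * L * (t - a))" using 0 M0 \<open>L > 0\<close> by (intro mult_left_mono) auto
    then show ?case using M[OF 0] by simp
  next
    case (Suc n)
    have ti: "(\<lambda>s. f s (Y j s)) integrable_on {a..t}" for j
      using Suc.prems by (intro integrable_continuous_interval continuous_on_subset[OF fc]) auto
    have "Y (Suc (Suc n)) t - Y (Suc n) t = integral {a..t} (\<lambda>s. f s (Y (Suc n) s) - f s (Y n s))"
    proof -
      have "Y (Suc m) t = u0 + integral {a..t} (\<lambda>s. f s (Y m s))" for m by (simp add: YS)
      from this[of "Suc n"] this[of n] show ?thesis
        using integral_diff[OF ti ti, of "Suc n" n] by simp
    qed
    also have "norm \<dots> \<le> integral {a..t} (\<lambda>s. L * (M * exp (2 * L * (s - a)) * (1 / 2) ^ n))"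
    proof (rule integral_norm_bound_integral)
      show "(\<lambda>s. f s (Y (Suc n) s) - f s (Y n s)) integrable_on {a..t}" by (intro integrable_diff ti)
      show "(\<lambda>s. L * (M * exp (2 * L * (s - a)) * (1 / 2) ^ n)) integrable_on {a..t}"
        by (intro integrable_continuous_interval continuous_intros)
      fix s assume s: "s \<in> {a..t}"
      have "norm (f s (Y (Suc n) s) - f s (Y n s)) \<le> L * norm (Y (Suc n) s - Y n s)"
        using s Suc.prems by (intro lip) auto
      also have "\<dots> \<le> L * (M * exp (2 * L * (s - a)) * (1 / 2) ^ n)"
        using s Suc.prems \<open>L > 0\<close> by (intro mult_left_mono Suc.IH) auto
      finally show "norm (f s (Y (Suc n) s) - f s (Y n s)) \<le> L * (M * exp (2 * L * (s - a)) * (1 / 2) ^ n)" .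
    qed
    also have "((\<lambda>s. L * (M * exp (2 * L * (s - a)) * (1 / 2) ^ n)) has_integral
        M * exp (2 * L * (t - a)) * (1 / 2) ^ Suc n - M * exp (2 * L * (a - a)) * (1 / 2) ^ Suc n) {a..t}"
      using Suc.prems
      by (intro fundamental_theorem_of_calculus)
        (auto intro!: derivative_eq_intros simp: has_real_derivative_iff_has_vector_derivative[symmetric])
    then have "integral {a..t} (\<lambda>s. L * (M * exp (2 * L * (s - a)) * (1 / 2) ^ n)) =
        M * exp (2 * L * (t - a)) * (1 / 2) ^ Suc n - M * exp (2 * L * (a - a)) * (1 / 2) ^ Suc n"
      by (rule integral_unique)
    also have "\<dots> \<le> M * exp (2 * L * (t - a)) * (1 / 2) ^ Suc n" using M0 by simp
    finally show ?case .
  qed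
  define C where "C = M * exp (2 * L * (b - a))"
  have "uniform_limit {a..b} (\<lambda>n t. \<Sum>i<n. Y (Suc i) t - Y i t) (\<lambda>t. \<Sum>i. Y (Suc i) t - Y i t) sequentially"
  proof (rule Weierstrass_m_test)
    fix n t assume t: "t \<in> {a..b}"
    have "M * exp (2 * L * (t - a)) * (1 / 2) ^ n \<le> C * (1 / 2) ^ n"
      unfolding C_def using t M0 \<open>L > 0\<close> by (intro mult_right_mono mult_left_mono) auto
    then show "norm (Y (Suc n) t - Y n t) \<le> C * (1 / 2) ^ n" using step[OF t, of n] by linarith
  qed (auto intro!: summable_mult)
  moreover have "(\<Sum>i<n. Y (Suc i) t - Y i t) = Y n t - u0" for n t
    using sum_lessThan_telescope[of "\<lambda>i. Y i t" n] by (simp add: Y0)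
  ultimately have ul0: "uniform_limit {a..b} (\<lambda>n t. Y n t - u0) (\<lambda>t. \<Sum>i. Y (Suc i) t - Y i t) sequentially"
    by simp
  define u where "u t = u0 + (\<Sum>i. Y (Suc i) t - Y i t)" for t
  have ul: "uniform_limit {a..b} Y u sequentially"
    using uniform_limit_add[OF uniform_limit_const ul0, of "\<lambda>_. u0"] by (simp add: u_def[abs_def])
  have ulf: "uniform_limit {a..b} (\<lambda>n t. f t (Y n t)) (\<lambda>t. f t (u t)) sequentially"
  proof (rule uniform_limitI)
    fix e :: real assume "e > 0"
    then have "e / L > 0" using \<open>L > 0\<close> by simp
    from uniform_limitD[OF ul this] show "\<forall>\<^sub>F n in sequentially. \<forall>x\<in>{a..b}. dist (f x (Y n x)) (f x (u x)) < e"
    proof eventually_elim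
      case (elim n)
      show ?case
      proof
        fix x assume x: "x \<in> {a..b}"
        have "norm (f x (Y n x) - f x (u x)) \<le> L * norm (Y n x - u x)" by (rule lip[OF x])
        also have "\<dots> < L * (e / L)" using elim x \<open>L > 0\<close> by (intro mult_strict_left_mono) (auto simp: dist_norm)
        finally show "dist (f x (Y n x)) (f x (u x)) < e" using \<open>L > 0\<close> by (simp add: dist_norm)
      qed
    qed
  qed
  show ?thesis
  proof
    have Ya: "Y n a = u0" for n by (cases n) (auto simp: Y0 YS)
    then show "u a = u0" by (simp add: u_def)
    fix t assume t: "t \<in> {a..b}"
    show "(u has_vector_derivative f t (u t)) (at t within {a..b})"
    proof (rule has_vector_derivative_uniform_limit[of a b "\<lambda>n. Y (Suc n)"])
      show "(\<lambda>n. Y (Suc n) t) \<longlonglongrightarrow> u t" if "t \<in> {a..b}" for t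
        using tendsto_uniform_limitI[OF ul that] by (rule LIMSEQ_Suc)
    qed (use Yd Yc ulf t in auto)
  qed
qed

section \<open>Smooth functions and regularizing functions\<close>

lemma smooth_on_imp_differentiable:
  "smooth_on f S \<Longrightarrow> x \<in> S \<Longrightarrow> f differentiable (at x)"
  unfolding smooth_on_def by (metis Cn_on.simps(2))

lemma smooth_on_frechet_derivative:
  "smooth_on f S \<Longrightarrow> smooth_on (\<lambda>x. frechet_derivative f (at x) v) S"
  unfolding smooth_on_def by (metis Cn_on.simps(2))

lemma smooth_on_imp_continuous_on: "smooth_on f S \<Longrightarrow> continuous_on S f"
  unfolding smooth_on_def by (metis Cn_on.simps(1))

lemma C1_imp_Lipschitz_on_compact_convex:
  fixes f :: "'a::euclidean_space \<Rightarrow> 'b::real_normed_vector"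
  assumes diff: "\<And>x. x \<in> S \<Longrightarrow> f differentiable (at x)"
    and cont: "\<And>v. continuous_on S (\<lambda>x. frechet_derivative f (at x) v)"
    and S: "compact S" "convex S"
  shows "\<exists>L\<ge>0. \<forall>x\<in>S. \<forall>y\<in>S. norm (f x - f y) \<le> L * norm (x - y)"
proof -
  have "\<exists>B. \<forall>x\<in>S. norm (frechet_derivative f (at x) i) \<le> B" for i
    using compact_imp_bounded[OF compact_continuous_image[OF cont[of i] S(1)]]
    by (auto simp: bounded_iff)
  then obtain B where B: "\<And>i x. x \<in> S \<Longrightarrow> norm (frechet_derivative f (at x) i) \<le> B i" by metis
  define L where "L = \<bar>\<Sum>i\<in>Basis. B i\<bar>"
  have "norm (f x - f y) \<le> L * norm (x - y)" if "x \<in> S" "y \<in> S" for x y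
  proof (rule differentiable_bound[OF S(2) _ _ that])
    fix z assume z: "z \<in> S"
    have d: "(f has_derivative frechet_derivative f (at z)) (at z)"
      using diff[OF z] frechet_derivative_works by blast
    then show "(f has_derivative frechet_derivative f (at z)) (at z within S)"
      by (rule has_derivative_at_withinI)
    have "onorm (frechet_derivative f (at z)) \<le> (\<Sum>i\<in>Basis. norm (frechet_derivative f (at z) i))"
      using d by (intro onorm_componentwise has_derivative_bounded_linear)
    also have "\<dots> \<le> (\<Sum>i\<in>Basis. B i)" using B z by (intro sum_mono) auto
    finally show "onorm (frechet_derivative f (at z)) \<le> L" by (simp add: L_def)
  qed
  moreover have "L \<ge> 0" by (simp add: L_def)
  ultimately show ?thesis by blast
qed

lemma smooth_on_imp_Lipschitz_on_compact_convex:
  fixes f :: "'a::euclidean_space \<Rightarrow> 'b::real_normed_vector"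
  assumes "smooth_on f U" "S \<subseteq> U" "compact S" "convex S"
  shows "\<exists>L\<ge>0. \<forall>x\<in>S. \<forall>y\<in>S. norm (f x - f y) \<le> L * norm (x - y)"
  using assms
  by (intro C1_imp_Lipschitz_on_compact_convex)
    (auto intro: smooth_on_imp_differentiable continuous_on_subset
      smooth_on_imp_continuous_on[OF smooth_on_frechet_derivative])

lemma continuous_on_if_Cn_on: "Cn_on n f S \<Longrightarrow> continuous_on S f"
proof (cases n)
  case (Suc m)
  assume "Cn_on n f S"
  then show ?thesis using Suc
    by (auto intro!: continuous_at_imp_continuous_on differentiable_imp_continuous_within)
qed simp

text \<open>Turns local properties into global ones with a single constant. Since
  \<open>k \<ge> 2\<close>, \<open>\<phi>\<close> is continuously differentiable, and it is constant
  outside [-1,1], hence Lipschitz on the line. The expansion is known only for small y > 0; away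
  from 0 its error is bounded by \<open>2 + phi_lead k \<phi> * y ^ k\<close>, which a multiple of
  \<open>y ^ (k + 1)\<close> dominates.\<close>

lemma regularizing_function_bounds:
  assumes reg: "regularizing_function k \<phi>" and k: "2 \<le> k"
  obtains M where "M \<ge> 1" "mono \<phi>" "\<And>y. \<bar>\<phi> y\<bar> \<le> 1"
    "\<And>y. y \<le> -1 \<Longrightarrow> \<phi> y = -1"
    "\<And>x y. \<bar>\<phi> x - \<phi> y\<bar> \<le> M * \<bar>x - y\<bar>"
    "\<And>y. y \<ge> 0 \<Longrightarrow> \<bar>1 + \<phi> (y - 1) - phi_lead k \<phi> * y ^ k\<bar> \<le> M * y ^ (k + 1)"
proof -
  have hi: "\<And>y. y \<ge> 1 \<Longrightarrow> \<phi> y = 1" and lo: "\<And>y. y \<le> -1 \<Longrightarrow> \<phi> y = -1"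
    and inn: "\<And>y. -1 < y \<Longrightarrow> y < 1 \<Longrightarrow> \<phi> y \<in> {-1<..<1} \<and> deriv \<phi> y > 0"
    and Cn: "Cn_on (k - 1) \<phi> UNIV" and pos: "phi_lead k \<phi> > 0"
    and bigo: "(\<lambda>y. \<phi> (y - 1) - (-1 + phi_lead k \<phi> * y ^ k)) \<in> O[at_right 0](\<lambda>y. y ^ (k + 1))"
    using reg unfolding regularizing_function_def by auto
  obtain j where j: "k - 1 = Suc j" using k by (cases "k - 1") auto
  have diff: "\<phi> differentiable (at x)" for x using Cn unfolding j by auto
  have cont': "continuous_on UNIV (\<lambda>x. frechet_derivative \<phi> (at x) v)" for v
    using Cn unfolding j by (auto intro: continuous_on_if_Cn_on)
  have abs1: "\<bar>\<phi> y\<bar> \<le> 1" for y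
    using hi[of y] lo[of y] inn[of y] by (cases "y \<ge> 1"; cases "y \<le> -1") auto
  have DER: "(\<phi> has_real_derivative deriv \<phi> x) (at x)" for x
    using diff[of x] by (simp add: DERIV_deriv_iff_real_differentiable)
  have cphi: "continuous_on UNIV \<phi>"
    using DER by (meson DERIV_isCont continuous_at_imp_continuous_on)
  have mono: "\<phi> x \<le> \<phi> y" if "x \<le> y" for x y
  proof -
    consider "x \<le> -1" | "y \<ge> 1" | "x > -1" "y < 1" by linarith
    then show ?thesis
    proof cases
      case 3
      show ?thesis
      proof (rule DERIV_nonneg_imp_nondecreasing[OF that])
        fix z assume "x \<le> z" "z \<le> y"
        then show "\<exists>d. (\<phi> has_real_derivative d) (at z) \<and> 0 \<le> d"
          using DER[of z] inn[of z] 3 by (intro exI[of _ "deriv \<phi> z"]) auto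
      qed
    qed (use abs1[of y] abs1[of x] lo hi in \<open>auto simp: abs_le_iff\<close>)
  qed
  obtain L where L: "L \<ge> 0" "\<And>x y. x \<in> {-1..1} \<Longrightarrow> y \<in> {-1..1} \<Longrightarrow> \<bar>\<phi> x - \<phi> y\<bar> \<le> L * \<bar>x - y\<bar>"
    using C1_imp_Lipschitz_on_compact_convex[of "{-1..1}" \<phi>, OF diff continuous_on_subset[OF cont']]
    by auto
  define cl where "cl x = max (-1) (min 1 x)" for x :: real
  have phicl: "\<phi> (cl x) = \<phi> x" for x
    using hi[of x] lo[of x] hi[of 1] lo[of "-1"] by (auto simp: cl_def max_def min_def)
  have lip: "\<bar>\<phi> x - \<phi> y\<bar> \<le> L * \<bar>x - y\<bar>" for x y
  proof -
    have "\<bar>\<phi> (cl x) - \<phi> (cl y)\<bar> \<le> L * \<bar>cl x - cl y\<bar>" by (rule L(2)) (auto simp: cl_def)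
    also have "\<dots> \<le> L * \<bar>x - y\<bar>" using L(1) by (intro mult_left_mono) (auto simp: cl_def)
    finally show ?thesis by (simp add: phicl)
  qed
  obtain c where c: "c > 0"
    "\<forall>\<^sub>F y in at_right 0. norm (\<phi> (y - 1) - (-1 + phi_lead k \<phi> * y ^ k)) \<le> c * norm (y ^ (k + 1))"
    using landau_o.bigE[OF bigo] by blast
  obtain d where d: "d > 0"
    "\<And>y. 0 < y \<Longrightarrow> y < d \<Longrightarrow> \<bar>1 + \<phi> (y - 1) - phi_lead k \<phi> * y ^ k\<bar> \<le> c * \<bar>y ^ (k + 1)\<bar>"
    using c(2) unfolding eventually_at_right_field by (auto simp: algebra_simps)
  \<comment> \<open>The first summand serves the range from d to 1, the second the range above
    1.\<close>
  define q where "q = (2 + phi_lead k \<phi>) / (min d 1) ^ (k + 1) + (2 + phi_lead k \<phi>)"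
  have tay: "\<bar>1 + \<phi> (y - 1) - phi_lead k \<phi> * y ^ k\<bar> \<le> (c + q) * y ^ (k + 1)" if y: "y \<ge> 0" for y
  proof -
    have q0: "q \<ge> 0" using pos d(1) by (auto simp: q_def)
    have A: "\<bar>1 + \<phi> (y - 1) - phi_lead k \<phi> * y ^ k\<bar> \<le> 2 + phi_lead k \<phi> * y ^ k"
      using abs1[of "y - 1"] pos y by (smt (verit, best) mult_nonneg_nonneg zero_le_power)
    consider "y = 0" | "0 < y" "y < d" | "y \<ge> 1" | "d \<le> y" "y < 1" using y by linarith
    then have "\<bar>1 + \<phi> (y - 1) - phi_lead k \<phi> * y ^ k\<bar> \<le> c * y ^ (k + 1) + q * y ^ (k + 1)"
    proof cases
      case 1 then show ?thesis using lo[of "-1"] k by simp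
    next
      case 2 then show ?thesis using d(2)[of y] q0 by (simp add: add_increasing2)
    next
      case 3
      have y1: "1 \<le> y ^ (k + 1)" "y ^ k \<le> y ^ (k + 1)"
        using 3 by (auto intro!: power_increasing one_le_power simp del: power_Suc)
      have "2 + phi_lead k \<phi> * y ^ k \<le> 2 * y ^ (k + 1) + phi_lead k \<phi> * y ^ (k + 1)"
        using y1 pos by (intro add_mono mult_left_mono) linarith+
      also have "\<dots> = (2 + phi_lead k \<phi>) * y ^ (k + 1)" by (simp only: distrib_right)
      also have "\<dots> \<le> q * y ^ (k + 1)"
        using pos d(1) y by (intro mult_right_mono) (auto simp: q_def)
      finally have "2 + phi_lead k \<phi> * y ^ k \<le> q * y ^ (k + 1)" .
      moreover have "0 \<le> c * y ^ (k + 1)" using c y by simp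
      ultimately show ?thesis using A by linarith
    next
      case 4
      have "y ^ k \<le> 1" using 4 y by (simp add: power_le_one)
      then have "2 + phi_lead k \<phi> * y ^ k \<le> 2 + phi_lead k \<phi>"
        using pos by (simp add: mult_left_le)
      also have "\<dots> = (2 + phi_lead k \<phi>) / (min d 1) ^ (k + 1) * (min d 1) ^ (k + 1)" using d(1) by simp
      also have "\<dots> \<le> (2 + phi_lead k \<phi>) / (min d 1) ^ (k + 1) * y ^ (k + 1)"
        using pos d(1) 4 by (intro mult_left_mono power_mono) auto
      also have "\<dots> \<le> q * y ^ (k + 1)" using pos y by (intro mult_right_mono) (auto simp: q_def)
      finally have "2 + phi_lead k \<phi> * y ^ k \<le> q * y ^ (k + 1)" .
      moreover have "0 \<le> c * y ^ (k + 1)" using c y by simp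
      ultimately show ?thesis using A by linarith
    qed
    then show ?thesis by (simp add: algebra_simps)
  qed
  define M where "M = 1 + L + c + q"
  have q0: "q \<ge> 0" using pos d(1) by (auto simp: q_def)
  show ?thesis
  proof (rule that[of M])
    show "M \<ge> 1" using L(1) c(1) q0 by (simp add: M_def)
    show "mono \<phi>" by (rule monoI) (rule mono)
    show "\<bar>\<phi> x - \<phi> y\<bar> \<le> M * \<bar>x - y\<bar>" for x y
      by (rule order_trans[OF lip]) (use c(1) q0 in \<open>auto simp: M_def intro!: mult_right_mono\<close>)
    show "\<bar>1 + \<phi> (y - 1) - phi_lead k \<phi> * y ^ k\<bar> \<le> M * y ^ (k + 1)" if "y \<ge> 0" for y
      by (rule order_trans[OF tay[OF that]]) (use L(1) that in \<open>auto simp: M_def intro!: mult_right_mono\<close>)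
  qed (use abs1 lo in auto)
qed

section \<open>The special trajectory of the limit system\<close>

text \<open>The limit orbit as a graph over x, which is possible because x moves at constant speed
  p; division by p gives \<open>Q = q / p\<close> and \<open>S = s / p\<close>. Derivatives are
  taken within the half-line up to \<open>X\<close>, so that the graph may end exactly at the
  crossing.\<close>

definition tail_solution :: "nat \<Rightarrow> real \<Rightarrow> real \<Rightarrow> (real \<Rightarrow> real) \<Rightarrow> real \<Rightarrow> bool" where
  "tail_solution k Q S y X \<longleftrightarrow>
     (\<forall>x\<le>X. (y has_real_derivative - (Q * y x ^ k) - S * x) (at x within {..X})) \<and>
     (\<exists>M N. \<forall>x\<le>N. \<bar>y x - root k (- S * x / Q)\<bar> \<le> M)"

lemma power_diff_le:
  fixes a b :: real
  assumes "\<bar>a\<bar> \<le> B" "\<bar>b\<bar> \<le> B" "1 \<le> B"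
  shows "\<bar>a ^ n - b ^ n\<bar> \<le> real n * B ^ n * \<bar>a - b\<bar>"
proof (induction n)
  case (Suc n)
  have "a ^ Suc n - b ^ Suc n = a * (a ^ n - b ^ n) + (a - b) * b ^ n" by (simp add: algebra_simps)
  also have "\<bar>\<dots>\<bar> \<le> \<bar>a\<bar> * \<bar>a ^ n - b ^ n\<bar> + \<bar>a - b\<bar> * \<bar>b\<bar> ^ n"
    by (metis abs_mult abs_triangle_ineq power_abs)
  also have "\<dots> \<le> B * (real n * B ^ n * \<bar>a - b\<bar>) + \<bar>a - b\<bar> * B ^ Suc n"
  proof (intro add_mono mult_mono)
    have "\<bar>b\<bar> ^ n \<le> B ^ n" using assms by (intro power_mono) auto
    also have "\<dots> \<le> B ^ Suc n" using assms by (intro power_increasing) auto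
    finally show "\<bar>b\<bar> ^ n \<le> B ^ Suc n" .
  qed (use Suc assms in auto)
  finally show ?case by (simp add: algebra_simps)
qed simp

text \<open>Strong monotonicity of the power above 1. Tail solutions are eventually at least 1, and
  there this estimate makes any two of them contract.\<close>

lemma power_diff_ge:
  fixes a b :: real
  assumes "1 \<le> a" "1 \<le> b" "1 \<le> n"
  shows "(a - b)\<^sup>2 \<le> (a - b) * (a ^ n - b ^ n)"
proof -
  have *: "a - b \<le> a ^ n - b ^ n" if "1 \<le> b" "b \<le> a" for a b :: real
  proof -
    obtain m where m: "n = Suc m" using assms(3) by (cases n) auto
    have "0 \<le> a * (a ^ m - b ^ m)" using that by (intro mult_nonneg_nonneg) (auto intro: power_mono)
    moreover have "(a - b) * 1 \<le> (a - b) * b ^ m" using that by (intro mult_left_mono) auto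
    moreover have "a ^ n - b ^ n = a * (a ^ m - b ^ m) + (a - b) * b ^ m" by (simp add: m algebra_simps)
    ultimately show ?thesis by simp
  qed
  show ?thesis
  proof (cases "b \<le> a")
    case True
    then show ?thesis using *[OF assms(2) True]
      by (simp add: power2_eq_square mult_left_mono)
  next
    case False
    then have "(b - a) * (b - a) \<le> (b - a) * (b ^ n - a ^ n)"
      using *[OF assms(1)] by (intro mult_left_mono) auto
    then show ?thesis by (simp add: power2_eq_square algebra_simps)
  qed
qed

lemma tail_solution_DERIV:
  "tail_solution k Q S y X \<Longrightarrow> x \<le> X \<Longrightarrow> A \<subseteq> {..X} \<Longrightarrow>
    (y has_real_derivative - (Q * y x ^ k) - S * x) (at x within A)"
  unfolding tail_solution_def by (meson DERIV_subset)

lemma tail_solution_restrict: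
  "tail_solution k Q S y X \<Longrightarrow> X' \<le> X \<Longrightarrow> tail_solution k Q S y X'"
  unfolding tail_solution_def
  by (meson DERIV_subset atMost_subset_iff order_trans)

lemma tail_solution_ge_1:
  assumes "tail_solution k Q S y X" "Q > 0" "S > 0" "k \<ge> 1"
  obtains N M where "N < 0" "\<And>x. x \<le> N \<Longrightarrow> 1 \<le> y x"
    "\<And>x. x \<le> N \<Longrightarrow> \<bar>y x - root k (- S * x / Q)\<bar> \<le> M"
proof -
  obtain M N where MN: "\<And>x. x \<le> N \<Longrightarrow> \<bar>y x - root k (- S * x / Q)\<bar> \<le> M"
    using assms(1) unfolding tail_solution_def by blast
  define M' where "M' = \<bar>M\<bar> + 1"
  \<comment> \<open>To the left of \<open>N'\<close> the root is at least
    \<open>\<bar>M\<bar> + 1\<close>, so a solution within \<open>M\<close> of it is at least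
    1.\<close>
  define N' where "N' = min N (- (M' ^ k * Q / S)) - 1"
  have "1 \<le> y x" if "x \<le> N'" for x
  proof -
    have "M' ^ k * Q / S \<le> - x" using that by (simp add: N'_def min_def split: if_splits)
    then have "M' ^ k \<le> - S * x / Q" using assms by (simp add: field_simps)
    then have "root k (M' ^ k) \<le> root k (- S * x / Q)" using assms by simp
    then have "M' \<le> root k (- S * x / Q)" using assms by (simp add: real_root_power_cancel M'_def)
    moreover have "\<bar>y x - root k (- S * x / Q)\<bar> \<le> M" using that by (intro MN) (simp add: N'_def)
    ultimately show ?thesis by (simp add: M'_def)
  qed
  moreover have "N' < 0"
  proof -
    have "M' ^ k * Q / S \<ge> 0" using assms by (auto simp: M'_def)
    then show ?thesis by (auto simp: N'_def min_def)
  qed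
  moreover have "\<bar>y x - root k (- S * x / Q)\<bar> \<le> M" if "x \<le> N'" for x
    using that by (intro MN) (simp add: N'_def)
  ultimately show ?thesis by (intro that[of N' M]) auto
qed

text \<open>The squared difference times \<open>exp (2 * Q * (x - s))\<close> does not increase. The
  case \<open>Q = 0\<close> is allowed and expresses that merely monotone fields do not separate
  solutions.\<close>

lemma exponential_contraction:
  fixes u v :: "real \<Rightarrow> real"
  assumes "s \<le> t" "Q \<ge> 0"
    and u: "\<And>x. x \<in> {s..t} \<Longrightarrow> (u has_real_derivative u' x) (at x within {s..t})"
    and v: "\<And>x. x \<in> {s..t} \<Longrightarrow> (v has_real_derivative v' x) (at x within {s..t})"
    and le: "\<And>x. x \<in> {s..t} \<Longrightarrow> (u x - v x) * (u' x - v' x) \<le> - (Q * (u x - v x)\<^sup>2)"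
  shows "(u t - v t)\<^sup>2 \<le> exp (- 2 * Q * (t - s)) * (u s - v s)\<^sup>2"
proof -
  define h where "h x = (u x - v x)\<^sup>2 * exp (2 * Q * (x - s))" for x
  have "h t \<le> h s"
  proof (rule derivative_nonpos_within_imp_le[OF \<open>s \<le> t\<close>])
    fix x assume x: "x \<in> {s..t}"
    show "(h has_real_derivative 2 * ((u x - v x) * (u' x - v' x) + Q * (u x - v x)\<^sup>2) * exp (2 * Q * (x - s))) (at x within {s..t})"
      unfolding h_def
      by (auto intro!: derivative_eq_intros u[OF x] v[OF x] simp: algebra_simps power2_eq_square)
    have "2 * ((u x - v x) * (u' x - v' x) + Q * (u x - v x)\<^sup>2) \<le> 0" using le[OF x] by simp
    then show "2 * ((u x - v x) * (u' x - v' x) + Q * (u x - v x)\<^sup>2) * exp (2 * Q * (x - s)) \<le> 0"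
      by (rule mult_nonpos_nonneg) simp
  qed
  then have "(u t - v t)\<^sup>2 * exp (2 * Q * (t - s)) \<le> (u s - v s)\<^sup>2" by (simp add: h_def)
  then have "exp (- 2 * Q * (t - s)) * ((u t - v t)\<^sup>2 * exp (2 * Q * (t - s))) \<le> exp (- 2 * Q * (t - s)) * (u s - v s)\<^sup>2"
    by (rule mult_left_mono) simp
  moreover have "exp (- 2 * Q * (t - s)) * exp (2 * Q * (t - s)) = 1" by (simp add: mult_exp_exp)
  then have "exp (- 2 * Q * (t - s)) * ((u t - v t)\<^sup>2 * exp (2 * Q * (t - s))) = (u t - v t)\<^sup>2"
    by (metis mult.left_commute mult.right_neutral)
  ultimately show ?thesis by linarith
qed

text \<open>The difference of two tail solutions is bounded towards minus infinity but contracts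
  exponentially to the right, so starting early enough shows that it is zero. Once the graphs agree
  on a left half-line, local Lipschitz uniqueness continues the agreement up to
  \<open>X\<close>.\<close>

lemma tail_solution_unique:
  assumes y: "tail_solution k Q S y X" and z: "tail_solution k Q S z X"
    and pos: "Q > 0" "S > 0" "k \<ge> 1" and x: "x \<le> X"
  shows "y x = z x"
proof -
  obtain N1 M1 where 1: "N1 < 0" "\<And>x. x \<le> N1 \<Longrightarrow> 1 \<le> y x"
    "\<And>x. x \<le> N1 \<Longrightarrow> \<bar>y x - root k (- S * x / Q)\<bar> \<le> M1"
    using tail_solution_ge_1[OF y pos] by blast
  obtain N2 M2 where 2: "N2 < 0" "\<And>x. x \<le> N2 \<Longrightarrow> 1 \<le> z x"
    "\<And>x. x \<le> N2 \<Longrightarrow> \<bar>z x - root k (- S * x / Q)\<bar> \<le> M2"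
    using tail_solution_ge_1[OF z pos] by blast
  define N where "N = min X (min N1 N2)"
  define M where "M = M1 + M2"
  have diff: "\<bar>y x - z x\<bar> \<le> M" if "x \<le> N" for x
    using 1(3)[of x] 2(3)[of x] that by (auto simp: N_def M_def abs_le_iff)
  have contr: "(y t - z t)\<^sup>2 \<le> exp (- 2 * Q * (t - s)) * (y s - z s)\<^sup>2" if "s \<le> t" "t \<le> N" for s t
  proof (rule exponential_contraction)
    fix x assume x: "x \<in> {s..t}"
    show "(y has_real_derivative - (Q * y x ^ k) - S * x) (at x within {s..t})"
      "(z has_real_derivative - (Q * z x ^ k) - S * x) (at x within {s..t})"
      using x that by (auto intro!: tail_solution_DERIV[OF y] tail_solution_DERIV[OF z] simp: N_def)
    have "(y x - z x)\<^sup>2 \<le> (y x - z x) * (y x ^ k - z x ^ k)"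
      using x that pos by (intro power_diff_ge 1 2) (auto simp: N_def)
    then have "Q * (y x - z x)\<^sup>2 \<le> Q * ((y x - z x) * (y x ^ k - z x ^ k))"
      using pos by (intro mult_left_mono) auto
    then show "(y x - z x) * (- (Q * y x ^ k) - S * x - (- (Q * z x ^ k) - S * x)) \<le> - (Q * (y x - z x)\<^sup>2)"
      by (simp add: algebra_simps)
  qed (use that pos in auto)
  have left: "y t = z t" if "t \<le> N" for t
  proof (rule ccontr)
    assume "y t \<noteq> z t"
    define e where "e = (y t - z t)\<^sup>2"
    have e: "e > 0" using \<open>y t \<noteq> z t\<close> by (simp add: e_def)
    \<comment> \<open>With the starting point \<open>s\<close> chosen below, the contraction factor
      is \<open>exp (- w)\<close>, and the crude bound \<open>exp (- w) \<le> 1 / (1 + w)\<close>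
      already makes the difference at \<open>t\<close> smaller than \<open>e\<close>.\<close>
    define w where "w = M\<^sup>2 / e"
    define s where "s = t - w / (2 * Q)"
    have w0: "w \<ge> 0" using e by (simp add: w_def)
    have st: "s \<le> t" using w0 pos by (simp add: s_def)
    have "e \<le> exp (- 2 * Q * (t - s)) * (y s - z s)\<^sup>2" unfolding e_def by (rule contr[OF st that])
    also have "\<dots> \<le> exp (- 2 * Q * (t - s)) * M\<^sup>2"
      using diff[of s] st that by (intro mult_left_mono) (auto simp: abs_le_square_iff[symmetric])
    also have "- 2 * Q * (t - s) = - w" using pos by (simp add: s_def)
    also have "exp (- w) * M\<^sup>2 \<le> (1 / (1 + w)) * M\<^sup>2"
      using exp_ge_add_one_self[of w] w0
      by (intro mult_right_mono) (auto simp: exp_minus field_simps)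
    also have "\<dots> < e"
    proof -
      have "e * (1 + w) = e + M\<^sup>2" using e by (simp add: w_def distrib_left)
      then have "M\<^sup>2 < e * (1 + w)" using e by simp
      then show ?thesis using w0 by (simp add: pos_divide_less_eq)
    qed
    finally show False by simp
  qed
  show ?thesis
  proof (cases "x \<le> N")
    case False
    have Nx: "N \<le> x" using False by simp
    have cont: "continuous_on {N..x} y" "continuous_on {N..x} z"
      using x by (auto intro!: DERIV_continuous_on tail_solution_DERIV[OF y] tail_solution_DERIV[OF z])
    have "bounded (y ` {N..x})" "bounded (z ` {N..x})"
      using cont by (auto intro!: compact_imp_bounded compact_continuous_image)
    then obtain B1 B2 where B: "\<And>t. t \<in> {N..x} \<Longrightarrow> \<bar>y t\<bar> \<le> B1" "\<And>t. t \<in> {N..x} \<Longrightarrow> \<bar>z t\<bar> \<le> B2"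
      unfolding bounded_iff by (metis imageI real_norm_def)
    define B where "B = max 1 (max B1 B2)"
    show ?thesis
    proof (rule ode_unique[where u = y and v = z and t = x and a = N and b = x and L = "Q * (real k * B ^ k)"])
      fix t assume t: "t \<in> {N..x}"
      show "(y has_vector_derivative - (Q * y t ^ k) - S * t) (at t within {N..x})"
        "(z has_vector_derivative - (Q * z t ^ k) - S * t) (at t within {N..x})"
        using x t by (auto intro!: tail_solution_DERIV[OF y] tail_solution_DERIV[OF z]
            simp: has_real_derivative_iff_has_vector_derivative[symmetric])
      have "\<bar>y t ^ k - z t ^ k\<bar> \<le> real k * B ^ k * \<bar>y t - z t\<bar>"
        using B[OF t] by (intro power_diff_le) (auto simp: B_def)
      then have "Q * \<bar>y t ^ k - z t ^ k\<bar> \<le> Q * (real k * B ^ k * \<bar>y t - z t\<bar>)"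
        using pos by (intro mult_left_mono) auto
      moreover have "- (Q * y t ^ k) - S * t - (- (Q * z t ^ k) - S * t) = - (Q * (y t ^ k - z t ^ k))"
        by (simp add: algebra_simps)
      ultimately show "norm (- (Q * y t ^ k) - S * t - (- (Q * z t ^ k) - S * t)) \<le> Q * (real k * B ^ k) * norm (y t - z t)"
        using pos by (simp add: abs_mult mult.assoc)
    qed (use pos Nx left in \<open>auto simp: B_def\<close>)
  qed (rule left)
qed

text \<open>On the line y = 0 the slope is \<open>- S * x\<close>: upward for x < 0 and downward for
  x > 0. Hence a graph that is positive far to the left can meet the line only at positive x, and
  only once.\<close>

lemma tail_solution_zero:
  assumes y: "tail_solution k Q S y X" and pos: "Q > 0" "S > 0" "k \<ge> 1"
    and zero: "y \<xi> = 0" and \<xi>: "\<xi> \<le> X"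
  shows "0 < \<xi>" and "\<And>x. x < \<xi> \<Longrightarrow> 0 < y x"
proof -
  obtain N M where N: "N < 0" "\<And>x. x \<le> N \<Longrightarrow> 1 \<le> y x"
    using tail_solution_ge_1[OF y pos] by metis
  have neg: "y x > 0" if "x < 0" "x \<le> X" for x
  proof (cases "x \<le> N")
    case False
    have "- y x < 0"
    proof (rule derivative_neg_at_zeros_imp_neg[where f = "\<lambda>x. - y x" and a = N and b = x and t = x])
      fix t assume t: "t \<in> {N..x}"
      show "((\<lambda>x. - y x) has_real_derivative - (- (Q * y t ^ k) - S * t)) (at t within {N..x})"
        using t that by (intro DERIV_minus tail_solution_DERIV[OF y]) auto
      assume "- y t = 0"
      then show "- (- (Q * y t ^ k) - S * t) < 0"
        using pos t that by (auto simp: power_0_left mult_pos_neg)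
    qed (use N(2)[of N] False in auto)
    then show ?thesis by simp
  qed (use N(2)[of x] in auto)
  \<comment> \<open>At the origin the slope vanishes and the barrier argument fails. Instead
    \<open>Q * y ^ k \<le> Q * B ^ j * y\<close> on the bounded range, so y decays at most
    exponentially from its positive value at \<open>N\<close>.\<close>
  have zero0: "y 0 > 0" if "0 \<le> X"
  proof -
    have cont: "continuous_on {N..0} y"
      using that by (auto intro!: DERIV_continuous_on tail_solution_DERIV[OF y])
    then have "bounded (y ` {N..0})"
      by (auto intro!: compact_imp_bounded compact_continuous_image)
    then obtain B where B: "\<And>t. t \<in> {N..0} \<Longrightarrow> \<bar>y t\<bar> \<le> B"
      unfolding bounded_iff by (metis imageI real_norm_def)
    have y0: "y 0 \<ge> 0"
      using continuous_ge_on_closure[of "{N..<0}" y 0 0] cont N(1) neg that by (force simp: less_imp_le)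
    obtain j where j: "k = Suc j" using pos(3) by (cases k) auto
    define h where "h x = - y x * exp (Q * B ^ j * x)" for x
    have "h 0 \<le> h N"
    proof (rule derivative_nonpos_within_imp_le[where f = h and a = N and b = 0])
      fix t assume t: "t \<in> {N..0}"
      show "(h has_real_derivative ((- (- (Q * y t ^ k) - S * t) - Q * B ^ j * y t) * exp (Q * B ^ j * t))) (at t within {N..0})"
        unfolding h_def using t that
        by (auto intro!: derivative_eq_intros tail_solution_DERIV[OF y] simp: algebra_simps)
      have yt: "y t \<ge> 0" using neg[of t] y0 t that by (cases "t = 0") (auto simp: less_imp_le)
      have "y t ^ j \<le> B ^ j" using B[OF t] yt by (intro power_mono) auto
      then have "Q * (y t * y t ^ j) \<le> Q * (y t * B ^ j)"
        using pos yt by (intro mult_left_mono) auto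
      moreover have "S * t \<le> 0" using t pos by (auto intro: mult_nonneg_nonpos)
      ultimately show "(- (- (Q * y t ^ k) - S * t) - Q * B ^ j * y t) * exp (Q * B ^ j * t) \<le> 0"
        by (intro mult_nonpos_nonneg) (auto simp: j algebra_simps)
    qed (use N in auto)
    moreover have "h N < 0" using N(2)[of N] by (simp add: h_def)
    ultimately show ?thesis by (simp add: h_def)
  qed
  have le0: "y x > 0" if "x \<le> 0" "x \<le> X" for x
    using neg[of x] zero0 that by (cases "x = 0") auto
  show \<xi>0: "0 < \<xi>" using le0[of \<xi>] zero \<xi> by (cases "\<xi> \<le> 0") auto
  show "0 < y x" if "x < \<xi>" for x
  proof (rule ccontr)
    assume nn: "\<not> 0 < y x"
    have x0: "0 < x" using le0[of x] that \<xi> nn by (cases "x \<le> 0") auto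
    have "y \<xi> < 0"
    proof (rule derivative_neg_at_zeros_imp_neg[where f = y and a = x and b = \<xi> and t = \<xi>])
      fix t assume t: "t \<in> {x..\<xi>}"
      show "(y has_real_derivative - (Q * y t ^ k) - S * t) (at t within {x..\<xi>})"
        using t \<xi> by (intro tail_solution_DERIV[OF y]) auto
      assume "y t = 0"
      then show "- (Q * y t ^ k) - S * t < 0" using pos t x0 by (auto simp: power_0_left)
    qed (use nn that in auto)
    then show False using zero by simp
  qed
qed

lemma tail_solution_zero_unique:
  assumes y: "tail_solution k Q S y \<xi>" and z: "tail_solution k Q S z \<zeta>"
    and pos: "Q > 0" "S > 0" "k \<ge> 1" and "y \<xi> = 0" "z \<zeta> = 0"
  shows "\<xi> = \<zeta>"
proof -
  have *: False if "tail_solution k Q S y \<xi>" "tail_solution k Q S z \<zeta>" "y \<xi> = 0" "z \<zeta> = 0" "\<xi> < \<zeta>" for y z \<xi> \<zeta>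
    using tail_solution_unique[OF that(1) tail_solution_restrict[OF that(2)] pos, of \<xi>]
      tail_solution_zero(2)[OF that(2) pos that(4), of \<xi>] that by auto
  show ?thesis using *[OF y z] *[OF z y] assms by (cases \<xi> \<zeta> rule: linorder_cases) auto
qed

section \<open>Crossing values and rescaling\<close>

lemma tail_solution_compose:
  assumes y: "tail_solution k Q S y X" and p: "p > 0" and tT: "t \<le> T" "p * T + c \<le> X"
  shows "((\<lambda>t. y (p * t + c)) has_real_derivative p * (- (Q * y (p * t + c) ^ k) - S * (p * t + c)))
     (at t within {..T})"
proof -
  have le: "p * s + c \<le> X" if "s \<le> T" for s
  proof -
    have "p * s \<le> p * T" using that p by (intro mult_left_mono) auto
    then show ?thesis using \<open>p * T + c \<le> X\<close> by simp
  qed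
  have "(y \<circ> (\<lambda>t. p * t + c) has_real_derivative (- (Q * y (p * t + c) ^ k) - S * (p * t + c)) * p) (at t within {..T})"
  proof (rule DERIV_image_chain)
    show "(y has_real_derivative - (Q * y (p * t + c) ^ k) - S * (p * t + c)) (at (p * t + c) within (\<lambda>t. p * t + c) ` {..T})"
      using le tT by (intro tail_solution_DERIV[OF y]) auto
  qed (auto intro!: derivative_eq_intros)
  then show ?thesis by (simp add: o_def mult.commute)
qed

text \<open>Resolves the definite description. A competing trajectory has
  \<open>x = p * t + c\<close> with a free time shift \<open>c\<close>; rewriting it as a graph over
  x removes the shift, and uniqueness of the zero of tail solutions applies.\<close>

lemma crossing_value_eqI:
  assumes y: "tail_solution k (q / p) (s / p) y \<xi>" and "y \<xi> = 0"
    and pos: "p > 0" "q > 0" "s > 0" "k \<ge> 1"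
  shows "crossing_value k p q s = \<xi>"
  unfolding crossing_value_def
proof (rule the_equality)
  obtain M N where MN: "\<And>x. x \<le> N \<Longrightarrow> \<bar>y x - root k (- (s / p) * x / (q / p))\<bar> \<le> M"
    using y unfolding tail_solution_def by blast
  show "\<exists>x y T.
       (\<forall>t\<le>T. (x has_real_derivative p) (at t within {..T}) \<and>
               (y has_real_derivative - q * y t ^ k - s * x t) (at t within {..T})) \<and>
       (\<lambda>t. y t - root k (- s * x t / q)) \<in> O[at_bot](\<lambda>_. 1) \<and> x T = \<xi> \<and> y T = 0"
  proof (rule exI[of _ "\<lambda>t. p * t"], rule exI[of _ "\<lambda>t. y (p * t)"], rule exI[of _ "\<xi> / p"],
      intro conjI allI impI)
    fix t assume t: "t \<le> \<xi> / p"
    show "((\<lambda>t. p * t) has_real_derivative p) (at t within {..\<xi> / p})" by (auto intro!: derivative_eq_intros)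
    show "((\<lambda>t. y (p * t)) has_real_derivative - q * y (p * t) ^ k - s * (p * t)) (at t within {..\<xi> / p})"
    proof -
      have "p * (- ((q / p) * y (p * t + 0) ^ k) - s / p * (p * t + 0)) = - q * y (p * t + 0) ^ k - s * (p * t + 0)"
        using pos by (simp add: field_simps)
      then show ?thesis
        using tail_solution_compose[OF y pos(1) t, of 0] pos by simp
    qed
  next
    show "(\<lambda>t. y (p * t) - root k (- s * (p * t) / q)) \<in> O[at_bot](\<lambda>_. 1)"
    proof (rule landau_o.bigI[of "\<bar>M\<bar> + 1"])
      show "\<forall>\<^sub>F t in at_bot. norm (y (p * t) - root k (- s * (p * t) / q)) \<le> (\<bar>M\<bar> + 1) * norm (1 :: real)"
        using eventually_le_at_bot[of "N / p"]
      proof eventually_elim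
        case (elim t)
        then have "p * t \<le> N" using pos by (simp add: field_simps)
        from MN[OF this] have "\<bar>y (p * t) - root k (- s * (p * t) / q)\<bar> \<le> M"
          using pos by (simp add: mult.assoc mult.commute[of t p])
        then show ?case by simp
      qed
    qed simp
  qed (use assms in auto)
next
  fix \<zeta>
  assume "\<exists>x y T.
       (\<forall>t\<le>T. (x has_real_derivative p) (at t within {..T}) \<and>
               (y has_real_derivative - q * y t ^ k - s * x t) (at t within {..T})) \<and>
       (\<lambda>t. y t - root k (- s * x t / q)) \<in> O[at_bot](\<lambda>_. 1) \<and> x T = \<zeta> \<and> y T = 0"
  then obtain x z T where x: "\<And>t. t \<le> T \<Longrightarrow> (x has_real_derivative p) (at t within {..T})"
    and z: "\<And>t. t \<le> T \<Longrightarrow> (z has_real_derivative - q * z t ^ k - s * x t) (at t within {..T})"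
    and bo: "(\<lambda>t. z t - root k (- s * x t / q)) \<in> O[at_bot](\<lambda>_. 1)" and fin: "x T = \<zeta>" "z T = 0"
    by blast
  have "\<exists>c. \<forall>t\<in>{..T}. x t - p * t = c"
    by (rule has_field_derivative_zero_constant) (auto intro!: derivative_eq_intros x)
  then obtain c where c: "\<And>t. t \<le> T \<Longrightarrow> x t = p * t + c" by (auto simp: algebra_simps)
  define w where "w u = z ((u - c) / p)" for u
  have "tail_solution k (q / p) (s / p) w \<zeta>"
    unfolding tail_solution_def
  proof (intro conjI allI impI)
    fix u assume u: "u \<le> \<zeta>"
    have T: "(v - c) / p \<le> T" if "v \<le> \<zeta>" for v using that c[of T] fin pos by (simp add: field_simps)
    have "(z \<circ> (\<lambda>u. (u - c) / p) has_real_derivative (- q * z ((u - c) / p) ^ k - s * x ((u - c) / p)) * (1 / p)) (at u within {..\<zeta>})"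
    proof (rule DERIV_image_chain)
      show "(z has_real_derivative - q * z ((u - c) / p) ^ k - s * x ((u - c) / p))
        (at ((u - c) / p) within (\<lambda>u. (u - c) / p) ` {..\<zeta>})"
        using z[OF T[OF u]] by (rule DERIV_subset) (use T in auto)
    qed (use pos in \<open>auto intro!: derivative_eq_intros\<close>)
    moreover have "x ((u - c) / p) = u" using c[OF T[OF u]] pos by simp
    ultimately show "(w has_real_derivative - ((q / p) * w u ^ k) - s / p * u) (at u within {..\<zeta>})"
      by (simp add: w_def[abs_def] o_def diff_divide_distrib)
  next
    obtain M where M: "M > 0" "\<forall>\<^sub>F t in at_bot. norm (z t - root k (- s * x t / q)) \<le> M * norm (1 :: real)"
      using landau_o.bigE[OF bo] by blast
    obtain N where N: "\<And>t. t \<le> N \<Longrightarrow> \<bar>z t - root k (- s * x t / q)\<bar> \<le> M"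
      using M(2) unfolding eventually_at_bot_linorder by auto
    show "\<exists>M N. \<forall>u\<le>N. \<bar>w u - root k (- (s / p) * u / (q / p))\<bar> \<le> M"
    proof (intro exI allI impI)
      fix u assume u: "u \<le> p * min N T + c"
      moreover have "p * min N T \<le> p * N" "p * min N T \<le> p * T" using pos by auto
      ultimately have "u - c \<le> p * N" "u - c \<le> p * T" by linarith+
      then have le: "(u - c) / p \<le> N" "(u - c) / p \<le> T"
        using pos by (auto simp: pos_divide_le_eq mult.commute)
      have "x ((u - c) / p) = u" using c[OF le(2)] pos by simp
      then show "\<bar>w u - root k (- (s / p) * u / (q / p))\<bar> \<le> M"
        using N[OF le(1)] pos by (simp add: w_def)
    qed
  qed
  moreover have "w \<zeta> = 0" using c[of T] fin pos by (auto simp: w_def)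
  ultimately show "\<zeta> = \<xi>"
    using tail_solution_zero_unique[OF _ y] assms by (auto simp del: times_divide_eq_left)
qed

text \<open>Stretching x by \<open>l\<close> and y by \<open>m\<close> turns the slope into
  \<open>- (m / l) * y ^ k - (m / l\<^sup>2) * x\<close> in terms of the unit solution; the two
  equations for \<open>l\<close> and \<open>m\<close> are exactly the matching of
  coefficients.\<close>

lemma tail_solution_scale:
  assumes y: "tail_solution k 1 1 y X"
    and pos: "l > 0" "m > 0" "k \<ge> 1" and Q: "Q * l * m ^ k = m" and S: "S * l\<^sup>2 = m"
  shows "tail_solution k Q S (\<lambda>x. m * y (x / l)) (l * X)"
  unfolding tail_solution_def
proof (intro conjI allI impI)
  fix x assume x: "x \<le> l * X"
  have "((\<lambda>x. m * y (1 / l * x + 0)) has_real_derivative m * (1 / l * (- (1 * y (1 / l * x + 0) ^ k) - 1 * (1 / l * x + 0)))) (at x within {..l * X})"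
    using pos x by (intro DERIV_cmult tail_solution_compose[OF y]) auto
  moreover have "m * (1 / l * (- (1 * y (1 / l * x + 0) ^ k) - 1 * (1 / l * x + 0))) =
      - (m / l) * y (x / l) ^ k - (m / l\<^sup>2) * x"
    using pos by (simp add: field_simps power2_eq_square)
  moreover have "m / l = Q * m ^ k" using Q pos by (simp add: field_simps)
  moreover have "m / l\<^sup>2 = S" using S pos by (simp add: field_simps)
  ultimately show "((\<lambda>x. m * y (x / l)) has_real_derivative - (Q * (m * y (x / l)) ^ k) - S * x) (at x within {..l * X})"
    by (simp add: power_mult_distrib mult.assoc)
next
  obtain M N where MN: "\<And>x. x \<le> N \<Longrightarrow> \<bar>y x - root k (- 1 * x / 1)\<bar> \<le> M"
    using y unfolding tail_solution_def by blast
  have Q0: "Q = m / (l * m ^ k)" "S = m / l\<^sup>2" using Q S pos by (auto simp: field_simps)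
  show "\<exists>M N. \<forall>x\<le>N. \<bar>m * y (x / l) - root k (- S * x / Q)\<bar> \<le> M"
  proof (intro exI allI impI)
    fix x assume "x \<le> l * N"
    then have x: "x / l \<le> N" using pos by (simp add: field_simps)
    have "- S * x / Q = m ^ k * (- (x / l))"
      using pos by (simp add: Q0 field_simps power2_eq_square)
    then have "root k (- S * x / Q) = m * root k (- (x / l))"
      using pos by (simp only: real_root_mult) (simp add: real_root_power_cancel)
    then have "m * y (x / l) - root k (- S * x / Q) = m * (y (x / l) - root k (- (x / l)))"
      by (simp add: algebra_simps)
    then show "\<bar>m * y (x / l) - root k (- S * x / Q)\<bar> \<le> m * M"
      using MN[OF x] pos by (simp add: abs_mult)
  qed
qed

section \<open>Existence of the special trajectory for the unit equation\<close>

lemma root_ge_1: "1 \<le> k \<Longrightarrow> 1 \<le> x \<Longrightarrow> 1 \<le> root k x"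
  using real_root_le_mono[of k 1 x] by simp

lemma DERIV_at_of_both_sides:
  fixes f :: "real \<Rightarrow> real"
  assumes "(f has_real_derivative D) (at x within {..x})" "(f has_real_derivative D) (at x within {x..})"
  shows "(f has_real_derivative D) (at x)"
proof -
  have "{..x} \<union> {x..} = UNIV" by auto
  then show ?thesis using assms Lim_within_Un[of _ D x "{..x}" "{x..}"]
    by (simp add: has_field_derivative_iff)
qed

text \<open>The graph of \<open>root k (- x)\<close> is where the slope of the unit equation
  vanishes. Being decreasing it is a lower barrier for solutions; falling at a rate of at most 1/2
  it becomes an upper barrier when lifted by 1, because there solutions fall at a rate of at least
  1.\<close>

lemma root_minus_DERIV:
  assumes "2 \<le> k" "t \<le> -1"
  shows "\<exists>d. ((\<lambda>x. root k (- x)) has_real_derivative d) (at t within A) \<and> - 1 / 2 \<le> d \<and> d < 0"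
proof (intro exI conjI impI)
  let ?d = "inverse (real k * root k (- t) ^ (k - Suc 0)) * (- 1)"
  show "((\<lambda>x. root k (- x)) has_real_derivative ?d) (at t within A)"
  proof (rule DERIV_chain2[where g = uminus])
    show "(root k has_real_derivative inverse (real k * root k (- t) ^ (k - Suc 0))) (at (- t))"
      using assms by (intro DERIV_real_root) auto
  qed (auto intro!: derivative_eq_intros)
  have r: "1 \<le> root k (- t) ^ (k - Suc 0)" using assms by (intro one_le_power root_ge_1) auto
  have *: "2 \<le> real k * root k (- t) ^ (k - Suc 0)" using mult_mono[of 2 "real k", OF _ r] assms by simp
  then have "inverse (real k * root k (- t) ^ (k - Suc 0)) \<le> inverse 2"
    by (intro le_imp_inverse_le) auto
  then show "- 1 / 2 \<le> ?d" by simp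
  have "0 < real k * root k (- t) ^ (k - Suc 0)" using * by linarith
  then show "?d < 0" by (simp only: mult_minus_right neg_less_0_iff_less mult_1_right positive_imp_inverse_positive)
qed

text \<open>The approximation starts at -n midway between the two barriers, which confine it up to
  -1. Beyond -1 dropping the nonpositive power term leaves y' \<le> -x, and y(-1) \<le> 2 gives the
  parabola with 5/2; it is negative at 4, which later forces a zero.\<close>

lemma unit_tail_approximation:
  fixes n :: nat
  assumes k: "2 \<le> k" and n: "1 \<le> n"
  shows "\<exists>y.
    (\<forall>x\<in>{- real n..4}. (y has_real_derivative - ((max 0 (y x)) ^ k) - x) (at x within {- real n..4})) \<and>
    (\<forall>x\<in>{- real n..-1}. root k (- x) \<le> y x \<and> y x \<le> root k (- x) + 1) \<and>
    (\<forall>x\<in>{-1..4}. y x \<le> 5 / 2 - x\<^sup>2 / 2)"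
proof -
  \<comment> \<open>A truncation level that makes the field globally Lipschitz and is never
    exceeded: the upper barrier is at most n + 1, and from -1 on the solution is at most
    5/2.\<close>
  define B where "B = real n + 3"
  define h where "h y = (max 0 (min y B)) ^ k" for y :: real
  have h_lip: "\<bar>h x - h y\<bar> \<le> (real k * B ^ k + 1) * \<bar>x - y\<bar>" for x y
  proof -
    have "\<bar>h x - h y\<bar> \<le> real k * B ^ k * \<bar>max 0 (min x B) - max 0 (min y B)\<bar>"
      unfolding h_def by (rule power_diff_le) (auto simp: B_def)
    also have "\<dots> \<le> (real k * B ^ k + 1) * \<bar>x - y\<bar>"
      by (intro mult_mono) (auto simp: B_def)
    finally show ?thesis .
  qed
  have h_cont: "continuous_on A h" for A unfolding h_def by (intro continuous_intros)
  obtain y where y0: "y (- real n) = root k n + 1 / 2"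
    and y: "\<And>t. t \<in> {- real n..4} \<Longrightarrow> (y has_vector_derivative - h (y t) - t) (at t within {- real n..4})"
  proof (rule picard_lindelof_global[of "- real n" 4 "real k * B ^ k + 1" "\<lambda>t y. - h y - t" "root k n + 1 / 2"])
    show "norm (- h x - t - (- h y - t)) \<le> (real k * B ^ k + 1) * norm (x - y)" for t x y :: real
      using h_lip[of y x] by (simp add: abs_minus_commute)
    show "continuous_on {- real n..4} (\<lambda>t. - h (Y t) - t)" if "continuous_on {- real n..4} Y" for Y
      by (intro continuous_intros continuous_on_compose2[OF h_cont[of UNIV] that]) auto
    show "0 < real k * B ^ k + 1" by (simp add: B_def add_nonneg_pos)
  qed auto
  have yD: "(y has_real_derivative - h (y t) - t) (at t within A)" if "t \<in> {- real n..4}" "A \<subseteq> {- real n..4}" for t A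
    using has_vector_derivative_within_subset[OF y[OF that(1)] that(2)]
    by (simp add: has_real_derivative_iff_has_vector_derivative)
  have le_n: "root k (- x) \<le> real n" if "x \<in> {- real n..-1}" for x
  proof -
    have "root k (- x) \<le> root k (real n ^ k)"
    proof (rule real_root_le_mono)
      have "real n ^ 1 \<le> real n ^ k" using k n by (intro power_increasing) auto
      moreover have "- x \<le> real n ^ 1" using that by simp
      ultimately show "- x \<le> real n ^ k" by linarith
    qed (use k in auto)
    then show ?thesis using k by (simp add: real_root_power_cancel)
  qed
  have rpow: "root k (- x) ^ k = - x" if "x \<le> -1" for x using that k by simp
  have hroot: "h (root k (- x)) = - x" if "x \<in> {- real n..-1}" for x
    using le_n[OF that] that k rpow[of x] by (simp add: h_def B_def)
  have root_d: "\<exists>d. \<forall>t\<in>A. ((\<lambda>x. root k (- x)) has_real_derivative d t) (at t within A) \<and> - 1 / 2 \<le> d t \<and> d t < 0"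
    if "A \<subseteq> {..-1}" for A
    using root_minus_DERIV[OF k, of _ A] that by (metis atMost_iff subsetD)
  have lower: "root k (- x) \<le> y x" if x: "x \<in> {- real n..-1}" for x
  proof (cases "x = - real n")
    case False
    obtain d where d: "\<forall>t\<in>{- real n..x}. ((\<lambda>x. root k (- x)) has_real_derivative d t) (at t within {- real n..x}) \<and> - 1 / 2 \<le> d t \<and> d t < 0"
      using root_d[of "{- real n..x}"] x by auto
    have "root k (- x) - y x < 0"
    proof (rule derivative_neg_at_zeros_imp_neg[where f = "\<lambda>x. root k (- x) - y x" and a = "- real n" and b = x and t = x])
      fix t assume t: "t \<in> {- real n..x}"
      show "((\<lambda>x. root k (- x) - y x) has_real_derivative d t - (- h (y t) - t)) (at t within {- real n..x})"
        using d t x by (intro DERIV_diff yD) auto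
      assume "root k (- t) - y t = 0"
      then have "y t = root k (- t)" by simp
      then show "d t - (- h (y t) - t) < 0"
        using hroot[of t] t x d by auto
    qed (use y0 x False in auto)
    then show ?thesis by simp
  qed (use y0 in simp)
  have upper: "y x \<le> root k (- x) + 1" if x: "x \<in> {- real n..-1}" for x
  proof (cases "x = - real n")
    case False
    obtain d where d: "\<forall>t\<in>{- real n..x}. ((\<lambda>x. root k (- x)) has_real_derivative d t) (at t within {- real n..x}) \<and> - 1 / 2 \<le> d t \<and> d t < 0"
      using root_d[of "{- real n..x}"] x by auto
    have "y x - root k (- x) - 1 < 0"
    proof (rule derivative_neg_at_zeros_imp_neg[where f = "\<lambda>x. y x - root k (- x) - 1" and a = "- real n" and b = x and t = x])
      fix t assume t: "t \<in> {- real n..x}"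
      show "((\<lambda>x. y x - root k (- x) - 1) has_real_derivative (- h (y t) - t) - d t - 0) (at t within {- real n..x})"
        using d t x by (intro DERIV_diff yD) auto
      assume "y t - root k (- t) - 1 = 0"
      then have yt: "y t = root k (- t) + 1" by simp
      have r1: "1 \<le> root k (- t)" using t x k by (intro root_ge_1) auto
      have "1 \<le> (root k (- t) + 1) ^ k - root k (- t) ^ k"
        using power_diff_ge[of "root k (- t) + 1" "root k (- t)" k] r1 k by simp
      moreover have "h (y t) = (root k (- t) + 1) ^ k"
        using le_n[of t] t x r1 by (simp add: h_def yt B_def)
      ultimately show "(- h (y t) - t) - d t - 0 < 0"
        using rpow[of t] t x d by force
    qed (use y0 x False in auto)
    then show ?thesis by simp
  qed (use y0 in simp)
  have mid: "y x \<le> 5 / 2 - x\<^sup>2 / 2" if x: "x \<in> {-1..4}" for x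
  proof -
    have "y x + x\<^sup>2 / 2 \<le> y (-1) + (-1)\<^sup>2 / 2"
    proof (rule derivative_nonpos_within_imp_le[where f = "\<lambda>x. y x + x\<^sup>2 / 2" and a = "-1" and b = x])
      fix t assume t: "t \<in> {-1..x}"
      show "((\<lambda>x. y x + x\<^sup>2 / 2) has_real_derivative (- h (y t) - t) + t) (at t within {-1..x})"
        using t x n by (intro DERIV_add yD) (auto intro!: derivative_eq_intros)
      show "(- h (y t) - t) + t \<le> 0" by (simp add: h_def)
    qed (use x in auto)
    moreover have "y (-1) \<le> 2" using upper[of "-1"] n k by simp
    ultimately show ?thesis by simp
  qed
  have leB: "y x \<le> B" if "x \<in> {- real n..4}" for x
  proof (cases "x \<le> -1")
    case True
    then show ?thesis using upper[of x] le_n[of x] that by (auto simp: B_def)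
  next
    case False
    then have "y x \<le> 5 / 2 - x\<^sup>2 / 2" using that by (intro mid) auto
    then show ?thesis using zero_le_power2[of x] unfolding B_def by linarith
  qed
  have "h (y x) = max 0 (y x) ^ k" if "x \<in> {- real n..4}" for x
    using leB[OF that] by (simp add: h_def min_def)
  then have "\<forall>x\<in>{- real n..4}. (y has_real_derivative - ((max 0 (y x)) ^ k) - x) (at x within {- real n..4})"
    using yD by (metis order_refl)
  then show ?thesis using lower upper mid by blast
qed

text \<open>The special trajectory is the limit of the approximations: two of them differ by at most
  1 at the later of their starting points, contract at rate 1 up to -1 and do not separate
  afterwards. Behind its first zero it is continued by the solution of y' = -x, since
  \<open>max 0 (Y x)\<close> vanishes there; this makes it an orbit of the full limit system on the
  whole line.\<close>

lemma unit_tail_solution_exists: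
  assumes k: "2 \<le> k"
  obtains Y \<xi> where "0 < \<xi>" "tail_solution k 1 1 Y \<xi>" "Y \<xi> = 0"
    "\<And>x. (Y has_real_derivative - (max 0 (Y x) ^ k) - x) (at x)"
    "\<And>x. x < \<xi> \<Longrightarrow> 0 < Y x" "\<And>x. \<xi> \<le> x \<Longrightarrow> Y x = (\<xi>\<^sup>2 - x\<^sup>2) / 2"
proof -
  define P where "P n y \<longleftrightarrow>
    (\<forall>x\<in>{- real n..4}. (y has_real_derivative - ((max 0 (y x)) ^ k) - x) (at x within {- real n..4})) \<and>
    (\<forall>x\<in>{- real n..-1}. root k (- x) \<le> y x \<and> y x \<le> root k (- x) + 1) \<and>
    (\<forall>x\<in>{-1..4}. y x \<le> 5 / 2 - x\<^sup>2 / 2)" for n and y :: "real \<Rightarrow> real"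
  have "\<forall>n. \<exists>y. 1 \<le> n \<longrightarrow> P n y" unfolding P_def using unit_tail_approximation[OF k] by blast
  then obtain U where U: "\<And>n. 1 \<le> n \<Longrightarrow> P n (U n)" by metis
  have UD: "(U n has_real_derivative - ((max 0 (U n x)) ^ k) - x) (at x within A)"
    if "1 \<le> n" "x \<in> {- real n..4}" "A \<subseteq> {- real n..4}" for n x A
    using U[OF that(1)] that DERIV_subset unfolding P_def by blast
  have Ulo: "root k (- x) \<le> U n x" "U n x \<le> root k (- x) + 1" if "1 \<le> n" "x \<in> {- real n..-1}" for n x
    using U[OF that(1)] that unfolding P_def by blast+
  have Umid: "U n x \<le> 5 / 2 - x\<^sup>2 / 2" if "1 \<le> n" "x \<in> {-1..4}" for n x
    using U[OF that(1)] that unfolding P_def by blast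
  have Umid': "U n x \<le> 3" if "1 \<le> n" "x \<in> {-1..4}" for n x
    using Umid[OF that] zero_le_power2[of x] by linarith
  \<comment> \<open>Uniform in x on the interval from \<open>a\<close> to 4, so that the
    differential equation survives the limit.\<close>
  have close: "\<bar>U m x - U n x\<bar> \<le> exp (1 - (a + real n))"
    if n: "1 \<le> n" "n \<le> m" and a: "- real n \<le> a" "a \<le> -1" and x: "x \<in> {a..4}" for n m a x
  proof -
    have contr1: "(U m t - U n t)\<^sup>2 \<le> exp (- 2 * 1 * (t - (- real n))) * (U m (- real n) - U n (- real n))\<^sup>2"
      if t: "t \<in> {- real n..-1}" for t
    proof (rule exponential_contraction)
      fix s assume s: "s \<in> {- real n..t}"
      show "(U m has_real_derivative - (max 0 (U m s) ^ k) - s) (at s within {- real n..t})"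
        "(U n has_real_derivative - (max 0 (U n s) ^ k) - s) (at s within {- real n..t})"
        using s t n by (auto intro!: UD)
      have "1 \<le> U m s" "1 \<le> U n s"
      proof -
        have "1 \<le> root k (- s)" using k s t by (intro root_ge_1) auto
        moreover have "root k (- s) \<le> U m s" "root k (- s) \<le> U n s"
          using n s t by (auto intro!: Ulo)
        ultimately show "1 \<le> U m s" "1 \<le> U n s" by linarith+
      qed
      then have "(U m s - U n s)\<^sup>2 \<le> (U m s - U n s) * (max 0 (U m s) ^ k - max 0 (U n s) ^ k)"
        using power_diff_ge[of "U m s" "U n s" k] k by simp
      then show "(U m s - U n s) * (- (max 0 (U m s) ^ k) - s - (- (max 0 (U n s) ^ k) - s)) \<le> - (1 * (U m s - U n s)\<^sup>2)"
        by (simp add: algebra_simps)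
    qed (use t in auto)
    have start: "(U m (- real n) - U n (- real n))\<^sup>2 \<le> 1"
      using Ulo[of m "- real n"] Ulo[of n "- real n"] n by (subst abs_square_le_1) (auto simp: abs_le_iff)
    have left: "(U m t - U n t)\<^sup>2 \<le> exp (- 2 * (t + real n))" if t: "t \<in> {- real n..-1}" for t
    proof -
      have eq: "- 2 * 1 * (t - (- real n)) = - 2 * (t + real n)" by simp
      show ?thesis
        using contr1[OF t] mult_left_mono[OF start exp_ge_zero, of "- 2 * (t + real n)"]
        unfolding eq by linarith
    qed
    have mono: "(u - v) * (max 0 u ^ k - max 0 v ^ k) \<ge> 0" for u v :: real
    proof (cases "u \<le> v")
      case True
      then have "max 0 u ^ k \<le> max 0 v ^ k" by (intro power_mono) auto
      then show ?thesis using True by (intro mult_nonpos_nonpos) auto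
    next
      case False
      then have "max 0 v ^ k \<le> max 0 u ^ k" by (intro power_mono) auto
      then show ?thesis using False by (intro mult_nonneg_nonneg) auto
    qed
    have "(U m x - U n x)\<^sup>2 \<le> (exp (1 - (a + real n)))\<^sup>2"
    proof (cases "x \<le> -1")
      case True
      have "(U m x - U n x)\<^sup>2 \<le> exp (- 2 * (x + real n))" using x a True by (intro left) auto
      also have "\<dots> \<le> exp (2 * (1 - (a + real n)))" using x by simp
      finally show ?thesis by (simp only: exp_double)
    next
      case False
      have "(U m x - U n x)\<^sup>2 \<le> exp (- 2 * 0 * (x - (-1))) * (U m (-1) - U n (-1))\<^sup>2"
      proof (rule exponential_contraction)
        fix s assume s: "s \<in> {-1..x}"
        show "(U m has_real_derivative - (max 0 (U m s) ^ k) - s) (at s within {-1..x})"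
          "(U n has_real_derivative - (max 0 (U n s) ^ k) - s) (at s within {-1..x})"
          using s x n by (auto intro!: UD)
        show "(U m s - U n s) * (- (max 0 (U m s) ^ k) - s - (- (max 0 (U n s) ^ k) - s)) \<le> - (0 * (U m s - U n s)\<^sup>2)"
          using mono[of "U m s" "U n s"] by (simp add: algebra_simps)
      qed (use False in auto)
      also have "\<dots> \<le> exp (- 2 * (-1 + real n))" using left[of "-1"] n by simp
      also have "\<dots> \<le> exp (2 * (1 - (a + real n)))" using a by simp
      finally show ?thesis by (simp only: exp_double)
    qed
    then have "\<bar>U m x - U n x\<bar> \<le> \<bar>exp (1 - (a + real n))\<bar>" by (simp only: abs_le_square_iff)
    then show ?thesis by simp
  qed
  have small: "\<exists>N. \<forall>n\<ge>N. exp (1 - (a + real n)) < e" if "e > 0" for a e :: real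
  proof -
    have "(\<lambda>n. exp (1 - (a + real n))) \<longlonglongrightarrow> 0" by real_asymp
    from LIMSEQ_D[OF this that] show ?thesis by auto
  qed
  have conv: "convergent (\<lambda>n. U n x)" if x: "x \<le> 4" for x
  proof (rule Cauchy_convergent, rule CauchyI')
    fix e :: real assume "e > 0"
    obtain N where N: "\<And>n. n \<ge> N \<Longrightarrow> exp (1 - (min x (-1) + real n)) < e" using small[OF \<open>e > 0\<close>] by blast
    define N' where "N' = max N (nat \<lceil>\<bar>x\<bar>\<rceil> + 1)"
    have "dist (U m x) (U n x) < e" if "N' \<le> m" "m < n" for m n
    proof -
      have "real m \<ge> \<bar>x\<bar> + 1" using that(1) unfolding N'_def by linarith
      then have "\<bar>U n x - U m x\<bar> \<le> exp (1 - (min x (-1) + real m))"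
        using that x by (intro close) auto
      also have "\<dots> < e" using that by (intro N) (simp add: N'_def)
      finally show ?thesis by (simp add: dist_real_def abs_minus_commute)
    qed
    then show "\<exists>M. \<forall>m\<ge>M. \<forall>n>m. dist (U m x) (U n x) < e" by blast
  qed
  define y where "y x = lim (\<lambda>n. U n x)" for x
  have lim: "(\<lambda>n. U n x) \<longlonglongrightarrow> y x" if "x \<le> 4" for x
    using conv[OF that] by (simp add: y_def convergent_LIMSEQ_iff)
  have ylo: "root k (- x) \<le> y x" "y x \<le> root k (- x) + 1" if "x \<le> -1" for x
  proof -
    have "\<forall>\<^sub>F n in sequentially. root k (- x) \<le> U n x \<and> U n x \<le> root k (- x) + 1"
      using eventually_ge_at_top[of "nat \<lceil>- x\<rceil> + 1"]
    proof eventually_elim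
      case (elim n)
      then have "- real n \<le> x" "1 \<le> n" by linarith+
      then show ?case using Ulo[of n x] that by auto
    qed
    then have ev: "\<forall>\<^sub>F n in sequentially. root k (- x) \<le> U n x"
        "\<forall>\<^sub>F n in sequentially. U n x \<le> root k (- x) + 1"
      by (auto elim: eventually_mono)
    have l: "(\<lambda>n. U n x) \<longlonglongrightarrow> y x" using lim that by auto
    show "root k (- x) \<le> y x" by (rule tendsto_lowerbound[OF l ev(1)]) simp
    show "y x \<le> root k (- x) + 1" by (rule tendsto_upperbound[OF l ev(2)]) simp
  qed
  have ymid: "y x \<le> 5 / 2 - x\<^sup>2 / 2" if "x \<in> {-1..4}" for x
  proof (rule tendsto_upperbound[of "\<lambda>n. U n x"])
    show "\<forall>\<^sub>F n in sequentially. U n x \<le> 5 / 2 - x\<^sup>2 / 2"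
      using eventually_ge_at_top[of 1] by eventually_elim (use Umid that in auto)
  qed (use lim that in auto)
  have yD: "(y has_real_derivative - ((max 0 (y x)) ^ k) - x) (at x within {a..4})"
    if a: "a \<le> -1" and x: "x \<in> {a..4}" for a x
  proof -
    define n0 where "n0 = nat \<lceil>- a\<rceil> + 1"
    have n0: "real n0 \<ge> - a" "n0 \<ge> 1" unfolding n0_def by linarith+
    define B where "B = - a + 4"
    have root_le: "root k (- t) \<le> - t" if "t \<le> -1" for t
    proof -
      have "(- t) ^ 1 \<le> (- t) ^ k" using that k by (intro power_increasing) auto
      then have "root k (- t) \<le> root k ((- t) ^ k)" using k by simp
      then show ?thesis using k that by (simp add: real_root_power_cancel)
    qed
    have UB: "U n t \<le> B" if "n0 \<le> n" "t \<in> {a..4}" for n t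
    proof (cases "t \<le> -1")
      case True
      then show ?thesis using Ulo(2)[of n t] root_le[OF True] that n0 by (auto simp: B_def)
    next
      case False
      then show ?thesis using Umid'[of n t] that n0 a by (auto simp: B_def)
    qed
    have yB: "y t \<le> B" if "t \<in> {a..4}" for t
    proof (rule tendsto_upperbound[of "\<lambda>n. U n t"])
      show "\<forall>\<^sub>F n in sequentially. U n t \<le> B"
        using eventually_ge_at_top[of n0] by eventually_elim (use UB that in auto)
    qed (use lim that in auto)
    have yclose: "\<bar>y t - U n t\<bar> \<le> exp (1 - (a + real n))" if n: "n0 \<le> n" and t: "t \<in> {a..4}" for n t
    proof (rule tendsto_upperbound[of "\<lambda>m. \<bar>U m t - U n t\<bar>"])
      show "((\<lambda>m. \<bar>U m t - U n t\<bar>) \<longlongrightarrow> \<bar>y t - U n t\<bar>) sequentially"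
        using lim[of t] t by (intro tendsto_intros) auto
      show "\<forall>\<^sub>F m in sequentially. \<bar>U m t - U n t\<bar> \<le> exp (1 - (a + real n))"
        using eventually_ge_at_top[of n]
        by eventually_elim (use close[of n _ a t] n n0 a t in auto)
    qed auto
    have ul: "uniform_limit {a..4} (\<lambda>n t. - (max 0 (U (n + n0) t) ^ k) - t) (\<lambda>t. - (max 0 (y t) ^ k) - t) sequentially"
    proof (rule uniform_limitI)
      fix e :: real assume "e > 0"
      define C where "C = real k * B ^ k + 1"
      have C: "C > 0" using a by (simp add: C_def B_def add_nonneg_pos)
      then have "e / C > 0" using \<open>e > 0\<close> by simp
      then obtain N where N: "\<And>n. n \<ge> N \<Longrightarrow> exp (1 - (a + real n)) < e / C" using small by blast
      show "\<forall>\<^sub>F n in sequentially. \<forall>t\<in>{a..4}. dist (- (max 0 (U (n + n0) t) ^ k) - t) (- (max 0 (y t) ^ k) - t) < e"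
        using eventually_ge_at_top[of N]
      proof (eventually_elim, intro ballI)
        fix n t assume n: "N \<le> n" and t: "t \<in> {a..4}"
        let ?u = "U (n + n0) t"
        have "\<bar>max 0 (y t) ^ k - max 0 ?u ^ k\<bar> \<le> real k * B ^ k * \<bar>max 0 (y t) - max 0 ?u\<bar>"
          using yB[OF t] UB[of "n + n0" t] t a by (intro power_diff_le) (auto simp: B_def)
        also have "\<dots> \<le> C * \<bar>y t - ?u\<bar>"
          using C a unfolding C_def by (intro mult_mono) (auto simp: B_def)
        also have "\<dots> \<le> C * exp (1 - (a + real (n + n0)))"
          using C t by (intro mult_left_mono yclose) auto
        also have "\<dots> < C * (e / C)" using C n by (intro mult_strict_left_mono N) auto
        finally show "dist (- (max 0 ?u ^ k) - t) (- (max 0 (y t) ^ k) - t) < e"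
          using C by (simp add: dist_real_def)
      qed
    qed
    have "(y has_vector_derivative (\<lambda>t. - (max 0 (y t) ^ k) - t) x) (at x within {a..4})"
    proof (rule has_vector_derivative_uniform_limit[OF _ ul _ x])
      fix n t assume t: "t \<in> {a..4}"
      show "(U (n + n0) has_vector_derivative - (max 0 (U (n + n0) t) ^ k) - t) (at t within {a..4})"
        using t n0 by (auto simp: has_real_derivative_iff_has_vector_derivative[symmetric] intro!: UD)
    next
      fix t assume "t \<in> {a..4}"
      then show "(\<lambda>n. U (n + n0) t) \<longlonglongrightarrow> y t" using lim[of t] by (intro LIMSEQ_ignore_initial_segment) auto
    qed
    then show ?thesis by (simp add: has_real_derivative_iff_has_vector_derivative)
  qed
  have cont: "continuous_on {-1..4} y" by (rule DERIV_continuous_on) (rule yD, auto)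
  define W where "W = {-1..4} \<inter> y -` {0}"
  have ym1: "1 \<le> y (-1)" using ylo(1)[of "-1"] k by simp
  have "\<exists>x\<ge>-1. x \<le> 4 \<and> y x = 0"
    using ym1 ymid[of 4] by (intro IVT2' cont) auto
  then have "W \<noteq> {}" by (auto simp: W_def)
  moreover have "compact W"
    using continuous_closed_preimage[OF cont, of "{0}"]
    by (auto simp: compact_eq_bounded_closed W_def intro: bounded_subset[of "{-1..4}"])
  ultimately obtain \<xi> where \<xi>: "\<xi> \<in> W" "\<And>w. w \<in> W \<Longrightarrow> \<xi> \<le> w"
    using compact_attains_inf[of W] by blast
  have \<xi>b: "-1 < \<xi>" "\<xi> \<le> 4" "y \<xi> = 0" using \<xi>(1) ym1 by (auto simp: W_def less_eq_real_def)
  have ypos: "0 < y x" if "x < \<xi>" for x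
  proof (cases "x \<le> -1")
    case True
    then have "1 \<le> root k (- x)" using k by (intro root_ge_1) auto
    then show ?thesis using ylo(1)[OF True] by linarith
  next
    case False
    show ?thesis
    proof (rule ccontr)
      assume "\<not> 0 < y x"
      then have "\<exists>z\<ge>-1. z \<le> x \<and> y z = 0"
        using ym1 False that \<xi>b by (intro IVT2' continuous_on_subset[OF cont]) auto
      then show False using \<xi>(2) that \<xi>b by (force simp: W_def)
    qed
  qed
  \<comment> \<open>The two pieces have the same one-sided derivative at \<open>\<xi>\<close>,
    because the power term vanishes at Y = 0.\<close>
  define Y where "Y x = (if x \<le> \<xi> then y x else (\<xi>\<^sup>2 - x\<^sup>2) / 2)" for x
  have YD1: "(Y has_real_derivative - (y x ^ k) - x) (at x within {..\<xi>})" if "x \<le> \<xi>" for x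
  proof -
    define a where "a = min x 0 - 2"
    have "(y has_real_derivative - ((max 0 (y x)) ^ k) - x) (at x within {a..4})"
      using that \<xi>b by (intro yD) (auto simp: a_def)
    then have "(y has_real_derivative - ((max 0 (y x)) ^ k) - x) (at x within {a..\<xi>})"
      by (rule DERIV_subset) (use \<xi>b in auto)
    moreover have "max 0 (y x) = y x" using ypos[of x] that \<xi>b by (cases "x = \<xi>") auto
    moreover have "at x within {a..\<xi>} = at x within {..\<xi>}"
      by (rule at_within_nhd[of _ "{a<..}"]) (auto simp: a_def)
    ultimately have "(y has_real_derivative - (y x ^ k) - x) (at x within {..\<xi>})" by simp
    then show ?thesis
      unfolding has_field_derivative_def
      by (rule has_derivative_transform[rotated 2]) (use that in \<open>auto simp: Y_def\<close>)
  qed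
  have YD2: "(Y has_real_derivative - x) (at x within {\<xi>..})" if "\<xi> \<le> x" for x
  proof -
    have "((\<lambda>x. (\<xi>\<^sup>2 - x\<^sup>2) / 2) has_real_derivative - x) (at x within {\<xi>..})"
      by (auto intro!: derivative_eq_intros)
    then show ?thesis
      unfolding has_field_derivative_def
      by (rule has_derivative_transform[rotated 2]) (use that \<xi>b in \<open>auto simp: Y_def\<close>)
  qed
  have tail: "tail_solution k 1 1 Y \<xi>"
    unfolding tail_solution_def
  proof (intro conjI allI impI)
    fix x assume "x \<le> \<xi>"
    then show "(Y has_real_derivative - (1 * Y x ^ k) - 1 * x) (at x within {..\<xi>})"
      using YD1[of x] by (simp add: Y_def)
  next
    have "\<bar>Y x - root k (- 1 * x / 1)\<bar> \<le> 1" if "x \<le> -1" for x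
      using ylo[OF that] that \<xi>b by (simp add: Y_def abs_le_iff)
    then show "\<exists>M N. \<forall>x\<le>N. \<bar>Y x - root k (- 1 * x / 1)\<bar> \<le> M" by blast
  qed
  have Y0: "Y \<xi> = 0" using \<xi>b by (simp add: Y_def)
  have \<xi>0: "0 < \<xi>" using tail_solution_zero(1)[OF tail _ _ _ Y0] k by simp
  have Yneg: "Y x = (\<xi>\<^sup>2 - x\<^sup>2) / 2" if "\<xi> \<le> x" for x
    using that \<xi>b by (cases "x = \<xi>") (auto simp: Y_def)
  have YD: "(Y has_real_derivative - (max 0 (Y x) ^ k) - x) (at x)" for x
  proof -
    consider "x < \<xi>" | "x = \<xi>" | "\<xi> < x" by linarith
    then show ?thesis
    proof cases
      case 1
      have "at x within {..\<xi>} = at x"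
        by (rule at_within_open_subset[of _ "{..<\<xi>}"]) (use 1 in auto)
      then show ?thesis using YD1[of x] 1 ypos[of x] by (simp add: Y_def)
    next
      case 2
      have "(Y has_real_derivative - \<xi>) (at \<xi>)"
        using YD1[of \<xi>] YD2[of \<xi>] \<xi>b k by (intro DERIV_at_of_both_sides) (auto simp: power_0_left)
      then show ?thesis using 2 Y0 k by (simp add: power_0_left)
    next
      case 3
      have "at x within {\<xi>..} = at x"
        by (rule at_within_open_subset[of _ "{\<xi><..}"]) (use 3 in auto)
      moreover have "\<xi>\<^sup>2 \<le> x\<^sup>2" using 3 \<xi>0 by (intro power_mono) auto
      then have "Y x \<le> 0" using 3 Yneg[of x] by simp
      ultimately show ?thesis using YD2[of x] 3 k by (simp add: max_def power_0_left)
    qed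
  qed
  show ?thesis
    using that[of \<xi> Y] \<xi>0 tail Y0 YD ypos Yneg by (auto simp: Y_def)
qed

section \<open>The rescaled field near the fold\<close>

text \<open>The components of \<open>X\<^sup>+\<close> and \<open>X\<^sup>-\<close> will be precomposed with a projection onto a small box, so
  that all bounds hold globally and flows exist for all times; \<open>a\<close> stands for \<open>phi_lead k \<phi>\<close>.\<close>

locale fold_system =
  fixes k :: nat and \<phi> :: "real \<Rightarrow> real" and a d M g0 b1 :: real
    and f1 f2 f3 g1 g2 g3 :: "r3 \<Rightarrow> real" and G :: "real \<Rightarrow> real"
  assumes k: "2 \<le> k" and a: "0 < a" and d: "0 < d" "d \<le> 1" and M: "1 \<le> M"
    and g0: "0 < g0" and b1: "0 < b1"
    and mono: "mono \<phi>" and phi_abs: "\<bar>\<phi> y\<bar> \<le> 1" and phi_low: "y \<le> -1 \<Longrightarrow> \<phi> y = -1"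
    and phi_lip: "\<bar>\<phi> x - \<phi> y\<bar> \<le> M * \<bar>x - y\<bar>"
    and phi_taylor: "0 \<le> y \<Longrightarrow> \<bar>1 + \<phi> (y - 1) - a * y ^ k\<bar> \<le> M * y ^ (k + 1)"
    and bound: "f \<in> {f1, f2, f3, g1, g2, g3} \<Longrightarrow> \<bar>f p\<bar> \<le> M"
    and lip: "f \<in> {f1, f2, f3, g1, g2, g3} \<Longrightarrow> \<bar>f p - f q\<bar> \<le> M * norm (p - q)"
    and g1_ge: "1 / 2 \<le> g1 p"
    and f2_le: "- d \<le> z \<Longrightarrow> z \<le> 0 \<Longrightarrow> f2 (0, 0, z) \<le> b1 * z"
    and g2_approx: "\<bar>x\<bar> \<le> d \<Longrightarrow> \<bar>y\<bar> \<le> d \<Longrightarrow> \<bar>z\<bar> \<le> d \<Longrightarrow> \<bar>g2 (x, y, z) + G z * x\<bar> \<le> M * (x\<^sup>2 + \<bar>y\<bar>)"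
    and g2_mixed: "\<bar>x\<bar> \<le> d \<Longrightarrow> \<bar>y\<bar> \<le> d \<Longrightarrow> \<bar>z\<bar> \<le> d \<Longrightarrow> \<bar>z'\<bar> \<le> d \<Longrightarrow>
      \<bar>g2 (x, y, z) - g2 (x, y, z')\<bar> \<le> M * (\<bar>x\<bar> + \<bar>y\<bar>) * \<bar>z - z'\<bar>"
    and G_ge: "\<bar>z\<bar> \<le> d \<Longrightarrow> g0 \<le> G z" and G_le: "\<bar>z\<bar> \<le> d \<Longrightarrow> G z \<le> M"
    and G_lip: "\<bar>z\<bar> \<le> d \<Longrightarrow> \<bar>z'\<bar> \<le> d \<Longrightarrow> \<bar>G z - G z'\<bar> \<le> M * \<bar>z - z'\<bar>"
begin

text \<open>The point of the piecewise smooth system that belongs to a point of the second chart: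
  the middle entry is \<open>\<epsilon> * (y - 1)\<close> with
  \<open>\<epsilon> = r ^ (2 * (2 * k - 1))\<close> and the shifted coordinate
  \<open>r\<^sup>2 * y\<close> in place of \<open>y\<close>.\<close>

definition arg :: "real \<Rightarrow> r3 \<Rightarrow> r3" where
  "arg r = (\<lambda>(x, y, z). (r ^ (2 * k) * x, r ^ (2 * (2 * k - 1)) * (r\<^sup>2 * y - 1), z))"

text \<open>The slow-fast field in the second chart, divided by \<open>r ^ (2 * (k - 1))\<close>;
  \<open>SF_chart2\<close> verifies this. The quotient by \<open>r ^ (2 * k)\<close> stays bounded
  on bounded sets, because both \<open>1 + \<phi>\<close> and \<open>g2\<close> are of order
  \<open>r ^ (2 * k)\<close> there.\<close>

definition V :: "real \<Rightarrow> r3 \<Rightarrow> r3" where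
  "V r u = (case u of (x, y, z) \<Rightarrow>
     ((1 + \<phi> (r\<^sup>2 * y - 1)) * f1 (arg r u) + (1 - \<phi> (r\<^sup>2 * y - 1)) * g1 (arg r u),
      ((1 + \<phi> (r\<^sup>2 * y - 1)) * f2 (arg r u) + (1 - \<phi> (r\<^sup>2 * y - 1)) * g2 (arg r u)) / r ^ (2 * k),
      r ^ (2 * k) * ((1 + \<phi> (r\<^sup>2 * y - 1)) * f3 (arg r u) + (1 - \<phi> (r\<^sup>2 * y - 1)) * g3 (arg r u))))"

text \<open>The limit of \<open>V r\<close> as \<open>r \<rightarrow> 0\<close>; \<open>max 0 y\<close> appears since \<open>\<phi>\<close> is constant below \<open>-1\<close>.\<close>

definition V0 :: "r3 \<Rightarrow> r3" where
  "V0 = (\<lambda>(x, y, z). (2 * g1 (0, 0, z), a * f2 (0, 0, z) * (max 0 y) ^ k - 2 * G z * x, 0))"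

end

lemma norm_r3_le: "norm ((x, y, z) :: r3) \<le> \<bar>x\<bar> + \<bar>y\<bar> + \<bar>z\<bar>"
proof -
  have "norm ((x, y, z) :: r3) \<le> norm x + norm (y, z)" by (rule norm_Pair_le)
  also have "norm (y, z) \<le> norm y + norm z" by (rule norm_Pair_le)
  finally show ?thesis by simp
qed

lemma r3_components_le_norm:
  "\<bar>x\<bar> \<le> norm ((x, y, z) :: r3)" "\<bar>y\<bar> \<le> norm ((x, y, z) :: r3)" "\<bar>z\<bar> \<le> norm ((x, y, z) :: r3)"
  using norm_fst_le[of x "(y, z)"] norm_snd_le[of "(y, z)" x] norm_fst_le[of y z] norm_snd_le[of z y]
  by auto

lemma abs_mult_diff_le:
  fixes p q p' q' :: real
  assumes "\<bar>p - p'\<bar> \<le> P" "\<bar>q - q'\<bar> \<le> Q" "\<bar>q\<bar> \<le> A" "\<bar>p'\<bar> \<le> B"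
  shows "\<bar>p * q - p' * q'\<bar> \<le> P * A + B * Q"
proof -
  have "p * q - p' * q' = (p - p') * q + p' * (q - q')" by (simp add: algebra_simps)
  then have "\<bar>p * q - p' * q'\<bar> \<le> \<bar>p - p'\<bar> * \<bar>q\<bar> + \<bar>p'\<bar> * \<bar>q - q'\<bar>"
    by (metis abs_mult abs_triangle_ineq)
  also have "\<dots> \<le> P * A + B * Q"
    using assms abs_ge_zero[of "p - p'"] abs_ge_zero[of "p'"] by (intro add_mono mult_mono) linarith+
  finally show ?thesis .
qed

lemma abs_combination_le:
  fixes u v w :: real
  shows "\<bar>u\<bar> \<le> A \<Longrightarrow> \<bar>v\<bar> \<le> B \<Longrightarrow> \<bar>w\<bar> \<le> C \<Longrightarrow> \<bar>u - v + 2 * w\<bar> \<le> A + B + 2 * C"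
  by linarith

context fold_system begin

section \<open>Closeness of the rescaled field to its limit, and its Lipschitz properties\<close>

lemma phi_shift_low: "y \<le> 0 \<Longrightarrow> \<phi> (y - 1) = -1"
  using phi_low[of "y - 1"] by simp

lemma one_plus_phi_le: "0 \<le> 1 + \<phi> y" "1 + \<phi> y \<le> 2" "0 \<le> 1 - \<phi> y" "1 - \<phi> y \<le> 2"
  using phi_abs[of y] by auto

text \<open>At the argument \<open>r\<^sup>2 * y\<close> the leading term of the expansion has the
  order \<open>r ^ (2 * k)\<close>, and the remainder gains a further \<open>r\<^sup>2\<close>. For
  negative y both sides are constant in \<open>\<phi>\<close>, which is what \<open>max 0 y\<close>
  encodes.\<close>

lemma phi_approx:
  assumes "\<bar>y\<bar> \<le> B" "0 \<le> r" "r \<le> 1" "1 \<le> B"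
  shows "\<bar>1 + \<phi> (r\<^sup>2 * y - 1) - a * r ^ (2 * k) * (max 0 y) ^ k\<bar> \<le> M * B ^ (k + 1) * r ^ (2 * k) * r\<^sup>2"
proof (cases "0 \<le> y")
  case True
  have "\<bar>1 + \<phi> (r\<^sup>2 * y - 1) - a * (r\<^sup>2 * y) ^ k\<bar> \<le> M * (r\<^sup>2 * y) ^ (k + 1)"
    using True by (intro phi_taylor) auto
  also have "\<dots> \<le> M * (r\<^sup>2 * B) ^ (k + 1)"
    using True assms M by (intro mult_left_mono power_mono) auto
  finally have *: "\<bar>1 + \<phi> (r\<^sup>2 * y - 1) - a * (r\<^sup>2 * y) ^ k\<bar> \<le> M * (r\<^sup>2 * B) ^ (k + 1)" .
  have e1: "(r\<^sup>2 * B) ^ (k + 1) = B ^ (k + 1) * (r ^ (2 * k) * r\<^sup>2)"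
    by (simp add: power_mult_distrib power_mult)
  have e2: "(r\<^sup>2 * y) ^ k = r ^ (2 * k) * y ^ k" by (simp add: power_mult_distrib power_mult)
  show ?thesis using * True unfolding e1 e2 by (simp add: mult.assoc)
next
  case False
  then have "r\<^sup>2 * y \<le> 0" by (intro mult_nonneg_nonpos) auto
  then have "\<phi> (r\<^sup>2 * y - 1) = -1" by (rule phi_shift_low)
  then show ?thesis using False k M assms by (simp add: power_0_left)
qed

lemma phi_small:
  assumes "\<bar>y\<bar> \<le> B" "0 \<le> r" "r \<le> 1" "1 \<le> B"
  shows "1 + \<phi> (r\<^sup>2 * y - 1) \<le> (a + M) * B ^ (k + 1) * r ^ (2 * k)"
proof -
  have "1 + \<phi> (r\<^sup>2 * y - 1) \<le> a * r ^ (2 * k) * (max 0 y) ^ k + M * B ^ (k + 1) * r ^ (2 * k) * r\<^sup>2"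
    using phi_approx[OF assms] by linarith
  also have "\<dots> \<le> a * r ^ (2 * k) * B ^ (k + 1) + M * B ^ (k + 1) * r ^ (2 * k) * 1"
  proof (intro add_mono mult_left_mono)
    have "(max 0 y) ^ k \<le> B ^ k" using assms by (intro power_mono) auto
    also have "\<dots> \<le> B ^ (k + 1)" using assms by (intro power_increasing) auto
    finally show "(max 0 y) ^ k \<le> B ^ (k + 1)" .
  qed (use assms a M in \<open>auto simp: power_le_one\<close>)
  finally show ?thesis by (simp add: algebra_simps)
qed

text \<open>The exponents compare as \<open>2 * k + 2 \<le> 2 * (2 * k - 1)\<close>, which is
  \<open>k \<ge> 2\<close>. Thus \<open>\<epsilon> * (y - 1)\<close> is smaller than the scale
  \<open>r ^ (2 * k)\<close> of x by a factor \<open>r\<^sup>2\<close>, and the y-dependence of the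
  fields disappears in the limit.\<close>

lemma eps_le: "0 \<le> (r::real) \<Longrightarrow> r \<le> 1 \<Longrightarrow> r ^ (2 * (2 * k - 1)) \<le> r ^ (2 * k) * r\<^sup>2"
proof -
  assume r: "0 \<le> r" "r \<le> 1"
  have "2 * k + 2 \<le> 2 * (2 * k - 1)" using k by linarith
  then have "r ^ (2 * (2 * k - 1)) \<le> r ^ (2 * k + 2)" using r by (intro power_decreasing)
  then show ?thesis by (simp only: power_add)
qed

lemma arg_bounds:
  fixes x y r B :: real
  assumes "\<bar>x\<bar> \<le> B" "\<bar>y\<bar> \<le> B" "0 \<le> r" "r \<le> 1" "1 \<le> B"
  shows "\<bar>r ^ (2 * k) * x\<bar> \<le> B * r ^ (2 * k)"
    "\<bar>r ^ (2 * (2 * k - 1)) * (r\<^sup>2 * y - 1)\<bar> \<le> (2 * B * r\<^sup>2) * r ^ (2 * k)"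
    "2 * B * r\<^sup>2 * r ^ (2 * k) \<le> 2 * B * r\<^sup>2" "B * r ^ (2 * k) \<le> B * r\<^sup>2"
proof -
  have r2: "r\<^sup>2 \<le> 1" using assms by (intro power_le_one)
  have rk: "r ^ (2 * k) \<le> r\<^sup>2" using assms k by (intro power_decreasing) auto
  show "\<bar>r ^ (2 * k) * x\<bar> \<le> B * r ^ (2 * k)"
    using assms by (simp add: abs_mult mult.commute mult_right_mono)
  have "r\<^sup>2 * \<bar>y\<bar> \<le> 1 * B" using assms r2 by (intro mult_mono) auto
  moreover have "\<bar>r\<^sup>2 * y\<bar> = r\<^sup>2 * \<bar>y\<bar>" by (simp add: abs_mult)
  ultimately have "\<bar>r\<^sup>2 * y - 1\<bar> \<le> 2 * B" using assms(5) by linarith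
  then have "r ^ (2 * (2 * k - 1)) * \<bar>r\<^sup>2 * y - 1\<bar> \<le> (r ^ (2 * k) * r\<^sup>2) * (2 * B)"
    using eps_le assms by (intro mult_mono) auto
  then show "\<bar>r ^ (2 * (2 * k - 1)) * (r\<^sup>2 * y - 1)\<bar> \<le> (2 * B * r\<^sup>2) * r ^ (2 * k)"
    using assms by (simp add: abs_mult mult_ac)
  show "2 * B * r\<^sup>2 * r ^ (2 * k) \<le> 2 * B * r\<^sup>2"
    using assms by (intro mult_left_le) (auto simp: power_le_one)
  show "B * r ^ (2 * k) \<le> B * r\<^sup>2" using assms rk by (intro mult_left_mono) auto
qed

text \<open>Each replacement costs a factor \<open>r\<^sup>2\<close>. Only the second component is
  delicate, as it is divided by \<open>r ^ (2 * k)\<close>: there every error must carry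
  \<open>r ^ (2 * k)\<close> besides the \<open>r\<^sup>2\<close>. The result is weakened to order
  r, the order in which the starting heights on the section depend on r.\<close>

lemma V_approx:
  assumes B: "1 \<le> B"
  obtains C r0 where "0 \<le> C" "0 < r0" "r0 \<le> 1"
    "\<And>r x y z. 0 < r \<Longrightarrow> r \<le> r0 \<Longrightarrow> \<bar>x\<bar> \<le> B \<Longrightarrow> \<bar>y\<bar> \<le> B \<Longrightarrow> \<bar>z\<bar> \<le> d \<Longrightarrow>
      norm (V r (x, y, z) - V0 (x, y, z)) \<le> C * r"
proof -
  define P where "P = (a + M) * B ^ (k + 1)"
  define C where "C = (2 * P * M + 6 * M * B) + (M * B ^ (k + 1) * M + a * B ^ k * (3 * M * B)
     + (P * (M * (B\<^sup>2 + 3 * B)) + 2 * M * (B\<^sup>2 + 2 * B))) + 4 * M"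
  have P0: "P \<ge> 0" using a M B by (simp add: P_def)
  have C0: "C \<ge> 0" using a M B P0 unfolding C_def by (intro add_nonneg_nonneg mult_nonneg_nonneg) auto
  \<comment> \<open>Keeps the arguments of the fields within the range \<open>d\<close> on which the
    expansion of \<open>g2\<close> is valid.\<close>
  define r0 where "r0 = min 1 (d / (2 * B))"
  show ?thesis
  proof (rule that[of C r0])
    show "0 < r0" "r0 \<le> 1" using d B by (auto simp: r0_def)
    fix r x y z :: real
    assume r: "0 < r" "r \<le> r0" and x: "\<bar>x\<bar> \<le> B" and y: "\<bar>y\<bar> \<le> B" and z: "\<bar>z\<bar> \<le> d"
    have r1: "0 \<le> r" "r \<le> 1" and rd: "2 * B * r \<le> d" using r B by (auto simp: r0_def field_simps)
    have rr: "r\<^sup>2 \<le> r" using r1 by (simp add: power2_eq_square mult_left_le)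
    define p where "p = 1 + \<phi> (r\<^sup>2 * y - 1)"
    define R where "R = r ^ (2 * k)"
    define X where "X = R * x"
    define Y where "Y = r ^ (2 * (2 * k - 1)) * (r\<^sup>2 * y - 1)"
    have R: "0 < R" "R \<le> r\<^sup>2" "R \<le> 1" using r1 r k by (auto simp: R_def power_le_one intro!: power_decreasing)
    have p: "0 \<le> p" "p \<le> P * R" "\<bar>p\<bar> \<le> 2"
      using one_plus_phi_le phi_small[OF y r1 B] by (auto simp: p_def P_def R_def)
    have q: "1 - \<phi> (r\<^sup>2 * y - 1) = 2 - p" by (simp add: p_def)
    have pa: "\<bar>p - a * R * max 0 y ^ k\<bar> \<le> M * B ^ (k + 1) * R * r\<^sup>2"
      using phi_approx[OF y r1 B] by (simp add: p_def R_def)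
    have X1: "\<bar>X\<bar> \<le> B * R" and Y1: "\<bar>Y\<bar> \<le> 2 * B * r\<^sup>2 * R"
      using arg_bounds(1,2)[OF x y r1 B] by (auto simp: X_def Y_def R_def)
    have Br: "B * R \<le> B * r\<^sup>2" "2 * B * r\<^sup>2 * R \<le> 2 * B * r\<^sup>2"
      using arg_bounds(3,4)[OF x y r1 B] by (auto simp: R_def)
    have BB: "2 * B * r\<^sup>2 \<le> 2 * B * r" using rr B by (intro mult_left_mono) auto
    have XBr: "\<bar>X\<bar> \<le> B * r\<^sup>2" using X1 Br by linarith
    have B0: "0 \<le> B * r\<^sup>2" using B by simp
    have XY: "\<bar>X\<bar> + \<bar>Y\<bar> \<le> 3 * B * r\<^sup>2" "\<bar>X\<bar> \<le> d" "\<bar>Y\<bar> \<le> d"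
      using X1 Y1 Br BB rd B0 by linarith+
    have arg: "arg r (x, y, z) = (X, Y, z)" by (simp add: arg_def X_def Y_def R_def)
    have dif: "\<bar>f (X, Y, z) - f (0, 0, z)\<bar> \<le> 3 * M * B * r\<^sup>2" if "f \<in> {f1, f2, f3, g1, g2, g3}" for f
    proof -
      have "\<bar>f (X, Y, z) - f (0, 0, z)\<bar> \<le> M * norm ((X, Y, z) - (0, 0, z))" using that by (rule lip)
      also have "\<dots> \<le> M * (3 * B * r\<^sup>2)"
        using norm_r3_le[of X Y 0] XY M by (intro mult_left_mono) auto
      finally show ?thesis by simp
    qed
    have Mf: "\<bar>f1 q\<bar> \<le> M" "\<bar>f2 q\<bar> \<le> M" "\<bar>f3 q\<bar> \<le> M" "\<bar>g1 q\<bar> \<le> M" "\<bar>g3 q\<bar> \<le> M" for q by (auto intro!: bound)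
    have pR: "p \<le> P * r\<^sup>2" using p(2) mult_left_mono[OF R(2) P0] by linarith
    have c1: "\<bar>(p * f1 (X, Y, z) + (2 - p) * g1 (X, Y, z)) - 2 * g1 (0, 0, z)\<bar> \<le> (2 * P * M + 6 * M * B) * r\<^sup>2"
    proof -
      have "\<bar>p * (f1 (X, Y, z) - g1 (X, Y, z))\<bar> \<le> (P * r\<^sup>2) * (2 * M)"
        unfolding abs_mult using p(1) pR Mf(1)[of "(X, Y, z)"] Mf(4)[of "(X, Y, z)"] by (intro mult_mono) auto
      moreover have "\<bar>g1 (X, Y, z) - g1 (0, 0, z)\<bar> \<le> 3 * M * B * r\<^sup>2" by (rule dif) simp
      moreover have "(p * f1 (X, Y, z) + (2 - p) * g1 (X, Y, z)) - 2 * g1 (0, 0, z) =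
        p * (f1 (X, Y, z) - g1 (X, Y, z)) + 2 * (g1 (X, Y, z) - g1 (0, 0, z))" by (simp add: algebra_simps)
      ultimately show ?thesis by (simp add: algebra_simps)
    qed
    have c3: "\<bar>R * (p * f3 (X, Y, z) + (2 - p) * g3 (X, Y, z))\<bar> \<le> 4 * M * r\<^sup>2"
    proof -
      have "\<bar>p * f3 (X, Y, z)\<bar> \<le> 2 * M" "\<bar>(2 - p) * g3 (X, Y, z)\<bar> \<le> 2 * M"
        unfolding abs_mult using p Mf(3,5)[of "(X, Y, z)"] by (auto intro!: mult_mono)
      then have "\<bar>p * f3 (X, Y, z) + (2 - p) * g3 (X, Y, z)\<bar> \<le> 4 * M" by linarith
      then have "R * \<bar>p * f3 (X, Y, z) + (2 - p) * g3 (X, Y, z)\<bar> \<le> r\<^sup>2 * (4 * M)"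
        using R M by (intro mult_mono) auto
      then show ?thesis using R by (simp add: abs_mult mult_ac)
    qed
    have c2: "\<bar>(p * f2 (X, Y, z) + (2 - p) * g2 (X, Y, z)) / R - (a * f2 (0, 0, z) * max 0 y ^ k - 2 * G z * x)\<bar>
       \<le> (M * B ^ (k + 1) * M + a * B ^ k * (3 * M * B) + (P * (M * (B\<^sup>2 + 3 * B)) + 2 * M * (B\<^sup>2 + 2 * B))) * r\<^sup>2"
    proof -
      have yk: "0 \<le> a * R * max 0 y ^ k" "a * R * max 0 y ^ k \<le> a * R * B ^ k"
        using a R B y by (auto intro!: mult_left_mono power_mono)
      have A: "\<bar>p * f2 (X, Y, z) - (a * R * max 0 y ^ k) * f2 (0, 0, z)\<bar> \<le> (M * B ^ (k + 1) * R * r\<^sup>2) * M + (a * R * B ^ k) * (3 * M * B * r\<^sup>2)"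
        using yk pa Mf(2) by (intro abs_mult_diff_le dif) auto
      \<comment> \<open>One factor of \<open>X\<^sup>2\<close> is bounded by \<open>B * R\<close>
        and the other by \<open>B * r\<^sup>2\<close>, so the quadratic term also carries the
        \<open>R\<close> that the division consumes.\<close>
      have D: "\<bar>g2 (X, Y, z) + G z * X\<bar> \<le> M * ((B\<^sup>2 + 2 * B) * (R * r\<^sup>2))"
      proof -
        have "\<bar>g2 (X, Y, z) + G z * X\<bar> \<le> M * (X\<^sup>2 + \<bar>Y\<bar>)" by (rule g2_approx) (use XY z in auto)
        also have "\<dots> \<le> M * ((B * R) * (B * r\<^sup>2) + 2 * B * r\<^sup>2 * R)"
        proof (intro mult_left_mono add_mono)
          have "X\<^sup>2 = \<bar>X\<bar> * \<bar>X\<bar>" by (simp add: power2_eq_square)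
          also have "\<bar>X\<bar> * \<bar>X\<bar> \<le> (B * R) * (B * r\<^sup>2)" using X1 XBr B R by (intro mult_mono) auto
          finally show "X\<^sup>2 \<le> (B * R) * (B * r\<^sup>2)" .
        qed (use Y1 M in auto)
        also have "\<dots> = M * ((B\<^sup>2 + 2 * B) * (R * r\<^sup>2))" by (simp add: algebra_simps power2_eq_square)
        finally show ?thesis .
      qed
      have gM: "\<bar>g2 (X, Y, z)\<bar> \<le> M * (B\<^sup>2 + 3 * B) * R"
      proof -
        have "\<bar>G z * X\<bar> \<le> M * (B * R)"
          unfolding abs_mult using X1 G_ge[OF z] G_le[OF z] g0 M by (intro mult_mono) auto
        moreover have "M * ((B\<^sup>2 + 2 * B) * (R * r\<^sup>2)) \<le> M * ((B\<^sup>2 + 2 * B) * (R * 1))"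
          using M B R r1 by (intro mult_left_mono) (auto intro!: power_le_one)
        ultimately have "\<bar>g2 (X, Y, z)\<bar> \<le> M * (B * R) + M * ((B\<^sup>2 + 2 * B) * (R * 1))" using D by linarith
        then show ?thesis by (simp add: algebra_simps)
      qed
      have Bq: "\<bar>p * g2 (X, Y, z)\<bar> \<le> (P * r\<^sup>2) * (M * (B\<^sup>2 + 3 * B) * R)"
        unfolding abs_mult using p pR gM by (intro mult_mono) auto
      have "(p * f2 (X, Y, z) + (2 - p) * g2 (X, Y, z)) / R - (a * f2 (0, 0, z) * max 0 y ^ k - 2 * G z * x) =
        ((p * f2 (X, Y, z) - (a * R * max 0 y ^ k) * f2 (0, 0, z)) - p * g2 (X, Y, z) + 2 * (g2 (X, Y, z) + G z * X)) / R"
        using R by (simp add: X_def field_simps)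
      also have "\<bar>\<dots>\<bar> \<le> ((M * B ^ (k + 1) * M + a * B ^ k * (3 * M * B) + (P * (M * (B\<^sup>2 + 3 * B)) + 2 * M * (B\<^sup>2 + 2 * B))) * r\<^sup>2 * R) / R"
      proof -
        have "\<bar>(p * f2 (X, Y, z) - (a * R * max 0 y ^ k) * f2 (0, 0, z)) - p * g2 (X, Y, z) + 2 * (g2 (X, Y, z) + G z * X)\<bar>
          \<le> (M * B ^ (k + 1) * R * r\<^sup>2) * M + (a * R * B ^ k) * (3 * M * B * r\<^sup>2) + (P * r\<^sup>2) * (M * (B\<^sup>2 + 3 * B) * R) + 2 * (M * ((B\<^sup>2 + 2 * B) * (R * r\<^sup>2)))"
          using A Bq D by (rule abs_combination_le)
        also have "\<dots> = (M * B ^ (k + 1) * M + a * B ^ k * (3 * M * B) + (P * (M * (B\<^sup>2 + 3 * B)) + 2 * M * (B\<^sup>2 + 2 * B))) * r\<^sup>2 * R"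
          by (simp add: algebra_simps)
        finally show ?thesis unfolding abs_divide abs_of_pos[OF R(1)]
          by (rule divide_right_mono) (use R in simp)
      qed
      finally show ?thesis using R by simp
    qed
    have "norm (V r (x, y, z) - V0 (x, y, z)) \<le>
      \<bar>(p * f1 (X, Y, z) + (2 - p) * g1 (X, Y, z)) - 2 * g1 (0, 0, z)\<bar> +
      \<bar>(p * f2 (X, Y, z) + (2 - p) * g2 (X, Y, z)) / R - (a * f2 (0, 0, z) * max 0 y ^ k - 2 * G z * x)\<bar> +
      \<bar>R * (p * f3 (X, Y, z) + (2 - p) * g3 (X, Y, z))\<bar>"
      using norm_r3_le by (simp add: V_def V0_def arg q p_def[symmetric] R_def[symmetric] diff_minus_eq_add)
    also have "\<dots> \<le> C * r\<^sup>2" using c1 c2 c3 by (simp add: C_def distrib_right)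
    also have "\<dots> \<le> C * r" using rr C0 by (intro mult_left_mono)
    finally show "norm (V r (x, y, z) - V0 (x, y, z)) \<le> C * r" .
  qed (rule C0)
qed

lemma V0_lipschitz:
  assumes B: "1 \<le> B"
  obtains L where "0 \<le> L"
    "\<And>x y z x' y' z'. \<lbrakk>\<bar>x\<bar> \<le> B; \<bar>y\<bar> \<le> B; \<bar>z\<bar> \<le> d; \<bar>x'\<bar> \<le> B; \<bar>y'\<bar> \<le> B; \<bar>z'\<bar> \<le> d\<rbrakk> \<Longrightarrow>
      norm (V0 (x, y, z) - V0 (x', y', z')) \<le> L * norm ((x, y, z) - (x', y', z'))"
proof -
  define L where "L = 2 * M + a * (M * B ^ k + M * (real k * B ^ k)) + 2 * (M * B + M * 1)"
  show ?thesis
  proof (rule that[of L])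
    show "0 \<le> L" using a M B by (auto simp: L_def intro!: add_nonneg_nonneg mult_nonneg_nonneg)
    fix x y z x' y' z' :: real
    assume b: "\<bar>x\<bar> \<le> B" "\<bar>y\<bar> \<le> B" "\<bar>z\<bar> \<le> d" "\<bar>x'\<bar> \<le> B" "\<bar>y'\<bar> \<le> B" "\<bar>z'\<bar> \<le> d"
    define n where "n = norm ((x, y, z) - (x', y', z'))"
    have n: "\<bar>x - x'\<bar> \<le> n" "\<bar>y - y'\<bar> \<le> n" "\<bar>z - z'\<bar> \<le> n"
      using r3_components_le_norm[where x="x - x'" and y="y - y'" and z="z - z'"] by (auto simp: n_def)
    have zdiff: "\<bar>f (0, 0, z) - f (0, 0, z')\<bar> \<le> M * n" if "f \<in> {f1, f2, f3, g1, g2, g3}" for f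
    proof -
      have "\<bar>f (0, 0, z) - f (0, 0, z')\<bar> \<le> M * norm ((0, 0, z) - (0, 0, z') :: r3)" using that by (rule lip)
      also have "norm ((0, 0, z) - (0, 0, z') :: r3) = \<bar>z - z'\<bar>" by (simp add: norm_Pair)
      also have "M * \<bar>z - z'\<bar> \<le> M * n" using n M by (intro mult_left_mono) auto
      finally show ?thesis .
    qed
    have c1: "\<bar>2 * g1 (0, 0, z) - 2 * g1 (0, 0, z')\<bar> \<le> 2 * M * n" using zdiff[of g1] by simp
    have "\<bar>max 0 y ^ k - max 0 y' ^ k\<bar> \<le> real k * B ^ k * \<bar>max 0 y - max 0 y'\<bar>"
      using b B by (intro power_diff_le) auto
    also have "\<dots> \<le> real k * B ^ k * n" using n B by (intro mult_left_mono) auto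
    finally have yk: "\<bar>max 0 y ^ k - max 0 y' ^ k\<bar> \<le> real k * B ^ k * n" .
    have "\<bar>f2 (0, 0, z) * max 0 y ^ k - f2 (0, 0, z') * max 0 y' ^ k\<bar> \<le> (M * n) * B ^ k + M * (real k * B ^ k * n)"
    proof (rule abs_mult_diff_le[OF zdiff yk])
      show "\<bar>max 0 y ^ k\<bar> \<le> B ^ k" using b B by (auto intro!: power_mono)
    qed (auto intro: bound)
    then have c2a: "\<bar>a * (f2 (0, 0, z) * max 0 y ^ k - f2 (0, 0, z') * max 0 y' ^ k)\<bar> \<le> a * ((M * n) * B ^ k + M * (real k * B ^ k * n))"
      unfolding abs_mult using a by (intro mult_mono) auto
    have Gz: "\<bar>G z - G z'\<bar> \<le> M * n"
      by (rule order_trans[OF G_lip]) (use b n M in \<open>auto intro!: mult_left_mono\<close>)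
    have c2b: "\<bar>G z * x - G z' * x'\<bar> \<le> (M * n) * B + M * n"
      using abs_mult_diff_le[OF Gz n(1) b(1)] G_ge[OF b(6)] G_le[OF b(6)] g0 by auto
    have eq: "V0 (x, y, z) - V0 (x', y', z') = (2 * g1 (0, 0, z) - 2 * g1 (0, 0, z'),
      a * (f2 (0, 0, z) * max 0 y ^ k - f2 (0, 0, z') * max 0 y' ^ k) - 2 * (G z * x - G z' * x'), 0)"
      by (simp add: V0_def algebra_simps)
    have "norm (V0 (x, y, z) - V0 (x', y', z')) \<le> \<bar>2 * g1 (0, 0, z) - 2 * g1 (0, 0, z')\<bar> +
      \<bar>a * (f2 (0, 0, z) * max 0 y ^ k - f2 (0, 0, z') * max 0 y' ^ k) - 2 * (G z * x - G z' * x')\<bar> + \<bar>0\<bar>"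
      unfolding eq by (rule norm_r3_le)
    also have "\<dots> \<le> 2 * M * n + (a * ((M * n) * B ^ k + M * (real k * B ^ k * n)) + 2 * ((M * n) * B + M * n)) + 0"
      using c1 c2a c2b by (intro add_mono) (auto simp: abs_le_iff)
    also have "\<dots> = L * n" by (simp add: L_def algebra_simps)
    finally show "norm (V0 (x, y, z) - V0 (x', y', z')) \<le> L * norm ((x, y, z) - (x', y', z'))"
      by (simp add: n_def)
  qed
qed

lemma arg_lipschitz:
  assumes r: "0 \<le> r" "r \<le> 1"
  shows "norm (arg r u - arg r v) \<le> 3 * norm (u - v)"
proof -
  obtain x y z where u: "u = (x, y, z)" by (cases u)
  obtain x' y' z' where v: "v = (x', y', z')" by (cases v)
  let ?n = "norm (u - v)"
  have n: "\<bar>x - x'\<bar> \<le> ?n" "\<bar>y - y'\<bar> \<le> ?n" "\<bar>z - z'\<bar> \<le> ?n"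
    using r3_components_le_norm[where x="x - x'" and y="y - y'" and z="z - z'"] by (auto simp: u v)
  have le: "\<bar>r ^ i * s\<bar> \<le> \<bar>s\<bar>" for i and s :: real
    using r power_le_one[of r i] by (simp add: abs_mult mult_left_le_one_le)
  have eq: "arg r u - arg r v = (r ^ (2 * k) * (x - x'), r ^ (2 * (2 * k - 1)) * (r\<^sup>2 * (y - y')), z - z')"
    by (simp add: arg_def u v algebra_simps)
  have "norm (arg r u - arg r v) \<le> \<bar>r ^ (2 * k) * (x - x')\<bar> + \<bar>r ^ (2 * (2 * k - 1)) * (r\<^sup>2 * (y - y'))\<bar> + \<bar>z - z'\<bar>"
    unfolding eq by (rule norm_r3_le)
  also have "\<dots> \<le> ?n + ?n + ?n"
    using n le[of "2 * k" "x - x'"] le[of 2 "y - y'"] le[of "2 * (2 * k - 1)" "r\<^sup>2 * (y - y')"] by linarith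
  finally show ?thesis by simp
qed

lemma phi_rescaled_lipschitz:
  assumes r: "0 \<le> r" "r \<le> 1"
  shows "\<bar>\<phi> (r\<^sup>2 * y - 1) - \<phi> (r\<^sup>2 * y' - 1)\<bar> \<le> M * \<bar>y - y'\<bar>"
proof -
  have "\<bar>\<phi> (r\<^sup>2 * y - 1) - \<phi> (r\<^sup>2 * y' - 1)\<bar> \<le> M * \<bar>(r\<^sup>2 * y - 1) - (r\<^sup>2 * y' - 1)\<bar>" by (rule phi_lip)
  also have "(r\<^sup>2 * y - 1) - (r\<^sup>2 * y' - 1) = r\<^sup>2 * (y - y')" by (simp add: algebra_simps)
  also have "M * \<bar>r\<^sup>2 * (y - y')\<bar> \<le> M * \<bar>y - y'\<bar>"
    using M r power_le_one[of r 2] by (intro mult_left_mono) (auto simp: abs_mult mult_left_le_one_le)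
  finally show ?thesis .
qed

lemma mixture_lipschitz:
  assumes r: "0 \<le> r" "r \<le> 1" and fg: "f \<in> {f1, f2, f3, g1, g2, g3}" "g \<in> {f1, f2, f3, g1, g2, g3}"
  shows "\<bar>((1 + \<phi> (r\<^sup>2 * y - 1)) * f (arg r (x, y, z)) + (1 - \<phi> (r\<^sup>2 * y - 1)) * g (arg r (x, y, z))) -
    ((1 + \<phi> (r\<^sup>2 * y' - 1)) * f (arg r (x', y', z')) + (1 - \<phi> (r\<^sup>2 * y' - 1)) * g (arg r (x', y', z')))\<bar>
    \<le> 2 * (M * M + 6 * M) * norm ((x, y, z) - (x', y', z'))"
proof -
  let ?u = "(x, y, z)" and ?v = "(x', y', z')"
  let ?n = "norm (?u - ?v)"
  have dif: "\<bar>h (arg r ?u) - h (arg r ?v)\<bar> \<le> 3 * M * ?n" if "h \<in> {f1, f2, f3, g1, g2, g3}" for h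
  proof -
    have "\<bar>h (arg r ?u) - h (arg r ?v)\<bar> \<le> M * norm (arg r ?u - arg r ?v)" using that by (rule lip)
    also have "\<dots> \<le> M * (3 * ?n)" using M by (intro mult_left_mono arg_lipschitz r) auto
    finally show ?thesis by simp
  qed
  have "\<bar>y - y'\<bar> \<le> ?n" using r3_components_le_norm[where x="x - x'" and y="y - y'" and z="z - z'"] by auto
  then have "M * \<bar>y - y'\<bar> \<le> M * ?n" using M by (intro mult_left_mono) auto
  then have ph: "\<bar>\<phi> (r\<^sup>2 * y - 1) - \<phi> (r\<^sup>2 * y' - 1)\<bar> \<le> M * ?n"
    using phi_rescaled_lipschitz[OF r, of y y'] by linarith
  have A: "\<bar>(1 + \<phi> (r\<^sup>2 * y - 1)) * f (arg r ?u) - (1 + \<phi> (r\<^sup>2 * y' - 1)) * f (arg r ?v)\<bar> \<le> (M * ?n) * M + 2 * (3 * M * ?n)"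
    by (rule abs_mult_diff_le[OF _ dif[OF fg(1)] bound[OF fg(1)]]) (use ph phi_abs[of "r\<^sup>2 * y' - 1"] in auto)
  have B: "\<bar>(1 - \<phi> (r\<^sup>2 * y - 1)) * g (arg r ?u) - (1 - \<phi> (r\<^sup>2 * y' - 1)) * g (arg r ?v)\<bar> \<le> (M * ?n) * M + 2 * (3 * M * ?n)"
    by (rule abs_mult_diff_le[OF _ dif[OF fg(2)] bound[OF fg(2)]]) (use ph phi_abs[of "r\<^sup>2 * y' - 1"] in auto)
  have sum: "\<bar>(p + q) - (p' + q')\<bar> \<le> 2 * e" if "\<bar>p - p'\<bar> \<le> e" "\<bar>q - q'\<bar> \<le> e" for p q p' q' e :: real
    using that by linarith
  have eq: "2 * ((M * ?n) * M + 2 * (3 * M * ?n)) = 2 * (M * M + 6 * M) * ?n" by (simp add: algebra_simps)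
  show ?thesis using sum[OF A B] unfolding eq .
qed

text \<open>The constant grows like r to the power -2k. It therefore serves only existence and
  uniqueness of orbits at a fixed r, never an estimate uniform in r.\<close>

lemma V_lipschitz:
  assumes r: "0 < r" "r \<le> 1"
  obtains L where "0 < L" "\<And>u v. norm (V r u - V r v) \<le> L * norm (u - v)"
proof -
  define Q where "Q = 2 * (M * M + 6 * M)"
  define R where "R = r ^ (2 * k)"
  have Q: "Q > 0" using M by (auto simp: Q_def intro!: add_pos_pos)
  have R: "0 < R" "R \<le> 1" using r by (auto simp: R_def intro!: power_le_one)
  show ?thesis
  proof (rule that[of "Q + Q / R + Q"])
    show "0 < Q + Q / R + Q" using Q R by (auto intro!: add_pos_pos)
    fix u v :: r3
    obtain x y z where u: "u = (x, y, z)" by (cases u)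
    obtain x' y' z' where v: "v = (x', y', z')" by (cases v)
    note ml = mixture_lipschitz[OF less_imp_le[OF r(1)] r(2), where x=x and y=y and z=z and x'=x' and y'=y' and z'=z',
        folded Q_def u v]
    define F where "F f g = ((1 + \<phi> (r\<^sup>2 * y - 1)) * f (arg r u) + (1 - \<phi> (r\<^sup>2 * y - 1)) * g (arg r u)) -
      ((1 + \<phi> (r\<^sup>2 * y' - 1)) * f (arg r v) + (1 - \<phi> (r\<^sup>2 * y' - 1)) * g (arg r v))" for f g
    have F: "\<bar>F f1 g1\<bar> \<le> Q * norm (u - v)" "\<bar>F f2 g2\<bar> \<le> Q * norm (u - v)" "\<bar>F f3 g3\<bar> \<le> Q * norm (u - v)"
      unfolding F_def by (rule ml; simp)+
    have eq: "V r u - V r v = (F f1 g1, F f2 g2 / R, R * F f3 g3)"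
      by (simp add: V_def u v F_def R_def diff_divide_distrib right_diff_distrib)
    have "norm (V r u - V r v) \<le> \<bar>F f1 g1\<bar> + \<bar>F f2 g2 / R\<bar> + \<bar>R * F f3 g3\<bar>"
      unfolding eq by (rule norm_r3_le)
    also have "\<dots> \<le> Q * norm (u - v) + Q * norm (u - v) / R + 1 * (Q * norm (u - v))"
    proof (intro add_mono)
      show "\<bar>F f2 g2 / R\<bar> \<le> Q * norm (u - v) / R"
        using R F(2) unfolding abs_divide abs_of_pos[OF R(1)] by (intro divide_right_mono) auto
      show "\<bar>R * F f3 g3\<bar> \<le> 1 * (Q * norm (u - v))"
        using R F(3) Q unfolding abs_mult by (intro mult_mono) auto
    qed (rule F(1))
    finally show "norm (V r u - V r v) \<le> (Q + Q / R + Q) * norm (u - v)" by (simp add: algebra_simps)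
  qed
qed

lemma V_flow_exists:
  assumes r: "0 < r" "r \<le> 1" and "0 \<le> T"
  obtains u where "u 0 = u0" "\<And>t. t \<in> {0..T} \<Longrightarrow> (u has_vector_derivative V r (u t)) (at t within {0..T})"
proof -
  obtain L where L: "0 < L" "\<And>u v. norm (V r u - V r v) \<le> L * norm (u - v)" using V_lipschitz[OF r] by blast
  have "continuous_on UNIV (V r)"
  proof (rule continuous_on_subset[OF _ subset_UNIV], unfold continuous_on_iff, intro ballI allI impI)
    fix u and e :: real assume "0 < e"
    have "dist (V r v) (V r u) < e" if "dist v u < e / L" for v
    proof -
      have "dist (V r v) (V r u) \<le> L * dist v u" using L(2) by (simp add: dist_norm)
      also have "\<dots> < L * (e / L)" using that L(1) by (intro mult_strict_left_mono) auto
      finally show ?thesis using L(1) by simp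
    qed
    then show "\<exists>d>0. \<forall>v\<in>UNIV. dist v u < d \<longrightarrow> dist (V r v) (V r u) < e"
      using L(1) \<open>0 < e\<close> by (intro exI[of _ "e / L"]) auto
  qed
  then have "continuous_on {0..T} (\<lambda>t. V r (Y t))" if "continuous_on {0..T} Y" for Y
    using that continuous_on_compose2 by blast
  then show ?thesis
    using picard_lindelof_global[of 0 T L "\<lambda>_. V r" u0] L assms that by blast
qed

text \<open>\<open>g2\<close> vanishes on the fold line, and points of a bounded part of the chart
  have a distance of order \<open>r ^ (2 * k)\<close> from it.\<close>

lemma g2_le:
  assumes "\<bar>x\<bar> \<le> B" "\<bar>y\<bar> \<le> B" "\<bar>z\<bar> \<le> d" "0 \<le> r" "r \<le> 1" "1 \<le> B" "2 * B * r \<le> d"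
  shows "\<bar>g2 (arg r (x, y, z))\<bar> \<le> 3 * M * B * r ^ (2 * k)"
proof -
  define X where "X = r ^ (2 * k) * x"
  define Y where "Y = r ^ (2 * (2 * k - 1)) * (r\<^sup>2 * y - 1)"
  note ab = arg_bounds[OF assms(1,2,4-6), folded X_def Y_def]
  have g0: "g2 (0, 0, z) = 0" using g2_approx[of 0 0 z] d assms by simp
  have "r\<^sup>2 \<le> 1" using assms by (intro power_le_one)
  then have "(2 * B * r ^ (2 * k)) * r\<^sup>2 \<le> (2 * B * r ^ (2 * k)) * 1" using assms by (intro mult_left_mono) auto
  then have Y: "\<bar>Y\<bar> \<le> 2 * B * r ^ (2 * k)" using ab(2) by (simp add: mult_ac)
  have "\<bar>g2 (X, Y, z) - g2 (0, 0, z)\<bar> \<le> M * norm ((X, Y, z) - (0, 0, z))" by (rule lip) simp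
  also have "\<dots> \<le> M * (3 * B * r ^ (2 * k))"
    using norm_r3_le[of X Y 0] Y ab(1) M by (intro mult_left_mono) auto
  finally show ?thesis using g0 by (simp add: arg_def X_def Y_def)
qed

text \<open>The expansion of \<open>\<phi>\<close> does not control \<open>\<phi>'\<close>, hence no Lipschitz constant of \<open>V r\<close>, as \<open>r \<rightarrow> 0\<close>. But
  the uncontrolled part is decreasing in \<open>y\<close> (\<open>\<phi>\<close> is monotone and \<open>f2 < 0\<close>), so it drops out of a one-sided bound.\<close>

lemma V_onesided:
  assumes B: "1 \<le> B" and \<zeta>: "0 < \<zeta>"
  obtains L r0 where "0 \<le> L" "0 < r0" "r0 \<le> 1"
    "\<And>r x y z x' y' z'. \<lbrakk>0 < r; r \<le> r0; \<bar>x\<bar> \<le> B; \<bar>y\<bar> \<le> B; - d \<le> z; z \<le> - \<zeta>;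
       \<bar>x'\<bar> \<le> B; \<bar>y'\<bar> \<le> B; - d \<le> z'; z' \<le> - \<zeta>\<rbrakk> \<Longrightarrow>
      ((x, y, z) - (x', y', z')) \<bullet> (V r (x, y, z) - V r (x', y', z')) \<le> L * (norm ((x, y, z) - (x', y', z')))\<^sup>2"
proof -
  define P where "P = (a + M) * B ^ (k + 1)"
  define Q where "Q = 2 * (M * M + 6 * M)"
  define C where "C = P * (3 * M) + (M * (3 * M * B) + 2 * (M * (2 + 3 * B)))"
  \<comment> \<open>The last entry keeps \<open>f2\<close> nonpositive: on the fold line it is at
    most \<open>- (b1 * \<zeta>)\<close>, and moving off the line changes it by at most
    \<open>3 * M * B * r\<close>.\<close>
  define r0 where "r0 = min 1 (min (d / (2 * B)) (b1 * \<zeta> / (3 * M * B)))"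
  have P0: "P \<ge> 0" using a M B by (simp add: P_def)
  have Q0: "Q \<ge> 0" using M by (simp add: Q_def)
  have C0: "C \<ge> 0" using P0 M B by (auto simp: C_def intro!: add_nonneg_nonneg mult_nonneg_nonneg)
  show ?thesis
  proof (rule that[of "Q + C + Q" r0])
    show "0 \<le> Q + C + Q" using Q0 C0 by simp
    show "0 < r0" "r0 \<le> 1" using d B b1 \<zeta> M by (auto simp: r0_def)
    fix r x y z x' y' z' :: real
    assume r: "0 < r" "r \<le> r0" and b: "\<bar>x\<bar> \<le> B" "\<bar>y\<bar> \<le> B" "- d \<le> z" "z \<le> - \<zeta>"
       "\<bar>x'\<bar> \<le> B" "\<bar>y'\<bar> \<le> B" "- d \<le> z'" "z' \<le> - \<zeta>"
    have zd: "\<bar>z\<bar> \<le> d" "\<bar>z'\<bar> \<le> d" using b \<zeta> by auto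
    have r1: "0 \<le> r" "r \<le> 1" and rd: "2 * B * r \<le> d" and rb: "3 * M * B * r \<le> b1 * \<zeta>"
      using r B M by (auto simp: r0_def field_simps)
    have rr: "r\<^sup>2 \<le> r" using r1 by (simp add: power2_eq_square mult_left_le)
    have r2: "r\<^sup>2 \<le> 1" using rr r1 by linarith
    define R where "R = r ^ (2 * k)"
    have R: "0 < R" "R \<le> 1" using r r1 by (auto simp: R_def intro!: power_le_one)
    define u where "u = (x, y, z)"
    define v where "v = (x', y', z')"
    define n where "n = norm (u - v)"
    have n: "\<bar>x - x'\<bar> \<le> n" "\<bar>y - y'\<bar> \<le> n" "\<bar>z - z'\<bar> \<le> n" "0 \<le> n"
      using r3_components_le_norm[where x="x - x'" and y="y - y'" and z="z - z'"] by (auto simp: n_def u_def v_def)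
    note ml = mixture_lipschitz[OF r1, where x=x and y=y and z=z and x'=x' and y'=y' and z'=z',
        folded Q_def u_def v_def]
    define p where "p = 1 + \<phi> (r\<^sup>2 * y - 1)"
    define p' where "p' = 1 + \<phi> (r\<^sup>2 * y' - 1)"
    have q: "1 - \<phi> (r\<^sup>2 * y - 1) = 2 - p" "1 - \<phi> (r\<^sup>2 * y' - 1) = 2 - p'" by (auto simp: p_def p'_def)
    define F where "F f g = (p * f (arg r u) + (2 - p) * g (arg r u)) - (p' * f (arg r v) + (2 - p') * g (arg r v))" for f g
    have F: "\<bar>F f1 g1\<bar> \<le> Q * n" "\<bar>F f3 g3\<bar> \<le> Q * n"
      unfolding F_def n_def by (rule ml[unfolded q, folded p_def p'_def]; simp)+
    have eq: "V r u - V r v = (F f1 g1, F f2 g2 / R, R * F f3 g3)"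
      by (simp add: V_def u_def v_def F_def R_def q p_def[symmetric] p'_def[symmetric] diff_divide_distrib right_diff_distrib)
    have pp: "\<bar>p - p'\<bar> \<le> M * n"
    proof -
      have "\<bar>p - p'\<bar> \<le> M * \<bar>y - y'\<bar>" using phi_rescaled_lipschitz[OF r1, of y y'] by (simp add: p_def p'_def)
      also have "\<dots> \<le> M * n" using M n by (intro mult_left_mono) auto
      finally show ?thesis .
    qed
    have p'P: "0 \<le> p'" "p' \<le> P * R" "p' \<le> 2" "\<bar>2 - p'\<bar> \<le> 2"
      using phi_small[OF b(6) r1 B] one_plus_phi_le by (auto simp: p'_def P_def R_def)
    have f2neg: "f2 (arg r u) \<le> 0"
    proof -
      define X where "X = R * x"
      define Y where "Y = r ^ (2 * (2 * k - 1)) * (r\<^sup>2 * y - 1)"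
      note ab = arg_bounds[OF b(1,2) r1 B, folded X_def[unfolded R_def] Y_def]
      have XY: "\<bar>X\<bar> + \<bar>Y\<bar> \<le> 3 * B * r\<^sup>2"
        using arg_bounds[OF b(1,2) r1 B] by (auto simp: X_def Y_def R_def)
      have "\<bar>f2 (X, Y, z) - f2 (0, 0, z)\<bar> \<le> M * norm ((X, Y, z) - (0, 0, z))" by (rule lip) simp
      also have "\<dots> \<le> M * (3 * B * r\<^sup>2)" using norm_r3_le[of X Y 0] XY M by (intro mult_left_mono) auto
      also have "\<dots> \<le> M * (3 * B * r)" using rr M B by (intro mult_left_mono) auto
      also have "\<dots> \<le> b1 * \<zeta>" using rb by (simp add: mult_ac)
      finally have "f2 (X, Y, z) \<le> f2 (0, 0, z) + b1 * \<zeta>" by linarith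
      moreover have "f2 (0, 0, z) \<le> b1 * z" using b \<zeta> by (intro f2_le) auto
      moreover have "b1 * z \<le> b1 * (- \<zeta>)" using b b1 by (intro mult_left_mono) auto
      ultimately show ?thesis by (simp add: arg_def u_def X_def Y_def R_def)
    qed
    have signs: "(y - y') * (p - p') * f2 (arg r u) \<le> 0"
    proof (cases "y \<le> y'")
      case True
      then have "p \<le> p'" using mono r1 by (auto simp: p_def p'_def intro!: monoD[OF mono] mult_left_mono)
      then have "0 \<le> (y - y') * (p - p')" using True by (intro mult_nonpos_nonpos) auto
      then show ?thesis using f2neg by (rule mult_nonneg_nonpos)
    next
      case False
      then have "p' \<le> p" using mono r1 by (auto simp: p_def p'_def intro!: monoD[OF mono] mult_left_mono)
      then have "0 \<le> (y - y') * (p - p')" using False by (intro mult_nonneg_nonneg) auto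
      then show ?thesis using f2neg by (rule mult_nonneg_nonpos)
    qed
    have df2: "\<bar>p' * (f2 (arg r u) - f2 (arg r v))\<bar> \<le> (P * (3 * M) * n) * R"
    proof -
      have "\<bar>f2 (arg r u) - f2 (arg r v)\<bar> \<le> M * norm (arg r u - arg r v)" by (rule lip) simp
      also have "\<dots> \<le> M * (3 * n)" using M unfolding n_def by (intro mult_left_mono arg_lipschitz r1) auto
      finally have "\<bar>p'\<bar> * \<bar>f2 (arg r u) - f2 (arg r v)\<bar> \<le> (P * R) * (M * (3 * n))"
        using p'P P0 R by (intro mult_mono) auto
      then show ?thesis by (simp add: abs_mult mult_ac)
    qed
    \<comment> \<open>The x,y-difference carries \<open>R\<close> because \<open>arg\<close>
      contracts these coordinates. In the z-direction it does not, and a plain Lipschitz bound would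
      be lost in the division by \<open>R\<close>; the mixed estimate supplies the missing factor
      through the smallness of \<open>X'\<close> and \<open>Y'\<close>.\<close>
    have dg2: "\<bar>g2 (arg r u) - g2 (arg r v)\<bar> \<le> M * (2 + 3 * B) * n * R"
    proof -
      define e where "e = r ^ (2 * (2 * k - 1))"
      define X where "X = R * x"
      define Y where "Y = e * (r\<^sup>2 * y - 1)"
      define X' where "X' = R * x'"
      define Y' where "Y' = e * (r\<^sup>2 * y' - 1)"
      have e: "0 \<le> e" "e \<le> R * r\<^sup>2" using eps_le[OF r1] r1 by (auto simp: e_def R_def)
      have au: "arg r u = (X, Y, z)" and av: "arg r v = (X', Y', z')"
        by (auto simp: arg_def u_def v_def X_def Y_def X'_def Y'_def R_def e_def)
      have X': "\<bar>X'\<bar> \<le> B * R" and Y': "\<bar>Y'\<bar> \<le> 2 * B * r\<^sup>2 * R"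
        using arg_bounds(1,2)[OF b(5,6) r1 B] by (auto simp: X'_def Y'_def R_def e_def)
      have "2 * B * R * r\<^sup>2 \<le> 2 * B * R * 1" using r2 B R by (intro mult_left_mono) auto
      then have XY': "\<bar>X'\<bar> + \<bar>Y'\<bar> \<le> 3 * B * R" using X' Y' by (simp add: mult_ac)
      have bd: "\<bar>X'\<bar> \<le> d" "\<bar>Y'\<bar> \<le> d"
      proof -
        have "\<bar>X'\<bar> \<le> B * r\<^sup>2" "\<bar>Y'\<bar> \<le> 2 * B * r\<^sup>2"
          using arg_bounds[OF b(5,6) r1 B] by (auto simp: X'_def Y'_def R_def e_def)
        moreover have "2 * B * r\<^sup>2 \<le> 2 * B * r" "0 \<le> B * r\<^sup>2" using rr B by (auto intro!: mult_left_mono)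
        ultimately show "\<bar>X'\<bar> \<le> d" "\<bar>Y'\<bar> \<le> d" using rd by linarith+
      qed
      have "\<bar>g2 (X, Y, z) - g2 (X', Y', z)\<bar> \<le> M * norm ((X, Y, z) - (X', Y', z))" by (rule lip) simp
      also have "\<dots> \<le> M * (\<bar>X - X'\<bar> + \<bar>Y - Y'\<bar>)" using norm_r3_le[of "X - X'" "Y - Y'" 0] M by (intro mult_left_mono) auto
      also have "\<dots> \<le> M * (R * n + R * n)"
      proof (intro mult_left_mono add_mono)
        have "\<bar>X - X'\<bar> = R * \<bar>x - x'\<bar>" using R by (simp add: X_def X'_def right_diff_distrib[symmetric] abs_mult)
        also have "\<dots> \<le> R * n" using R n by (intro mult_left_mono) auto
        finally show "\<bar>X - X'\<bar> \<le> R * n" .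
        have "Y - Y' = e * r\<^sup>2 * (y - y')" by (simp add: Y_def Y'_def algebra_simps)
        then have "\<bar>Y - Y'\<bar> = e * r\<^sup>2 * \<bar>y - y'\<bar>" using e by (simp add: abs_mult)
        also have "\<dots> \<le> R * n"
        proof (intro mult_mono)
          have "e * r\<^sup>2 \<le> e * 1" using r2 e by (intro mult_left_mono)
          moreover have "R * r\<^sup>2 \<le> R * 1" using r2 R by (intro mult_left_mono) auto
          ultimately show "e * r\<^sup>2 \<le> R" using e(2) by linarith
        qed (use n R in auto)
        finally show "\<bar>Y - Y'\<bar> \<le> R * n" .
      qed (use M in auto)
      finally have 1: "\<bar>g2 (X, Y, z) - g2 (X', Y', z)\<bar> \<le> M * (R * n + R * n)" .
      have "\<bar>g2 (X', Y', z) - g2 (X', Y', z')\<bar> \<le> M * (\<bar>X'\<bar> + \<bar>Y'\<bar>) * \<bar>z - z'\<bar>"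
        using bd zd by (intro g2_mixed)
      also have "\<dots> \<le> M * (3 * B * R) * n"
        using XY' n M B R by (intro mult_mono mult_left_mono) auto
      finally have 2: "\<bar>g2 (X', Y', z) - g2 (X', Y', z')\<bar> \<le> M * (3 * B * R) * n" .
      have "\<bar>g2 (X, Y, z) - g2 (X', Y', z')\<bar> \<le> M * (R * n + R * n) + M * (3 * B * R) * n" using 1 2 by linarith
      also have "\<dots> = M * (2 + 3 * B) * n * R" by (simp add: algebra_simps)
      finally show ?thesis unfolding au av .
    qed
    have gg: "\<bar>(2 - p) * g2 (arg r u) - (2 - p') * g2 (arg r v)\<bar> \<le> (M * n) * (3 * M * B * R) + 2 * (M * (2 + 3 * B) * n * R)"
    proof (rule abs_mult_diff_le[OF _ dg2])
      show "\<bar>g2 (arg r u)\<bar> \<le> 3 * M * B * R" unfolding u_def R_def by (rule g2_le[OF b(1,2) zd(1) r1 B rd])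
    qed (use pp p'P in auto)
    have c2: "(y - y') * (F f2 g2 / R) \<le> C * n * n"
    proof -
      \<comment> \<open>Everything except the increment of \<open>p\<close> times \<open>f2\<close>;
        that product has the right sign and is dropped, while \<open>W\<close> is of order
        \<open>n * R\<close>.\<close>
      define W where "W = p' * (f2 (arg r u) - f2 (arg r v)) + ((2 - p) * g2 (arg r u) - (2 - p') * g2 (arg r v))"
      have W: "\<bar>W\<bar> \<le> C * n * R"
      proof -
        have "\<bar>W\<bar> \<le> (P * (3 * M) * n) * R + ((M * n) * (3 * M * B * R) + 2 * (M * (2 + 3 * B) * n * R))"
          unfolding W_def using df2 gg by (rule order_trans[OF abs_triangle_ineq add_mono])
        also have "\<dots> = C * n * R" by (simp add: C_def algebra_simps)
        finally show ?thesis .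
      qed
      have "F f2 g2 = (p - p') * f2 (arg r u) + W" by (simp add: F_def W_def algebra_simps)
      then have "(y - y') * F f2 g2 = (y - y') * (p - p') * f2 (arg r u) + (y - y') * W"
        by (simp only: distrib_left mult.assoc)
      also have "\<dots> \<le> (y - y') * W" using signs by simp
      also have "\<dots> \<le> \<bar>y - y'\<bar> * \<bar>W\<bar>" by (metis abs_ge_self abs_mult)
      also have "\<dots> \<le> n * (C * n * R)" using n W by (intro mult_mono) auto
      finally have "(y - y') * F f2 g2 / R \<le> (C * n * n * R) / R"
        using R by (intro divide_right_mono) (auto simp: mult_ac)
      then show ?thesis using R by simp
    qed
    have c1: "(x - x') * F f1 g1 \<le> n * (Q * n)"
    proof -
      have "(x - x') * F f1 g1 \<le> \<bar>x - x'\<bar> * \<bar>F f1 g1\<bar>" by (metis abs_ge_self abs_mult)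
      also have "\<dots> \<le> n * (Q * n)" using n F by (intro mult_mono) auto
      finally show ?thesis .
    qed
    have c3: "(z - z') * (R * F f3 g3) \<le> n * (Q * n)"
    proof -
      have "(z - z') * (R * F f3 g3) \<le> \<bar>z - z'\<bar> * \<bar>R * F f3 g3\<bar>" by (metis abs_ge_self abs_mult)
      also have "\<dots> \<le> n * (1 * (Q * n))" using n F R Q0 unfolding abs_mult by (intro mult_mono) auto
      finally show ?thesis by simp
    qed
    have "((x, y, z) - (x', y', z')) \<bullet> (V r (x, y, z) - V r (x', y', z')) =
      (x - x') * F f1 g1 + ((y - y') * (F f2 g2 / R) + (z - z') * (R * F f3 g3))"
      unfolding eq[unfolded u_def v_def] by simp
    also have "\<dots> \<le> n * (Q * n) + (C * n * n + n * (Q * n))" using c1 c2 c3 by linarith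
    also have "\<dots> = (Q + C + Q) * n\<^sup>2" by (simp add: algebra_simps power2_eq_square)
    finally show "((x, y, z) - (x', y', z')) \<bullet> (V r (x, y, z) - V r (x', y', z')) \<le>
       (Q + C + Q) * (norm ((x, y, z) - (x', y', z')))\<^sup>2" by (simp add: n_def u_def v_def)
  qed
qed

end

section \<open>The passage from a section to the crossing\<close>

lemma derivative_bound_within:
  fixes f :: "real \<Rightarrow> real"
  assumes "s \<le> t"
    and der: "\<And>q. q \<in> {s..t} \<Longrightarrow> (f has_real_derivative f' q) (at q within {s..t})"
    and le: "\<And>q. q \<in> {s..t} \<Longrightarrow> \<bar>f' q\<bar> \<le> C"
  shows "\<bar>f t - f s\<bar> \<le> C * (t - s)"
proof -
  have "f t - C * t \<le> f s - C * s"
  proof (rule derivative_nonpos_within_imp_le[where f = "\<lambda>q. f q - C * q" and a = s and b = t])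
    fix q assume q: "q \<in> {s..t}"
    show "((\<lambda>q. f q - C * q) has_real_derivative f' q - C) (at q within {s..t})"
      using der[OF q] by (auto intro!: derivative_eq_intros)
    show "f' q - C \<le> 0" using le[OF q] by linarith
  qed fact
  moreover have "- f t - C * t \<le> - f s - C * s"
  proof (rule derivative_nonpos_within_imp_le[where f = "\<lambda>q. - f q - C * q" and a = s and b = t])
    fix q assume q: "q \<in> {s..t}"
    show "((\<lambda>q. - f q - C * q) has_real_derivative - f' q - C) (at q within {s..t})"
      using der[OF q] by (auto intro!: derivative_eq_intros)
    show "- f' q - C \<le> 0" using le[OF q] by linarith
  qed fact
  ultimately show ?thesis by (simp add: right_diff_distrib abs_le_iff)
qed

lemma r3_has_derivative_components:
  fixes u :: "real \<Rightarrow> r3"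
  assumes "(u has_vector_derivative w) F"
  shows "((\<lambda>t. fst (u t)) has_real_derivative fst w) F"
    "((\<lambda>t. fst (snd (u t))) has_real_derivative fst (snd w)) F"
    "((\<lambda>t. snd (snd (u t))) has_real_derivative snd (snd w)) F"
proof -
  have s: "((\<lambda>t. snd (u t)) has_vector_derivative snd w) F"
    by (rule bounded_linear.has_vector_derivative[OF bounded_linear_snd assms])
  show "((\<lambda>t. fst (u t)) has_real_derivative fst w) F"
    using bounded_linear.has_vector_derivative[OF bounded_linear_fst assms]
    by (simp add: has_real_derivative_iff_has_vector_derivative)
  show "((\<lambda>t. fst (snd (u t))) has_real_derivative fst (snd w)) F"
    using bounded_linear.has_vector_derivative[OF bounded_linear_fst s]
    by (simp add: has_real_derivative_iff_has_vector_derivative)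
  show "((\<lambda>t. snd (snd (u t))) has_real_derivative snd (snd w)) F"
    using bounded_linear.has_vector_derivative[OF bounded_linear_snd s]
    by (simp add: has_real_derivative_iff_has_vector_derivative)
qed

lemma r3_components_le_norm':
  "\<bar>fst u\<bar> \<le> norm (u :: r3)" "\<bar>fst (snd u)\<bar> \<le> norm u" "\<bar>snd (snd u)\<bar> \<le> norm u"
  using r3_components_le_norm[where x = "fst u" and y = "fst (snd u)" and z = "snd (snd u)"] by auto

text \<open>Data on the section x2 = -x0: \<open>Ys r \<zeta>\<close> is the height at which the
  leaf meets it and \<open>v \<zeta>\<close> is the limit orbit that starts there. The constant
  \<open>c\<close> makes the transversal crossing at \<open>\<eta> \<zeta>\<close> quantitative: the
  height is at least linear in the distance to the crossing on the left, and its negative on the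
  right. All constants are uniform in \<open>\<zeta>\<close>.\<close>

locale fold_section = fold_system +
  fixes za zb x0 K r1 T B c \<eta>0 :: real and Ys :: "real \<Rightarrow> real \<Rightarrow> real"
    and v :: "real \<Rightarrow> real \<Rightarrow> r3" and \<eta> :: "real \<Rightarrow> real"
  assumes z: "- d < za" "za \<le> zb" "zb < 0" and x0: "0 < x0" and K: "0 \<le> K" and r1: "0 < r1"
    and T: "0 < T" and B: "1 \<le> B" and c: "0 < c" and \<eta>0: "0 < \<eta>0"
    and Ys_lip: "\<lbrakk>r \<in> {0..r1}; r' \<in> {0..r1}; \<zeta> \<in> {za..zb}; \<zeta>' \<in> {za..zb}\<rbrakk> \<Longrightarrow>
      \<bar>Ys r \<zeta> - Ys r' \<zeta>'\<bar> \<le> K * (\<bar>r - r'\<bar> + \<bar>\<zeta> - \<zeta>'\<bar>)"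
    and v_0: "\<zeta> \<in> {za..zb} \<Longrightarrow> v \<zeta> 0 = (- x0, Ys 0 \<zeta>, \<zeta>)"
    and v_ode: "\<lbrakk>\<zeta> \<in> {za..zb}; t \<in> {0..T}\<rbrakk> \<Longrightarrow> (v \<zeta> has_vector_derivative V0 (v \<zeta> t)) (at t within {0..T})"
    and v_bound: "\<lbrakk>\<zeta> \<in> {za..zb}; t \<in> {0..T}\<rbrakk> \<Longrightarrow>
      \<bar>fst (v \<zeta> t)\<bar> \<le> B \<and> \<bar>fst (snd (v \<zeta> t))\<bar> \<le> B \<and> snd (snd (v \<zeta> t)) = \<zeta>"
    and v_left: "\<lbrakk>\<zeta> \<in> {za..zb}; t \<in> {0..T}; fst (v \<zeta> t) \<le> \<eta> \<zeta>\<rbrakk> \<Longrightarrow>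
      c * (\<eta> \<zeta> - fst (v \<zeta> t)) \<le> fst (snd (v \<zeta> t))"
    and v_right: "\<lbrakk>\<zeta> \<in> {za..zb}; t \<in> {0..T}; \<eta> \<zeta> \<le> fst (v \<zeta> t)\<rbrakk> \<Longrightarrow>
      fst (snd (v \<zeta> t)) \<le> - c * (fst (v \<zeta> t) - \<eta> \<zeta>)"
    and v_end: "\<zeta> \<in> {za..zb} \<Longrightarrow> \<eta> \<zeta> + 1 \<le> fst (v \<zeta> T)"
    and \<eta>: "\<zeta> \<in> {za..zb} \<Longrightarrow> \<eta>0 \<le> \<eta> \<zeta>"
begin

definition sol :: "real \<Rightarrow> real \<Rightarrow> (real \<Rightarrow> r3) \<Rightarrow> bool" where
  "sol r \<zeta> u \<longleftrightarrow> u 0 = (- x0, Ys r \<zeta>, \<zeta>) \<and>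
     (\<forall>t\<in>{0..T}. (u has_vector_derivative V r (u t)) (at t within {0..T}))"

lemma sol_DERIV:
  assumes "sol r \<zeta> u" "t \<in> A" "A \<subseteq> {0..T}"
  shows "(u has_vector_derivative V r (u t)) (at t within A)"
    "((\<lambda>t. fst (u t)) has_real_derivative fst (V r (u t))) (at t within A)"
    "((\<lambda>t. fst (snd (u t))) has_real_derivative fst (snd (V r (u t)))) (at t within A)"
    "((\<lambda>t. snd (snd (u t))) has_real_derivative snd (snd (V r (u t)))) (at t within A)"
proof -
  show "(u has_vector_derivative V r (u t)) (at t within A)"
    using assms by (auto simp: sol_def intro: has_vector_derivative_within_subset)
  from r3_has_derivative_components[OF this]
  show "((\<lambda>t. fst (u t)) has_real_derivative fst (V r (u t))) (at t within A)"
    "((\<lambda>t. fst (snd (u t))) has_real_derivative fst (snd (V r (u t)))) (at t within A)"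
    "((\<lambda>t. snd (snd (u t))) has_real_derivative snd (snd (V r (u t)))) (at t within A)" .
qed

lemma V_bounds:
  assumes r: "0 < r" "r \<le> 1"
  shows "\<bar>fst (V r u)\<bar> \<le> 4 * M" "\<bar>snd (snd (V r u))\<bar> \<le> 4 * M * r ^ (2 * k)"
proof -
  obtain x y z where u: "u = (x, y, z)" by (cases u)
  define p where "p = \<phi> (r\<^sup>2 * y - 1)"
  have p: "\<bar>1 + p\<bar> \<le> 2" "\<bar>1 - p\<bar> \<le> 2" using phi_abs[of "r\<^sup>2 * y - 1"] by (auto simp: p_def abs_le_iff)
  have *: "\<bar>(1 + p) * f q + (1 - p) * g q\<bar> \<le> 4 * M" if "f \<in> {f1, f2, f3, g1, g2, g3}" "g \<in> {f1, f2, f3, g1, g2, g3}" for f g q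
  proof -
    have "\<bar>(1 + p) * f q\<bar> \<le> 2 * M" "\<bar>(1 - p) * g q\<bar> \<le> 2 * M"
      unfolding abs_mult using p bound[OF that(1), of q] bound[OF that(2), of q] by (auto intro!: mult_mono)
    then show ?thesis by linarith
  qed
  show "\<bar>fst (V r u)\<bar> \<le> 4 * M" using *[of f1 g1 "arg r u"] by (simp add: V_def u p_def)
  have "r ^ (2 * k) * \<bar>(1 + p) * f3 (arg r u) + (1 - p) * g3 (arg r u)\<bar> \<le> r ^ (2 * k) * (4 * M)"
    using *[of f3 g3 "arg r u"] r by (intro mult_left_mono) auto
  then show "\<bar>snd (snd (V r u))\<bar> \<le> 4 * M * r ^ (2 * k)" using r by (simp add: V_def u p_def abs_mult mult.commute)
qed

lemma rk_le: "0 < r \<Longrightarrow> r \<le> 1 \<Longrightarrow> r ^ (2 * k) \<le> (r::real)\<^sup>2" "0 < r \<Longrightarrow> r \<le> 1 \<Longrightarrow> (r::real)\<^sup>2 \<le> r"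
  subgoal using k by (intro power_decreasing) auto
  subgoal by (simp add: power2_eq_square mult_left_le)
  done

text \<open>The speed of z is of order \<open>r ^ (2 * k)\<close>, hence \<open>r * r\<close>; one
  factor r compensates for the constants and the length \<open>T\<close>.\<close>

lemma sol_z:
  assumes s: "sol r \<zeta> u" and r: "0 < r" "r \<le> 1" "4 * M * T * r \<le> 1" and t: "t \<in> {0..T}"
  shows "\<bar>snd (snd (u t)) - \<zeta>\<bar> \<le> r"
proof -
  have "\<bar>snd (snd (u t)) - snd (snd (u 0))\<bar> \<le> 4 * M * r ^ (2 * k) * (t - 0)"
  proof (rule derivative_bound_within)
    fix q assume q: "q \<in> {0..t}"
    show "((\<lambda>t. snd (snd (u t))) has_real_derivative snd (snd (V r (u q)))) (at q within {0..t})"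
      using q t by (intro sol_DERIV(4)[OF s]) auto
  qed (use t V_bounds(2) r in auto)
  also have "\<dots> \<le> (4 * M * (r * r)) * T"
    using rk_le[OF r(1,2)] M t r by (intro mult_mono mult_left_mono) (auto simp: power2_eq_square)
  also have "\<dots> = (4 * M * T * r) * r" by simp
  also have "\<dots> \<le> 1 * r" using r by (intro mult_right_mono) auto
  finally show ?thesis using s by (simp add: sol_def)
qed

text \<open>The limit orbit may start at a different parameter within distance r. This allows the
  crossing to be compared with \<open>\<eta>\<close> at the z-value where it takes place instead of
  the one where the orbit started.\<close>

lemma sol_close:
  obtains C r0 where "0 \<le> C" "0 < r0" "r0 \<le> 1" "r0 \<le> r1"
    "\<And>r \<zeta> \<zeta>' u t. \<lbrakk>0 < r; r \<le> r0; \<zeta> \<in> {za..zb}; \<zeta>' \<in> {za..zb}; \<bar>\<zeta> - \<zeta>'\<bar> \<le> r; sol r \<zeta> u; t \<in> {0..T}\<rbrakk> \<Longrightarrow>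
      norm (u t - v \<zeta>' t) \<le> C * r \<and> norm (u t - v \<zeta>' t) \<le> 1 \<and>
      \<bar>snd (snd (u t)) - \<zeta>\<bar> \<le> r \<and> - d \<le> snd (snd (u t)) \<and> snd (snd (u t)) \<le> zb / 2"
proof -
  have B1: "1 \<le> B + 1" using B by simp
  obtain L where L: "0 \<le> L" "\<And>x y z x' y' z'. \<lbrakk>\<bar>x\<bar> \<le> B + 1; \<bar>y\<bar> \<le> B + 1; \<bar>z\<bar> \<le> d; \<bar>x'\<bar> \<le> B + 1; \<bar>y'\<bar> \<le> B + 1; \<bar>z'\<bar> \<le> d\<rbrakk> \<Longrightarrow>
      norm (V0 (x, y, z) - V0 (x', y', z')) \<le> L * norm ((x, y, z) - (x', y', z'))"
    using V0_lipschitz[OF B1] by blast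
  obtain C1 r2 where C1: "0 \<le> C1" "0 < r2" "r2 \<le> 1"
    "\<And>r x y z. 0 < r \<Longrightarrow> r \<le> r2 \<Longrightarrow> \<bar>x\<bar> \<le> B + 1 \<Longrightarrow> \<bar>y\<bar> \<le> B + 1 \<Longrightarrow> \<bar>z\<bar> \<le> d \<Longrightarrow>
      norm (V r (x, y, z) - V0 (x, y, z)) \<le> C1 * r"
    using V_approx[OF B1] by blast
  define E where "E = exp ((2 * L + 1) * T) * (1 + T)"
  \<comment> \<open>\<open>2 * K\<close> comes from the change of height on the section when both r
    and the parameter move, 1 from the parameter itself, and \<open>C1\<close> from replacing
    \<open>V r\<close> by \<open>V0\<close> along the orbit.\<close>
  define C where "C = E * ((2 * K + 1) + C1)"
  have E: "E > 0" using T by (simp add: E_def)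
  have C: "C > 0" using E C1 K by (auto simp: C_def intro!: mult_pos_pos add_pos_nonneg)
  \<comment> \<open>\<open>1 / (2 * C)\<close> keeps the distance below 1, as the bootstrap demands;
    the last two entries leave room for the drift of z between -d and zb/2.\<close>
  define r0 where "r0 = Min {1, r1, r2, 1 / (4 * M * T), 1 / (2 * C), d + za, - zb / 2}"
  have r0: "0 < r0" using r1 C1 M T C z d by (simp add: r0_def)
  have r0_le: "r0 \<le> 1" "r0 \<le> r1" "r0 \<le> r2" "r0 \<le> 1 / (4 * M * T)" "r0 \<le> 1 / (2 * C)" "r0 \<le> d + za" "r0 \<le> - zb / 2"
    unfolding r0_def by (rule Min_le; simp)+
  show ?thesis
  proof (rule that[of C r0])
    fix r \<zeta> \<zeta>' u t
    assume r: "0 < r" "r \<le> r0" and \<zeta>: "\<zeta> \<in> {za..zb}" "\<zeta>' \<in> {za..zb}" "\<bar>\<zeta> - \<zeta>'\<bar> \<le> r" and s: "sol r \<zeta> u" and t: "t \<in> {0..T}"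
    have rle: "r \<le> 1" "r \<le> r1" "r \<le> r2" "4 * M * T * r \<le> 1" "2 * C * r \<le> 1" "r \<le> d + za" "r \<le> - zb / 2"
    proof -
      have "r \<le> 1 / (4 * M * T)" "r \<le> 1 / (2 * C)" using r r0_le by linarith+
      then show "4 * M * T * r \<le> 1" "2 * C * r \<le> 1" using M T C by (auto simp: field_simps)
    qed (use r r0_le in linarith)+
    have uz: "\<bar>snd (snd (u t)) - \<zeta>\<bar> \<le> r" "- d \<le> snd (snd (u t))" "snd (snd (u t)) \<le> zb / 2" "\<bar>snd (snd (u t))\<bar> \<le> d" if "t \<in> {0..T}" for t
    proof -
      show 1: "\<bar>snd (snd (u t)) - \<zeta>\<bar> \<le> r" by (rule sol_z[OF s r(1) rle(1,4) that])
      show "- d \<le> snd (snd (u t))" using 1 rle \<zeta> by auto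
      show "snd (snd (u t)) \<le> zb / 2" using 1 rle \<zeta> by auto
      then show "\<bar>snd (snd (u t))\<bar> \<le> d" using 1 rle \<zeta> z by auto
    qed
    have init: "norm (u 0 - v \<zeta>' 0) \<le> (2 * K + 1) * r"
    proof -
      have "norm (u 0 - v \<zeta>' 0) \<le> \<bar>0\<bar> + \<bar>Ys r \<zeta> - Ys 0 \<zeta>'\<bar> + \<bar>\<zeta> - \<zeta>'\<bar>"
        using norm_r3_le[of 0 "Ys r \<zeta> - Ys 0 \<zeta>'" "\<zeta> - \<zeta>'"] s v_0[OF \<zeta>(2)] by (simp add: sol_def)
      also have "\<bar>Ys r \<zeta> - Ys 0 \<zeta>'\<bar> \<le> K * (\<bar>r - 0\<bar> + \<bar>\<zeta> - \<zeta>'\<bar>)" using r rle r1 \<zeta> by (intro Ys_lip) auto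
      also have "\<dots> \<le> K * (2 * r)" using K r \<zeta> by (intro mult_left_mono) auto
      finally show ?thesis using \<zeta>(3) by (simp add: algebra_simps)
    qed
    have small: "E * (norm (u 0 - v \<zeta>' 0) + C1 * r) \<le> C * r"
    proof -
      have "E * (norm (u 0 - v \<zeta>' 0) + C1 * r) \<le> E * ((2 * K + 1) * r + C1 * r)"
        using init E by (intro mult_left_mono) auto
      then show ?thesis by (simp add: C_def algebra_simps)
    qed
    have Cr: "C * r < 1" using rle C r by simp
    have main: "norm (u t - v \<zeta>' t) \<le> E * (norm (u 0 - v \<zeta>' 0) + C1 * r)"
      unfolding E_def
    proof (rule ode_compare[where L = L and \<delta> = "C1 * r" and u' = "\<lambda>t. V r (u t)" and v' = "\<lambda>t. V0 (v \<zeta>' t)"])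
      show "exp ((2 * L + 1) * T) * (1 + T) * (norm (u 0 - v \<zeta>' 0) + C1 * r) < 1"
        using small Cr by (simp add: E_def)
      fix q assume q: "q \<in> {0..T}" and le1: "norm (u q - v \<zeta>' q) \<le> 1"
      obtain x y w where uq: "u q = (x, y, w)" by (cases "u q")
      obtain x' y' w' where vq: "v \<zeta>' q = (x', y', w')" by (cases "v \<zeta>' q")
      have b': "\<bar>x'\<bar> \<le> B" "\<bar>y'\<bar> \<le> B" "w' = \<zeta>'" using v_bound[OF \<zeta>(2) q] by (auto simp: vq)
      have b: "\<bar>x\<bar> \<le> B + 1" "\<bar>y\<bar> \<le> B + 1" "\<bar>w\<bar> \<le> d"
        using b' le1 r3_components_le_norm'[of "u q - v \<zeta>' q"] uz(4)[OF q] by (auto simp: uq vq)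
      have w': "\<bar>w'\<bar> \<le> d" using b' \<zeta> z by auto
      have "norm (V r (u q) - V0 (v \<zeta>' q)) \<le> norm (V r (u q) - V0 (u q)) + norm (V0 (u q) - V0 (v \<zeta>' q))"
        using norm_triangle_ineq[of "V r (u q) - V0 (u q)" "V0 (u q) - V0 (v \<zeta>' q)"] by simp
      also have "\<dots> \<le> C1 * r + L * norm (u q - v \<zeta>' q)"
        unfolding uq vq using b b' w' r rle by (intro add_mono C1 L) auto
      finally have N: "norm (V r (u q) - V0 (v \<zeta>' q)) \<le> C1 * r + L * norm (u q - v \<zeta>' q)" .
      have "(u q - v \<zeta>' q) \<bullet> (V r (u q) - V0 (v \<zeta>' q)) \<le> norm (u q - v \<zeta>' q) * norm (V r (u q) - V0 (v \<zeta>' q))"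
        by (rule norm_cauchy_schwarz)
      also have "\<dots> \<le> norm (u q - v \<zeta>' q) * (C1 * r + L * norm (u q - v \<zeta>' q))"
        using N by (intro mult_left_mono) auto
      finally show "(u q - v \<zeta>' q) \<bullet> (V r (u q) - V0 (v \<zeta>' q)) \<le> L * (norm (u q - v \<zeta>' q))\<^sup>2 + C1 * r * norm (u q - v \<zeta>' q)"
        by (simp add: power2_eq_square algebra_simps)
    qed (use L C1 r s t v_ode[OF \<zeta>(2)] in \<open>auto simp: sol_def\<close>)
    then show "norm (u t - v \<zeta>' t) \<le> C * r \<and> norm (u t - v \<zeta>' t) \<le> 1 \<and>
      \<bar>snd (snd (u t)) - \<zeta>\<bar> \<le> r \<and> - d \<le> snd (snd (u t)) \<and> snd (snd (u t)) \<le> zb / 2"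
      using small Cr uz[OF t] by linarith
  qed (use C r0 r0_le in auto)
qed

definition crossing :: "real \<Rightarrow> (real \<Rightarrow> r3) \<Rightarrow> real \<Rightarrow> bool" where
  "crossing r u \<tau> \<longleftrightarrow> \<tau> \<in> {0..T} \<and> fst (snd (u \<tau>)) = 0 \<and> (\<forall>t\<in>{0..<\<tau>}. 0 < fst (snd (u t)))"

text \<open>Closeness transfers the signs of the limit orbit at times 0 and \<open>T\<close>, so
  there is a first zero. At any zero the height of the limit orbit is at most \<open>C0 * r\<close>,
  and the linear bounds \<open>v_left\<close> and \<open>v_right\<close> turn this into a bound for
  the distance in x to \<open>\<eta>\<close>.\<close>

lemma crossing_exists:
  obtains C r0 where "0 \<le> C" "0 < r0" "r0 \<le> 1" "r0 \<le> r1"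
    "\<And>r \<zeta> u. \<lbrakk>0 < r; r \<le> r0; \<zeta> \<in> {za..zb}; sol r \<zeta> u\<rbrakk> \<Longrightarrow> \<exists>\<tau>. crossing r u \<tau>"
    "\<And>r \<zeta> \<zeta>' u \<tau>. \<lbrakk>0 < r; r \<le> r0; \<zeta> \<in> {za..zb}; \<zeta>' \<in> {za..zb}; \<bar>\<zeta> - \<zeta>'\<bar> \<le> r; sol r \<zeta> u; crossing r u \<tau>\<rbrakk> \<Longrightarrow>
      \<bar>fst (u \<tau>) - \<eta> \<zeta>'\<bar> \<le> C * r \<and> \<eta>0 / 2 \<le> fst (u \<tau>)"
    "\<And>r \<zeta> u t. \<lbrakk>0 < r; r \<le> r0; \<zeta> \<in> {za..zb}; sol r \<zeta> u; t \<in> {0..T}\<rbrakk> \<Longrightarrow>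
      \<bar>fst (u t)\<bar> \<le> B + 1 \<and> \<bar>fst (snd (u t))\<bar> \<le> B + 1 \<and>
      \<bar>snd (snd (u t)) - \<zeta>\<bar> \<le> r \<and> - d \<le> snd (snd (u t)) \<and> snd (snd (u t)) \<le> zb / 2"
proof -
  obtain C0 r2 where C0: "0 \<le> C0" "0 < r2" "r2 \<le> 1" "r2 \<le> r1"
    "\<And>r \<zeta> \<zeta>' u t. \<lbrakk>0 < r; r \<le> r2; \<zeta> \<in> {za..zb}; \<zeta>' \<in> {za..zb}; \<bar>\<zeta> - \<zeta>'\<bar> \<le> r; sol r \<zeta> u; t \<in> {0..T}\<rbrakk> \<Longrightarrow>
      norm (u t - v \<zeta>' t) \<le> C0 * r \<and> norm (u t - v \<zeta>' t) \<le> 1 \<and>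
      \<bar>snd (snd (u t)) - \<zeta>\<bar> \<le> r \<and> - d \<le> snd (snd (u t)) \<and> snd (snd (u t)) \<le> zb / 2"
    using sol_close by metis
  define C where "C = C0 / c + C0 + 1"
  define r0 where "r0 = Min {r2, \<eta>0 / (2 * C), c / (2 * (C0 + 1)), c * x0 / (2 * (C0 + 1))}"
  have C: "C > 0" using C0 c by (auto simp: C_def intro!: add_nonneg_pos)
  have r0: "0 < r0" using C0 C c x0 \<eta>0 by (simp add: r0_def)
  have r0_le: "r0 \<le> r2" "r0 \<le> \<eta>0 / (2 * C)" "r0 \<le> c / (2 * (C0 + 1))" "r0 \<le> c * x0 / (2 * (C0 + 1))"
    unfolding r0_def by (rule Min_le; simp)+
  show ?thesis
  proof (rule that[of C r0])
    fix r \<zeta> u assume r: "0 < r" "r \<le> r0" and \<zeta>: "\<zeta> \<in> {za..zb}" and s: "sol r \<zeta> u"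
    have rr: "r \<le> r2" "2 * (C0 + 1) * r \<le> c" "2 * (C0 + 1) * r \<le> c * x0"
    proof -
      have "r \<le> c / (2 * (C0 + 1))" "r \<le> c * x0 / (2 * (C0 + 1))" using r r0_le by linarith+
      then show "2 * (C0 + 1) * r \<le> c" "2 * (C0 + 1) * r \<le> c * x0" using C0(1) by (auto simp: field_simps)
    qed (use r r0_le in linarith)
    have "0 \<le> C0 * r" "2 * (C0 + 1) * r = 2 * (C0 * r) + 2 * r" using C0(1) r by (auto simp: algebra_simps)
    then have rr': "C0 * r < c" "C0 * r < c * x0" using rr r by linarith+
    have cl: "norm (u t - v \<zeta> t) \<le> C0 * r" if "t \<in> {0..T}" for t
      using C0(5)[OF r(1) rr(1) \<zeta> \<zeta> _ s that] r by simp
    have yT: "fst (snd (u T)) < 0"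
    proof -
      have "fst (snd (v \<zeta> T)) \<le> - c * (fst (v \<zeta> T) - \<eta> \<zeta>)" using v_end[OF \<zeta>] T by (intro v_right \<zeta>) auto
      also have "\<dots> \<le> - c * 1" using v_end[OF \<zeta>] c by (intro mult_left_mono_neg) auto
      finally show ?thesis
        using cl[of T] r3_components_le_norm'(2)[of "u T - v \<zeta> T"] T rr' by auto
    qed
    have y0: "0 < fst (snd (u 0))"
    proof -
      have "c * (\<eta> \<zeta> - fst (v \<zeta> 0)) \<le> fst (snd (v \<zeta> 0))"
        using v_0[OF \<zeta>] \<eta>[OF \<zeta>] \<eta>0 x0 T by (intro v_left \<zeta>) auto
      moreover have "c * x0 \<le> c * (\<eta> \<zeta> - fst (v \<zeta> 0))"
        using v_0[OF \<zeta>] \<eta>[OF \<zeta>] \<eta>0 c by (intro mult_left_mono) auto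
      ultimately show ?thesis
        using cl[of 0] r3_components_le_norm'(2)[of "u 0 - v \<zeta> 0"] T rr' by auto
    qed
    have cont: "continuous_on {0..T} (\<lambda>t. fst (snd (u t)))"
      by (rule DERIV_continuous_on) (rule sol_DERIV(3)[OF s], auto)
    define W where "W = {0..T} \<inter> (\<lambda>t. fst (snd (u t))) -` {0}"
    have "\<exists>x\<ge>0. x \<le> T \<and> fst (snd (u x)) = 0"
      using y0 yT T by (intro IVT2' cont) auto
    then have "W \<noteq> {}" by (auto simp: W_def)
    moreover have "compact W"
      using continuous_closed_preimage[OF cont, of "{0}"]
      by (auto simp: compact_eq_bounded_closed W_def intro: bounded_subset[of "{0..T}"])
    ultimately obtain \<tau> where \<tau>: "\<tau> \<in> W" "\<And>w. w \<in> W \<Longrightarrow> \<tau> \<le> w"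
      using compact_attains_inf[of W] by blast
    have "0 < fst (snd (u t))" if t: "t \<in> {0..<\<tau>}" for t
    proof (rule ccontr)
      assume "\<not> 0 < fst (snd (u t))"
      then have "\<exists>x\<ge>0. x \<le> t \<and> fst (snd (u x)) = 0"
        using y0 t \<tau>(1) by (intro IVT2' continuous_on_subset[OF cont]) (auto simp: W_def)
      then show False using \<tau> t by (force simp: W_def)
    qed
    then show "\<exists>\<tau>. crossing r u \<tau>" using \<tau>(1) by (auto simp: crossing_def W_def)
  next
    fix r \<zeta> \<zeta>' u \<tau>
    assume r: "0 < r" "r \<le> r0" and \<zeta>: "\<zeta> \<in> {za..zb}" "\<zeta>' \<in> {za..zb}" "\<bar>\<zeta> - \<zeta>'\<bar> \<le> r" and s: "sol r \<zeta> u" and cr: "crossing r u \<tau>"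
    have rr: "r \<le> r2" "2 * C * r \<le> \<eta>0"
    proof -
      have "r \<le> \<eta>0 / (2 * C)" using r r0_le by linarith
      then show "2 * C * r \<le> \<eta>0" using C by (simp add: field_simps)
    qed (use r r0_le in linarith)
    have \<tau>: "\<tau> \<in> {0..T}" "fst (snd (u \<tau>)) = 0" using cr by (auto simp: crossing_def)
    have N: "norm (u \<tau> - v \<zeta>' \<tau>) \<le> C0 * r" using C0(5)[OF r(1) rr(1) \<zeta> s \<tau>(1)] by simp
    have y: "\<bar>fst (snd (v \<zeta>' \<tau>))\<bar> \<le> C0 * r" and x: "\<bar>fst (u \<tau>) - fst (v \<zeta>' \<tau>)\<bar> \<le> C0 * r"
      using N \<tau>(2) r3_components_le_norm'[of "u \<tau> - v \<zeta>' \<tau>"] by auto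
    have "c * \<bar>fst (v \<zeta>' \<tau>) - \<eta> \<zeta>'\<bar> \<le> C0 * r"
    proof (cases "fst (v \<zeta>' \<tau>) \<le> \<eta> \<zeta>'")
      case True
      then show ?thesis using v_left[OF \<zeta>(2) \<tau>(1) True] y by simp
    next
      case False
      then show ?thesis using v_right[OF \<zeta>(2) \<tau>(1)] y by (simp add: algebra_simps)
    qed
    then have "\<bar>fst (v \<zeta>' \<tau>) - \<eta> \<zeta>'\<bar> \<le> C0 / c * r" using c by (simp add: field_simps)
    then have xe: "\<bar>fst (u \<tau>) - \<eta> \<zeta>'\<bar> \<le> C0 / c * r + C0 * r" using x by linarith
    have "\<dots> \<le> C * r" using r by (simp add: C_def algebra_simps)
    then have xe: "\<bar>fst (u \<tau>) - \<eta> \<zeta>'\<bar> \<le> C * r" using xe by linarith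
    then show "\<bar>fst (u \<tau>) - \<eta> \<zeta>'\<bar> \<le> C * r \<and> \<eta>0 / 2 \<le> fst (u \<tau>)"
      using \<eta>[OF \<zeta>(2)] rr by auto
  next
    fix r \<zeta> u t assume r: "0 < r" "r \<le> r0" and \<zeta>: "\<zeta> \<in> {za..zb}" and s: "sol r \<zeta> u" and t: "t \<in> {0..T}"
    have rr: "r \<le> r2" using r r0_le by linarith
    have N: "norm (u t - v \<zeta> t) \<le> 1 \<and> \<bar>snd (snd (u t)) - \<zeta>\<bar> \<le> r \<and> - d \<le> snd (snd (u t)) \<and> snd (snd (u t)) \<le> zb / 2"
      using C0(5)[OF r(1) rr \<zeta> \<zeta> _ s t] r by simp
    then show "\<bar>fst (u t)\<bar> \<le> B + 1 \<and> \<bar>fst (snd (u t))\<bar> \<le> B + 1 \<and>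
      \<bar>snd (snd (u t)) - \<zeta>\<bar> \<le> r \<and> - d \<le> snd (snd (u t)) \<and> snd (snd (u t)) \<le> zb / 2"
      using v_bound[OF \<zeta> t] r3_components_le_norm'[of "u t - v \<zeta> t"] by auto
  qed (use C r0 r0_le C0 in auto)
qed

text \<open>The one-sided bound makes the separation of two orbits proportional to that of their
  starting parameters, and transversality does the same for the crossing times. In the z-direction
  both the speed and its variation carry at least a factor r, so the map from start to crossing is a
  small Lipschitz perturbation of the identity.\<close>

lemma crossing_lipschitz:
  obtains C r0 where "0 \<le> C" "0 < r0" "r0 \<le> 1" "r0 \<le> r1"
    "\<And>r \<zeta> \<zeta>' u u' \<tau> \<tau>'. \<lbrakk>0 < r; r \<le> r0; \<zeta> \<in> {za..zb}; \<zeta>' \<in> {za..zb}; sol r \<zeta> u; sol r \<zeta>' u'; crossing r u \<tau>; crossing r u' \<tau>'\<rbrakk> \<Longrightarrow>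
      \<bar>fst (u \<tau>) - fst (u' \<tau>')\<bar> \<le> C * \<bar>\<zeta> - \<zeta>'\<bar> \<and>
      \<bar>(snd (snd (u \<tau>)) - snd (snd (u' \<tau>'))) - (\<zeta> - \<zeta>')\<bar> \<le> C * r * \<bar>\<zeta> - \<zeta>'\<bar>"
proof -
  have B1: "1 \<le> B + 1" using B by simp
  obtain Cx r2 where Cx: "0 \<le> Cx" "0 < r2" "r2 \<le> 1" "r2 \<le> r1"
    "\<And>r \<zeta> \<zeta>' u \<tau>. \<lbrakk>0 < r; r \<le> r2; \<zeta> \<in> {za..zb}; \<zeta>' \<in> {za..zb}; \<bar>\<zeta> - \<zeta>'\<bar> \<le> r; sol r \<zeta> u; crossing r u \<tau>\<rbrakk> \<Longrightarrow>
      \<bar>fst (u \<tau>) - \<eta> \<zeta>'\<bar> \<le> Cx * r \<and> \<eta>0 / 2 \<le> fst (u \<tau>)"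
    "\<And>r \<zeta> u t. \<lbrakk>0 < r; r \<le> r2; \<zeta> \<in> {za..zb}; sol r \<zeta> u; t \<in> {0..T}\<rbrakk> \<Longrightarrow>
      \<bar>fst (u t)\<bar> \<le> B + 1 \<and> \<bar>fst (snd (u t))\<bar> \<le> B + 1 \<and>
      \<bar>snd (snd (u t)) - \<zeta>\<bar> \<le> r \<and> - d \<le> snd (snd (u t)) \<and> snd (snd (u t)) \<le> zb / 2"
    by (rule crossing_exists) blast
  obtain L r3 where L: "0 \<le> L" "0 < r3" "r3 \<le> 1"
    "\<And>r x y z x' y' z'. \<lbrakk>0 < r; r \<le> r3; \<bar>x\<bar> \<le> B + 1; \<bar>y\<bar> \<le> B + 1; - d \<le> z; z \<le> - (- zb / 2);
       \<bar>x'\<bar> \<le> B + 1; \<bar>y'\<bar> \<le> B + 1; - d \<le> z'; z' \<le> - (- zb / 2)\<rbrakk> \<Longrightarrow>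
      ((x, y, z) - (x', y', z')) \<bullet> (V r (x, y, z) - V r (x', y', z')) \<le> L * (norm ((x, y, z) - (x', y', z')))\<^sup>2"
    using V_onesided[OF B1, of "- zb / 2"] z by (metis divide_pos_pos neg_0_less_iff_less zero_less_numeral)
  obtain C1 r4 where C1: "0 \<le> C1" "0 < r4" "r4 \<le> 1"
    "\<And>r x y z. 0 < r \<Longrightarrow> r \<le> r4 \<Longrightarrow> \<bar>x\<bar> \<le> B + 1 \<Longrightarrow> \<bar>y\<bar> \<le> B + 1 \<Longrightarrow> \<bar>z\<bar> \<le> d \<Longrightarrow>
      norm (V r (x, y, z) - V0 (x, y, z)) \<le> C1 * r"
    using V_approx[OF B1] by blast
  define K3 where "K3 = exp ((2 * L + 1) * T) * (1 + T) * (K + 1)"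
  \<comment> \<open>For x \<ge> \<eta>0/4 the limit field pushes y down at a rate of at least
    \<open>2 * c2\<close>; half of this is reserved for the error \<open>C1 * r\<close>.\<close>
  define c2 where "c2 = g0 * \<eta>0 / 4"
  define K4 where "K4 = K3 / c2 + 4 * K3 * T / \<eta>0"
  define Q where "Q = 2 * (M * M + 6 * M)"
  define C where "C = (4 * M * K4 + K3) + (4 * M * K4 + Q * K3 * T)"
  define r0 where "r0 = Min {r2, r3, r4, c2 / (C1 + 1), 1 / (C1 + 1)}"
  have K3: "K3 > 0" using T K by (auto simp: K3_def intro!: mult_pos_pos)
  have c2: "c2 > 0" using g0 \<eta>0 by (simp add: c2_def)
  have K4: "K4 > 0" using K3 c2 T \<eta>0 by (auto simp: K4_def intro!: add_pos_pos)
  have Q: "Q > 0" using M by (auto simp: Q_def intro!: add_pos_pos)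
  have r0: "0 < r0" using Cx L C1 c2 by (simp add: r0_def)
  have r0_le: "r0 \<le> r2" "r0 \<le> r3" "r0 \<le> r4" "r0 \<le> c2 / (C1 + 1)" "r0 \<le> 1 / (C1 + 1)"
    unfolding r0_def by (rule Min_le; simp)+
  have C0: "0 \<le> C" using M K4 K3 Q T by (auto simp: C_def intro!: add_nonneg_nonneg mult_nonneg_nonneg)
  have main: "\<bar>fst (u \<tau>) - fst (u' \<tau>')\<bar> \<le> C * \<bar>\<zeta> - \<zeta>'\<bar> \<and>
      \<bar>(snd (snd (u \<tau>)) - snd (snd (u' \<tau>'))) - (\<zeta> - \<zeta>')\<bar> \<le> C * r * \<bar>\<zeta> - \<zeta>'\<bar>"
    if r: "0 < r" "r \<le> r0" and \<zeta>: "\<zeta> \<in> {za..zb}" "\<zeta>' \<in> {za..zb}" and s: "sol r \<zeta> u" "sol r \<zeta>' u'"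
      and cr: "crossing r u \<tau>" "crossing r u' \<tau>'" and le: "\<tau> \<le> \<tau>'" for r \<zeta> \<zeta>' u u' \<tau> \<tau>'
  proof -
    define D where "D = \<bar>\<zeta> - \<zeta>'\<bar>"
    have rr: "r \<le> r2" "r \<le> r3" "r \<le> r4" "r \<le> 1" using r r0_le Cx by linarith+
    have rC: "C1 * r \<le> c2" "C1 * r \<le> 1"
    proof -
      have "r \<le> c2 / (C1 + 1)" "r \<le> 1 / (C1 + 1)" using r r0_le by linarith+
      then have "(C1 + 1) * r \<le> c2" "(C1 + 1) * r \<le> 1" using C1(1) by (auto simp: pos_le_divide_eq mult.commute)
      moreover have "(C1 + 1) * r = C1 * r + r" by (simp add: distrib_right)
      ultimately show "C1 * r \<le> c2" "C1 * r \<le> 1" using r by linarith+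
    qed
    have \<tau>: "0 \<le> \<tau>" "\<tau>' \<le> T" "fst (snd (u \<tau>)) = 0" "fst (snd (u' \<tau>')) = 0" using cr by (auto simp: crossing_def)
    note bu = Cx(6)[OF r(1) rr(1) \<zeta>(1) s(1)] and bu' = Cx(6)[OF r(1) rr(1) \<zeta>(2) s(2)]
    have close: "norm (u t - u' t) \<le> K3 * D" if t: "t \<in> {0..T}" for t
    proof -
      have "norm (u t - u' t) \<le> exp ((2 * L + 1) * (t - 0)) * (1 + (t - 0)) * (norm (u 0 - u' 0) + 0)"
      proof (rule ode_compare_basic)
        fix q assume q: "q \<in> {0..t}"
        show "(u has_vector_derivative V r (u q)) (at q within {0..t})"
          "(u' has_vector_derivative V r (u' q)) (at q within {0..t})"
          using q t by (auto intro!: sol_DERIV(1)[OF s(1)] sol_DERIV(1)[OF s(2)])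
        have qT: "q \<in> {0..T}" using q t by auto
        obtain x y w where uq: "u q = (x, y, w)" by (cases "u q")
        obtain x' y' w' where vq: "u' q = (x', y', w')" by (cases "u' q")
        show "(u q - u' q) \<bullet> (V r (u q) - V r (u' q)) \<le> L * (norm (u q - u' q))\<^sup>2 + 0 * norm (u q - u' q)"
          using L(4)[OF r(1) rr(2), of x y w x' y' w'] bu[OF qT] bu'[OF qT] unfolding uq vq by auto
      qed (use L t in auto)
      also have "\<dots> \<le> exp ((2 * L + 1) * T) * (1 + T) * ((K + 1) * D)"
      proof (intro mult_mono)
        have "norm (u 0 - u' 0) \<le> \<bar>0\<bar> + \<bar>Ys r \<zeta> - Ys r \<zeta>'\<bar> + \<bar>\<zeta> - \<zeta>'\<bar>"
          using norm_r3_le[of 0 "Ys r \<zeta> - Ys r \<zeta>'" "\<zeta> - \<zeta>'"] s by (simp add: sol_def)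
        also have "\<bar>Ys r \<zeta> - Ys r \<zeta>'\<bar> \<le> K * (\<bar>r - r\<bar> + \<bar>\<zeta> - \<zeta>'\<bar>)" using r rr Cx \<zeta> by (intro Ys_lip) auto
        finally show "norm (u 0 - u' 0) + 0 \<le> (K + 1) * D" by (simp add: D_def algebra_simps)
      qed (use t L in \<open>auto intro!: mult_left_mono\<close>)
      finally show ?thesis by (simp add: K3_def mult.assoc)
    qed
    have comps: "\<bar>fst (u t) - fst (u' t)\<bar> \<le> K3 * D" "\<bar>fst (snd (u t)) - fst (snd (u' t))\<bar> \<le> K3 * D" if "t \<in> {0..T}" for t
      using close[OF that] r3_components_le_norm'[of "u t - u' t"] by auto
    have D0: "D \<ge> 0" by (simp add: D_def)
    have Vx: "0 \<le> fst (V r (u' t))" and Vy: "\<eta>0 / 4 \<le> fst (u' t) \<Longrightarrow> fst (snd (V r (u' t))) \<le> - c2" if t: "t \<in> {0..T}" for t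
    proof -
      obtain x y w where ut: "u' t = (x, y, w)" by (cases "u' t")
      have b: "\<bar>x\<bar> \<le> B + 1" "\<bar>y\<bar> \<le> B + 1" "- d \<le> w" "w \<le> 0" "\<bar>w\<bar> \<le> d" using bu'[OF t] z by (auto simp: ut)
      have N: "norm (V r (x, y, w) - V0 (x, y, w)) \<le> C1 * r" by (rule C1(4)[OF r(1) rr(3) b(1,2,5)])
      have 1: "\<bar>fst (V r (x, y, w)) - 2 * g1 (0, 0, w)\<bar> \<le> C1 * r"
        "\<bar>fst (snd (V r (x, y, w))) - (a * f2 (0, 0, w) * (max 0 y) ^ k - 2 * G w * x)\<bar> \<le> C1 * r"
        using N r3_components_le_norm'[of "V r (x, y, w) - V0 (x, y, w)"] by (auto simp: V0_def)
      show "0 \<le> fst (V r (u' t))" using 1(1) g1_ge[of "(0, 0, w)"] rC by (auto simp: ut)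
      assume "\<eta>0 / 4 \<le> fst (u' t)"
      then have x: "\<eta>0 / 4 \<le> x" by (simp add: ut)
      have "f2 (0, 0, w) \<le> b1 * w" by (rule f2_le[OF b(3,4)])
      also have "\<dots> \<le> 0" using b b1 by (intro mult_nonneg_nonpos) auto
      finally have "a * (max 0 y) ^ k * f2 (0, 0, w) \<le> 0" using a by (intro mult_nonneg_nonpos) auto
      moreover have "g0 * (\<eta>0 / 4) \<le> G w * x" using G_ge[OF b(5)] g0 x \<eta>0 by (intro mult_mono) auto
      ultimately have "a * f2 (0, 0, w) * (max 0 y) ^ k - 2 * G w * x \<le> - 2 * c2"
        by (simp add: c2_def mult_ac)
      then show "fst (snd (V r (u' t))) \<le> - c2" using 1(2) rC by (auto simp: ut)
    qed
    \<comment> \<open>If the orbits are close, the later one is still at x \<ge> \<eta>0/4 at the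
      earlier crossing time and descends at rate \<open>c2\<close> from a height of at most
      \<open>K3 * D\<close>. Otherwise \<open>D\<close> is bounded below and the trivial bound
      \<open>T\<close> suffices. The two summands of \<open>K4\<close> belong to these two
      cases.\<close>
    have dt: "\<tau>' - \<tau> \<le> K4 * D"
    proof (cases "K3 * D \<le> \<eta>0 / 4")
      case True
      have "\<eta>0 / 2 \<le> fst (u \<tau>)" using Cx(5)[OF r(1) rr(1) \<zeta>(1) \<zeta>(1) _ s(1) cr(1)] r by simp
      then have x\<tau>: "\<eta>0 / 4 \<le> fst (u' \<tau>)" using comps(1)[of \<tau>] \<tau> le True by auto
      have xt: "\<eta>0 / 4 \<le> fst (u' t)" if t: "t \<in> {\<tau>..\<tau>'}" for t
      proof -
        have "- fst (u' t) \<le> - fst (u' \<tau>)"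
        proof (rule derivative_nonpos_within_imp_le[where f = "\<lambda>q. - fst (u' q)" and a = \<tau> and b = t])
          fix q assume q: "q \<in> {\<tau>..t}"
          show "((\<lambda>q. - fst (u' q)) has_real_derivative - fst (V r (u' q))) (at q within {\<tau>..t})"
            using q t \<tau> by (intro DERIV_minus sol_DERIV(2)[OF s(2)]) auto
          show "- fst (V r (u' q)) \<le> 0" using Vx[of q] q t \<tau> by auto
        qed (use t in auto)
        then show ?thesis using x\<tau> by simp
      qed
      have "fst (snd (u' \<tau>')) + c2 * \<tau>' \<le> fst (snd (u' \<tau>)) + c2 * \<tau>"
      proof (rule derivative_nonpos_within_imp_le[where f = "\<lambda>q. fst (snd (u' q)) + c2 * q" and a = \<tau> and b = \<tau>'])
        fix q assume q: "q \<in> {\<tau>..\<tau>'}"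
        show "((\<lambda>q. fst (snd (u' q)) + c2 * q) has_real_derivative fst (snd (V r (u' q))) + c2) (at q within {\<tau>..\<tau>'})"
          using q \<tau> by (intro DERIV_add sol_DERIV(3)[OF s(2)]) (auto intro!: derivative_eq_intros)
        show "fst (snd (V r (u' q))) + c2 \<le> 0" using Vy[of q] xt[OF q] q \<tau> by auto
      qed (use le in auto)
      then have "c2 * (\<tau>' - \<tau>) \<le> K3 * D" using \<tau> le comps(2)[of \<tau>] by (simp add: algebra_simps)
      then have "\<tau>' - \<tau> \<le> K3 / c2 * D" using c2 by (simp add: field_simps)
      moreover have "0 \<le> 4 * K3 * T / \<eta>0 * D" using K3 T \<eta>0 D0 by simp
      ultimately show ?thesis by (simp add: K4_def distrib_right)
    next
      case False
      then have "1 \<le> 4 * K3 * D / \<eta>0" using \<eta>0 by (simp add: field_simps)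
      then have "1 * T \<le> 4 * K3 * D / \<eta>0 * T" using T by (intro mult_right_mono) auto
      moreover have "0 \<le> K3 / c2 * D" using K3 c2 D0 by simp
      moreover have "K4 * D = K3 / c2 * D + 4 * K3 * D / \<eta>0 * T" by (simp add: K4_def algebra_simps)
      ultimately show ?thesis using \<tau> by linarith
    qed
    have xs: "\<bar>fst (u' \<tau>') - fst (u' \<tau>)\<bar> \<le> 4 * M * (\<tau>' - \<tau>)"
    proof (rule derivative_bound_within[OF le])
      fix q assume q: "q \<in> {\<tau>..\<tau>'}"
      show "((\<lambda>t. fst (u' t)) has_real_derivative fst (V r (u' q))) (at q within {\<tau>..\<tau>'})"
        using q \<tau> by (intro sol_DERIV(2)[OF s(2)]) auto
      show "\<bar>fst (V r (u' q))\<bar> \<le> 4 * M" by (rule V_bounds[OF r(1) rr(4)])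
    qed
    have dtM: "4 * M * (\<tau>' - \<tau>) \<le> 4 * M * (K4 * D)" using M dt by (intro mult_left_mono) auto
    have "\<bar>fst (u \<tau>) - fst (u' \<tau>')\<bar> \<le> (4 * M * K4 + K3) * D"
      using xs dtM comps(1)[of \<tau>] \<tau> le by (simp add: distrib_right mult.assoc)
    also have "\<dots> \<le> C * D" using D0 M K4 Q K3 T by (intro mult_right_mono) (auto simp: C_def)
    finally have X: "\<bar>fst (u \<tau>) - fst (u' \<tau>')\<bar> \<le> C * D" .
    have Rr: "r ^ (2 * k) \<le> r" using rk_le[OF r(1) rr(4)] by linarith
    have zs: "\<bar>snd (snd (u' \<tau>')) - snd (snd (u' \<tau>))\<bar> \<le> 4 * M * r ^ (2 * k) * (\<tau>' - \<tau>)"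
    proof (rule derivative_bound_within[OF le])
      fix q assume q: "q \<in> {\<tau>..\<tau>'}"
      show "((\<lambda>t. snd (snd (u' t))) has_real_derivative snd (snd (V r (u' q)))) (at q within {\<tau>..\<tau>'})"
        using q \<tau> by (intro sol_DERIV(4)[OF s(2)]) auto
      show "\<bar>snd (snd (V r (u' q)))\<bar> \<le> 4 * M * r ^ (2 * k)" by (rule V_bounds[OF r(1) rr(4)])
    qed
    have "4 * M * r ^ (2 * k) * (\<tau>' - \<tau>) \<le> 4 * M * r * (K4 * D)"
      using M Rr dt le r by (intro mult_mono mult_left_mono) auto
    with zs have zs: "\<bar>snd (snd (u' \<tau>')) - snd (snd (u' \<tau>))\<bar> \<le> 4 * M * K4 * r * D" by (simp add: mult_ac)
    \<comment> \<open>Differences of the z-speeds, not only the speeds, are of order r times the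
      separation; this is what makes the error proportional to the parameter difference.\<close>
    have zz: "\<bar>(snd (snd (u \<tau>)) - snd (snd (u' \<tau>))) - (snd (snd (u 0)) - snd (snd (u' 0)))\<bar> \<le> r * (Q * (K3 * D)) * (\<tau> - 0)"
    proof (rule derivative_bound_within[OF \<tau>(1)])
      fix q assume q: "q \<in> {0..\<tau>}"
      show "((\<lambda>t. snd (snd (u t)) - snd (snd (u' t))) has_real_derivative snd (snd (V r (u q))) - snd (snd (V r (u' q)))) (at q within {0..\<tau>})"
        using q \<tau> le by (intro DERIV_diff sol_DERIV(4)[OF s(1)] sol_DERIV(4)[OF s(2)]) auto
      obtain x y w where uq: "u q = (x, y, w)" by (cases "u q")
      obtain x' y' w' where vq: "u' q = (x', y', w')" by (cases "u' q")
      have "\<bar>snd (snd (V r (u q))) - snd (snd (V r (u' q)))\<bar> \<le> r ^ (2 * k) * (Q * norm (u q - u' q))"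
      proof -
        let ?e = "((1 + \<phi> (r\<^sup>2 * y - 1)) * f3 (arg r (x, y, w)) + (1 - \<phi> (r\<^sup>2 * y - 1)) * g3 (arg r (x, y, w))) -
          ((1 + \<phi> (r\<^sup>2 * y' - 1)) * f3 (arg r (x', y', w')) + (1 - \<phi> (r\<^sup>2 * y' - 1)) * g3 (arg r (x', y', w')))"
        have "snd (snd (V r (u q))) - snd (snd (V r (u' q))) = r ^ (2 * k) * ?e"
          by (simp add: V_def uq vq right_diff_distrib)
        moreover have "\<bar>?e\<bar> \<le> Q * norm (u q - u' q)"
          unfolding uq vq Q_def by (rule mixture_lipschitz) (use r rr in auto)
        then have "r ^ (2 * k) * \<bar>?e\<bar> \<le> r ^ (2 * k) * (Q * norm (u q - u' q))" using r by (intro mult_left_mono) auto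
        ultimately show ?thesis using r by (simp add: abs_mult)
      qed
      also have "\<dots> \<le> r * (Q * (K3 * D))"
        using Rr r Q close[of q] q \<tau> le by (intro mult_mono mult_left_mono) auto
      finally show "\<bar>snd (snd (V r (u q))) - snd (snd (V r (u' q)))\<bar> \<le> r * (Q * (K3 * D))" .
    qed
    have "r * (Q * (K3 * D)) * (\<tau> - 0) \<le> r * (Q * (K3 * D)) * T"
      using r Q K3 D0 \<tau> le by (intro mult_left_mono) auto
    moreover have "snd (snd (u 0)) = \<zeta>" "snd (snd (u' 0)) = \<zeta>'" using s by (auto simp: sol_def)
    ultimately have zz: "\<bar>(snd (snd (u \<tau>)) - snd (snd (u' \<tau>))) - (\<zeta> - \<zeta>')\<bar> \<le> Q * K3 * T * r * D"
      using zz by (simp add: mult_ac)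
    have "\<bar>(snd (snd (u \<tau>)) - snd (snd (u' \<tau>'))) - (\<zeta> - \<zeta>')\<bar> \<le> 4 * M * K4 * r * D + Q * K3 * T * r * D"
      using zz zs by linarith
    also have "\<dots> = (4 * M * K4 + Q * K3 * T) * (r * D)" by (simp add: algebra_simps)
    also have "\<dots> \<le> C * (r * D)" using D0 r M K4 K3 by (intro mult_right_mono) (auto simp: C_def)
    finally show ?thesis using X by (simp add: D_def mult.assoc)
  qed
  show ?thesis
  proof (rule that[of C r0])
    fix r \<zeta> \<zeta>' u u' \<tau> \<tau>'
    assume r: "0 < r" "r \<le> r0" and \<zeta>: "\<zeta> \<in> {za..zb}" "\<zeta>' \<in> {za..zb}" and s: "sol r \<zeta> u" "sol r \<zeta>' u'"
      and cr: "crossing r u \<tau>" "crossing r u' \<tau>'"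
    show "\<bar>fst (u \<tau>) - fst (u' \<tau>')\<bar> \<le> C * \<bar>\<zeta> - \<zeta>'\<bar> \<and>
      \<bar>(snd (snd (u \<tau>)) - snd (snd (u' \<tau>'))) - (\<zeta> - \<zeta>')\<bar> \<le> C * r * \<bar>\<zeta> - \<zeta>'\<bar>"
    proof (cases "\<tau> \<le> \<tau>'")
      case True
      then show ?thesis by (rule main[OF r \<zeta> s cr])
    next
      case False
      then have "\<tau>' \<le> \<tau>" by simp
      from main[OF r \<zeta>(2,1) s(2,1) cr(2,1) this] show ?thesis
        by (simp add: abs_minus_commute) (simp add: abs_if split: if_splits)
    qed
  qed (use C0 r0 r0_le Cx in auto)
qed

end

section \<open>From the normal form to the rescaled field\<close>

definition box3 :: "real \<Rightarrow> r3 set" where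
  "box3 d = cbox (- d, - d, - d) (d, d, d)"

lemma mem_box3: "(x, y, z) \<in> box3 d \<longleftrightarrow> \<bar>x\<bar> \<le> d \<and> \<bar>y\<bar> \<le> d \<and> \<bar>z\<bar> \<le> d"
  unfolding box3_def by (auto simp: cbox_Pair_eq abs_le_iff)

lemma compact_box3: "compact (box3 d)" and convex_box3: "convex (box3 d)"
  by (auto simp: box3_def)

lemma box3_mono: "d \<le> d' \<Longrightarrow> box3 d \<subseteq> box3 d'"
  by (auto simp: mem_box3)

lemma box3_subset_open:
  assumes "open U" "(0, 0, 0) \<in> U"
  obtains d where "0 < d" "box3 d \<subseteq> U"
proof -
  obtain e where e: "e > 0" "ball (0, 0, 0) e \<subseteq> U" using assms open_contains_ball by blast
  show ?thesis
  proof (rule that[of "e / 4"])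
    show "box3 (e / 4) \<subseteq> U"
    proof
      fix p assume "p \<in> box3 (e / 4)"
      moreover obtain x y z where p: "p = (x, y, z)" by (cases p)
      ultimately have "\<bar>x\<bar> + \<bar>y\<bar> + \<bar>z\<bar> < e" using e by (auto simp: mem_box3)
      then have "norm p < e" using norm_r3_le[of x y z] p by simp
      then show "p \<in> U" using e(2) by (auto simp: dist_norm p zero_prod_def[symmetric] subset_iff)
    qed
  qed (use e in auto)
qed

definition clamp3 :: "real \<Rightarrow> r3 \<Rightarrow> r3" where
  "clamp3 d = clamp (- d, - d, - d) (d, d, d)"

lemma clamp3:
  assumes "0 \<le> d"
  shows "clamp3 d p \<in> box3 d" "norm (clamp3 d p - clamp3 d q) \<le> norm (p - q)" "p \<in> box3 d \<Longrightarrow> clamp3 d p = p"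
proof -
  have B: "(- d, - d, - d) \<bullet> i \<le> (d, d, d) \<bullet> i" if "i \<in> Basis" for i :: r3
    using that assms by (auto simp: Basis_prod_def)
  show "clamp3 d p \<in> box3 d" unfolding clamp3_def box3_def by (rule clamp_in_interval) (rule B)
  show "norm (clamp3 d p - clamp3 d q) \<le> norm (p - q)"
    using dist_clamps_le_dist_args[of "(- d, - d, - d)" "(d, d, d)" p q] by (simp add: clamp3_def dist_norm)
  show "p \<in> box3 d \<Longrightarrow> clamp3 d p = p" unfolding clamp3_def box3_def by (rule clamp_cancel_cbox)
qed

definition Lip_on :: "r3 set \<Rightarrow> (r3 \<Rightarrow> real) \<Rightarrow> real \<Rightarrow> bool" where
  "Lip_on S f L \<longleftrightarrow> 0 \<le> L \<and> (\<forall>p\<in>S. \<forall>q\<in>S. \<bar>f p - f q\<bar> \<le> L * norm (p - q))"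

lemma Lip_onD: "Lip_on S f L \<Longrightarrow> p \<in> S \<Longrightarrow> q \<in> S \<Longrightarrow> \<bar>f p - f q\<bar> \<le> L * norm (p - q)"
  by (simp add: Lip_on_def)

lemma Lip_on_weaken: "Lip_on S f L \<Longrightarrow> T \<subseteq> S \<Longrightarrow> L \<le> L' \<Longrightarrow> Lip_on T f L'"
  unfolding Lip_on_def by (meson mult_right_mono norm_ge_zero order_trans subsetD)

lemma Lip_on_add: "Lip_on S f L \<Longrightarrow> Lip_on S g L' \<Longrightarrow> Lip_on S (\<lambda>p. f p + g p) (L + L')"
  unfolding Lip_on_def
proof (intro conjI ballI)
  fix p q assume a: "0 \<le> L \<and> (\<forall>p\<in>S. \<forall>q\<in>S. \<bar>f p - f q\<bar> \<le> L * norm (p - q))"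
    "0 \<le> L' \<and> (\<forall>p\<in>S. \<forall>q\<in>S. \<bar>g p - g q\<bar> \<le> L' * norm (p - q))" and pq: "p \<in> S" "q \<in> S"
  have "\<bar>f p - f q\<bar> \<le> L * norm (p - q)" "\<bar>g p - g q\<bar> \<le> L' * norm (p - q)" using a pq by blast+
  then show "\<bar>f p + g p - (f q + g q)\<bar> \<le> (L + L') * norm (p - q)" unfolding distrib_right by linarith
qed auto

lemma smooth_on_Lip_on:
  assumes "smooth_on f U" "box3 d \<subseteq> U"
  obtains L where "Lip_on (box3 d) f L"
  using smooth_on_imp_Lipschitz_on_compact_convex[OF assms compact_box3 convex_box3]
  by (auto simp: Lip_on_def)

lemma affine_Lip_on: "Lip_on S (\<lambda>(x, y, z). p * x + q * y + s * z + t) (\<bar>p\<bar> + \<bar>q\<bar> + \<bar>s\<bar>)"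
  unfolding Lip_on_def
proof (intro conjI ballI)
  fix u v :: r3
  obtain x y z where u: "u = (x, y, z)" by (cases u)
  obtain x' y' z' where v: "v = (x', y', z')" by (cases v)
  have n: "\<bar>x - x'\<bar> \<le> norm (u - v)" "\<bar>y - y'\<bar> \<le> norm (u - v)" "\<bar>z - z'\<bar> \<le> norm (u - v)"
    using r3_components_le_norm'[of "u - v"] by (auto simp: u v)
  have "(p * x + q * y + s * z + t) - (p * x' + q * y' + s * z' + t) = p * (x - x') + q * (y - y') + s * (z - z')"
    by (simp add: algebra_simps)
  also have "\<bar>\<dots>\<bar> \<le> \<bar>p\<bar> * \<bar>x - x'\<bar> + \<bar>q\<bar> * \<bar>y - y'\<bar> + \<bar>s\<bar> * \<bar>z - z'\<bar>"
    unfolding abs_mult[symmetric] by linarith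
  also have "\<dots> \<le> \<bar>p\<bar> * norm (u - v) + \<bar>q\<bar> * norm (u - v) + \<bar>s\<bar> * norm (u - v)"
    using n by (intro add_mono mult_left_mono) auto
  finally show "\<bar>(case u of (x, y, z) \<Rightarrow> p * x + q * y + s * z + t) - (case v of (x, y, z) \<Rightarrow> p * x + q * y + s * z + t)\<bar>
      \<le> (\<bar>p\<bar> + \<bar>q\<bar> + \<bar>s\<bar>) * norm (u - v)" by (simp add: u v algebra_simps)
qed auto

abbreviation partial :: "(r3 \<Rightarrow> real) \<Rightarrow> r3 \<Rightarrow> r3 \<Rightarrow> real" where
  "partial f v p \<equiv> frechet_derivative f (at p) v"

lemma smooth_on_line_DERIV:
  fixes f :: "r3 \<Rightarrow> real"
  assumes "smooth_on f U" "p + t *\<^sub>R w \<in> U"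
  shows "((\<lambda>t. f (p + t *\<^sub>R w)) has_real_derivative partial f w (p + t *\<^sub>R w)) (at t within A)"
proof -
  have "(f has_derivative frechet_derivative f (at (p + t *\<^sub>R w))) (at (p + t *\<^sub>R w))"
    using smooth_on_imp_differentiable[OF assms] frechet_derivative_works by blast
  moreover have "((\<lambda>t. p + t *\<^sub>R w) has_vector_derivative w) (at t within A)"
    by (auto intro!: derivative_eq_intros)
  ultimately have "((f \<circ> (\<lambda>t. p + t *\<^sub>R w)) has_vector_derivative frechet_derivative f (at (p + t *\<^sub>R w)) w) (at t within A)"
    by (intro vector_derivative_diff_chain_within) (auto intro: has_derivative_at_withinI)
  then show ?thesis by (simp add: o_def has_real_derivative_iff_has_vector_derivative)
qed

lemma partial_expand:
  fixes f :: "r3 \<Rightarrow> real"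
  assumes "smooth_on f U" "p \<in> U"
  shows "partial f (x, y, z) p = x * partial f (1, 0, 0) p + y * partial f (0, 1, 0) p + z * partial f (0, 0, 1) p"
proof -
  have "linear (frechet_derivative f (at p))"
    using smooth_on_imp_differentiable[OF assms] by (rule linear_frechet_derivative)
  then interpret linear "frechet_derivative f (at p)" .
  have "(x, y, z) = x *\<^sub>R (1, 0, 0) + y *\<^sub>R (0, 1, 0) + z *\<^sub>R (0, 0, 1 :: real)" by simp
  then have "partial f (x, y, z) p = partial f (x *\<^sub>R (1, 0, 0) + y *\<^sub>R (0, 1, 0) + z *\<^sub>R (0, 0, 1)) p" by simp
  then show ?thesis by (simp only: add scaleR real_scaleR_def)
qed

lemma abs_mult_mult_abs: "\<bar>x\<bar> * (c * \<bar>x\<bar>) = c * (x::real)\<^sup>2"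
proof -
  have "\<bar>x\<bar> * (c * \<bar>x\<bar>) = c * (\<bar>x\<bar> * \<bar>x\<bar>)" by (simp only: mult.left_commute)
  then show ?thesis by (simp add: power2_eq_square)
qed

lemma mean_value_unit:
  fixes h :: "real \<Rightarrow> real"
  assumes "\<And>t. t \<in> {0..1} \<Longrightarrow> (h has_real_derivative h' t) (at t within {0..1})"
    and "\<And>t. t \<in> {0..1} \<Longrightarrow> \<bar>h' t\<bar> \<le> C"
  shows "\<bar>h 1 - h 0\<bar> \<le> C"
  using derivative_bound_within[of 0 1 h h' C] assms by simp

section \<open>Remainder estimates near the fold line\<close>

context
  fixes Q :: "r3 \<Rightarrow> real" and U :: "r3 set" and d L :: real
  assumes sm: "smooth_on Q U" and sub: "box3 d \<subseteq> U" and d: "0 < d"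
    and Lx: "Lip_on (box3 d) (partial Q (1, 0, 0)) L"
    and Ly: "Lip_on (box3 d) (partial Q (0, 1, 0)) L"
    and Lz: "Lip_on (box3 d) (partial Q (0, 0, 1)) L"
begin

lemma quadratic_remainder_z:
  assumes "partial Q (0, 0, 1) (0, 0, 0) = 0" "\<bar>z\<bar> \<le> d"
  shows "\<bar>Q (0, 0, z) - Q (0, 0, 0)\<bar> \<le> L * z\<^sup>2"
proof -
  have inb: "(0, 0, t * z) \<in> box3 d" if "t \<in> {0..1}" for t
    using assms that mult_left_le_one_le[of "\<bar>z\<bar>" t] d by (simp add: mem_box3 abs_mult)
  have "\<bar>(\<lambda>t. Q ((0, 0, 0) + t *\<^sub>R (0, 0, z))) 1 - (\<lambda>t. Q ((0, 0, 0) + t *\<^sub>R (0, 0, z))) 0\<bar> \<le> L * z\<^sup>2"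
  proof (rule mean_value_unit)
    fix t :: real assume t: "t \<in> {0..1}"
    have m: "(0, 0, 0) + t *\<^sub>R (0, 0, z) \<in> box3 d" using inb[OF t] by simp
    show "((\<lambda>t. Q ((0, 0, 0) + t *\<^sub>R (0, 0, z))) has_real_derivative partial Q (0, 0, z) ((0, 0, 0) + t *\<^sub>R (0, 0, z))) (at t within {0..1})"
      using m sub by (intro smooth_on_line_DERIV[OF sm]) auto
    have "partial Q (0, 0, z) ((0, 0, 0) + t *\<^sub>R (0, 0, z)) = z * partial Q (0, 0, 1) (0, 0, t * z)"
      using partial_expand[OF sm, of "(0, 0, t * z)" 0 0 z] inb[OF t] sub by auto
    moreover have "\<bar>partial Q (0, 0, 1) (0, 0, t * z) - partial Q (0, 0, 1) (0, 0, 0)\<bar> \<le> L * norm ((0, 0, t * z) - (0, 0, 0) :: r3)"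
      using inb[OF t] d by (intro Lip_onD[OF Lz]) (auto simp: mem_box3)
    moreover have "L * norm ((0, 0, t * z) - (0, 0, 0) :: r3) \<le> L * \<bar>z\<bar>"
      using t mult_left_le_one_le[of "\<bar>z\<bar>" t] Lz by (intro mult_left_mono) (auto simp: norm_Pair abs_mult Lip_on_def)
    ultimately have "\<bar>partial Q (0, 0, z) ((0, 0, 0) + t *\<^sub>R (0, 0, z))\<bar> \<le> \<bar>z\<bar> * (L * \<bar>z\<bar>)"
      using assms by (simp add: abs_mult mult_left_mono)
    then show "\<bar>partial Q (0, 0, z) ((0, 0, 0) + t *\<^sub>R (0, 0, z))\<bar> \<le> L * z\<^sup>2"
      by (simp only: abs_mult_mult_abs)
  qed
  then show ?thesis by simp
qed

text \<open>Mean value estimate along the segment from the fold line, after subtraction of the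
  linear part; the Lipschitz bound of the partial derivative gives the second factor x.\<close>

lemma quadratic_remainder_x:
  assumes "\<bar>x\<bar> \<le> d" "\<bar>z\<bar> \<le> d" "Q (0, 0, z) = 0"
  shows "\<bar>Q (x, 0, z) - partial Q (1, 0, 0) (0, 0, z) * x\<bar> \<le> L * x\<^sup>2"
proof -
  define D where "D = partial Q (1, 0, 0) (0, 0, z)"
  have inb: "(t * x, 0, z) \<in> box3 d" if "t \<in> {0..1}" for t
    using assms that mult_left_le_one_le[of "\<bar>x\<bar>" t] d by (simp add: mem_box3 abs_mult)
  define h where "h t = Q ((0, 0, z) + t *\<^sub>R (x, 0, 0)) - t * (D * x)" for t
  have "\<bar>h 1 - h 0\<bar> \<le> L * x\<^sup>2"
  proof (rule mean_value_unit)
    fix t :: real assume t: "t \<in> {0..1}"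
    have m: "(0, 0, z) + t *\<^sub>R (x, 0, 0) \<in> U" using inb[OF t] sub by auto
    have px: "partial Q (x, 0, 0) ((0, 0, z) + t *\<^sub>R (x, 0, 0)) = x * partial Q (1, 0, 0) (t * x, 0, z)"
      using partial_expand[OF sm, of "(t * x, 0, z)" x 0 0] inb[OF t] sub by auto
    show "(h has_real_derivative x * partial Q (1, 0, 0) (t * x, 0, z) - D * x) (at t within {0..1})"
      unfolding h_def px[symmetric]
      by (rule DERIV_diff[OF smooth_on_line_DERIV[OF sm m]]) (auto intro!: derivative_eq_intros)
    have "\<bar>partial Q (1, 0, 0) (t * x, 0, z) - partial Q (1, 0, 0) (0, 0, z)\<bar> \<le> L * norm ((t * x, 0, z) - (0, 0, z) :: r3)"
      using inb[OF t] d assms by (intro Lip_onD[OF Lx]) (auto simp: mem_box3)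
    also have "\<dots> \<le> L * \<bar>x\<bar>"
      using t mult_left_le_one_le[of "\<bar>x\<bar>" t] Lx by (intro mult_left_mono) (auto simp: norm_Pair abs_mult Lip_on_def)
    finally have "\<bar>x\<bar> * \<bar>partial Q (1, 0, 0) (t * x, 0, z) - D\<bar> \<le> \<bar>x\<bar> * (L * \<bar>x\<bar>)"
      unfolding D_def by (intro mult_left_mono) auto
    moreover have "x * partial Q (1, 0, 0) (t * x, 0, z) - D * x = x * (partial Q (1, 0, 0) (t * x, 0, z) - D)"
      by (simp add: algebra_simps)
    ultimately show "\<bar>x * partial Q (1, 0, 0) (t * x, 0, z) - D * x\<bar> \<le> L * x\<^sup>2"
      by (simp only: abs_mult abs_mult_mult_abs)
  qed
  then show ?thesis using assms by (simp add: h_def D_def)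
qed

text \<open>Both values are connected to the fold line, where \<open>Q\<close> vanishes, along
  parallel segments in x and y. The partial derivatives on the two segments differ by at most
  \<open>L * \<bar>z - z'\<bar>\<close>, and the length of the segments contributes the other
  factor; a mean value estimate in z would not.\<close>

lemma mixed_difference:
  assumes "\<bar>x\<bar> \<le> d" "\<bar>y\<bar> \<le> d" "\<bar>z\<bar> \<le> d" "\<bar>z'\<bar> \<le> d" "Q (0, 0, z) = 0" "Q (0, 0, z') = 0"
  shows "\<bar>Q (x, y, z) - Q (x, y, z')\<bar> \<le> L * (\<bar>x\<bar> + \<bar>y\<bar>) * \<bar>z - z'\<bar>"
proof -
  have inb: "(t * x, t * y, w) \<in> box3 d" if "t \<in> {0..1}" "\<bar>w\<bar> \<le> d" for t w
    using assms that mult_left_le_one_le[of "\<bar>x\<bar>" t] mult_left_le_one_le[of "\<bar>y\<bar>" t] by (simp add: mem_box3 abs_mult)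
  define h where "h t = Q ((0, 0, z) + t *\<^sub>R (x, y, 0)) - Q ((0, 0, z') + t *\<^sub>R (x, y, 0))" for t
  have "\<bar>h 1 - h 0\<bar> \<le> L * (\<bar>x\<bar> + \<bar>y\<bar>) * \<bar>z - z'\<bar>"
  proof (rule mean_value_unit)
    fix t :: real assume t: "t \<in> {0..1}"
    have m: "(0, 0, w) + t *\<^sub>R (x, y, 0) \<in> U" if "\<bar>w\<bar> \<le> d" for w using inb[OF t that] sub by auto
    have px: "partial Q (x, y, 0) ((0, 0, w) + t *\<^sub>R (x, y, 0)) =
      x * partial Q (1, 0, 0) (t * x, t * y, w) + y * partial Q (0, 1, 0) (t * x, t * y, w)" if "\<bar>w\<bar> \<le> d" for w
      using partial_expand[OF sm, of "(t * x, t * y, w)" x y 0] inb[OF t that] sub by auto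
    show "(h has_real_derivative partial Q (x, y, 0) ((0, 0, z) + t *\<^sub>R (x, y, 0)) - partial Q (x, y, 0) ((0, 0, z') + t *\<^sub>R (x, y, 0))) (at t within {0..1})"
      unfolding h_def
      by (intro DERIV_diff smooth_on_line_DERIV[OF sm] m assms)
    have l: "\<bar>partial Q w (t * x, t * y, z) - partial Q w (t * x, t * y, z')\<bar> \<le> L * \<bar>z - z'\<bar>"
      if "Lip_on (box3 d) (partial Q w) L" for w
      using Lip_onD[OF that inb[OF t assms(3)] inb[OF t assms(4)]] by (simp add: norm_Pair)
    have "partial Q (x, y, 0) ((0, 0, z) + t *\<^sub>R (x, y, 0)) - partial Q (x, y, 0) ((0, 0, z') + t *\<^sub>R (x, y, 0)) =
      x * (partial Q (1, 0, 0) (t * x, t * y, z) - partial Q (1, 0, 0) (t * x, t * y, z')) +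
      y * (partial Q (0, 1, 0) (t * x, t * y, z) - partial Q (0, 1, 0) (t * x, t * y, z'))"
      unfolding px[OF assms(3)] px[OF assms(4)] by (simp add: algebra_simps)
    also have "\<bar>\<dots>\<bar> \<le> \<bar>x\<bar> * (L * \<bar>z - z'\<bar>) + \<bar>y\<bar> * (L * \<bar>z - z'\<bar>)"
      using mult_left_mono[OF l[OF Lx], of "\<bar>x\<bar>"] mult_left_mono[OF l[OF Ly], of "\<bar>y\<bar>"]
      by (intro order_trans[OF abs_triangle_ineq] add_mono) (auto simp: abs_mult)
    finally show "\<bar>partial Q (x, y, 0) ((0, 0, z) + t *\<^sub>R (x, y, 0)) - partial Q (x, y, 0) ((0, 0, z') + t *\<^sub>R (x, y, 0))\<bar> \<le> L * (\<bar>x\<bar> + \<bar>y\<bar>) * \<bar>z - z'\<bar>"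
      by (simp add: algebra_simps)
  qed
  then show ?thesis using assms by (simp add: h_def)
qed

end

lemma Lip_on_cong: "Lip_on S g L \<Longrightarrow> (\<And>p. p \<in> S \<Longrightarrow> f p = g p) \<Longrightarrow> Lip_on S f L"
  by (simp add: Lip_on_def)

text \<open>On a compact cube all components and the first derivatives of \<open>P2\<close> and
  \<open>Q2\<close> are Lipschitz. Shrinking the cube keeps the leading coefficients of the normal
  form at no less than half of their values at the origin, and clamping makes the bounds
  global.\<close>

lemma two_fold_normal_form_fold_system:
  assumes k: "2 \<le> k" and b: "b \<noteq> 0" and \<beta>: "\<beta> > 0"
    and reg: "regularizing_function k \<phi>" and nf: "two_fold_normal_form a b c \<alpha> \<beta> \<gamma> Xp Xm"
  obtains d M where
    "fold_system k \<phi> (phi_lead k \<phi>) d M (\<beta> / 2) (\<bar>b\<bar> / 2)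
      (\<lambda>p. fst (Xp (clamp3 d p))) (\<lambda>p. fst (snd (Xp (clamp3 d p)))) (\<lambda>p. snd (snd (Xp (clamp3 d p))))
      (\<lambda>p. fst (Xm (clamp3 d p))) (\<lambda>p. fst (snd (Xm (clamp3 d p)))) (\<lambda>p. snd (snd (Xm (clamp3 d p)))) (fold_G Xm)"
    "\<And>z. \<bar>z\<bar> \<le> d \<Longrightarrow> \<bar>fold_A Xm z - 1\<bar> \<le> M * \<bar>z\<bar>"
    "\<And>z. \<bar>z\<bar> \<le> d \<Longrightarrow> \<bar>fold_B Xp z - \<bar>b\<bar> * z\<bar> \<le> M * z\<^sup>2"
    "\<And>z. \<bar>z\<bar> \<le> d \<Longrightarrow> \<bar>fold_G Xm z - \<beta>\<bar> \<le> M * \<bar>z\<bar>"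
proof -
  obtain U P1 P2 P3 Q1 Q2 Q3 where U: "open U" "(0, 0, 0) \<in> U"
    and sm: "smooth_on P1 U" "smooth_on P2 U" "smooth_on P3 U" "smooth_on Q1 U" "smooth_on Q2 U" "smooth_on Q3 U"
    and XX: "\<forall>x y z. (x, y, z) \<in> U \<longrightarrow>
           Xp (x, y, z) =
             (c / \<bar>\<beta>\<bar> + P1 (x, y, z), a * y + \<bar>b\<bar> * z + P2 (x, y, z), sgn b + P3 (x, y, z)) \<and>
           Xm (x, y, z) =
             (sgn \<beta> + Q1 (x, y, z), \<alpha> * y - \<bar>\<beta>\<bar> * x + Q2 (x, y, z), \<gamma> / \<bar>b\<bar> + Q3 (x, y, z))"
    and zero: "P1 (0, 0, 0) = 0" "P3 (0, 0, 0) = 0" "Q1 (0, 0, 0) = 0" "Q3 (0, 0, 0) = (0::real)"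
    and P2d: "(P2 has_derivative (\<lambda>_. 0)) (at (0, 0, 0))" and P2z: "\<forall>x. (x, 0, 0) \<in> U \<longrightarrow> P2 (x, 0, 0) = 0"
    and Q2d: "(Q2 has_derivative (\<lambda>_. 0)) (at (0, 0, 0))" and Q2z: "\<forall>z. (0, 0, z) \<in> U \<longrightarrow> Q2 (0, 0, z) = 0"
    using nf unfolding two_fold_normal_form_def by blast
  obtain e where e: "0 < e" "box3 e \<subseteq> U" using box3_subset_open[OF U] .
  let ?F = "{(\<lambda>p. fst (Xp p)), (\<lambda>p. fst (snd (Xp p))), (\<lambda>p. snd (snd (Xp p))),
    (\<lambda>p. fst (Xm p)), (\<lambda>p. fst (snd (Xm p))), (\<lambda>p. snd (snd (Xm p)))}"
  have XpU: "Xp (x, y, z) = (c / \<beta> + P1 (x, y, z), a * y + \<bar>b\<bar> * z + P2 (x, y, z), sgn b + P3 (x, y, z))"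
    and XmU: "Xm (x, y, z) = (1 + Q1 (x, y, z), \<alpha> * y - \<beta> * x + Q2 (x, y, z), \<gamma> / \<bar>b\<bar> + Q3 (x, y, z))"
    if "(x, y, z) \<in> U" for x y z using XX that \<beta> by auto
  have Lip_ex: "\<exists>L. Lip_on (box3 e) f L" if "f \<in> ?F" for f
  proof -
    \<comment> \<open>All six components have the form affine plus smooth remainder.\<close>
    have gen: "\<exists>L. Lip_on (box3 e) f L" if P: "smooth_on P U"
      "\<And>x y z. (x, y, z) \<in> U \<Longrightarrow> f (x, y, z) = (p * x + q * y + s * z + t) + P (x, y, z)" for f P p q s t
    proof -
      obtain L where "Lip_on (box3 e) P L" using smooth_on_Lip_on[OF P(1) e(2)] .
      from Lip_on_add[OF affine_Lip_on this, of p q s t]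
      have "Lip_on (box3 e) f (\<bar>p\<bar> + \<bar>q\<bar> + \<bar>s\<bar> + L)"
      proof (rule Lip_on_cong)
        fix r assume "r \<in> box3 e"
        then have "r \<in> U" using e(2) by blast
        then show "f r = (case r of (x, y, z) \<Rightarrow> p * x + q * y + s * z + t) + P r" using P(2) by (cases r) auto
      qed
      then show ?thesis by blast
    qed
    show ?thesis using that
    proof (elim insertE emptyE)
      assume "f = (\<lambda>p. fst (Xp p))" then show ?thesis
        using gen[OF sm(1), of f 0 0 0 "c / \<beta>"] XpU by simp
    next
      assume "f = (\<lambda>p. fst (snd (Xp p)))" then show ?thesis
        using gen[OF sm(2), of f 0 a "\<bar>b\<bar>" 0] XpU by simp
    next
      assume "f = (\<lambda>p. snd (snd (Xp p)))" then show ?thesis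
        using gen[OF sm(3), of f 0 0 0 "sgn b"] XpU by simp
    next
      assume "f = (\<lambda>p. fst (Xm p))" then show ?thesis
        using gen[OF sm(4), of f 0 0 0 1] XmU by simp
    next
      assume "f = (\<lambda>p. fst (snd (Xm p)))" then show ?thesis
        using gen[OF sm(5), of f "- \<beta>" \<alpha> 0 0] XmU by simp
    next
      assume "f = (\<lambda>p. snd (snd (Xm p)))" then show ?thesis
        using gen[OF sm(6), of f 0 0 0 "\<gamma> / \<bar>b\<bar>"] XmU by simp
    qed
  qed
  define LF where "LF f = (SOME L. Lip_on (box3 e) f L)" for f
  have LF: "Lip_on (box3 e) f (LF f)" if "f \<in> ?F" for f
    unfolding LF_def by (rule someI_ex) (rule Lip_ex[OF that])
  define L1 where "L1 = Max (LF ` ?F)"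
  have LF1: "Lip_on (box3 e) f L1" if "f \<in> ?F" for f
    by (rule Lip_on_weaken[OF LF[OF that] order_refl]) (use that in \<open>auto simp: L1_def\<close>)
  have L1: "0 \<le> L1" using LF1[of "\<lambda>p. fst (Xp p)"] by (simp add: Lip_on_def)
  have LD_ex: "\<exists>L. Lip_on (box3 e) (partial Q v) L" if "Q \<in> {P2, Q2}" for Q v
  proof -
    consider "Q = P2" | "Q = Q2" using \<open>Q \<in> {P2, Q2}\<close> by blast
    then show ?thesis
    proof cases
      case 1
      show ?thesis unfolding 1 by (rule smooth_on_Lip_on[OF smooth_on_frechet_derivative[OF sm(2)] e(2)]) (rule exI)
    next
      case 2
      show ?thesis unfolding 2 by (rule smooth_on_Lip_on[OF smooth_on_frechet_derivative[OF sm(5)] e(2)]) (rule exI)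
    qed
  qed
  define LD where "LD Q v = (SOME L. Lip_on (box3 e) (partial Q v) L)" for Q v
  have LD: "Lip_on (box3 e) (partial Q v) (LD Q v)" if "Q \<in> {P2, Q2}" for Q v
    unfolding LD_def by (rule someI_ex) (rule LD_ex[OF that])
  define L2 where "L2 = Max ((\<lambda>(Q, v). LD Q v) ` ({P2, Q2} \<times> {(1, 0, 0), (0, 1, 0), (0, 0, 1)}))"
  have LD2: "Lip_on (box3 e) (partial Q v) L2" if "Q \<in> {P2, Q2}" "v \<in> {(1, 0, 0), (0, 1, 0), (0, 0, 1)}" for Q v
    by (rule Lip_on_weaken[OF LD[OF that(1)] order_refl]) (use that in \<open>auto simp: L2_def intro!: Max_ge\<close>)
  have L2: "0 \<le> L2" using LD2[of P2 "(1, 0, 0)"] by (simp add: Lip_on_def)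
  have pd0: "partial P2 v (0, 0, 0) = 0" "partial Q2 v (0, 0, 0) = 0" for v
    using frechet_derivative_at[OF P2d, symmetric] frechet_derivative_at[OF Q2d, symmetric] by simp_all
  \<comment> \<open>The negative x-derivative of the second component of \<open>Xm\<close> on the
    fold line; its value at 0 is \<open>\<beta>\<close>, since the derivative of \<open>Q2\<close>
    vanishes there.\<close>
  define G where "G z = \<beta> - partial Q2 (1, 0, 0) (0, 0, z)" for z
  have fold_G: "fold_G Xm z = G z" if z: "(0, 0, z) \<in> U" for z
  proof -
    have line: "((\<lambda>t. Q2 ((0, 0, z) + t *\<^sub>R (1, 0, 0))) has_real_derivative partial Q2 (1, 0, 0) (0, 0, z)) (at 0)"
      using smooth_on_line_DERIV[OF sm(5), of "(0, 0, z)" 0 "(1, 0, 0)" UNIV] z by simp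
    have "((\<lambda>x. fst (snd (Xm (x, 0, z)))) has_real_derivative - \<beta> + partial Q2 (1, 0, 0) (0, 0, z)) (at 0)"
    proof (rule has_field_derivative_transform_within_open[where S = "(\<lambda>x. (x, 0, z)) -` U"])
      show "((\<lambda>t. - \<beta> * t + Q2 ((0, 0, z) + t *\<^sub>R (1, 0, 0))) has_real_derivative - \<beta> + partial Q2 (1, 0, 0) (0, 0, z)) (at 0)"
        by (intro DERIV_add line) (auto intro!: derivative_eq_intros)
      show "open ((\<lambda>x. (x, 0, z)) -` U)" by (intro open_vimage U continuous_intros)
    qed (use z XmU in auto)
    then show ?thesis unfolding fold_G_def G_def by (simp add: DERIV_imp_deriv)
  qed
  \<comment> \<open>The last three entries keep, in this order, the first component of
    \<open>Xm\<close> above 1/2, the slope of \<open>fold_B\<close> above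
    \<open>\<bar>b\<bar> / 2\<close>, and \<open>G\<close> within \<open>\<beta> / 2\<close> of
    \<open>\<beta>\<close>.\<close>
  define d where "d = Min {1, e, 1 / (6 * (L1 + 1)), \<bar>b\<bar> / (2 * (L2 + 1)), \<beta> / (2 * (L2 + 1))}"
  have d: "0 < d" using e L1 L2 b \<beta> by (simp add: d_def)
  have d_le: "d \<le> 1" "d \<le> e" "d \<le> 1 / (6 * (L1 + 1))" "d \<le> \<bar>b\<bar> / (2 * (L2 + 1))" "d \<le> \<beta> / (2 * (L2 + 1))"
    unfolding d_def by (rule Min_le; simp)+
  have d3: "3 * L1 * d \<le> 1 / 2"
  proof -
    have "6 * (L1 + 1) * d \<le> 1" using d_le(3) L1 by (simp add: field_simps)
    moreover have "6 * (L1 + 1) * d = 2 * (3 * L1 * d) + 6 * d" by (simp add: algebra_simps)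
    ultimately show ?thesis using d by linarith
  qed
  have d4: "L2 * d \<le> \<bar>b\<bar> / 2" "L2 * d \<le> \<beta> / 2"
  proof -
    have "2 * (L2 + 1) * d \<le> \<bar>b\<bar>" "2 * (L2 + 1) * d \<le> \<beta>" using d_le(4,5) L2 by (auto simp: field_simps)
    moreover have "2 * (L2 + 1) * d = 2 * (L2 * d) + 2 * d" by (simp add: algebra_simps)
    ultimately show "L2 * d \<le> \<bar>b\<bar> / 2" "L2 * d \<le> \<beta> / 2" using d by linarith+
  qed
  have sub: "box3 d \<subseteq> U" using box3_mono[OF d_le(2)] e(2) by blast
  have LFd: "Lip_on (box3 d) f L1" if "f \<in> ?F" for f
    by (rule Lip_on_weaken[OF LF1[OF that] box3_mono[OF d_le(2)] order_refl])
  have LDd: "Lip_on (box3 d) (partial Q v) L2" if "Q \<in> {P2, Q2}" "v \<in> {(1, 0, 0), (0, 1, 0), (0, 0, 1)}" for Q v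
    by (rule Lip_on_weaken[OF LD2[OF that] box3_mono[OF d_le(2)] order_refl])
  obtain Mp where Mp: "Mp \<ge> 1" "mono \<phi>" "\<And>y. \<bar>\<phi> y\<bar> \<le> 1" "\<And>y. y \<le> -1 \<Longrightarrow> \<phi> y = -1"
    "\<And>x y. \<bar>\<phi> x - \<phi> y\<bar> \<le> Mp * \<bar>x - y\<bar>"
    "\<And>y. y \<ge> 0 \<Longrightarrow> \<bar>1 + \<phi> (y - 1) - phi_lead k \<phi> * y ^ k\<bar> \<le> Mp * y ^ (k + 1)"
    using regularizing_function_bounds[OF reg k] by metis
  define M0 where "M0 = Max ((\<lambda>f. \<bar>f (0, 0, 0)\<bar>) ` ?F)"
  have M0: "\<bar>f (0, 0, 0)\<bar> \<le> M0" if "f \<in> ?F" for f using that unfolding M0_def by (intro Max_ge) auto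
  have M00: "0 \<le> M0" using M0[of "\<lambda>p. fst (Xp p)"] by auto
  define M where "M = Mp + (M0 + 3 * L1) + L1 + (\<bar>\<alpha>\<bar> + L1 + L2) + L2 + (2 * \<beta>)"
  have M_ge: "Mp \<le> M" "M0 + 3 * L1 \<le> M" "L1 \<le> M" "\<bar>\<alpha>\<bar> + L1 + L2 \<le> M" "L2 \<le> M" "2 * \<beta> \<le> M" "1 \<le> M"
    using Mp(1) M00 L1 L2 \<beta> by (auto simp: M_def)
  have norm3: "norm p \<le> 3 * d" if "p \<in> box3 d" for p
    using that norm_r3_le[of "fst p" "fst (snd p)" "snd (snd p)"] by (cases p) (auto simp: mem_box3)
  have o_box: "(0, 0, 0) \<in> box3 d" using d by (simp add: mem_box3)
  have from0: "\<bar>f p - f (0, 0, 0)\<bar> \<le> 3 * L1 * d" if "f \<in> ?F" "p \<in> box3 d" for f p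
  proof -
    have "\<bar>f p - f (0, 0, 0)\<bar> \<le> L1 * norm (p - (0, 0, 0))" by (rule Lip_onD[OF LFd[OF that(1)] that(2) o_box])
    also have "\<dots> \<le> L1 * (3 * d)" using norm3[OF that(2)] L1 by (intro mult_left_mono) (auto simp: zero_prod_def[symmetric])
    finally show ?thesis by simp
  qed
  have cb: "clamp3 d p \<in> box3 d" for p using clamp3(1)[of d] d by simp
  have Q2_0: "Q2 (0, 0, z) = 0" if "\<bar>z\<bar> \<le> d" for z
    using Q2z sub d that by (auto simp: mem_box3 subset_iff)
  have zb: "(0, 0, z) \<in> box3 d" if "\<bar>z\<bar> \<le> d" for z using that d by (simp add: mem_box3)
  have G_lip: "\<bar>G z - G z'\<bar> \<le> L2 * \<bar>z - z'\<bar>" if "\<bar>z\<bar> \<le> d" "\<bar>z'\<bar> \<le> d" for z z'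
    using Lip_onD[OF LDd[of Q2 "(1, 0, 0)"] zb[OF that(1)] zb[OF that(2)]] by (simp add: G_def norm_Pair abs_minus_commute)
  have G0: "G 0 = \<beta>" by (simp add: G_def pd0)
  have G_near: "\<bar>G z - \<beta>\<bar> \<le> L2 * \<bar>z\<bar>" if "\<bar>z\<bar> \<le> d" for z using G_lip[OF that, of 0] d by (simp add: G0)
  have G_bd: "\<bar>G z - \<beta>\<bar> \<le> \<beta> / 2" if "\<bar>z\<bar> \<le> d" for z
    using G_near[OF that] mult_left_mono[OF that L2] d4 by linarith
  have fG: "fold_G Xm z = G z" if "\<bar>z\<bar> \<le> d" for z using fold_G[of z] zb[OF that] sub by auto
  have Xm2: "fst (snd (Xm (x, y, z))) = \<alpha> * y - \<beta> * x + Q2 (x, y, z)" if "\<bar>x\<bar> \<le> d" "\<bar>y\<bar> \<le> d" "\<bar>z\<bar> \<le> d" for x y z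
    using XmU[of x y z] sub that by (auto simp: mem_box3 subset_iff)
  have g2_approx: "\<bar>fst (snd (Xm (x, y, z))) + G z * x\<bar> \<le> M * (x\<^sup>2 + \<bar>y\<bar>)" if b3: "\<bar>x\<bar> \<le> d" "\<bar>y\<bar> \<le> d" "\<bar>z\<bar> \<le> d" for x y z
  proof -
    have "\<bar>Q2 (x, 0, z) - partial Q2 (1, 0, 0) (0, 0, z) * x\<bar> \<le> L2 * x\<^sup>2"
      by (rule quadratic_remainder_x[OF sm(5) sub d]) (use LDd b3 Q2_0 in auto)
    moreover have "\<bar>fst (snd (Xm (x, y, z))) - fst (snd (Xm (x, 0, z)))\<bar> \<le> L1 * norm ((x, y, z) - (x, 0, z))"
      by (rule Lip_onD[OF LFd]) (use b3 d in \<open>auto simp: mem_box3\<close>)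
    moreover have "fst (snd (Xm (x, 0, z))) + G z * x = Q2 (x, 0, z) - partial Q2 (1, 0, 0) (0, 0, z) * x"
      using Xm2[of x 0 z] b3 d by (simp add: G_def algebra_simps)
    ultimately have "\<bar>fst (snd (Xm (x, y, z))) + G z * x\<bar> \<le> L2 * x\<^sup>2 + L1 * \<bar>y\<bar>" by (simp add: norm_Pair)
    also have "\<dots> \<le> M * x\<^sup>2 + M * \<bar>y\<bar>" using M_ge by (intro add_mono mult_right_mono) auto
    finally show ?thesis by (simp add: distrib_left)
  qed
  have mixed: "\<bar>fst (snd (Xm (x, y, z))) - fst (snd (Xm (x, y, z')))\<bar> \<le> M * (\<bar>x\<bar> + \<bar>y\<bar>) * \<bar>z - z'\<bar>"
    if b3: "\<bar>x\<bar> \<le> d" "\<bar>y\<bar> \<le> d" "\<bar>z\<bar> \<le> d" "\<bar>z'\<bar> \<le> d" for x y z z'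
  proof -
    have "\<bar>Q2 (x, y, z) - Q2 (x, y, z')\<bar> \<le> L2 * (\<bar>x\<bar> + \<bar>y\<bar>) * \<bar>z - z'\<bar>"
      by (rule mixed_difference[OF sm(5) sub d]) (use LDd b3 Q2_0 in auto)
    also have "\<dots> \<le> M * (\<bar>x\<bar> + \<bar>y\<bar>) * \<bar>z - z'\<bar>" using M_ge by (intro mult_right_mono) auto
    finally show ?thesis using Xm2 b3 by simp
  qed
  have Bz: "\<bar>fold_B Xp z - \<bar>b\<bar> * z\<bar> \<le> L2 * z\<^sup>2" if z: "\<bar>z\<bar> \<le> d" for z
  proof -
    have "\<bar>P2 (0, 0, z) - P2 (0, 0, 0)\<bar> \<le> L2 * z\<^sup>2"
      by (rule quadratic_remainder_z[OF sm(2) sub d]) (use LDd z pd0 in auto)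
    moreover have "P2 (0, 0, 0) = 0" using P2z U by blast
    moreover have "fold_B Xp z = \<bar>b\<bar> * z + P2 (0, 0, z)"
      using XpU[of 0 0 z] zb[OF z] sub by (auto simp: fold_B_def)
    ultimately show ?thesis by simp
  qed
  have cl_id: "clamp3 d (x, y, z) = (x, y, z)" if "\<bar>x\<bar> \<le> d" "\<bar>y\<bar> \<le> d" "\<bar>z\<bar> \<le> d" for x y z
    using clamp3(3)[of d "(x, y, z)"] that d by (simp add: mem_box3)
  show ?thesis
  proof (rule that[of d M])
    show "fold_system k \<phi> (phi_lead k \<phi>) d M (\<beta> / 2) (\<bar>b\<bar> / 2)
      (\<lambda>p. fst (Xp (clamp3 d p))) (\<lambda>p. fst (snd (Xp (clamp3 d p)))) (\<lambda>p. snd (snd (Xp (clamp3 d p))))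
      (\<lambda>p. fst (Xm (clamp3 d p))) (\<lambda>p. fst (snd (Xm (clamp3 d p)))) (\<lambda>p. snd (snd (Xm (clamp3 d p)))) (fold_G Xm)"
    proof
      show "0 < phi_lead k \<phi>" using reg by (simp add: regularizing_function_def)
      show "\<bar>\<phi> x - \<phi> y\<bar> \<le> M * \<bar>x - y\<bar>" for x y
        by (rule order_trans[OF Mp(5)]) (use M_ge in \<open>auto intro!: mult_right_mono\<close>)
      show "\<bar>1 + \<phi> (y - 1) - phi_lead k \<phi> * y ^ k\<bar> \<le> M * y ^ (k + 1)" if "0 \<le> y" for y
        by (rule order_trans[OF Mp(6)[OF that]]) (use M_ge that in \<open>auto intro!: mult_right_mono\<close>)
    next
      fix f p q assume f: "f \<in> {\<lambda>p. fst (Xp (clamp3 d p)), \<lambda>p. fst (snd (Xp (clamp3 d p))), \<lambda>p. snd (snd (Xp (clamp3 d p))),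
        \<lambda>p. fst (Xm (clamp3 d p)), \<lambda>p. fst (snd (Xm (clamp3 d p))), \<lambda>p. snd (snd (Xm (clamp3 d p)))}"
      then obtain h where h: "h \<in> ?F" "f = (\<lambda>p. h (clamp3 d p))" by auto
      have "\<bar>h (clamp3 d p)\<bar> \<le> M0 + 3 * L1 * d" using from0[OF h(1) cb[of p]] M0[OF h(1)] by linarith
      also have "\<dots> \<le> M0 + 3 * L1 * 1" using L1 d_le by (intro add_left_mono mult_left_mono) auto
      finally show "\<bar>f p\<bar> \<le> M" using M_ge h by simp
      have "\<bar>f p - f q\<bar> \<le> L1 * norm (clamp3 d p - clamp3 d q)" unfolding h by (rule Lip_onD[OF LFd[OF h(1)] cb cb])
      also have "\<dots> \<le> M * norm (p - q)" using clamp3(2)[of d p q] d M_ge L1 by (intro mult_mono) auto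
      finally show "\<bar>f p - f q\<bar> \<le> M * norm (p - q)" .
    next
      fix p
      have "fst (Xm (0, 0, 0)) = 1" using XmU[of 0 0 0] U zero by simp
      then show "1 / 2 \<le> fst (Xm (clamp3 d p))" using from0[OF _ cb[of p], of "\<lambda>p. fst (Xm p)"] d3 by auto
    next
      fix z assume z: "- d \<le> z" "z \<le> 0"
      have "L2 * z\<^sup>2 = - z * (L2 * (- z))" by (simp add: power2_eq_square)
      also have "\<dots> \<le> - z * (\<bar>b\<bar> / 2)" using z L2 d4 mult_left_mono[of "- z" d L2] by (intro mult_left_mono) auto
      finally have "L2 * z\<^sup>2 \<le> - z * (\<bar>b\<bar> / 2)" .
      moreover have "fold_B Xp z - \<bar>b\<bar> * z \<le> L2 * z\<^sup>2"
        by (rule order_trans[OF abs_ge_self Bz]) (use z in auto)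
      moreover have "- z * (\<bar>b\<bar> / 2) + \<bar>b\<bar> * z = \<bar>b\<bar> / 2 * z" by (simp add: field_simps)
      ultimately have "fold_B Xp z \<le> \<bar>b\<bar> / 2 * z" by linarith
      then show "fst (snd (Xp (clamp3 d (0, 0, z)))) \<le> \<bar>b\<bar> / 2 * z" using cl_id[of 0 0 z] z d by (simp add: fold_B_def)
    next
      fix x y z :: real assume b3: "\<bar>x\<bar> \<le> d" "\<bar>y\<bar> \<le> d" "\<bar>z\<bar> \<le> d"
      show "\<bar>fst (snd (Xm (clamp3 d (x, y, z)))) + fold_G Xm z * x\<bar> \<le> M * (x\<^sup>2 + \<bar>y\<bar>)"
        unfolding cl_id[OF b3] fG[OF b3(3)] by (rule g2_approx[OF b3])
      fix z' :: real assume z': "\<bar>z'\<bar> \<le> d"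
      show "\<bar>fst (snd (Xm (clamp3 d (x, y, z)))) - fst (snd (Xm (clamp3 d (x, y, z'))))\<bar> \<le> M * (\<bar>x\<bar> + \<bar>y\<bar>) * \<bar>z - z'\<bar>"
        unfolding cl_id[OF b3] cl_id[OF b3(1,2) z'] by (rule mixed[OF b3 z'])
    next
      fix z z' :: real assume z: "\<bar>z\<bar> \<le> d"
      show "\<beta> / 2 \<le> fold_G Xm z" "fold_G Xm z \<le> M"
        using G_bd[OF z] M_ge \<beta> unfolding fG[OF z] by linarith+
      assume z': "\<bar>z'\<bar> \<le> d"
      show "\<bar>fold_G Xm z - fold_G Xm z'\<bar> \<le> M * \<bar>z - z'\<bar>"
        unfolding fG[OF z] fG[OF z'] by (rule order_trans[OF G_lip[OF z z']]) (use M_ge in \<open>auto intro!: mult_right_mono\<close>)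
    qed (use k d d_le M_ge \<beta> b Mp in simp_all)
    show "\<bar>fold_A Xm z - 1\<bar> \<le> M * \<bar>z\<bar>" if "\<bar>z\<bar> \<le> d" for z
    proof -
      have "fst (Xm (0, 0, 0)) = 1" using XmU[of 0 0 0] U zero by simp
      then have "\<bar>fold_A Xm z - 1\<bar> \<le> L1 * \<bar>z\<bar>"
        using Lip_onD[OF LFd[of "\<lambda>p. fst (Xm p)"] zb[OF that] o_box] by (simp add: fold_A_def norm_Pair)
      also have "\<dots> \<le> M * \<bar>z\<bar>" using M_ge by (intro mult_right_mono) auto
      finally show ?thesis .
    qed
    show "\<bar>fold_B Xp z - \<bar>b\<bar> * z\<bar> \<le> M * z\<^sup>2" if "\<bar>z\<bar> \<le> d" for z
      by (rule order_trans[OF Bz[OF that]]) (use M_ge in \<open>auto intro!: mult_right_mono\<close>)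
    show "\<bar>fold_G Xm z - \<beta>\<bar> \<le> M * \<bar>z\<bar>" if "\<bar>z\<bar> \<le> d" for z
      unfolding fG[OF that] by (rule order_trans[OF G_near[OF that]]) (use M_ge in \<open>auto intro!: mult_right_mono\<close>)
  qed
qed

section \<open>The expansion of the crossing value\<close>

text \<open>Solution of the scaling equations for \<open>Q = q / (2 * A)\<close> and
  \<open>S = g / A\<close>: eliminating the stretching \<open>m = S * l\<^sup>2\<close> of y gives
  the power 2k-1 of l as \<open>(2 * A) ^ k / (q * (2 * g) ^ (k - 1))\<close>.\<close>

definition scale_x :: "nat \<Rightarrow> real \<Rightarrow> real \<Rightarrow> real \<Rightarrow> real" where
  "scale_x k A q g = (2 * A) powr (real k / (2 * real k - 1)) * q powr (- 1 / (2 * real k - 1)) *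
     (2 * g) powr (- (real k - 1) / (2 * real k - 1))"

definition scale_y :: "nat \<Rightarrow> real \<Rightarrow> real \<Rightarrow> real \<Rightarrow> real" where
  "scale_y k A q g = g / A * (scale_x k A q g)\<^sup>2"

lemma scale_positive:
  assumes "0 < A" "0 < q" "0 < g"
  shows "0 < scale_x k A q g" "0 < scale_y k A q g"
  using assms by (auto simp: scale_x_def scale_y_def)

text \<open>After taking logarithms the equation with fractional powers is a linear identity in the
  logarithms of \<open>2 * A\<close>, \<open>q\<close> and \<open>2 * g\<close>.\<close>

lemma scale_equations:
  assumes k: "2 \<le> k" and pos: "0 < A" "0 < q" "0 < g"
  shows "q / (2 * A) * scale_x k A q g * scale_y k A q g ^ k = scale_y k A q g"
    and "2 * g / (2 * A) * (scale_x k A q g)\<^sup>2 = scale_y k A q g"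
proof -
  define l where "l = scale_x k A q g"
  define n where "n = 2 * real k - 1"
  have l: "0 < l" using scale_positive(1)[OF pos] by (simp add: l_def)
  have n: "n > 0" using k by (simp add: n_def)
  show 2: "2 * g / (2 * A) * (scale_x k A q g)\<^sup>2 = scale_y k A q g" by (simp add: scale_y_def)
  have ln_l: "n * ln l = real k * ln (2 * A) - ln q - (real k - 1) * ln (2 * g)"
  proof -
    have "ln l = real k / n * ln (2 * A) + (- 1 / n) * ln q + (- (real k - 1) / n) * ln (2 * g)"
      using pos by (simp add: l_def scale_x_def n_def ln_mult ln_powr)
    then have "n * ln l = n * (real k / n * ln (2 * A) + (- 1 / n) * ln q + (- (real k - 1) / n) * ln (2 * g))" by simp
    also have "\<dots> = real k * ln (2 * A) - ln q - (real k - 1) * ln (2 * g)"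
      using n by (simp add: field_simps)
    finally show ?thesis .
  qed
  define m where "m = scale_y k A q g"
  have m: "0 < m" using scale_positive(2)[OF pos] by (simp add: m_def)
  have "m = (2 * g) / (2 * A) * l\<^sup>2" by (simp add: m_def scale_y_def l_def)
  then have ln_m: "ln m = ln (2 * g) - ln (2 * A) + 2 * ln l"
    using pos l by (simp add: ln_mult ln_div ln_realpow)
  have "ln (q / (2 * A) * l * m ^ k) = ln q - ln (2 * A) + ln l + real k * ln m"
    using pos l m by (simp add: ln_mult ln_div ln_realpow)
  also have "\<dots> = ln m + (ln q - ln (2 * A) + ln l + (real k - 1) * ln m)" by (simp add: algebra_simps)
  also have "ln q - ln (2 * A) + ln l + (real k - 1) * ln m =
      n * ln l - (real k * ln (2 * A) - ln q - (real k - 1) * ln (2 * g))"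
    unfolding ln_m n_def by (simp add: algebra_simps)
  finally have "ln (q / (2 * A) * l * m ^ k) = ln m" using ln_l by simp
  then show "q / (2 * A) * scale_x k A q g * scale_y k A q g ^ k = scale_y k A q g"
    using pos l m ln_inj_iff[of "q / (2 * A) * l * m ^ k" m] by (simp add: l_def m_def)
qed

lemma crossing_value_scale:
  assumes k: "2 \<le> k" and pos: "0 < A" "0 < q" "0 < g"
    and Y: "tail_solution k 1 1 Y \<xi>" "Y \<xi> = 0"
  shows "tail_solution k (q / (2 * A)) (2 * g / (2 * A)) (\<lambda>x. scale_y k A q g * Y (x / scale_x k A q g)) (scale_x k A q g * \<xi>)"
    "crossing_value k (2 * A) q (2 * g) = scale_x k A q g * \<xi>"
proof -
  note sp = scale_positive[OF pos, of k]
  show t: "tail_solution k (q / (2 * A)) (2 * g / (2 * A)) (\<lambda>x. scale_y k A q g * Y (x / scale_x k A q g)) (scale_x k A q g * \<xi>)"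
    using k by (intro tail_solution_scale[OF Y(1) sp] scale_equations pos) auto
  show "crossing_value k (2 * A) q (2 * g) = scale_x k A q g * \<xi>"
    by (rule crossing_value_eqI[OF t]) (use pos k sp Y in auto)
qed

lemma eta_tilde_eq: "2 \<le> k \<Longrightarrow> tail_solution k 1 1 Y \<xi> \<Longrightarrow> Y \<xi> = 0 \<Longrightarrow> eta_tilde k = \<xi>"
  unfolding eta_tilde_def by (rule crossing_value_eqI[where y = Y]) simp_all

lemma powr_lipschitz:
  fixes e lo hi :: real
  assumes "0 < lo" "lo \<le> hi"
  shows "\<exists>L\<ge>0. \<forall>x\<in>{lo..hi}. \<forall>y\<in>{lo..hi}. \<bar>x powr e - y powr e\<bar> \<le> L * \<bar>x - y\<bar>"
proof -
  have cont: "continuous_on {lo..hi} (\<lambda>x. \<bar>e * x powr (e - 1)\<bar>)"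
    using assms by (intro continuous_intros) auto
  obtain L where L: "\<And>x. x \<in> {lo..hi} \<Longrightarrow> \<bar>e * x powr (e - 1)\<bar> \<le> L"
    using compact_imp_bounded[OF compact_continuous_image[OF cont compact_Icc]] unfolding bounded_iff by force
  have "\<bar>x powr e - y powr e\<bar> \<le> \<bar>L\<bar> * \<bar>x - y\<bar>" if xy: "x \<in> {lo..hi}" "y \<in> {lo..hi}" for x y
  proof -
    have *: "\<bar>y powr e - x powr e\<bar> \<le> \<bar>L\<bar> * (y - x)" if "x \<le> y" "x \<in> {lo..hi}" "y \<in> {lo..hi}" for x y
    proof (rule derivative_bound_within[OF that(1)])
      fix q assume q: "q \<in> {x..y}"
      show "((\<lambda>x. x powr e) has_real_derivative e * q powr (e - 1)) (at q within {x..y})"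
        using q that assms by (intro DERIV_subset[OF has_real_derivative_powr]) auto
      show "\<bar>e * q powr (e - 1)\<bar> \<le> \<bar>L\<bar>" using L[of q] q that by auto
    qed
    show ?thesis using *[of x y] *[of y x] xy by (cases "x \<le> y") (auto simp: abs_minus_commute)
  qed
  then show ?thesis by (intro exI[of _ "\<bar>L\<bar>"]) auto
qed

lemma powr_near:
  fixes e x0 :: real
  assumes "0 < x0"
  shows "\<exists>L\<ge>0. \<forall>x. \<bar>x - x0\<bar> \<le> x0 / 2 \<longrightarrow> \<bar>x powr e - x0 powr e\<bar> \<le> L * \<bar>x - x0\<bar> \<and> \<bar>x powr e\<bar> \<le> L"
proof -
  obtain L where L: "L \<ge> 0" "\<And>x y. x \<in> {x0 / 2..2 * x0} \<Longrightarrow> y \<in> {x0 / 2..2 * x0} \<Longrightarrow> \<bar>x powr e - y powr e\<bar> \<le> L * \<bar>x - y\<bar>"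
    using powr_lipschitz[of "x0 / 2" "2 * x0" e] assms by auto
  define L' where "L' = L + L * x0 + x0 powr e"
  have L': "L' \<ge> 0" "L \<le> L'" using L(1) assms by (auto simp: L'_def)
  have "\<bar>x powr e - x0 powr e\<bar> \<le> L' * \<bar>x - x0\<bar> \<and> \<bar>x powr e\<bar> \<le> L'" if x: "\<bar>x - x0\<bar> \<le> x0 / 2" for x
  proof
    have "x0 / 2 \<le> x" "x \<le> 2 * x0" using x assms by linarith+
    then have 1: "\<bar>x powr e - x0 powr e\<bar> \<le> L * \<bar>x - x0\<bar>" using assms by (intro L(2)) auto
    also have "\<dots> \<le> L' * \<bar>x - x0\<bar>" using L' by (intro mult_right_mono) auto
    finally show "\<bar>x powr e - x0 powr e\<bar> \<le> L' * \<bar>x - x0\<bar>" .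
    have "L * \<bar>x - x0\<bar> \<le> L * x0" using x assms L(1) by (intro mult_left_mono) auto
    then show "\<bar>x powr e\<bar> \<le> L'" using 1 L(1) by (auto simp: L'_def)
  qed
  then show ?thesis using L' by blast
qed

text \<open>\<open>\<eta>\<close> is \<open>scale_x\<close> times \<open>eta_tilde k\<close>. The
  zero of \<open>fold_B\<close> at z = 0 is split off as the factor z; the remaining coefficients
  tend to 1, \<open>\<bar>b\<bar>\<close> and \<open>\<beta>\<close> with error of order z, and
  products of powers are Lipschitz near these positive limits.\<close>

lemma eta_expansion:
  assumes k: "2 \<le> k" and pl: "0 < phi_lead k \<phi>" and b: "b \<noteq> 0" and \<beta>: "0 < \<beta>" and d: "0 < d" and M: "0 \<le> M"
    and A: "\<And>z. \<bar>z\<bar> \<le> d \<Longrightarrow> \<bar>fold_A Xm z - 1\<bar> \<le> M * \<bar>z\<bar>"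
    and Bz: "\<And>z. \<bar>z\<bar> \<le> d \<Longrightarrow> \<bar>fold_B Xp z - \<bar>b\<bar> * z\<bar> \<le> M * z\<^sup>2"
    and G: "\<And>z. \<bar>z\<bar> \<le> d \<Longrightarrow> \<bar>fold_G Xm z - \<beta>\<bar> \<le> M * \<bar>z\<bar>"
  obtains \<delta> K R where "0 < \<delta>" "\<delta> \<le> d" "0 < K"
    "\<And>z. z \<in> {-\<delta>..<0} \<Longrightarrow> \<bar>R z\<bar> \<le> K * \<bar>z\<bar> \<and>
       eta k \<phi> Xp Xm z = 2 powr (1 / (2 * real k - 1)) *
         (\<bar>b\<bar> powr (- 1 / (2 * real k - 1)) * \<bar>\<beta>\<bar> powr (- (real k - 1) / (2 * real k - 1)) + R z) *
         (- phi_lead k \<phi> * z) powr (- 1 / (2 * real k - 1)) * eta_tilde k \<and>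
       \<bar>eta k \<phi> Xp Xm z\<bar> \<le> K * (- phi_lead k \<phi> * z) powr (- 1 / (2 * real k - 1))"
proof -
  define n where "n = 2 * real k - 1"
  have n: "n > 0" using k by (simp add: n_def)
  define e1 where "e1 = real k / n"
  define e2 where "e2 = - 1 / n"
  define e3 where "e3 = - (real k - 1) / n"
  define P where "P = phi_lead k \<phi>"
  have P: "0 < P" using pl by (simp add: P_def)
  obtain Y \<xi> where Y: "0 < \<xi>" "tail_solution k 1 1 Y \<xi>" "Y \<xi> = 0" using unit_tail_solution_exists[OF k] by metis
  have et: "eta_tilde k = \<xi>" by (rule eta_tilde_eq[OF k Y(2,3)])
  obtain L1 where L1: "L1 \<ge> 0" "\<And>x. \<bar>x - 1\<bar> \<le> 1 / 2 \<Longrightarrow> \<bar>x powr e1 - 1 powr e1\<bar> \<le> L1 * \<bar>x - 1\<bar> \<and> \<bar>x powr e1\<bar> \<le> L1"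
    using powr_near[of 1 e1] by auto
  obtain L2 where L2: "L2 \<ge> 0" "\<And>x. \<bar>x - \<bar>b\<bar>\<bar> \<le> \<bar>b\<bar> / 2 \<Longrightarrow> \<bar>x powr e2 - \<bar>b\<bar> powr e2\<bar> \<le> L2 * \<bar>x - \<bar>b\<bar>\<bar> \<and> \<bar>x powr e2\<bar> \<le> L2"
    using powr_near[of "\<bar>b\<bar>" e2] b by auto
  obtain L3 where L3: "L3 \<ge> 0" "\<And>x. \<bar>x - \<beta>\<bar> \<le> \<beta> / 2 \<Longrightarrow> \<bar>x powr e3 - \<beta> powr e3\<bar> \<le> L3 * \<bar>x - \<beta>\<bar> \<and> \<bar>x powr e3\<bar> \<le> L3"
    using powr_near[of \<beta> e3] \<beta> by auto
  \<comment> \<open>Keeps each of the three coefficients within half of its limit, hence positive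
    and in the range where the powers are Lipschitz.\<close>
  define \<delta> where "\<delta> = Min {d, 1 / (2 * (M + 1)), \<bar>b\<bar> / (2 * (M + 1)), \<beta> / (2 * (M + 1))}"
  have \<delta>: "0 < \<delta>" using d M b \<beta> by (simp add: \<delta>_def)
  have \<delta>_le: "\<delta> \<le> d" "\<delta> \<le> 1 / (2 * (M + 1))" "\<delta> \<le> \<bar>b\<bar> / (2 * (M + 1))" "\<delta> \<le> \<beta> / (2 * (M + 1))"
    unfolding \<delta>_def by (rule Min_le; simp)+
  \<comment> \<open>The regular factor that remains when the powers of 2 and of
    \<open>- phi_lead k \<phi> * z\<close> are removed from \<open>scale_x\<close>; \<open>R\<close>
    is its deviation from the value at the fold.\<close>
  define bx where "bx z = fold_A Xm z powr e1 * (fold_B Xp z / z) powr e2 * fold_G Xm z powr e3" for z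
  define b0 where "b0 = \<bar>b\<bar> powr e2 * \<beta> powr e3"
  define R where "R z = bx z - b0" for z
  define Kb where "Kb = (L1 * M) * (L2 * L3) + 1 * ((L2 * M) * L3 + L2 * (L3 * M))"
  define K where "K = Kb + 2 powr (1 / n) * (L1 * L2 * L3) * \<xi> + 1"
  have Kb: "Kb \<ge> 0" using L1 L2 L3 M by (auto simp: Kb_def intro!: add_nonneg_nonneg mult_nonneg_nonneg)
  have K: "K > 0" "Kb \<le> K" "2 powr (1 / n) * (L1 * L2 * L3) * \<xi> \<le> K"
    using Kb L1 L2 L3 Y by (auto simp: K_def intro!: add_nonneg_pos add_nonneg_nonneg mult_nonneg_nonneg)
  show ?thesis
  proof (rule that[of \<delta> K R])
    fix z assume z: "z \<in> {-\<delta>..<0}"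
    have zd: "\<bar>z\<bar> \<le> d" using z \<delta>_le by auto
    have "2 * ((M + 1) * \<bar>z\<bar>) \<le> 1 \<and> 2 * ((M + 1) * \<bar>z\<bar>) \<le> \<bar>b\<bar> \<and> 2 * ((M + 1) * \<bar>z\<bar>) \<le> \<beta>"
    proof -
      have "\<bar>z\<bar> \<le> 1 / (2 * (M + 1))" "\<bar>z\<bar> \<le> \<bar>b\<bar> / (2 * (M + 1))" "\<bar>z\<bar> \<le> \<beta> / (2 * (M + 1))" using z \<delta>_le by auto
      then show ?thesis using M by (auto simp: pos_le_divide_eq mult_ac)
    qed
    moreover have "M * \<bar>z\<bar> \<le> (M + 1) * \<bar>z\<bar>" by (intro mult_right_mono) auto
    ultimately have Mz: "M * \<bar>z\<bar> \<le> 1 / 2" "M * \<bar>z\<bar> \<le> \<bar>b\<bar> / 2" "M * \<bar>z\<bar> \<le> \<beta> / 2" by linarith+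
    define A' where "A' = fold_A Xm z"
    define B' where "B' = fold_B Xp z / z"
    define G' where "G' = fold_G Xm z"
    have a: "\<bar>A' - 1\<bar> \<le> M * \<bar>z\<bar>" using A[OF zd] by (simp add: A'_def)
    have g: "\<bar>G' - \<beta>\<bar> \<le> M * \<bar>z\<bar>" using G[OF zd] by (simp add: G'_def)
    have bb: "\<bar>B' - \<bar>b\<bar>\<bar> \<le> M * \<bar>z\<bar>"
    proof -
      have "B' - \<bar>b\<bar> = (fold_B Xp z - \<bar>b\<bar> * z) / z" using z by (simp add: B'_def field_simps)
      then have "\<bar>B' - \<bar>b\<bar>\<bar> = \<bar>fold_B Xp z - \<bar>b\<bar> * z\<bar> / \<bar>z\<bar>" by simp
      also have "\<dots> \<le> M * z\<^sup>2 / \<bar>z\<bar>" using Bz[OF zd] by (rule divide_right_mono) simp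
      also have "\<dots> = M * \<bar>z\<bar>" using z by (simp add: power2_eq_square field_simps)
      finally show ?thesis .
    qed
    have pos: "0 < A'" "0 < B'" "0 < G'" using a bb g Mz b \<beta> by linarith+
    have r1: "\<bar>A' powr e1 - 1\<bar> \<le> L1 * (M * \<bar>z\<bar>)" "\<bar>A' powr e1\<bar> \<le> L1"
      using L1(2)[of A'] a Mz mult_left_mono[OF a L1(1)] by auto
    have r2: "\<bar>B' powr e2 - \<bar>b\<bar> powr e2\<bar> \<le> L2 * (M * \<bar>z\<bar>)" "\<bar>B' powr e2\<bar> \<le> L2" "\<bar>\<bar>b\<bar> powr e2\<bar> \<le> L2"
      using L2(2)[of B'] L2(2)[of "\<bar>b\<bar>"] bb Mz mult_left_mono[OF bb L2(1)] by auto
    have r3: "\<bar>G' powr e3 - \<beta> powr e3\<bar> \<le> L3 * (M * \<bar>z\<bar>)" "\<bar>G' powr e3\<bar> \<le> L3"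
      using L3(2)[of G'] g Mz mult_left_mono[OF g L3(1)] by auto
    have r23: "\<bar>B' powr e2 * G' powr e3 - \<bar>b\<bar> powr e2 * \<beta> powr e3\<bar> \<le> (L2 * (M * \<bar>z\<bar>)) * L3 + L2 * (L3 * (M * \<bar>z\<bar>))"
      by (rule abs_mult_diff_le[OF r2(1) r3(1) r3(2) r2(3)])
    have r23b: "\<bar>B' powr e2 * G' powr e3\<bar> \<le> L2 * L3" unfolding abs_mult using r2 r3 L2(1) by (intro mult_mono) auto
    have "\<bar>A' powr e1 * (B' powr e2 * G' powr e3) - 1 * (\<bar>b\<bar> powr e2 * \<beta> powr e3)\<bar>
        \<le> (L1 * (M * \<bar>z\<bar>)) * (L2 * L3) + 1 * ((L2 * (M * \<bar>z\<bar>)) * L3 + L2 * (L3 * (M * \<bar>z\<bar>)))"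
      by (rule abs_mult_diff_le[OF r1(1) r23 r23b]) simp
    also have "\<dots> = Kb * \<bar>z\<bar>" by (simp add: Kb_def algebra_simps)
    finally have Rz: "\<bar>R z\<bar> \<le> Kb * \<bar>z\<bar>" by (simp add: R_def bx_def b0_def A'_def B'_def G'_def mult.assoc)
    then have Rz': "\<bar>R z\<bar> \<le> K * \<bar>z\<bar>" using mult_right_mono[OF K(2), of "\<bar>z\<bar>"] by simp
    have q: "- (P * fold_B Xp z) = (- P * z) * B'" using z by (simp add: B'_def)
    have Pz: "0 < - P * z" using P z by (simp add: mult_pos_neg)
    have q0: "0 < (- P * z) * B'" by (rule mult_pos_pos[OF Pz pos(2)])
    have "eta k \<phi> Xp Xm z = scale_x k A' ((- P * z) * B') G' * \<xi>"
      unfolding eta_def A'_def[symmetric] G'_def[symmetric] P_def[symmetric] q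
      by (rule crossing_value_scale(2)[OF k pos(1) q0 pos(3) Y(2,3)])
    also have "scale_x k A' ((- P * z) * B') G' = 2 powr (e1 + e3) * bx z * (- P * z) powr e2"
      unfolding scale_x_def n_def[symmetric] e1_def[symmetric] e2_def[symmetric] e3_def[symmetric]
    proof -
      have h1: "(2 * A') powr e1 = 2 powr e1 * A' powr e1" using pos by (simp add: powr_mult)
      have h2: "((- P * z) * B') powr e2 = (- P * z) powr e2 * B' powr e2" by (rule powr_mult)
      have h3: "(2 * G') powr e3 = 2 powr e3 * G' powr e3" using pos by (simp add: powr_mult)
      have "bx z = A' powr e1 * B' powr e2 * G' powr e3" by (simp add: bx_def A'_def B'_def G'_def)
      then show "(2 * A') powr e1 * ((- P * z) * B') powr e2 * (2 * G') powr e3 = 2 powr (e1 + e3) * bx z * (- P * z) powr e2"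
        unfolding h1 h2 h3 powr_add[of 2 e1 e3] by (simp only: mult_ac)
    qed
    \<comment> \<open>The powers of 2 from \<open>2 * A\<close> and \<open>2 * g\<close> combine to
      the single factor in the claimed formula.\<close>
    also have "e1 + e3 = 1 / n" using n by (simp add: e1_def e3_def field_simps)
    finally have eta: "eta k \<phi> Xp Xm z = 2 powr (1 / n) * bx z * (- P * z) powr e2 * \<xi>" .
    have bxb: "\<bar>bx z\<bar> \<le> L1 * L2 * L3"
      unfolding bx_def abs_mult A'_def[symmetric] B'_def[symmetric] G'_def[symmetric]
      using r1(2) r2(2) r3(2) L1(1) L2(1) L3(1) by (intro mult_mono) auto
    have "\<bar>eta k \<phi> Xp Xm z\<bar> = (2 powr (1 / n) * \<bar>bx z\<bar> * \<xi>) * (- P * z) powr e2"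
      using Y(1) by (simp add: eta abs_mult)
    also have "\<dots> \<le> K * (- P * z) powr e2"
    proof (rule mult_right_mono)
      have "2 powr (1 / n) * \<bar>bx z\<bar> * \<xi> \<le> 2 powr (1 / n) * (L1 * L2 * L3) * \<xi>"
        using bxb Y(1) by (intro mult_right_mono mult_left_mono) auto
      then show "2 powr (1 / n) * \<bar>bx z\<bar> * \<xi> \<le> K" using K(3) by linarith
    qed simp
    finally have "\<bar>eta k \<phi> Xp Xm z\<bar> \<le> K * (- P * z) powr e2" .
    then show "\<bar>R z\<bar> \<le> K * \<bar>z\<bar> \<and>
       eta k \<phi> Xp Xm z = 2 powr (1 / (2 * real k - 1)) *
         (\<bar>b\<bar> powr (- 1 / (2 * real k - 1)) * \<bar>\<beta>\<bar> powr (- (real k - 1) / (2 * real k - 1)) + R z) *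
         (- phi_lead k \<phi> * z) powr (- 1 / (2 * real k - 1)) * eta_tilde k \<and>
       \<bar>eta k \<phi> Xp Xm z\<bar> \<le> K * (- phi_lead k \<phi> * z) powr (- 1 / (2 * real k - 1))"
      using Rz' \<beta> eta et unfolding n_def[symmetric] e2_def[symmetric] e3_def[symmetric] P_def[symmetric]
      by (simp add: R_def b0_def)
  qed (use \<delta> \<delta>_le K in auto)
qed

section \<open>The slow-fast system and its centre manifold\<close>

locale fold_chart = fold_system k \<phi> "phi_lead k \<phi>" d M g0 b1
    "\<lambda>p. fst (Xp (clamp3 d p))" "\<lambda>p. fst (snd (Xp (clamp3 d p)))" "\<lambda>p. snd (snd (Xp (clamp3 d p)))"
    "\<lambda>p. fst (Xm (clamp3 d p))" "\<lambda>p. fst (snd (Xm (clamp3 d p)))" "\<lambda>p. snd (snd (Xm (clamp3 d p)))"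
    "fold_G Xm"
  for k :: nat and \<phi> :: "real \<Rightarrow> real" and d M g0 b1 :: real and Xp Xm :: "r3 \<Rightarrow> r3"
begin

abbreviation F1 :: "real \<Rightarrow> r3 \<Rightarrow> real" where
  "F1 \<epsilon> p \<equiv> fst (regularized_field \<phi> (\<lambda>p. Xp (clamp3 d p)) (\<lambda>p. Xm (clamp3 d p)) \<epsilon> p)"
abbreviation F2 :: "real \<Rightarrow> r3 \<Rightarrow> real" where
  "F2 \<epsilon> p \<equiv> fst (snd (regularized_field \<phi> (\<lambda>p. Xp (clamp3 d p)) (\<lambda>p. Xm (clamp3 d p)) \<epsilon> p))"
abbreviation F3 :: "real \<Rightarrow> r3 \<Rightarrow> real" where
  "F3 \<epsilon> p \<equiv> snd (snd (regularized_field \<phi> (\<lambda>p. Xp (clamp3 d p)) (\<lambda>p. Xm (clamp3 d p)) \<epsilon> p))"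

lemma F_eq:
  "F1 \<epsilon> (x, y, z) = (1 + \<phi> (y - 1)) * fst (Xp (clamp3 d (x, \<epsilon> * (y - 1), z))) + (1 - \<phi> (y - 1)) * fst (Xm (clamp3 d (x, \<epsilon> * (y - 1), z)))"
  "F2 \<epsilon> (x, y, z) = (1 + \<phi> (y - 1)) * fst (snd (Xp (clamp3 d (x, \<epsilon> * (y - 1), z)))) + (1 - \<phi> (y - 1)) * fst (snd (Xm (clamp3 d (x, \<epsilon> * (y - 1), z))))"
  "F3 \<epsilon> (x, y, z) = (1 + \<phi> (y - 1)) * snd (snd (Xp (clamp3 d (x, \<epsilon> * (y - 1), z)))) + (1 - \<phi> (y - 1)) * snd (snd (Xm (clamp3 d (x, \<epsilon> * (y - 1), z))))"
  by (simp_all add: regularized_field_def)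

text \<open>Points at which clamping has no effect, so that the global field and the given one
  coincide.\<close>

definition region :: "real \<Rightarrow> r3 set" where
  "region \<epsilon> = {(x, y, z). \<bar>x\<bar> \<le> d \<and> \<bar>\<epsilon> * (y - 1)\<bar> \<le> d \<and> \<bar>z\<bar> \<le> d}"

lemma clamp3_id: "\<bar>x\<bar> \<le> d \<Longrightarrow> \<bar>y\<bar> \<le> d \<Longrightarrow> \<bar>z\<bar> \<le> d \<Longrightarrow> clamp3 d (x, y, z) = (x, y, z)"
  using clamp3(3)[of d "(x, y, z)"] d by (simp add: mem_box3)

lemma regularized_field_region:
  assumes "p \<in> region \<epsilon>"
  shows "regularized_field \<phi> Xp Xm \<epsilon> p = (F1 \<epsilon> p, F2 \<epsilon> p, F3 \<epsilon> p)"
    "slow_fast_field \<phi> Xp Xm \<epsilon> p = (\<epsilon> * F1 \<epsilon> p, F2 \<epsilon> p, \<epsilon> * F3 \<epsilon> p)"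
proof -
  show *: "regularized_field \<phi> Xp Xm \<epsilon> p = (F1 \<epsilon> p, F2 \<epsilon> p, F3 \<epsilon> p)"
    using assms by (auto simp: region_def regularized_field_def clamp3_id)
  show "slow_fast_field \<phi> Xp Xm \<epsilon> p = (\<epsilon> * F1 \<epsilon> p, F2 \<epsilon> p, \<epsilon> * F3 \<epsilon> p)"
    by (simp add: slow_fast_field_def * case_prod_beta)
qed

lemma F_lipschitz_y:
  assumes "0 \<le> \<epsilon>"
  shows "\<bar>F1 \<epsilon> (x, y, z) - F1 \<epsilon> (x, y', z)\<bar> \<le> (2 * M * M + 4 * M * \<epsilon>) * \<bar>y - y'\<bar>"
    "\<bar>F2 \<epsilon> (x, y, z) - F2 \<epsilon> (x, y', z)\<bar> \<le> (2 * M * M + 4 * M * \<epsilon>) * \<bar>y - y'\<bar>"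
    "\<bar>F3 \<epsilon> (x, y, z) - F3 \<epsilon> (x, y', z)\<bar> \<le> (2 * M * M + 4 * M * \<epsilon>) * \<bar>y - y'\<bar>"
proof -
  let ?F = "{\<lambda>p. fst (Xp (clamp3 d p)), \<lambda>p. fst (snd (Xp (clamp3 d p))), \<lambda>p. snd (snd (Xp (clamp3 d p))),
        \<lambda>p. fst (Xm (clamp3 d p)), \<lambda>p. fst (snd (Xm (clamp3 d p))), \<lambda>p. snd (snd (Xm (clamp3 d p)))}"
  have *: "\<bar>((1 + \<phi> (y - 1)) * f (x, \<epsilon> * (y - 1), z) + (1 - \<phi> (y - 1)) * g (x, \<epsilon> * (y - 1), z)) -
     ((1 + \<phi> (y' - 1)) * f (x, \<epsilon> * (y' - 1), z) + (1 - \<phi> (y' - 1)) * g (x, \<epsilon> * (y' - 1), z))\<bar> \<le> (2 * M * M + 4 * M * \<epsilon>) * \<bar>y - y'\<bar>"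
    if f: "f \<in> ?F" and g: "g \<in> ?F" for f g
  proof -
    have ph: "\<bar>\<phi> (y - 1) - \<phi> (y' - 1)\<bar> \<le> M * \<bar>y - y'\<bar>" using phi_lip[of "y - 1" "y' - 1"] by simp
    have e: "\<bar>\<epsilon> * (y - 1) - \<epsilon> * (y' - 1)\<bar> = \<epsilon> * \<bar>y - y'\<bar>"
      using assms by (simp add: right_diff_distrib[symmetric] abs_mult)
    have dif: "\<bar>h (x, \<epsilon> * (y - 1), z) - h (x, \<epsilon> * (y' - 1), z)\<bar> \<le> M * (\<epsilon> * \<bar>y - y'\<bar>)" if "h \<in> ?F" for h
    proof -
      have "\<bar>h (x, \<epsilon> * (y - 1), z) - h (x, \<epsilon> * (y' - 1), z)\<bar> \<le> M * norm ((x, \<epsilon> * (y - 1), z) - (x, \<epsilon> * (y' - 1), z))"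
        using that by (rule lip)
      also have "norm ((x, \<epsilon> * (y - 1), z) - (x, \<epsilon> * (y' - 1), z)) = \<epsilon> * \<bar>y - y'\<bar>"
        unfolding e[symmetric] by (simp add: norm_Pair)
      finally show ?thesis .
    qed
    have A: "\<bar>(1 + \<phi> (y - 1)) * f (x, \<epsilon> * (y - 1), z) - (1 + \<phi> (y' - 1)) * f (x, \<epsilon> * (y' - 1), z)\<bar> \<le> (M * \<bar>y - y'\<bar>) * M + 2 * (M * (\<epsilon> * \<bar>y - y'\<bar>))"
      by (rule abs_mult_diff_le[OF _ dif[OF f] bound[OF f]]) (use ph phi_abs[of "y' - 1"] in auto)
    have B: "\<bar>(1 - \<phi> (y - 1)) * g (x, \<epsilon> * (y - 1), z) - (1 - \<phi> (y' - 1)) * g (x, \<epsilon> * (y' - 1), z)\<bar> \<le> (M * \<bar>y - y'\<bar>) * M + 2 * (M * (\<epsilon> * \<bar>y - y'\<bar>))"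
      by (rule abs_mult_diff_le[OF _ dif[OF g] bound[OF g]]) (use ph phi_abs[of "y' - 1"] in auto)
    have sum: "\<bar>(p + q) - (p' + q')\<bar> \<le> e + e" if "\<bar>p - p'\<bar> \<le> e" "\<bar>q - q'\<bar> \<le> e" for p q p' q' e :: real
      using that by linarith
    have eq: "((M * \<bar>y - y'\<bar>) * M + 2 * (M * (\<epsilon> * \<bar>y - y'\<bar>))) + ((M * \<bar>y - y'\<bar>) * M + 2 * (M * (\<epsilon> * \<bar>y - y'\<bar>))) =
      (2 * M * M + 4 * M * \<epsilon>) * \<bar>y - y'\<bar>" by (simp add: algebra_simps)
    show ?thesis using sum[OF A B] unfolding eq .
  qed
  show "\<bar>F1 \<epsilon> (x, y, z) - F1 \<epsilon> (x, y', z)\<bar> \<le> (2 * M * M + 4 * M * \<epsilon>) * \<bar>y - y'\<bar>"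
    unfolding F_eq by (rule *) simp_all
  show "\<bar>F2 \<epsilon> (x, y, z) - F2 \<epsilon> (x, y', z)\<bar> \<le> (2 * M * M + 4 * M * \<epsilon>) * \<bar>y - y'\<bar>"
    unfolding F_eq by (rule *) simp_all
  show "\<bar>F3 \<epsilon> (x, y, z) - F3 \<epsilon> (x, y', z)\<bar> \<le> (2 * M * M + 4 * M * \<epsilon>) * \<bar>y - y'\<bar>"
    unfolding F_eq by (rule *) simp_all
qed

section \<open>The second chart at fixed parameter\<close>

definition chart2 :: "real \<Rightarrow> r3 \<Rightarrow> r3" where
  "chart2 r = (\<lambda>(x, y, z). (r ^ (2 * k) * x, r\<^sup>2 * y, z))"

definition chart2_inv :: "real \<Rightarrow> r3 \<Rightarrow> r3" where
  "chart2_inv r = (\<lambda>(x, y, z). (x / r ^ (2 * k), y / r\<^sup>2, z))"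

lemma chart2_inverse: "r \<noteq> 0 \<Longrightarrow> chart2 r (chart2_inv r p) = p" "r \<noteq> 0 \<Longrightarrow> chart2_inv r (chart2 r p) = p"
  by (auto simp: chart2_def chart2_inv_def split: prod.splits)

lemma bounded_linear_chart2: "bounded_linear (chart2 r)" "bounded_linear (chart2_inv r)"
  unfolding linear_conv_bounded_linear[symmetric]
  by (auto intro!: linearI simp: chart2_def chart2_inv_def algebra_simps add_divide_distrib)

abbreviation SF :: "real \<Rightarrow> r3 \<Rightarrow> r3" where
  "SF \<epsilon> p \<equiv> (\<epsilon> * F1 \<epsilon> p, F2 \<epsilon> p, \<epsilon> * F3 \<epsilon> p)"

text \<open>Because \<open>2 * (2 * k - 1) = 2 * (k - 1) + 2 * k\<close> and
  \<open>2 * k = 2 * (k - 1) + 2\<close>, the same power of r comes out of all three components; it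
  is a rescaling of time.\<close>

lemma SF_chart2:
  assumes "0 < r"
  shows "SF (r ^ (2 * (2 * k - 1))) (chart2 r u) = r ^ (2 * (k - 1)) *\<^sub>R chart2 r (V r u)"
proof -
  obtain x y z where u: "u = (x, y, z)" by (cases u)
  have e1: "2 * (2 * k - 1) = 2 * (k - 1) + 2 * k" using k by simp
  have e2: "2 * k = 2 * (k - 1) + 2" using k by simp
  have p1: "r ^ (2 * (2 * k - 1)) = r ^ (2 * (k - 1)) * r ^ (2 * k)" unfolding e1 power_add ..
  have p2: "r ^ (2 * k) = r ^ (2 * (k - 1)) * r\<^sup>2"
    by (subst e2) (simp only: power_add)
  have rk: "r ^ (2 * k) \<noteq> 0" using assms by simp
  have F: "F1 (r ^ (2 * (2 * k - 1))) (chart2 r u) = fst (V r u)"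
    "F2 (r ^ (2 * (2 * k - 1))) (chart2 r u) = r ^ (2 * k) * fst (snd (V r u))"
    "r ^ (2 * k) * F3 (r ^ (2 * (2 * k - 1))) (chart2 r u) = snd (snd (V r u))"
    using assms by (simp_all add: u chart2_def F_eq V_def arg_def)
  obtain v1 v2 v3 where v: "V r u = (v1, v2, v3)" by (cases "V r u")
  have c: "chart2 r (V r u) = (r ^ (2 * k) * v1, r\<^sup>2 * v2, v3)" by (simp add: chart2_def v)
  have 1: "r ^ (2 * (2 * k - 1)) * v1 = r ^ (2 * (k - 1)) * (r ^ (2 * k) * v1)" by (simp only: p1 mult.assoc)
  have 2: "r ^ (2 * k) * v2 = r ^ (2 * (k - 1)) * (r\<^sup>2 * v2)" by (simp only: p2 mult.assoc)
  have 3: "r ^ (2 * (2 * k - 1)) * F3 (r ^ (2 * (2 * k - 1))) (chart2 r u) = r ^ (2 * (k - 1)) * v3"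
  proof -
    have "r ^ (2 * (2 * k - 1)) * X = r ^ (2 * (k - 1)) * (r ^ (2 * k) * X)" for X by (simp only: p1 mult.assoc)
    then show ?thesis using F(3) by (simp only: v snd_conv)
  qed
  show ?thesis unfolding c F(1,2) unfolding v fst_conv snd_conv 1 2 3 by simp
qed

lemma solution_from_chart2:
  assumes r: "0 < r" and u: "\<And>s. s \<in> {0..S} \<Longrightarrow> (u has_vector_derivative V r (u s)) (at s within {0..S})"
    and t: "t \<in> {0..S / r ^ (2 * (k - 1))}"
  shows "((\<lambda>t. chart2 r (u (r ^ (2 * (k - 1)) * t))) has_vector_derivative
     SF (r ^ (2 * (2 * k - 1))) (chart2 r (u (r ^ (2 * (k - 1)) * t)))) (at t within {0..S / r ^ (2 * (k - 1))})"
proof -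
  define w where "w = r ^ (2 * (k - 1))"
  have w: "w > 0" using r by (simp add: w_def)
  have im: "w * t \<in> {0..S}" if "t \<in> {0..S / w}" for t using that w by (auto simp: field_simps)
  have "((\<lambda>t. w * t) has_vector_derivative w) (at t within {0..S / w})"
    by (auto intro!: derivative_eq_intros simp: has_real_derivative_iff_has_vector_derivative[symmetric])
  moreover have "(u has_vector_derivative V r (u (w * t))) (at (w * t) within (\<lambda>t. w * t) ` {0..S / w})"
    using t w_def im by (intro has_vector_derivative_within_subset[OF u]) auto
  ultimately have "((u \<circ> (\<lambda>t. w * t)) has_vector_derivative w *\<^sub>R V r (u (w * t))) (at t within {0..S / w})"
    by (rule vector_diff_chain_within)
  from bounded_linear.has_vector_derivative[OF bounded_linear_chart2(1) this, of r]
  show ?thesis unfolding SF_chart2[OF r] w_def[symmetric]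
    by (simp add: o_def linear_cmul[OF bounded_linear.linear[OF bounded_linear_chart2(1)]])
qed

lemma solution_to_chart2:
  assumes r: "0 < r"
    and w: "\<And>t. t \<in> {t0..t1} \<Longrightarrow> (w has_vector_derivative SF (r ^ (2 * (2 * k - 1))) (w t)) (at t within {t0..t1})"
    and s: "s \<in> {0..r ^ (2 * (k - 1)) * (t1 - t0)}"
  shows "((\<lambda>s. chart2_inv r (w (t0 + s / r ^ (2 * (k - 1))))) has_vector_derivative
     V r (chart2_inv r (w (t0 + s / r ^ (2 * (k - 1)))))) (at s within {0..r ^ (2 * (k - 1)) * (t1 - t0)})"
proof -
  define c where "c = r ^ (2 * (k - 1))"
  have c: "c > 0" using r by (simp add: c_def)
  let ?I = "{0..c * (t1 - t0)}"
  have im: "t0 + s / c \<in> {t0..t1}" if "s \<in> ?I" for s using that c by (auto simp: field_simps)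
  have "((\<lambda>s. t0 + s / c) has_vector_derivative 1 / c) (at s within ?I)"
    using c by (auto intro!: derivative_eq_intros simp: has_real_derivative_iff_has_vector_derivative[symmetric])
  moreover have "(w has_vector_derivative SF (r ^ (2 * (2 * k - 1))) (w (t0 + s / c))) (at (t0 + s / c) within (\<lambda>s. t0 + s / c) ` ?I)"
    using s c_def im by (intro has_vector_derivative_within_subset[OF w]) auto
  ultimately have "((w \<circ> (\<lambda>s. t0 + s / c)) has_vector_derivative (1 / c) *\<^sub>R SF (r ^ (2 * (2 * k - 1))) (w (t0 + s / c))) (at s within ?I)"
    by (rule vector_diff_chain_within)
  note * = bounded_linear.has_vector_derivative[OF bounded_linear_chart2(2) this, of r]
  define u where "u = chart2_inv r (w (t0 + s / c))"
  have wu: "w (t0 + s / c) = chart2 r u" using r by (simp add: u_def chart2_inverse)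
  have "chart2_inv r ((1 / c) *\<^sub>R SF (r ^ (2 * (2 * k - 1))) (w (t0 + s / c))) = V r u"
    unfolding wu SF_chart2[OF r] c_def[symmetric] using c r by (simp add: chart2_inverse)
  then show ?thesis using * by (simp add: o_def c_def u_def)
qed

end

text \<open>The second smallness condition makes the second component of \<open>Xm\<close> on the
  critical manifold small against that of \<open>Xp\<close>, which is bounded away from 0 by the
  distance of the z-range to the origin. It is used to find the direction of the drift in x.\<close>

locale fold_center = fold_chart +
  fixes za zb rmax emax :: real and m :: "r3 \<Rightarrow> real"
  assumes zz: "- d < za" "za < zb" "zb < 0" and rpos: "0 < rmax" "rmax \<le> 1" and epos: "0 < emax"
    and cm: "center_manifold k \<phi> Xp Xm {za..zb} rmax emax m"
    and small: "rmax ^ (2 * k) \<le> d" "8 * M * (M + 1) * rmax ^ (2 * k) \<le> b1 * (- zb)"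
begin

abbreviation box :: "r3 set" where "box \<equiv> {0..rmax} \<times> {za..zb} \<times> {0..emax}"

definition mD :: "r3 \<Rightarrow> r3 \<Rightarrow>\<^sub>L real" where
  "mD = (SOME m'. continuous_on box m' \<and>
         (\<forall>p\<in>box. (m has_derivative blinfun_apply (m' p)) (at p within box)) \<and>
         (\<forall>(r, z, e)\<in>box.
            case chart1_field k \<phi> Xp Xm (r, m (r, z, e), z, e) of
              (dr, dy, dz, de) \<Rightarrow> dy = blinfun_apply (m' (r, z, e)) (dr, dz, de)))"

lemma mD: "continuous_on box mD"
    "p \<in> box \<Longrightarrow> (m has_derivative blinfun_apply (mD p)) (at p within box)"
    "(r, z, e) \<in> box \<Longrightarrow> (case chart1_field k \<phi> Xp Xm (r, m (r, z, e), z, e) of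
              (dr, dy, dz, de) \<Rightarrow> dy = blinfun_apply (mD (r, z, e)) (dr, dz, de))"
proof -
  have "\<exists>m'. continuous_on box m' \<and>
         (\<forall>p\<in>box. (m has_derivative blinfun_apply (m' p)) (at p within box)) \<and>
         (\<forall>(r, z, e)\<in>box.
            case chart1_field k \<phi> Xp Xm (r, m (r, z, e), z, e) of
              (dr, dy, dz, de) \<Rightarrow> dy = blinfun_apply (m' (r, z, e)) (dr, dz, de))"
    by (rule conjunct1[OF cm[unfolded center_manifold_def Let_def]])
  note * = someI_ex[OF this, folded mD_def]
  show "continuous_on box mD"
    "p \<in> box \<Longrightarrow> (m has_derivative blinfun_apply (mD p)) (at p within box)"
    "(r, z, e) \<in> box \<Longrightarrow> (case chart1_field k \<phi> Xp Xm (r, m (r, z, e), z, e) of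
              (dr, dy, dz, de) \<Rightarrow> dy = blinfun_apply (mD (r, z, e)) (dr, dz, de))"
    using conjunct1[OF *] bspec[OF conjunct1[OF conjunct2[OF *]]] bspec[OF conjunct2[OF conjunct2[OF *]], of "(r, z, e)"]
    by simp_all
qed

lemma m_axis_r: "z \<in> {za..zb} \<Longrightarrow> m (0, z, 0) = equilibrium_y1 k \<phi> Xp Xm z"
  by (rule bspec[OF conjunct1[OF conjunct2[OF cm[unfolded center_manifold_def Let_def]]]])

lemma m_axis_e: "r \<in> {0<..rmax} \<Longrightarrow> z \<in> {za..zb} \<Longrightarrow> (- (r ^ (2 * k)), r\<^sup>2 * m (r, z, 0), z) \<in> critical_manifold \<phi> Xp Xm"
  by (rule bspec[OF bspec[OF conjunct2[OF conjunct2[OF cm[unfolded center_manifold_def Let_def]]]]])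

lemma compact_box: "compact box" and convex_box: "convex box"
  by (auto intro!: compact_Times convex_Times)

lemma m_cont: "continuous_on box m"
  by (rule has_derivative_continuous_on) (rule mD(2))

lemma mD_bounded: obtains L where "0 < L" "\<And>p. p \<in> box \<Longrightarrow> norm (mD p) \<le> L"
proof -
  have "bounded (mD ` box)" by (intro compact_imp_bounded compact_continuous_image mD(1) compact_box)
  then show ?thesis using that unfolding bounded_pos by auto
qed

lemma m_lipschitz: obtains L where "0 < L" "\<And>p q. p \<in> box \<Longrightarrow> q \<in> box \<Longrightarrow> \<bar>m p - m q\<bar> \<le> L * norm (p - q)"
proof -
  obtain L where L: "0 < L" "\<And>p. p \<in> box \<Longrightarrow> norm (mD p) \<le> L" using mD_bounded by blast
  have "norm (m p - m q) \<le> L * norm (p - q)" if "p \<in> box" "q \<in> box" for p q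
    by (rule differentiable_bound[OF convex_box mD(2) _ that]) (use L(2) in \<open>auto simp: norm_blinfun.rep_eq\<close>)
  then show ?thesis using that L(1) by simp
qed

lemma m_bounded: obtains B where "0 < B" "\<And>p. p \<in> box \<Longrightarrow> \<bar>m p\<bar> \<le> B"
proof -
  have "bounded (m ` box)" by (intro compact_imp_bounded compact_continuous_image m_cont compact_box)
  then show ?thesis using that unfolding bounded_pos by auto
qed

lemma z_in: "z \<in> {za..zb} \<Longrightarrow> \<bar>z\<bar> \<le> d" "z \<in> {za..zb} \<Longrightarrow> z < 0"
  using zz by auto

lemma fold_AB: assumes "\<bar>z\<bar> \<le> d"
  shows "fold_A Xm z = fst (Xm (clamp3 d (0, 0, z)))" "fold_B Xp z = fst (snd (Xp (clamp3 d (0, 0, z))))"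
  using clamp3_id[of 0 0 z] assms d by (auto simp: fold_A_def fold_B_def)

lemma A_ge: "\<bar>z\<bar> \<le> d \<Longrightarrow> 1 / 2 \<le> fold_A Xm z"
  using g1_ge[of "(0, 0, z)"] by (simp add: fold_AB)

lemma B_neg: "z \<in> {za..zb} \<Longrightarrow> fold_B Xp z \<le> b1 * zb" "z \<in> {za..zb} \<Longrightarrow> fold_B Xp z < 0"
proof -
  assume z: "z \<in> {za..zb}"
  have "fold_B Xp z \<le> b1 * z" using f2_le[of z] z zz by (simp add: fold_AB z_in[OF z])
  also have "\<dots> \<le> b1 * zb" using z b1 by (intro mult_left_mono) auto
  finally show "fold_B Xp z \<le> b1 * zb" .
  also have "\<dots> < 0" using b1 zz by (intro mult_pos_neg) auto
  finally show "fold_B Xp z < 0" .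
qed

lemma equilibrium_pos: assumes "z \<in> {za..zb}" shows "0 < equilibrium_y1 k \<phi> Xp Xm z"
proof -
  have "0 < fold_G Xm z" using G_ge[OF z_in(1)[OF assms]] g0 by linarith
  moreover have "0 < phi_lead k \<phi> * (- fold_B Xp z)" using B_neg(2)[OF assms] a by (intro mult_pos_pos) auto
  ultimately show ?thesis unfolding equilibrium_y1_def using k by (intro real_root_gt_zero divide_pos_pos) auto
qed

lemma region_axis: "\<bar>z\<bar> \<le> d \<Longrightarrow> (0, 0, z) \<in> region 0"
  using d by (simp add: region_def)

lemma phi_m1: "\<phi> (- 1) = - 1" by (rule phi_low) simp

lemma F_axis: assumes "\<bar>z\<bar> \<le> d" shows "F1 0 (0, 0, z) = 2 * fold_A Xm z"
  using assms by (simp add: F_eq phi_m1 fold_AB)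

section \<open>The centre manifold on its two faces\<close>

text \<open>The graph over the face r = 0. There r and z are at rest, so for each z it is a function
  of e alone.\<close>

definition mu :: "real \<Rightarrow> real \<Rightarrow> real" where "mu z e = m (0, z, e)"
definition mu' :: "real \<Rightarrow> real \<Rightarrow> real" where "mu' z e = blinfun_apply (mD (0, z, e)) (0, 0, 1)"

lemma mu_DERIV:
  assumes z: "z \<in> {za..zb}" and e: "e \<in> {0..emax}"
  shows "(mu z has_real_derivative mu' z e) (at e within {0..emax})"
proof -
  have "((\<lambda>e. (0, z, e)) has_vector_derivative (0, 0, 1)) (at e within {0..emax})"
    by (auto intro!: derivative_eq_intros has_vector_derivative_Pair)
  moreover have "(m has_derivative blinfun_apply (mD (0, z, e))) (at (0, z, e) within (\<lambda>e. (0, z, e)) ` {0..emax})"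
    by (rule has_derivative_subset[OF mD(2)]) (use z e rpos in auto)
  ultimately have "((m \<circ> (\<lambda>e. (0, z, e))) has_vector_derivative blinfun_apply (mD (0, z, e)) (0, 0, 1)) (at e within {0..emax})"
    by (rule vector_derivative_diff_chain_within)
  then show ?thesis by (simp add: o_def mu_def[abs_def] mu'_def has_real_derivative_iff_has_vector_derivative)
qed

text \<open>The invariance equation on r = 0, where the field is evaluated on the fold line with
  \<open>\<phi> = -1\<close> and its first component is that of \<open>Xm\<close> alone. The
  coefficient of the derivative vanishes at e = 0 to second order, so the equation does not by
  itself fix the solution from its value there.\<close>

lemma mu_ode:
  assumes z: "z \<in> {za..zb}" and e: "e \<in> {0..emax}"
  shows "(2 * real k - 1) / real k * e\<^sup>2 * (2 * fold_A Xm z) * mu' z e =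
    phi_lead k \<phi> * fold_B Xp z * mu z e ^ k + 2 * fold_G Xm z + 2 * fold_A Xm z * mu z e * e / real k"
proof -
  have k0: "k \<noteq> 0" "2 * (2 * k - 1) \<noteq> 0" "2 * k \<noteq> 0" using k by auto
  have rf: "regularized_field \<phi> Xp Xm 0 (0, 0, z) = (2 * fold_A Xm z, F2 0 (0, 0, z), F3 0 (0, 0, z))"
    using regularized_field_region(1)[OF region_axis[OF z_in(1)[OF z]]] F_axis[OF z_in(1)[OF z]] by simp
  have "(case chart1_field k \<phi> Xp Xm (0, m (0, z, e), z, e) of
              (dr, dy, dz, de) \<Rightarrow> dy = blinfun_apply (mD (0, z, e)) (dr, dz, de))"
    by (rule mD(3)) (use z e rpos in auto)
  then have "phi_lead k \<phi> * fold_B Xp z * mu z e ^ k + 2 * fold_G Xm z + mu z e * e * (2 * fold_A Xm z) / real k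
    = blinfun_apply (mD (0, z, e)) (0, 0, (2 * real k - 1) / real k * e\<^sup>2 * (2 * fold_A Xm z))"
    using k0 by (simp add: chart1_field_def power_0_left rf mu_def)
  also have "(0, 0, (2 * real k - 1) / real k * e\<^sup>2 * (2 * fold_A Xm z)) =
    ((2 * real k - 1) / real k * e\<^sup>2 * (2 * fold_A Xm z)) *\<^sub>R (0, 0, 1 :: real)" by simp
  also have "blinfun_apply (mD (0, z, e)) \<dots> = ((2 * real k - 1) / real k * e\<^sup>2 * (2 * fold_A Xm z)) * mu' z e"
    by (simp only: blinfun.scaleR_right mu'_def real_scaleR_def)
  finally show ?thesis by (simp add: mult_ac)
qed

lemma mu_0: "z \<in> {za..zb} \<Longrightarrow> mu z 0 = equilibrium_y1 k \<phi> Xp Xm z"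
  using m_axis_r by (simp add: mu_def)

text \<open>At a zero with e > 0 the equation leaves only the positive term
  \<open>2 * fold_G Xm z\<close> on the right, so the derivative would be positive; a graph that
  starts positive at e = 0 cannot arrive at such a zero.\<close>

lemma mu_pos:
  assumes z: "z \<in> {za..zb}" and e: "e \<in> {0..emax}"
  shows "0 < mu z e"
proof (cases "e = 0")
  case True
  then show ?thesis using mu_0[OF z] equilibrium_pos[OF z] by simp
next
  case False
  have "- mu z e < 0"
  proof (rule derivative_neg_at_zeros_imp_neg[where f = "\<lambda>e. - mu z e" and a = 0 and b = emax and t = e])
    fix t assume t: "t \<in> {0..emax}"
    show "((\<lambda>e. - mu z e) has_real_derivative - mu' z t) (at t within {0..emax})"
      by (rule DERIV_minus[OF mu_DERIV[OF z t]])
    assume mt: "- mu z t = 0"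
    then have t0: "0 < t" using mu_0[OF z] equilibrium_pos[OF z] t by (cases "t = 0") auto
    have "(2 * real k - 1) / real k * t\<^sup>2 * (2 * fold_A Xm z) * mu' z t = 2 * fold_G Xm z"
      using mu_ode[OF z t] mt k by (simp add: power_0_left)
    moreover have "0 < 2 * fold_G Xm z" using G_ge[OF z_in(1)[OF z]] g0 by simp
    moreover have "0 < (2 * real k - 1) / real k * t\<^sup>2 * (2 * fold_A Xm z)"
      using k t0 A_ge[OF z_in(1)[OF z]] by (intro mult_pos_pos divide_pos_pos) auto
    ultimately have "0 < mu' z t" by (metis zero_less_mult_pos)
    then show "- mu' z t < 0" by simp
  qed (use False e mu_0[OF z] equilibrium_pos[OF z] in auto)
  then show ?thesis by simp
qed

text \<open>On the critical manifold the second components balance. That of \<open>Xm\<close> is of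
  order x while that of \<open>Xp\<close> is bounded away from 0, so the weight p = 1 + \<phi> of
  \<open>Xp\<close> satisfies p(M+1) \<le> 1/2. Then the first component of \<open>Xm\<close>, which
  is at least 1/2, dominates the drift.\<close>

lemma axis_e_pos:
  assumes r: "r \<in> {0<..rmax}" and z: "z \<in> {za..zb}"
  shows "0 < m (r, z, 0)" "0 < F1 0 (- (r ^ (2 * k)), r\<^sup>2 * m (r, z, 0), z)"
proof -
  define x where "x = - (r ^ (2 * k))"
  define y where "y = r\<^sup>2 * m (r, z, 0)"
  have c: "x < 0" "z < 0" "0 < y" "y < 2" "slow_fast_field \<phi> Xp Xm 0 (x, y, z) = 0"
    using m_axis_e[OF r z] by (auto simp: critical_manifold_def x_def y_def)
  show "0 < m (r, z, 0)" using c(3) r by (simp add: y_def zero_less_mult_iff)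
  have xr: "\<bar>x\<bar> \<le> rmax ^ (2 * k)" using r by (auto simp: x_def intro!: power_mono)
  then have xd: "\<bar>x\<bar> \<le> d" using small by linarith
  have reg: "(x, y, z) \<in> region 0" using xd z_in(1)[OF z] d by (simp add: region_def)
  define p where "p = 1 + \<phi> (y - 1)"
  have p: "0 \<le> p" "p \<le> 2" using one_plus_phi_le by (auto simp: p_def)
  have q: "1 - \<phi> (y - 1) = 2 - p" by (simp add: p_def)
  define f2 where "f2 = fst (snd (Xp (clamp3 d (x, 0, z))))"
  define g2 where "g2 = fst (snd (Xm (clamp3 d (x, 0, z))))"
  define f1 where "f1 = fst (Xp (clamp3 d (x, 0, z)))"
  define g1 where "g1 = fst (Xm (clamp3 d (x, 0, z)))"
  have "F2 0 (x, y, z) = 0" using c(5) regularized_field_region(2)[OF reg] by (simp add: zero_prod_def)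
  then have bal: "p * f2 + (2 - p) * g2 = 0" by (simp add: F_eq p_def f2_def g2_def)
  have nx: "norm ((x, 0, z) - (0, 0, z) :: r3) = \<bar>x\<bar>" by (simp add: norm_Pair)
  have "\<bar>f2 - fold_B Xp z\<bar> \<le> M * \<bar>x\<bar>"
    unfolding f2_def fold_AB(2)[OF z_in(1)[OF z]] nx[symmetric] by (rule lip) simp
  then have f2: "f2 \<le> b1 * zb + M * \<bar>x\<bar>" using B_neg(1)[OF z] by linarith
  have "fst (snd (Xm (clamp3 d (0, 0, z)))) = 0" using g2_approx[of 0 0 z] z_in(1)[OF z] d by simp
  moreover have "\<bar>g2 - fst (snd (Xm (clamp3 d (0, 0, z))))\<bar> \<le> M * \<bar>x\<bar>"
    unfolding g2_def nx[symmetric] by (rule lip) simp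
  ultimately have g2: "\<bar>g2\<bar> \<le> M * \<bar>x\<bar>" by simp
  define s where "s = M * \<bar>x\<bar>"
  have s0: "0 \<le> s" using M by (simp add: s_def)
  have s: "8 * (M + 1) * s \<le> b1 * (- zb)"
  proof -
    have "8 * M * (M + 1) * \<bar>x\<bar> \<le> 8 * M * (M + 1) * rmax ^ (2 * k)" using xr M by (intro mult_left_mono) auto
    then show ?thesis using small(2) by (simp add: s_def mult_ac)
  qed
  have s1: "2 * s \<le> b1 * (- zb)"
  proof -
    have "8 * 1 * s \<le> 8 * (M + 1) * s" using M s0 by (intro mult_right_mono) auto
    then show ?thesis using s s0 by linarith
  qed
  have f2': "b1 * (- zb) / 2 \<le> - f2" using f2 s1 by (simp add: s_def field_simps)
  have "p * (b1 * (- zb) / 2) \<le> p * (- f2)" using p f2' by (intro mult_left_mono)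
  also have "\<dots> = (2 - p) * g2" using bal by simp
  also have "(2 - p) * g2 \<le> (2 - p) * s" using p g2 unfolding s_def by (intro mult_left_mono) auto
  also have "(2 - p) * s \<le> 2 * s" using p s0 by (intro mult_right_mono) auto
  finally have "p * (b1 * (- zb)) \<le> 4 * s" by simp
  moreover have "p * (8 * (M + 1) * s) \<le> p * (b1 * (- zb))" using p s by (intro mult_left_mono)
  ultimately have "p * (8 * (M + 1) * s) \<le> 4 * s" by linarith
  moreover have sp: "0 < s" unfolding s_def by (rule mult_pos_pos) (use c(1) M in auto)
  moreover have "p * (8 * (M + 1) * s) = 8 * (s * (p * (M + 1)))" by (simp only: mult_ac)
  ultimately have "s * (p * (M + 1)) \<le> s * (1 / 2)" by linarith
  then have pM: "p * (M + 1) \<le> 1 / 2" using sp by (simp only: mult_le_cancel_left_pos)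
  have "\<bar>f1\<bar> \<le> M" unfolding f1_def by (rule bound) simp
  then have "- M \<le> f1" by linarith
  then have "p * (- M) \<le> p * f1" using p by (intro mult_left_mono)
  moreover have "(2 - p) * (1 / 2) \<le> (2 - p) * g1" unfolding g1_def using p g1_ge by (intro mult_left_mono) auto
  moreover have "p * (M + 1) = p * M + p" by (simp add: distrib_left)
  ultimately have "0 < p * f1 + (2 - p) * g1" using pM p by simp
  then show "0 < F1 0 (- (r ^ (2 * k)), r\<^sup>2 * m (r, z, 0), z)"
    unfolding x_def[symmetric] y_def[symmetric] by (simp add: F_eq p_def[symmetric] q f1_def g1_def)
qed

lemma F1_continuous:
  assumes "continuous_on S \<epsilon>" "continuous_on S x" "continuous_on S y" "continuous_on S z"
  shows "continuous_on S (\<lambda>p. F1 (\<epsilon> p) (x p, y p, z p))"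
proof -
  have cphi: "continuous_on UNIV \<phi>"
    unfolding continuous_on_iff
  proof (intro ballI allI impI)
    fix x e :: real assume "0 < e"
    have "dist (\<phi> y) (\<phi> x) < e" if "dist y x < e / M" for y
      using phi_lip[of y x] that M \<open>0 < e\<close> by (simp add: dist_real_def field_simps)
    then show "\<exists>d>0. \<forall>x'\<in>UNIV. dist x' x < d \<longrightarrow> dist (\<phi> x') (\<phi> x) < e"
      using \<open>0 < e\<close> M by (intro exI[of _ "e / M"]) auto
  qed
  have cf: "continuous_on UNIV f" if f: "f \<in> {\<lambda>p. fst (Xp (clamp3 d p)), \<lambda>p. fst (snd (Xp (clamp3 d p))), \<lambda>p. snd (snd (Xp (clamp3 d p))),
        \<lambda>p. fst (Xm (clamp3 d p)), \<lambda>p. fst (snd (Xm (clamp3 d p))), \<lambda>p. snd (snd (Xm (clamp3 d p)))}" for f :: "r3 \<Rightarrow> real"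
    unfolding continuous_on_iff
  proof (intro ballI allI impI)
    fix x and e :: real assume "0 < e"
    have "dist (f y) (f x) < e" if y: "dist y x < e / M" for y
      using lip[OF f, of y x] y M \<open>0 < e\<close> by (simp add: dist_norm field_simps)
    then show "\<exists>d>0. \<forall>x'\<in>UNIV. dist x' x < d \<longrightarrow> dist (f x') (f x) < e"
      using \<open>0 < e\<close> M by (intro exI[of _ "e / M"]) auto
  qed
  show ?thesis
    unfolding F_eq
    by (intro continuous_intros assms continuous_on_compose2[OF cphi] continuous_on_compose2[OF cf[of "\<lambda>p. fst (Xp (clamp3 d p))"]]
        continuous_on_compose2[OF cf[of "\<lambda>p. fst (Xm (clamp3 d p))"]]) auto
qed

text \<open>The set where positivity fails is compact and misses the faces r = 0 and e = 0. On it
  the product that defines the leaf parameter is positive, hence has a positive minimum, and leaves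
  with a smaller parameter avoid it.\<close>

lemma leaf_positive:
  obtains \<epsilon>0 where "0 < \<epsilon>0"
    "\<And>r z e. (r, z, e) \<in> box \<Longrightarrow> r ^ (2 * (2 * k - 1)) * e < \<epsilon>0 \<Longrightarrow>
       0 < m (r, z, e) \<and> 0 < F1 (r ^ (2 * (2 * k - 1)) * e) (- (r ^ (2 * k)), r\<^sup>2 * m (r, z, e), z)"
proof -
  define g where "g p = (case p of (r, z, e) \<Rightarrow> F1 (r ^ (2 * (2 * k - 1)) * e) (- (r ^ (2 * k)), r\<^sup>2 * m (r, z, e), z))" for p
  define h where "h p = min (m p) (g p)" for p
  define E where "E p = (case p of (r, z, e) \<Rightarrow> r ^ (2 * (2 * k - 1)) * e)" for p :: r3
  have gc: "continuous_on box g"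
  proof -
    have "g = (\<lambda>p. F1 (fst p ^ (2 * (2 * k - 1)) * snd (snd p)) (- (fst p ^ (2 * k)), (fst p)\<^sup>2 * m p, fst (snd p)))"
      by (auto simp: g_def fun_eq_iff)
    show ?thesis unfolding \<open>g = _\<close>
      by (rule F1_continuous) (intro continuous_intros m_cont)+
  qed
  have hc: "continuous_on box h" unfolding h_def by (intro continuous_intros m_cont gc)
  have Ec: "continuous_on box E"
  proof -
    have "E = (\<lambda>p. fst p ^ (2 * (2 * k - 1)) * snd (snd p))" by (auto simp: E_def fun_eq_iff)
    show ?thesis unfolding \<open>E = _\<close> by (intro continuous_intros)
  qed
  define Bad where "Bad = box \<inter> h -` {..0}"
  have "closed Bad" unfolding Bad_def
    by (rule continuous_closed_preimage[OF hc]) (auto intro!: compact_imp_closed compact_box)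
  then have cB: "compact Bad" using compact_Int_closed[OF compact_box, of Bad] by (simp add: Bad_def Int_absorb1)
  have axis: "0 < h (r, z, e)" if "(r, z, e) \<in> box" "r = 0 \<or> e = 0" for r z e
  proof (cases "r = 0")
    case True
    have z: "z \<in> {za..zb}" using that by auto
    have "0 < mu z e" using that by (intro mu_pos) auto
    moreover have "g (r, z, e) = 2 * fold_A Xm z" using True k F_axis[OF z_in(1)[OF z]] by (simp add: g_def power_0_left)
    ultimately show ?thesis using A_ge[OF z_in(1)[OF z]] True by (simp add: h_def mu_def)
  next
    case False
    then show ?thesis using axis_e_pos[of r z] that by (auto simp: h_def g_def)
  qed
  have pos: "0 < E p" if "p \<in> Bad" for p
  proof -
    obtain r z e where p: "p = (r, z, e)" by (cases p)
    have "\<not> (r = 0 \<or> e = 0)" using axis[of r z e] that by (auto simp: Bad_def p)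
    then show ?thesis using that by (auto simp: Bad_def p E_def)
  qed
  have "\<exists>\<epsilon>0>0. \<forall>p\<in>Bad. \<epsilon>0 \<le> E p"
  proof (cases "Bad = {}")
    case False
    have "continuous_on Bad E" using Ec by (rule continuous_on_subset) (auto simp: Bad_def)
    from continuous_attains_inf[OF cB False this] show ?thesis using pos by blast
  qed (auto intro: exI[of _ 1])
  then obtain \<epsilon>0 where \<epsilon>0: "\<epsilon>0 > 0" "\<And>p. p \<in> Bad \<Longrightarrow> \<epsilon>0 \<le> E p" by blast
  show ?thesis
  proof (rule that[OF \<epsilon>0(1)])
    fix r z e assume p: "(r, z, e) \<in> box" and lt: "r ^ (2 * (2 * k - 1)) * e < \<epsilon>0"
    have "(r, z, e) \<notin> Bad" using \<epsilon>0(2)[of "(r, z, e)"] lt by (auto simp: E_def)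
    then have "0 < h (r, z, e)" using p by (auto simp: Bad_def)
    then show "0 < m (r, z, e) \<and> 0 < F1 (r ^ (2 * (2 * k - 1)) * e) (- (r ^ (2 * k)), r\<^sup>2 * m (r, z, e), z)"
      by (simp add: h_def g_def)
  qed
qed

section \<open>Invariance of the leaves and arrival at the section\<close>

text \<open>\<open>rr\<close> and \<open>ee\<close> invert the first chart at fixed
  \<open>\<epsilon>\<close>: both chart coordinates become functions of x, and the leaf becomes a
  graph of y over x and z.\<close>

definition rr :: "real \<Rightarrow> real" where "rr x = root (2 * k) (- x)"
definition ee :: "real \<Rightarrow> real \<Rightarrow> real" where "ee \<epsilon> x = \<epsilon> / rr x ^ (2 * (2 * k - 1))"

definition on_leaf :: "real \<Rightarrow> r3 \<Rightarrow> bool" where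
  "on_leaf \<epsilon> p \<longleftrightarrow> (case p of (x, y, z) \<Rightarrow> y = (rr x)\<^sup>2 * m (rr x, z, ee \<epsilon> x))"

lemma rr_power: "x \<le> 0 \<Longrightarrow> rr x ^ (2 * k) = - x" and rr_neg_power: "0 \<le> r \<Longrightarrow> rr (- (r ^ (2 * k))) = r"
  using k by (auto simp: rr_def real_root_power_cancel)

lemma rr_bounds:
  assumes "0 < rs" "rs \<le> rmax" "x \<in> {- (rmax ^ (2 * k))..- (rs ^ (2 * k))}"
  shows "rs \<le> rr x" "rr x \<le> rmax" "x < 0"
proof -
  have "rr (- (rs ^ (2 * k))) \<le> rr x" "rr x \<le> rr (- (rmax ^ (2 * k)))"
    unfolding rr_def using assms k by (auto intro!: real_root_le_mono)
  then show "rs \<le> rr x" "rr x \<le> rmax" using assms rr_neg_power by auto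
  have "0 < rs ^ (2 * k)" using assms by simp
  moreover have "x \<le> - (rs ^ (2 * k))" using assms(3) by simp
  ultimately show "x < 0" by linarith
qed

text \<open>A Gronwall estimate for the distance of \<open>y\<close> to the graph of \<open>m\<close>, whose derivative along the
  flow is given by the invariance equation.\<close>

lemma leaf_invariant:
  assumes \<epsilon>: "0 < \<epsilon>" and mb: "0 < Bm" "\<And>p. p \<in> box \<Longrightarrow> \<bar>m p\<bar> \<le> Bm" and eB: "\<epsilon> * (1 + Bm) \<le> d"
    and rs: "0 < rs" "rs \<le> rmax" "rs ^ (2 * (2 * k - 1)) * emax = \<epsilon>"
    and ode: "\<And>t. t \<in> {0..T} \<Longrightarrow> (w has_vector_derivative SF \<epsilon> (w t)) (at t within {0..T})"
    and x: "\<And>t. t \<in> {0..T} \<Longrightarrow> fst (w t) \<in> {- (rmax ^ (2 * k))..- (rs ^ (2 * k))}"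
    and z: "\<And>t. t \<in> {0..T} \<Longrightarrow> snd (snd (w t)) \<in> {za..zb}"
    and init: "on_leaf \<epsilon> (w 0)" and t: "t \<in> {0..T}"
  shows "on_leaf \<epsilon> (w t)"
proof -
  define X where "X t = fst (w t)" for t
  define Yy where "Yy t = fst (snd (w t))" for t
  define Z where "Z t = snd (snd (w t))" for t
  have w: "w t = (X t, Yy t, Z t)" for t by (simp add: X_def Yy_def Z_def)
  define r where "r t = rr (X t)" for t
  define e where "e t = ee \<epsilon> (X t)" for t
  define R where "R t = r t ^ (2 * k)" for t
  define n where "n = 2 * (2 * k - 1)"
  define P where "P t = (r t, Z t, e t)" for t
  define f1 where "f1 t = F1 \<epsilon> (w t)" for t
  define f2 where "f2 t = F2 \<epsilon> (w t)" for t
  define f3 where "f3 t = F3 \<epsilon> (w t)" for t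
  define h1 where "h1 t = F1 \<epsilon> (X t, (r t)\<^sup>2 * m (P t), Z t)" for t
  define h2 where "h2 t = F2 \<epsilon> (X t, (r t)\<^sup>2 * m (P t), Z t)" for t
  define h3 where "h3 t = F3 \<epsilon> (X t, (r t)\<^sup>2 * m (P t), Z t)" for t
  \<comment> \<open>Chain rule factors: along the flow r has the derivative
    \<open>\<rho> * f1\<close>, and that of e is \<open>\<kappa>\<close> times that of r.\<close>
  define \<rho> where "\<rho> t = - \<epsilon> * r t / (2 * real k * R t)" for t
  define \<kappa> where "\<kappa> t = - \<epsilon> * real n * r t / (R t)\<^sup>2" for t
  have k0: "0 < real k" using k by simp
  have rb: "rs \<le> r t" "r t \<le> rmax" "X t < 0" "0 < r t" if "t \<in> {0..T}" for t
    using rr_bounds[OF rs(1,2) x[OF that]] rs(1) by (auto simp: r_def X_def)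
  have R: "R t = - X t" "0 < R t" if "t \<in> {0..T}" for t
    using rb(3)[OF that] rr_power[of "X t"] by (auto simp: R_def r_def)
  have nk: "n = 4 * k - 2" "2 * k - 1 + 1 = 2 * k" "n + 2 = 2 * k + 2 * k" "real n = 2 * (2 * real k - 1)"
    using k by (auto simp: n_def of_nat_diff)
  have rn: "r t ^ n * (r t)\<^sup>2 = (R t)\<^sup>2" for t
    unfolding R_def power_add[symmetric] nk(3) by (simp only: power2_eq_square power_add)
  have rk: "r t ^ (2 * k - 1) * r t = R t" for t
    using nk(2) power_Suc2[of "r t" "2 * k - 1"] by (simp add: R_def)
  have e_eq: "e t = \<epsilon> * (r t)\<^sup>2 / (R t)\<^sup>2" if "t \<in> {0..T}" for t
    using rn[of t] rb(4)[OF that] R(2)[OF that] unfolding e_def ee_def r_def[symmetric] n_def[symmetric]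
    by (simp add: field_simps)
  have e_eps: "r t ^ n * e t = \<epsilon>" if "t \<in> {0..T}" for t
    using rb(4)[OF that] unfolding e_def ee_def r_def[symmetric] n_def[symmetric] by simp
  have Pbox: "P t \<in> box" if "t \<in> {0..T}" for t
  proof -
    have "rs ^ n \<le> r t ^ n" using rs rb[OF that] by (intro power_mono) auto
    then have "\<epsilon> \<le> r t ^ n * emax" using rs(3) epos unfolding n_def[symmetric] by (metis mult_le_cancel_right_pos)
    then have "e t \<le> emax" unfolding e_def ee_def r_def[symmetric] n_def[symmetric]
      using rb[OF that] by (simp add: field_simps)
    moreover have "0 \<le> e t" using e_eq[OF that] \<epsilon> by simp
    ultimately show ?thesis using z[OF that] rb[OF that] by (simp add: P_def Z_def)
  qed
  have comp: "(X has_real_derivative \<epsilon> * f1 t) (at t within {0..T})"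
    "(Yy has_real_derivative f2 t) (at t within {0..T})"
    "(Z has_real_derivative \<epsilon> * f3 t) (at t within {0..T})" if "t \<in> {0..T}" for t
    using r3_has_derivative_components[OF ode[OF that]]
    by (simp_all add: X_def[abs_def] Yy_def[abs_def] Z_def[abs_def] f1_def f2_def f3_def)
  have rD: "(r has_real_derivative \<rho> t * f1 t) (at t within {0..T})" if tt: "t \<in> {0..T}" for t
  proof -
    have "((\<lambda>t. root (2 * k) (- X t)) has_real_derivative inverse (real (2 * k) * root (2 * k) (- X t) ^ (2 * k - Suc 0)) * (- (\<epsilon> * f1 t))) (at t within {0..T})"
    proof (rule DERIV_chain2[where g = "\<lambda>t. - X t"])
      show "(root (2 * k) has_real_derivative inverse (real (2 * k) * root (2 * k) (- X t) ^ (2 * k - Suc 0))) (at (- X t))"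
        using rb(3)[OF tt] k by (intro DERIV_real_root) auto
      show "((\<lambda>t. - X t) has_real_derivative - (\<epsilon> * f1 t)) (at t within {0..T})" by (intro DERIV_minus comp tt)
    qed
    moreover have "inverse (real (2 * k) * r t ^ (2 * k - Suc 0)) * (- (\<epsilon> * f1 t)) = \<rho> t * f1 t"
    proof -
      have "r t ^ (2 * k - Suc 0) = R t / r t" using rk[of t] rb(4)[OF tt] by (simp add: field_simps)
      then show ?thesis using rb(4)[OF tt] R(2)[OF tt] k0 by (simp add: \<rho>_def field_simps)
    qed
    ultimately show ?thesis by (simp add: r_def[abs_def] rr_def)
  qed
  have eD: "(e has_real_derivative \<kappa> t * \<rho> t * f1 t) (at t within {0..T})" if tt: "t \<in> {0..T}" for t
  proof -
    have "((\<lambda>t. \<epsilon> / r t ^ n) has_real_derivative - \<epsilon> * (real n * r t ^ (n - Suc 0) * (\<rho> t * f1 t)) / (r t ^ n * r t ^ n)) (at t within {0..T})"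
      using rb(4)[OF tt] by (auto intro!: derivative_eq_intros rD[OF tt])
    moreover have "- \<epsilon> * (real n * r t ^ (n - Suc 0) * (\<rho> t * f1 t)) / (r t ^ n * r t ^ n) = \<kappa> t * \<rho> t * f1 t"
    proof -
      have "n \<noteq> 0" using k by (simp add: n_def)
      then have "r t ^ n = r t ^ (n - Suc 0) * r t" by (metis power_minus_mult not_gr_zero One_nat_def)
      then have a1: "r t ^ (n - Suc 0) = r t ^ n / r t" using rb(4)[OF tt] by simp
      have a2: "r t ^ n = (R t)\<^sup>2 / (r t)\<^sup>2" using rn[of t] rb(4)[OF tt] by (simp add: field_simps)
      show ?thesis unfolding a1 a2 \<kappa>_def using rb(4)[OF tt] R(2)[OF tt] by (simp add: field_simps power2_eq_square)
    qed
    ultimately show ?thesis by (simp add: e_def[abs_def] ee_def r_def[abs_def] n_def)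
  qed
  \<comment> \<open>The derivative of the distance \<open>g\<close> to the graph, as a linear
    function of the velocity. It vanishes for the velocity \<open>h1\<close>, \<open>h2\<close>,
    \<open>h3\<close> at the foot point on the graph, and the actual velocity differs from this by a
    multiple of \<open>g\<close>.\<close>
  define J where "J t a1 a2 a3 = a2 - 2 * r t * \<rho> t * m (P t) * a1 -
    (r t)\<^sup>2 * blinfun_apply (mD (P t)) (\<rho> t * a1, \<epsilon> * a3, \<kappa> t * \<rho> t * a1)" for t a1 a2 a3
  define g where "g t = Yy t - (r t)\<^sup>2 * m (P t)" for t
  have gD: "(g has_real_derivative J t (f1 t) (f2 t) (f3 t)) (at t within {0..T})" if tt: "t \<in> {0..T}" for t
  proof -
    have "(P has_vector_derivative (\<rho> t * f1 t, \<epsilon> * f3 t, \<kappa> t * \<rho> t * f1 t)) (at t within {0..T})"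
      unfolding P_def[abs_def]
      by (intro has_vector_derivative_Pair has_real_derivative_iff_has_vector_derivative[THEN iffD1] rD eD comp tt)
    moreover have "(m has_derivative blinfun_apply (mD (P t))) (at (P t) within P ` {0..T})"
      by (rule has_derivative_subset[OF mD(2)[OF Pbox[OF tt]]], rule image_subsetI, rule Pbox)
    ultimately have "((m \<circ> P) has_vector_derivative blinfun_apply (mD (P t)) (\<rho> t * f1 t, \<epsilon> * f3 t, \<kappa> t * \<rho> t * f1 t)) (at t within {0..T})"
      by (rule vector_derivative_diff_chain_within)
    then have mP: "((\<lambda>t. m (P t)) has_real_derivative blinfun_apply (mD (P t)) (\<rho> t * f1 t, \<epsilon> * f3 t, \<kappa> t * \<rho> t * f1 t)) (at t within {0..T})"
      by (simp add: o_def has_real_derivative_iff_has_vector_derivative)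
    have "((\<lambda>t. Yy t - (r t)\<^sup>2 * m (P t)) has_real_derivative
      f2 t - (2 * r t * (\<rho> t * f1 t) * m (P t) + (r t)\<^sup>2 * blinfun_apply (mD (P t)) (\<rho> t * f1 t, \<epsilon> * f3 t, \<kappa> t * \<rho> t * f1 t))) (at t within {0..T})"
      by (auto intro!: derivative_eq_intros comp(2)[OF tt] rD[OF tt] mP)
    then show ?thesis by (simp add: g_def[abs_def] J_def algebra_simps)
  qed
  \<comment> \<open>The invariance equation of the first chart multiplied by \<open>R t\<close>; the
    identity \<open>v\<close> below compares the velocities in the chart with those in the original
    time.\<close>
  have J0: "J t (h1 t) (h2 t) (h3 t) = 0" if tt: "t \<in> {0..T}" for t
  proof -
    have r0: "r t \<noteq> 0" "R t \<noteq> 0" using rb(4)[OF tt] R(2)[OF tt] by auto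
    have Pb: "(r t, Z t, e t) \<in> box" using Pbox[OF tt] by (simp add: P_def)
    have reg: "(X t, (r t)\<^sup>2 * m (P t), Z t) \<in> region \<epsilon>"
    proof -
      have "\<bar>X t\<bar> \<le> d" using x[OF tt] rb(3)[OF tt] small by (auto simp: X_def)
      moreover have "\<bar>Z t\<bar> \<le> d" using z_in(1) z[OF tt] by (auto simp: Z_def)
      moreover have "\<bar>\<epsilon> * ((r t)\<^sup>2 * m (P t) - 1)\<bar> \<le> d"
      proof -
        have "(r t)\<^sup>2 \<le> 1" using rb[OF tt] rpos by (intro power_le_one) auto
        then have "(r t)\<^sup>2 * \<bar>m (P t)\<bar> \<le> 1 * Bm" using mb(2)[OF Pbox[OF tt]] by (intro mult_mono) auto
        then have "\<bar>(r t)\<^sup>2 * m (P t)\<bar> \<le> Bm" by (simp add: abs_mult)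
        then have "\<bar>(r t)\<^sup>2 * m (P t) - 1\<bar> \<le> 1 + Bm" by linarith
        then have "\<epsilon> * \<bar>(r t)\<^sup>2 * m (P t) - 1\<bar> \<le> \<epsilon> * (1 + Bm)" using \<epsilon> by (intro mult_left_mono) auto
        then have "\<epsilon> * \<bar>(r t)\<^sup>2 * m (P t) - 1\<bar> \<le> d" using eB by linarith
        then show ?thesis using \<epsilon> by (simp only: abs_mult abs_of_pos)
      qed
      ultimately show ?thesis by (simp add: region_def)
    qed
    have c1: "(case chart1_field k \<phi> Xp Xm (r t, m (r t, Z t, e t), Z t, e t) of
              (dr, dy, dz, de) \<Rightarrow> dy = blinfun_apply (mD (r t, Z t, e t)) (dr, dz, de))" by (rule mD(3)[OF Pb])
    have c2: "- (r t ^ (2 * k)) = X t" using R(1)[OF tt] by (simp add: R_def)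
    have c3: "r t ^ (2 * (2 * k - 1)) * e t = \<epsilon>" using e_eps[OF tt] by (simp add: n_def)
    have inv: "h2 t / R t + m (P t) * e t * h1 t / real k =
      blinfun_apply (mD (P t)) (- (r t * e t * h1 t) / (2 * real k), R t * e t * h3 t, (2 * real k - 1) / real k * (e t)\<^sup>2 * h1 t)"
    proof -
      have rf: "regularized_field \<phi> Xp Xm \<epsilon> (X t, (r t)\<^sup>2 * m (P t), Z t) = (h1 t, h2 t, h3 t)"
        by (simp only: regularized_field_region(1)[OF reg] h1_def h2_def h3_def)
      from c1 c2 c3 show ?thesis using r0(1) by (simp add: chart1_field_def P_def[symmetric] rf R_def[symmetric])
    qed
    have v: "(r t)\<^sup>2 *\<^sub>R (\<rho> t * h1 t, \<epsilon> * h3 t, \<kappa> t * \<rho> t * h1 t) =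
      R t *\<^sub>R (- (r t * e t * h1 t) / (2 * real k), R t * e t * h3 t, (2 * real k - 1) / real k * (e t)\<^sup>2 * h1 t)"
      using r0 k0 unfolding e_eq[OF tt] \<rho>_def \<kappa>_def nk(4) by (simp add: field_simps power2_eq_square)
    have "(r t)\<^sup>2 * blinfun_apply (mD (P t)) (\<rho> t * h1 t, \<epsilon> * h3 t, \<kappa> t * \<rho> t * h1 t) =
      blinfun_apply (mD (P t)) ((r t)\<^sup>2 *\<^sub>R (\<rho> t * h1 t, \<epsilon> * h3 t, \<kappa> t * \<rho> t * h1 t))"
      by (simp only: blinfun.scaleR_right real_scaleR_def)
    also have "\<dots> = R t * (h2 t / R t + m (P t) * e t * h1 t / real k)"
      unfolding v inv by (simp only: blinfun.scaleR_right real_scaleR_def)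
    also have "\<dots> = h2 t - 2 * r t * \<rho> t * m (P t) * h1 t"
      using r0 k0 unfolding e_eq[OF tt] \<rho>_def by (simp add: field_simps power2_eq_square)
    finally show ?thesis by (simp add: J_def)
  qed
  obtain L where L: "0 < L" "\<And>p. p \<in> box \<Longrightarrow> norm (mD p) \<le> L" using mD_bounded by blast
  \<comment> \<open>The bounds depend on \<open>\<epsilon>\<close> and \<open>rs\<close> and may
    blow up as these tend to 0. This is harmless, since only the exact value g = 0 is
    propagated.\<close>
  define Lf where "Lf = 2 * M * M + 4 * M * \<epsilon>"
  define R1 where "R1 = \<epsilon> / rs ^ (2 * k)"
  define K1 where "K1 = \<epsilon> * real n / (rs ^ (2 * k))\<^sup>2"
  define C where "C = Lf + 2 * R1 * Bm * Lf + L * (R1 * Lf + \<epsilon> * Lf + K1 * R1 * Lf)"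
  have Lf: "0 \<le> Lf" using M \<epsilon> by (simp add: Lf_def)
  have R1: "0 \<le> R1" and K1: "0 \<le> K1" using \<epsilon> rs by (auto simp: R1_def K1_def)
  have C: "0 \<le> C" using Lf R1 K1 L \<epsilon> mb(1) by (auto simp: C_def intro!: add_nonneg_nonneg mult_nonneg_nonneg)
  have bound_J: "\<bar>J t (f1 t) (f2 t) (f3 t)\<bar> \<le> C * \<bar>g t\<bar>" if tt: "t \<in> {0..T}" for t
  proof -
    have r1: "0 \<le> r t" "r t \<le> 1" "(r t)\<^sup>2 \<le> 1" using rb[OF tt] rpos by (auto intro!: power_le_one)
    have Rs: "rs ^ (2 * k) \<le> R t" "0 < rs ^ (2 * k)" using rb[OF tt] rs by (auto simp: R_def intro!: power_mono)
    have \<rho>b: "\<bar>\<rho> t\<bar> \<le> R1"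
    proof -
      have "\<bar>\<rho> t\<bar> = \<epsilon> * r t / (2 * real k * R t)" using \<epsilon> r1 R(2)[OF tt] k0 by (simp add: \<rho>_def abs_mult)
      also have "\<dots> \<le> \<epsilon> * 1 / (1 * rs ^ (2 * k))"
        using \<epsilon> r1 Rs k by (intro frac_le mult_mono) auto
      finally show ?thesis by (simp add: R1_def)
    qed
    have \<kappa>b: "\<bar>\<kappa> t\<bar> \<le> K1"
    proof -
      have "\<bar>\<kappa> t\<bar> = \<epsilon> * real n * r t / (R t)\<^sup>2" using \<epsilon> r1 by (simp add: \<kappa>_def abs_mult)
      also have "\<dots> \<le> \<epsilon> * real n * 1 / (rs ^ (2 * k))\<^sup>2"
        using \<epsilon> r1 Rs rs(1) by (intro frac_le mult_mono power_mono) auto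
      finally show ?thesis by (simp add: K1_def)
    qed
    define D1 where "D1 = f1 t - h1 t"
    define D2 where "D2 = f2 t - h2 t"
    define D3 where "D3 = f3 t - h3 t"
    have D: "\<bar>D1\<bar> \<le> Lf * \<bar>g t\<bar>" "\<bar>D2\<bar> \<le> Lf * \<bar>g t\<bar>" "\<bar>D3\<bar> \<le> Lf * \<bar>g t\<bar>"
      unfolding D1_def D2_def D3_def f1_def f2_def f3_def h1_def h2_def h3_def w Lf_def g_def
      by (intro F_lipschitz_y less_imp_le[OF \<epsilon>])+
    have lin: "blinfun_apply (mD (P t)) (\<rho> t * f1 t, \<epsilon> * f3 t, \<kappa> t * \<rho> t * f1 t) =
      blinfun_apply (mD (P t)) (\<rho> t * h1 t, \<epsilon> * h3 t, \<kappa> t * \<rho> t * h1 t) +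
      blinfun_apply (mD (P t)) (\<rho> t * D1, \<epsilon> * D3, \<kappa> t * \<rho> t * D1)"
      unfolding blinfun.add_right[symmetric] by (simp add: D1_def D3_def algebra_simps)
    have "J t (f1 t) (f2 t) (f3 t) = J t (h1 t) (h2 t) (h3 t) + (D2 - 2 * r t * \<rho> t * m (P t) * D1 -
       (r t)\<^sup>2 * blinfun_apply (mD (P t)) (\<rho> t * D1, \<epsilon> * D3, \<kappa> t * \<rho> t * D1))"
      unfolding J_def lin by (simp add: D1_def D2_def algebra_simps)
    then have Je: "J t (f1 t) (f2 t) (f3 t) = D2 - (2 * r t * \<rho> t * m (P t) * D1 +
       (r t)\<^sup>2 * blinfun_apply (mD (P t)) (\<rho> t * D1, \<epsilon> * D3, \<kappa> t * \<rho> t * D1))" using J0[OF tt] by simp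
    have q1: "\<bar>\<rho> t * D1\<bar> \<le> R1 * (Lf * \<bar>g t\<bar>)" unfolding abs_mult using \<rho>b D R1 by (intro mult_mono) auto
    have q3: "\<bar>\<epsilon> * D3\<bar> \<le> \<epsilon> * (Lf * \<bar>g t\<bar>)" unfolding abs_mult using \<epsilon> D by (intro mult_mono) auto
    have q2: "\<bar>\<kappa> t * \<rho> t * D1\<bar> \<le> K1 * (R1 * (Lf * \<bar>g t\<bar>))"
      unfolding mult.assoc abs_mult[of "\<kappa> t"] using \<kappa>b q1 K1 by (intro mult_mono) auto
    have A: "\<bar>2 * r t * \<rho> t * m (P t) * D1\<bar> \<le> 2 * (Bm * (R1 * (Lf * \<bar>g t\<bar>)))"
    proof -
      have "\<bar>m (P t)\<bar> * \<bar>\<rho> t * D1\<bar> \<le> Bm * (R1 * (Lf * \<bar>g t\<bar>))" using mb Pbox[OF tt] q1 by (intro mult_mono) auto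
      then have "r t * (\<bar>m (P t)\<bar> * \<bar>\<rho> t * D1\<bar>) \<le> 1 * (Bm * (R1 * (Lf * \<bar>g t\<bar>)))"
        using r1 by (intro mult_mono[of "r t"]) auto
      moreover have "\<bar>2 * r t * \<rho> t * m (P t) * D1\<bar> = 2 * (r t * (\<bar>m (P t)\<bar> * \<bar>\<rho> t * D1\<bar>))"
        using r1 by (simp add: abs_mult mult_ac)
      ultimately show ?thesis by simp
    qed
    have "\<bar>blinfun_apply (mD (P t)) (\<rho> t * D1, \<epsilon> * D3, \<kappa> t * \<rho> t * D1)\<bar> \<le> norm (mD (P t)) * norm (\<rho> t * D1, \<epsilon> * D3, \<kappa> t * \<rho> t * D1)"
      using norm_blinfun[of "mD (P t)"] by (metis real_norm_def)
    also have "\<dots> \<le> L * (R1 * (Lf * \<bar>g t\<bar>) + \<epsilon> * (Lf * \<bar>g t\<bar>) + K1 * (R1 * (Lf * \<bar>g t\<bar>)))"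
      using L Pbox[OF tt] norm_r3_le[of "\<rho> t * D1" "\<epsilon> * D3" "\<kappa> t * \<rho> t * D1"] q1 q2 q3 by (intro mult_mono) auto
    finally have B: "\<bar>(r t)\<^sup>2 * blinfun_apply (mD (P t)) (\<rho> t * D1, \<epsilon> * D3, \<kappa> t * \<rho> t * D1)\<bar> \<le>
        1 * (L * (R1 * (Lf * \<bar>g t\<bar>) + \<epsilon> * (Lf * \<bar>g t\<bar>) + K1 * (R1 * (Lf * \<bar>g t\<bar>))))"
      unfolding abs_mult using r1 by (intro mult_mono) auto
    have "\<bar>J t (f1 t) (f2 t) (f3 t)\<bar> \<le> Lf * \<bar>g t\<bar> + (2 * (Bm * (R1 * (Lf * \<bar>g t\<bar>))) +
        1 * (L * (R1 * (Lf * \<bar>g t\<bar>) + \<epsilon> * (Lf * \<bar>g t\<bar>) + K1 * (R1 * (Lf * \<bar>g t\<bar>)))))"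
      unfolding Je using D(2) A B by linarith
    also have "\<dots> = C * \<bar>g t\<bar>" by (simp add: C_def algebra_simps)
    finally show ?thesis .
  qed
  have "g t = 0"
  proof (rule ode_unique[where u = g and v = "\<lambda>_. 0" and u' = "\<lambda>t. J t (f1 t) (f2 t) (f3 t)" and v' = "\<lambda>_. 0" and a = 0 and b = T and L = C and t = t])
    fix t assume tt: "t \<in> {0..T}"
    show "(g has_vector_derivative J t (f1 t) (f2 t) (f3 t)) (at t within {0..T})"
      using gD[OF tt] by (simp add: has_real_derivative_iff_has_vector_derivative)
    show "((\<lambda>_. 0) has_vector_derivative 0) (at t within {0..T})" by simp
    show "norm (J t (f1 t) (f2 t) (f3 t) - 0) \<le> C * norm (g t - 0)" using bound_J[OF tt] by simp
  next
    show "g 0 = 0" using init w[of 0] by (simp add: on_leaf_def g_def r_def P_def e_def)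
  qed (use C t in auto)
  then show ?thesis by (simp add: on_leaf_def w g_def r_def P_def e_def)
qed

lemma leaf_box:
  assumes "0 < \<epsilon>" "0 < rs" "rs \<le> rmax" "rs ^ (2 * (2 * k - 1)) * emax = \<epsilon>"
    "x \<in> {- (rmax ^ (2 * k))..- (rs ^ (2 * k))}" "z \<in> {za..zb}"
  shows "(rr x, z, ee \<epsilon> x) \<in> box" "rr x ^ (2 * (2 * k - 1)) * ee \<epsilon> x = \<epsilon>"
proof -
  note rb = rr_bounds[OF assms(2,3,5)]
  have r0: "0 < rr x" using rb assms by linarith
  have "rs ^ (2 * (2 * k - 1)) \<le> rr x ^ (2 * (2 * k - 1))" using assms rb by (intro power_mono) auto
  then have "rs ^ (2 * (2 * k - 1)) * emax \<le> rr x ^ (2 * (2 * k - 1)) * emax" using epos by (intro mult_right_mono) auto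
  then have "ee \<epsilon> x \<le> emax" unfolding ee_def assms(4) using r0 by (simp add: pos_divide_le_eq mult.commute)
  moreover have "0 \<le> ee \<epsilon> x" using r0 assms(1) by (simp add: ee_def)
  ultimately show "(rr x, z, ee \<epsilon> x) \<in> box" using rb r0 assms by simp
  show "rr x ^ (2 * (2 * k - 1)) * ee \<epsilon> x = \<epsilon>" using r0 by (simp add: ee_def)
qed

text \<open>On the leaf y is positive, so an orbit that ends at y = 0 must have left it. As long as
  x stays in the range of the leaf, invariance keeps the orbit on it and x increases; the only exit
  is the end with the largest x, which is the section e = emax.\<close>

lemma leaf_reaches_section:
  assumes \<epsilon>: "0 < \<epsilon>" and mb: "0 < Bm" "\<And>p. p \<in> box \<Longrightarrow> \<bar>m p\<bar> \<le> Bm" and eB: "\<epsilon> * (1 + Bm) \<le> d"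
    and rs: "0 < rs" "rs \<le> rmax" "rs ^ (2 * (2 * k - 1)) * emax = \<epsilon>"
    and pos: "\<And>r z e. (r, z, e) \<in> box \<Longrightarrow> r ^ (2 * (2 * k - 1)) * e = \<epsilon> \<Longrightarrow>
       0 < m (r, z, e) \<and> 0 < F1 \<epsilon> (- (r ^ (2 * k)), r\<^sup>2 * m (r, z, e), z)"
    and T: "0 \<le> T" and ode: "\<And>t. t \<in> {0..T} \<Longrightarrow> (w has_vector_derivative SF \<epsilon> (w t)) (at t within {0..T})"
    and z: "\<And>t. t \<in> {0..T} \<Longrightarrow> snd (snd (w t)) \<in> {za..zb}"
    and init: "w 0 \<in> slow_manifold k {za..zb} rmax emax m \<epsilon>"
    and fin: "fst (snd (w T)) = 0"
  obtains t0 where "t0 \<in> {0..T}" "w t0 = (- (rs ^ (2 * k)), rs\<^sup>2 * m (rs, snd (snd (w t0)), emax), snd (snd (w t0)))"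
proof -
  define xs where "xs = - (rs ^ (2 * k))"
  obtain r0 z0 e0 where w0: "w 0 = (- (r0 ^ (2 * k)), r0\<^sup>2 * m (r0, z0, e0), z0)" "r0 \<in> {0<..rmax}" "e0 \<in> {0..emax}"
    "r0 ^ (2 * (2 * k - 1)) * e0 = \<epsilon>"
    using init unfolding slow_manifold_def by blast
  \<comment> \<open>With the product fixed to \<open>\<epsilon>\<close>, the bound
    \<open>e0 \<le> emax\<close> is a lower bound for the radius: no point of the leaf lies beyond
    the section.\<close>
  have r0: "rs \<le> r0"
  proof (rule ccontr)
    assume "\<not> rs \<le> r0"
    then have "r0 ^ (2 * (2 * k - 1)) < rs ^ (2 * (2 * k - 1))" using w0(2) k by (intro power_strict_mono) auto
    then have "r0 ^ (2 * (2 * k - 1)) * emax < rs ^ (2 * (2 * k - 1)) * emax" using epos by simp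
    moreover have "r0 ^ (2 * (2 * k - 1)) * e0 \<le> r0 ^ (2 * (2 * k - 1)) * emax" using w0 by (intro mult_left_mono) auto
    ultimately show False using w0(4) rs(3) by linarith
  qed
  have x0: "fst (w 0) \<in> {- (rmax ^ (2 * k))..xs}"
    using w0 r0 rs by (auto simp: xs_def intro!: power_mono)
  have leaf0: "on_leaf \<epsilon> (w 0)"
  proof -
    have "rr (- (r0 ^ (2 * k))) = r0" using w0(2) by (intro rr_neg_power) auto
    moreover have "ee \<epsilon> (- (r0 ^ (2 * k))) = e0" using w0(2) unfolding ee_def calculation w0(4)[symmetric] by simp
    ultimately show ?thesis by (simp add: on_leaf_def w0(1))
  qed
  have leaf_pos: "0 < fst (snd (w t))" "0 < F1 \<epsilon> (w t)"
    if "t \<in> {0..T}" "fst (w t) \<in> {- (rmax ^ (2 * k))..xs}" "on_leaf \<epsilon> (w t)" for t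
  proof -
    obtain x y z' where wt: "w t = (x, y, z')" by (cases "w t")
    have xx: "x \<in> {- (rmax ^ (2 * k))..- (rs ^ (2 * k))}" and zz': "z' \<in> {za..zb}" using that z[OF that(1)] by (auto simp: wt xs_def)
    note lb = leaf_box[OF \<epsilon> rs xx zz']
    have x: "- (rr x ^ (2 * k)) = x" using rr_power[of x] rr_bounds(3)[OF rs(1,2) xx] by simp
    have y: "y = (rr x)\<^sup>2 * m (rr x, z', ee \<epsilon> x)" using that(3) by (simp add: on_leaf_def wt)
    note p = pos[OF lb, unfolded x]
    have "0 < rr x" using rr_bounds(1)[OF rs(1,2) xx] rs by linarith
    then show "0 < fst (snd (w t))" using p by (simp add: wt y)
    show "0 < F1 \<epsilon> (w t)" using p by (simp add: wt y)
  qed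
  have leaf: "on_leaf \<epsilon> (w t)" if t0: "t0 \<in> {0..T}" "\<And>s. s \<in> {0..t0} \<Longrightarrow> fst (w s) \<in> {- (rmax ^ (2 * k))..xs}" and t: "t \<in> {0..t0}" for t0 t
  proof (rule leaf_invariant[where w = w and T = t0 and t = t, OF \<epsilon> mb eB rs _ _ _ leaf0 t])
    fix s assume s: "s \<in> {0..t0}"
    show "(w has_vector_derivative SF \<epsilon> (w s)) (at s within {0..t0})"
      using s t0(1) by (intro has_vector_derivative_within_subset[OF ode]) auto
    show "fst (w s) \<in> {- (rmax ^ (2 * k))..- (rs ^ (2 * k))}" using t0(2)[OF s] by (simp add: xs_def)
    show "snd (snd (w s)) \<in> {za..zb}" using s t0(1) by (intro z) auto
  qed
  \<comment> \<open>Membership in the leaf gives x' > 0, but needs x in range up to that time; the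
    history hypothesis of the barrier lemma supplies the range and breaks the circle.\<close>
  have stay: "fst (w t) \<in> {- (rmax ^ (2 * k))..xs}"
    if t0: "t0 \<in> {0..T}" "\<And>s. s \<in> {0..t0} \<Longrightarrow> fst (w s) \<le> xs" and t: "t \<in> {0..t0}" for t0 t
  proof -
    have "fst (w 0) \<le> fst (w t)"
    proof (cases "t = 0")
      case False
      have "fst (w 0) - fst (w t) < 0"
      proof (rule derivative_neg_at_zeros_imp_neg[where f = "\<lambda>t. fst (w 0) - fst (w t)" and a = 0 and b = t0 and t = t])
        fix s assume s: "s \<in> {0..t0}"
        have "((\<lambda>t. fst (w t)) has_real_derivative \<epsilon> * F1 \<epsilon> (w s)) (at s within {0..T})"
          using r3_has_derivative_components(1)[OF ode] s t0(1) by simp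
        then have "((\<lambda>t. fst (w t)) has_real_derivative \<epsilon> * F1 \<epsilon> (w s)) (at s within {0..t0})"
          by (rule DERIV_subset) (use t0(1) in auto)
        then show "((\<lambda>t. fst (w 0) - fst (w t)) has_real_derivative 0 - \<epsilon> * F1 \<epsilon> (w s)) (at s within {0..t0})"
          by (intro DERIV_diff) auto
        assume "\<And>q. q \<in> {0..s} \<Longrightarrow> fst (w 0) - fst (w q) \<le> 0"
        then have in': "fst (w q) \<in> {- (rmax ^ (2 * k))..xs}" if "q \<in> {0..s}" for q
          using that s t0(2)[of q] x0 by force
        have "on_leaf \<epsilon> (w s)" by (rule leaf[of s]) (use s t0(1) in' in auto)
        then have "0 < F1 \<epsilon> (w s)" by (intro leaf_pos(2)) (use s t0(1) in' in auto)
        then show "0 - \<epsilon> * F1 \<epsilon> (w s) < 0" using \<epsilon> by simp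
      qed (use t False in auto)
      then show ?thesis by simp
    qed simp
    then show ?thesis using x0 t0(2)[OF t] by simp
  qed
  have cont: "continuous_on {0..T} (\<lambda>t. fst (w t))"
    by (rule DERIV_continuous_on) (rule r3_has_derivative_components(1)[OF ode])
  define W where "W = {0..T} \<inter> (\<lambda>t. fst (w t)) -` {xs..}"
  have "W \<noteq> {}"
  proof
    assume "W = {}"
    then have lt: "fst (w s) \<le> xs" if "s \<in> {0..T}" for s using that by (auto simp: W_def)
    have "on_leaf \<epsilon> (w T)" by (rule leaf[of T]) (use T stay[of T] lt in auto)
    then have "0 < fst (snd (w T))" by (intro leaf_pos(1)) (use T stay[of T T] lt in auto)
    then show False using fin by simp
  qed
  moreover have "compact W"
    using continuous_closed_preimage[OF cont, of "{xs..}"]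
    by (auto simp: compact_eq_bounded_closed W_def intro: bounded_subset[of "{0..T}"])
  ultimately obtain t0 where t0: "t0 \<in> W" "\<And>s. s \<in> W \<Longrightarrow> t0 \<le> s"
    using compact_attains_inf[of W] by blast
  have t0T: "t0 \<in> {0..T}" using t0 by (simp add: W_def)
  have "\<exists>s\<ge>0. s \<le> t0 \<and> fst (w s) = xs"
    using x0 t0(1) by (intro IVT' continuous_on_subset[OF cont]) (auto simp: W_def)
  then obtain s where s: "0 \<le> s" "s \<le> t0" "fst (w s) = xs" by blast
  then have "s \<in> W" using t0T by (simp add: W_def)
  then have xt0: "fst (w t0) = xs" using t0(2)[of s] s by simp
  have le: "fst (w q) \<le> xs" if "q \<in> {0..t0}" for q
  proof (rule ccontr)
    assume "\<not> fst (w q) \<le> xs"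
    then have "q \<in> W" using that t0T by (simp add: W_def)
    then have "q = t0" using t0(2)[of q] that by simp
    then show False using \<open>\<not> fst (w q) \<le> xs\<close> xt0 by simp
  qed
  have "on_leaf \<epsilon> (w t0)" by (rule leaf[of t0]) (use t0T stay[of t0] le in auto)
  moreover have "rr xs = rs" unfolding xs_def using rs by (intro rr_neg_power) auto
  moreover have "ee \<epsilon> xs = emax" unfolding ee_def calculation(2) using rs(1) by (simp add: rs(3)[symmetric])
  ultimately have "w t0 = (- (rs ^ (2 * k)), rs\<^sup>2 * m (rs, snd (snd (w t0)), emax), snd (snd (w t0)))"
    using xt0 by (cases "w t0") (simp add: on_leaf_def xs_def)
  then show ?thesis using that t0T by blast
qed

end

section \<open>Matching the centre manifold with the special trajectory\<close>

text \<open>Left of \<xi>/2 the function has a positive minimum on the compact range; between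
  \<xi>/2 and \<open>\<xi>\<close> its slope is at most -\<xi>/2; to the right of
  \<open>\<xi>\<close> it is the explicit parabola.\<close>

lemma unit_tail_linear_bound:
  assumes \<xi>: "0 < \<xi>" and zero: "Y \<xi> = 0"
    and D: "\<And>x. (Y has_real_derivative - (max 0 (Y x) ^ k) - x) (at x)"
    and pos: "\<And>x. x < \<xi> \<Longrightarrow> 0 < Y x" and right: "\<And>x. \<xi> \<le> x \<Longrightarrow> Y x = (\<xi>\<^sup>2 - x\<^sup>2) / 2"
  obtains c where "0 < c"
    "\<And>x. - N \<le> x \<Longrightarrow> x \<le> \<xi> \<Longrightarrow> c * (\<xi> - x) \<le> Y x" "\<And>x. \<xi> \<le> x \<Longrightarrow> Y x \<le> - c * (x - \<xi>)"
proof -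
  define N' where "N' = max N 0"
  have cont: "continuous_on {- N'..\<xi> / 2} Y" by (rule DERIV_continuous_on) (rule DERIV_subset[OF D], simp)
  have ne: "{- N'..\<xi> / 2} \<noteq> {}" using \<xi> by (auto simp: N'_def)
  obtain x0 where x0: "x0 \<in> {- N'..\<xi> / 2}" "\<And>x. x \<in> {- N'..\<xi> / 2} \<Longrightarrow> Y x0 \<le> Y x"
    using continuous_attains_inf[OF compact_Icc ne cont] by blast
  have Yx0: "0 < Y x0" using x0(1) \<xi> by (intro pos) auto
  define c where "c = min (\<xi> / 2) (Y x0 / (\<xi> + N'))"
  have pN: "0 < \<xi> + N'" using \<xi> by (auto simp: N'_def)
  have c: "0 < c" "c \<le> \<xi> / 2" using \<xi> Yx0 pN unfolding c_def by (simp, intro min.cobounded1)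
  have "c \<le> Y x0 / (\<xi> + N')" unfolding c_def by (rule min.cobounded2)
  then have c3: "c * (\<xi> + N') \<le> Y x0" using pN by (simp add: pos_le_divide_eq)
  show ?thesis
  proof (rule that[OF c(1)])
    fix x assume x: "- N \<le> x" "x \<le> \<xi>"
    show "c * (\<xi> - x) \<le> Y x"
    proof (cases "x \<le> \<xi> / 2")
      case True
      have "c * (\<xi> - x) \<le> c * (\<xi> + N')" using c x by (intro mult_left_mono) (auto simp: N'_def)
      also have "\<dots> \<le> Y x0" by (rule c3)
      also have "\<dots> \<le> Y x" using True x by (intro x0) (auto simp: N'_def)
      finally show ?thesis .
    next
      case False
      have "Y \<xi> + \<xi> / 2 * \<xi> \<le> Y x + \<xi> / 2 * x"
      proof (rule derivative_nonpos_within_imp_le[where f = "\<lambda>t. Y t + \<xi> / 2 * t" and a = x and b = \<xi>])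
        fix t assume t: "t \<in> {x..\<xi>}"
        show "((\<lambda>t. Y t + \<xi> / 2 * t) has_real_derivative (- (max 0 (Y t) ^ k) - t) + \<xi> / 2) (at t within {x..\<xi>})"
          by (intro DERIV_add DERIV_subset[OF D]) (auto intro!: derivative_eq_intros)
        have "0 \<le> max 0 (Y t) ^ k" by simp
        moreover have "\<xi> / 2 \<le> t" using t False by auto
        ultimately show "(- (max 0 (Y t) ^ k) - t) + \<xi> / 2 \<le> 0" by linarith
      qed (use x in auto)
      then have "\<xi> / 2 * (\<xi> - x) \<le> Y x" using zero by (simp add: algebra_simps)
      moreover have "c * (\<xi> - x) \<le> \<xi> / 2 * (\<xi> - x)" using c x by (intro mult_right_mono) auto
      ultimately show ?thesis by linarith
    qed
  next
    fix x assume x: "\<xi> \<le> x"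
    have "Y x = - ((x + \<xi>) / 2 * (x - \<xi>))" using right[OF x] by (simp add: power2_eq_square field_simps)
    moreover have "c * (x - \<xi>) \<le> (x + \<xi>) / 2 * (x - \<xi>)" using c x \<xi> by (intro mult_right_mono) auto
    ultimately show "Y x \<le> - c * (x - \<xi>)" by simp
  qed
qed

context fold_center begin

definition qq :: "real \<Rightarrow> real" where "qq z = - (phi_lead k \<phi> * fold_B Xp z)"

lemma coeff_pos: assumes "z \<in> {za..zb}"
  shows "0 < fold_A Xm z" "0 < qq z" "0 < fold_G Xm z"
proof -
  show "0 < fold_A Xm z" using A_ge[OF z_in(1)[OF assms]] by linarith
  show "0 < fold_G Xm z" using G_ge[OF z_in(1)[OF assms]] g0 by linarith
  show "0 < qq z" unfolding qq_def using mult_pos_neg[OF a B_neg(2)[OF assms]] by simp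
qed

lemma equilibrium_qq: "equilibrium_y1 k \<phi> Xp Xm z = root k (2 * fold_G Xm z / qq z)"
  by (simp add: equilibrium_y1_def qq_def)

text \<open>The section \<open>e = emax\<close> of the first chart is \<open>x2 = - (\<kappa> ^ (2 * k))\<close> in the second one, and there
  the radial coordinates of the two charts differ by the factor \<open>\<kappa>\<close>.\<close>

definition \<kappa> :: real where "\<kappa> = emax powr (- 1 / (2 * (2 * real k - 1)))"

lemma \<kappa>: "0 < \<kappa>" "\<kappa> ^ (2 * (2 * k - 1)) * emax = 1" "\<kappa> ^ (2 * k) = emax powr (- real k / (2 * real k - 1))"
  "\<kappa>\<^sup>2 = emax powr (- 1 / (2 * real k - 1))"
proof -
  show k0: "0 < \<kappa>" using epos by (simp add: \<kappa>_def)
  have n: "2 * real k - 1 > 0" using k by simp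
  have pw: "\<kappa> ^ i = emax powr (- real i / (2 * (2 * real k - 1)))" for i
    unfolding \<kappa>_def using epos by (simp add: powr_realpow[symmetric] powr_powr)
  have "real (2 * (2 * k - 1)) = 2 * (2 * real k - 1)" using k by (simp add: of_nat_diff)
  moreover have neg: "- x / x = - 1" if "0 < x" for x :: real using that by simp
  have "- (2 * (2 * real k - 1)) / (2 * (2 * real k - 1)) = - 1" by (rule neg) (use k in simp)
  ultimately have "- real (2 * (2 * k - 1)) / (2 * (2 * real k - 1)) = - 1" by (simp only:)
  then have "\<kappa> ^ (2 * (2 * k - 1)) = emax powr (- 1)" unfolding pw by (simp only:)
  then show "\<kappa> ^ (2 * (2 * k - 1)) * emax = 1" using epos by (simp add: powr_minus)
  have ex: "- (2 * x) / (2 * y) = - x / y" for x y :: real by simp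
  show "\<kappa> ^ (2 * k) = emax powr (- real k / (2 * real k - 1))"
    unfolding pw of_nat_mult of_nat_numeral by (simp only: ex)
  have "- real 2 / (2 * (2 * real k - 1)) = - 1 / (2 * real k - 1)" using ex[of 1 "2 * real k - 1"] by (simp only: of_nat_numeral mult_1_right)
  then show "\<kappa>\<^sup>2 = emax powr (- 1 / (2 * real k - 1))" unfolding pw by (simp only:)
qed

text \<open>Change from the first to the second chart at r = 0: e = (-x)^(-(2k-1)/k), and y gains
  the factor (-x)^(1/k). Differentiating this factor produces a term that cancels
  \<open>mu / k\<close> in the invariance equation, and the limit equation remains. The growth
  condition follows from the Lipschitz bound at e = 0, because (-x)^(1/k) times e is bounded for x
  \<le> -1.\<close>

lemma center_tail_solution:
  assumes z: "z \<in> {za..zb}"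
  shows "tail_solution k (qq z / (2 * fold_A Xm z)) (2 * fold_G Xm z / (2 * fold_A Xm z))
     (\<lambda>x. (- x) powr (1 / real k) * mu z ((- x) powr (- (2 * real k - 1) / real k))) (- (\<kappa> ^ (2 * k)))"
proof -
  define s where "s = (2 * real k - 1) / real k"
  define p where "p x = (- x) powr (1 / real k)" for x :: real
  define e where "e x = (- x) powr (- s)" for x :: real
  define A where "A = fold_A Xm z"
  define G where "G = fold_G Xm z"
  have k0: "0 < real k" using k by simp
  have ms: "- (2 * real k - 1) / real k = - s" unfolding s_def by (rule minus_divide_left[symmetric])
  have s0: "s > 0" using k by (simp add: s_def)
  note cp = coeff_pos[OF z, folded A_def G_def]
  have x0: "0 < \<kappa> ^ (2 * k)" using \<kappa>(1) by simp
  have e_in: "e x \<in> {0..emax}" if "x \<le> - (\<kappa> ^ (2 * k))" for x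
  proof -
    have "e x \<le> (\<kappa> ^ (2 * k)) powr (- s)"
      unfolding e_def using that x0 s0 by (intro powr_mono2') auto
    also have "\<dots> = emax powr ((- real k / (2 * real k - 1)) * (- s))" unfolding \<kappa>(3) by (simp add: powr_powr)
    also have "(- real k / (2 * real k - 1)) * (- s) = 1" using k by (simp add: s_def)
    finally show ?thesis using epos by (simp add: e_def)
  qed
  have e_pos: "0 < e x" if "x < 0" for x using that by (simp add: e_def)
  \<comment> \<open>The relation between the two fractional powers, coming from 2 - s = 1/k; it
    removes them from the differential equation.\<close>
  have pe: "p x = (- x)\<^sup>2 * e x" if "x < 0" for x
  proof -
    have "(- x)\<^sup>2 * e x = (- x) powr 2 * (- x) powr (- s)" using that by (simp add: e_def)
    also have "\<dots> = (- x) powr (2 + (- s))" by (rule powr_add[symmetric])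
    also have "2 + (- s) = 1 / real k" using k0 by (simp add: s_def field_simps)
    finally show ?thesis by (simp add: p_def)
  qed
  have pk: "p x ^ k = - x" if "x < 0" for x
    using that k0 by (simp add: p_def powr_realpow[symmetric] powr_powr)
  show ?thesis
    unfolding tail_solution_def
  proof (intro conjI allI impI)
    fix x assume x: "x \<le> - (\<kappa> ^ (2 * k))"
    have xn: "x < 0" using x x0 by linarith
    have pD: "(p has_real_derivative - (1 / real k) * (p x / (- x))) (at x within {..- (\<kappa> ^ (2 * k))})"
    proof -
      have "((\<lambda>x. (- x) powr (1 / real k)) has_real_derivative (1 / real k) * (- x) powr (1 / real k - 1) * (- 1)) (at x within {..- (\<kappa> ^ (2 * k))})"
        using xn by (intro DERIV_chain2[where g = uminus] has_real_derivative_powr) (auto intro!: derivative_eq_intros)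
      moreover have "(- x) powr (1 / real k - 1) = p x / (- x)" using xn by (simp add: powr_diff p_def)
      ultimately show ?thesis by (simp add: p_def[abs_def])
    qed
    have eD: "(e has_real_derivative s * (e x / (- x))) (at x within {..- (\<kappa> ^ (2 * k))})"
    proof -
      have "((\<lambda>x. (- x) powr (- s)) has_real_derivative (- s) * (- x) powr (- s - 1) * (- 1)) (at x within {..- (\<kappa> ^ (2 * k))})"
        using xn by (intro DERIV_chain2[where g = uminus] has_real_derivative_powr) (auto intro!: derivative_eq_intros)
      moreover have "(- x) powr (- s - 1) = e x / (- x)" using xn unfolding powr_diff by (simp add: e_def)
      ultimately show ?thesis by (simp add: e_def[abs_def])
    qed
    have mD: "((mu z \<circ> e) has_real_derivative mu' z (e x) * (s * (e x / (- x)))) (at x within {..- (\<kappa> ^ (2 * k))})"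
    proof (rule DERIV_image_chain[OF _ eD])
      show "(mu z has_real_derivative mu' z (e x)) (at (e x) within e ` {..- (\<kappa> ^ (2 * k))})"
        by (rule DERIV_subset[OF mu_DERIV[OF z e_in[OF x]]]) (use e_in in auto)
    qed
    have prod: "((\<lambda>x. p x * mu z (e x)) has_real_derivative
      - (1 / real k) * (p x / (- x)) * mu z (e x) + p x * (mu' z (e x) * (s * (e x / (- x))))) (at x within {..- (\<kappa> ^ (2 * k))})"
      using DERIV_mult[OF pD mD] by (simp add: o_def algebra_simps)
    have ode: "s * (e x)\<^sup>2 * (2 * A) * mu' z (e x) = - qq z * mu z (e x) ^ k + 2 * G + 2 * A * mu z (e x) * e x / real k"
      using mu_ode[OF z e_in[OF x]] by (simp add: s_def A_def G_def qq_def)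
    have e0: "e x \<noteq> 0" using e_pos[OF xn] by simp
    have "s * e x * mu' z (e x) = (- qq z * mu z (e x) ^ k + 2 * G + 2 * A * mu z (e x) * e x / real k) / (2 * A * e x)"
      unfolding ode[symmetric] using cp(1) e0 by (simp add: field_simps power2_eq_square)
    also have "\<dots> = (- qq z * mu z (e x) ^ k + 2 * G) / (2 * A * e x) + mu z (e x) / real k"
      using cp(1) e0 k0 by (simp add: field_simps)
    finally have sm: "s * e x * mu' z (e x) = (- qq z * mu z (e x) ^ k + 2 * G) / (2 * A * e x) + mu z (e x) / real k" .
    have "- (1 / real k) * (p x / (- x)) * mu z (e x) + p x * (mu' z (e x) * (s * (e x / (- x)))) =
      p x / (- x) * (s * e x * mu' z (e x) - mu z (e x) / real k)" using xn k0 by (simp add: field_simps)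
    also have "\<dots> = p x / (- x) * ((- qq z * mu z (e x) ^ k + 2 * G) / (2 * A * e x))" unfolding sm by simp
    also have "\<dots> = (- x) * (- qq z * mu z (e x) ^ k + 2 * G) / (2 * A)"
      unfolding pe[OF xn] using xn e0 cp(1) by (simp add: field_simps power2_eq_square)
    also have "\<dots> = - (qq z / (2 * A) * (p x * mu z (e x)) ^ k) - 2 * G / (2 * A) * x"
      unfolding power_mult_distrib pk[OF xn] using cp(1) by (simp add: field_simps)
    finally have eq: "- (1 / real k) * (p x / (- x)) * mu z (e x) + p x * (mu' z (e x) * (s * (e x / (- x)))) =
      - (qq z / (2 * A) * (p x * mu z (e x)) ^ k) - 2 * G / (2 * A) * x" .
    show "((\<lambda>x. (- x) powr (1 / real k) * mu z ((- x) powr (- (2 * real k - 1) / real k))) has_real_derivative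
        - (qq z / (2 * fold_A Xm z) * ((- x) powr (1 / real k) * mu z ((- x) powr (- (2 * real k - 1) / real k))) ^ k) -
        2 * fold_G Xm z / (2 * fold_A Xm z) * x) (at x within {..- (\<kappa> ^ (2 * k))})"
      using prod unfolding eq unfolding p_def e_def A_def G_def ms .
  next
    obtain L where L: "0 < L" "\<And>p q. p \<in> box \<Longrightarrow> q \<in> box \<Longrightarrow> \<bar>m p - m q\<bar> \<le> L * norm (p - q)"
      using m_lipschitz by blast
    have "\<bar>p x * mu z (e x) - root k (- (2 * G / (2 * A)) * x / (qq z / (2 * A)))\<bar> \<le> L" if x: "x \<le> min (- (\<kappa> ^ (2 * k))) (- 1)" for x
    proof -
      have xn: "x < 0" and x1: "1 \<le> - x" and xk: "x \<le> - (\<kappa> ^ (2 * k))" using x by auto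
      have "- (2 * G / (2 * A)) * x / (qq z / (2 * A)) = (- x) * (2 * G / qq z)" using cp by (simp add: field_simps)
      then have "root k (- (2 * G / (2 * A)) * x / (qq z / (2 * A))) = root k (- x) * root k (2 * G / qq z)"
        by (simp only: real_root_mult)
      also have "root k (- x) = p x" using xn k by (simp add: p_def root_powr_inverse inverse_eq_divide)
      also have "root k (2 * G / qq z) = mu z 0" using mu_0[OF z] equilibrium_qq by (simp add: G_def)
      finally have "\<bar>p x * mu z (e x) - root k (- (2 * G / (2 * A)) * x / (qq z / (2 * A)))\<bar> = p x * \<bar>mu z (e x) - mu z 0\<bar>"
        by (simp add: right_diff_distrib[symmetric] abs_mult p_def)
      also have "\<bar>mu z (e x) - mu z 0\<bar> \<le> L * e x"
      proof -
        have "\<bar>mu z (e x) - mu z 0\<bar> \<le> L * norm ((0, z, e x) - (0, z, 0) :: r3)"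
          unfolding mu_def using e_in[OF xk] z rpos epos by (intro L(2)) auto
        then show ?thesis using e_in[OF xk] by (simp add: norm_Pair)
      qed
      also have "p x * (L * e x) = L * (p x * e x)" by simp
      also have "p x * e x = (- x) powr (1 / real k + (- s))" unfolding p_def e_def by (rule powr_add[symmetric])
      also have "\<dots> \<le> (- x) powr 0"
        using x1 k by (intro powr_mono) (auto simp: s_def field_simps)
      finally show ?thesis using xn L by (simp add: p_def mult_left_mono)
    qed
    then show "\<exists>M N. \<forall>x\<le>N. \<bar>(- x) powr (1 / real k) * mu z ((- x) powr (- (2 * real k - 1) / real k)) -
       root k (- (2 * fold_G Xm z / (2 * fold_A Xm z)) * x / (qq z / (2 * fold_A Xm z)))\<bar> \<le> M"
      unfolding p_def e_def A_def G_def ms by blast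
  qed
qed

text \<open>Both sides are values of tail solutions of the same equation at the right end
  -\<kappa>^(2k), where e = emax: one solution comes from the centre manifold, the other from
  rescaling the unit solution. Uniqueness identifies them.\<close>

lemma section_matching:
  assumes z: "z \<in> {za..zb}" and Y: "tail_solution k 1 1 Y \<xi>" "0 < \<xi>"
  shows "\<kappa>\<^sup>2 * m (0, z, emax) =
    scale_y k (fold_A Xm z) (qq z) (fold_G Xm z) * Y (- (\<kappa> ^ (2 * k)) / scale_x k (fold_A Xm z) (qq z) (fold_G Xm z))"
proof -
  let ?l = "scale_x k (fold_A Xm z) (qq z) (fold_G Xm z)"
  let ?m = "scale_y k (fold_A Xm z) (qq z) (fold_G Xm z)"
  note cp = coeff_pos[OF z]
  note sp = scale_positive[OF cp, of k]
  have x0: "0 < \<kappa> ^ (2 * k)" using \<kappa>(1) by simp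
  have n: "2 * real k - 1 > 0" using k by simp
  have t: "tail_solution k (qq z / (2 * fold_A Xm z)) (2 * fold_G Xm z / (2 * fold_A Xm z)) (\<lambda>x. ?m * Y (x / ?l)) (- (\<kappa> ^ (2 * k)))"
  proof (rule tail_solution_restrict)
    show "tail_solution k (qq z / (2 * fold_A Xm z)) (2 * fold_G Xm z / (2 * fold_A Xm z)) (\<lambda>x. ?m * Y (x / ?l)) (?l * \<xi>)"
      using k by (intro tail_solution_scale[OF Y(1) sp] scale_equations cp) auto
    show "- (\<kappa> ^ (2 * k)) \<le> ?l * \<xi>" using x0 mult_pos_pos[OF sp(1) Y(2)] by linarith
  qed
  have "(- (- (\<kappa> ^ (2 * k)))) powr (1 / real k) * mu z ((- (- (\<kappa> ^ (2 * k)))) powr (- (2 * real k - 1) / real k)) = ?m * Y (- (\<kappa> ^ (2 * k)) / ?l)"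
    by (rule tail_solution_unique[OF center_tail_solution[OF z] t]) (use cp k in auto)
  moreover have "(\<kappa> ^ (2 * k)) powr (1 / real k) = \<kappa>\<^sup>2"
    unfolding \<kappa>(3,4) using k by (simp add: powr_powr)
  moreover have "(\<kappa> ^ (2 * k)) powr (- (2 * real k - 1) / real k) = emax"
  proof -
    have "(- real k / (2 * real k - 1)) * (- (2 * real k - 1) / real k) = 1" using k n by (simp add: field_simps)
    then show ?thesis unfolding \<kappa>(3) powr_powr using epos by simp
  qed
  ultimately show ?thesis by (simp add: mu_def)
qed

end

lemma lipschitz_imp_continuous_on_real:
  fixes f :: "real \<Rightarrow> real"
  assumes "0 \<le> L" "\<And>x y. x \<in> S \<Longrightarrow> y \<in> S \<Longrightarrow> \<bar>f x - f y\<bar> \<le> L * \<bar>x - y\<bar>"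
  shows "continuous_on S f"
  by (rule lipschitz_on_continuous_on[of L]) (use assms in \<open>auto intro!: lipschitz_onI simp: dist_real_def\<close>)

lemma positive_continuous_bounds:
  fixes f :: "real \<Rightarrow> real"
  assumes "continuous_on {a..b} f" "a \<le> b" "\<And>x. x \<in> {a..b} \<Longrightarrow> 0 < f x"
  obtains l u where "0 < l" "0 < u" "\<And>x. x \<in> {a..b} \<Longrightarrow> l \<le> f x \<and> f x \<le> u"
proof -
  have ne: "{a..b} \<noteq> {}" using assms by simp
  obtain p where p: "p \<in> {a..b}" "\<And>x. x \<in> {a..b} \<Longrightarrow> f p \<le> f x"
    using continuous_attains_inf[OF compact_Icc ne assms(1)] by blast
  obtain q where q: "q \<in> {a..b}" "\<And>x. x \<in> {a..b} \<Longrightarrow> f x \<le> f q"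
    using continuous_attains_sup[OF compact_Icc ne assms(1)] by blast
  show ?thesis by (rule that[of "f p" "f q"]) (use p q assms(3) in auto)
qed

context fold_center begin

definition lam :: "real \<Rightarrow> real" where "lam z = scale_x k (fold_A Xm z) (qq z) (fold_G Xm z)"
definition mus :: "real \<Rightarrow> real" where "mus z = scale_y k (fold_A Xm z) (qq z) (fold_G Xm z)"

lemma coeff_continuous:
  "continuous_on {za..zb} (\<lambda>z. fold_A Xm z)" "continuous_on {za..zb} qq" "continuous_on {za..zb} (\<lambda>z. fold_G Xm z)"
proof -
  have n: "norm ((0, 0, z) - (0, 0, z') :: r3) = \<bar>z - z'\<bar>" for z z' :: real by (simp add: norm_Pair)
  have M0: "0 \<le> M" using M by simp
  show "continuous_on {za..zb} (\<lambda>z. fold_A Xm z)"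
  proof (rule lipschitz_imp_continuous_on_real[OF M0])
    fix z z' assume "z \<in> {za..zb}" "z' \<in> {za..zb}"
    then show "\<bar>fold_A Xm z - fold_A Xm z'\<bar> \<le> M * \<bar>z - z'\<bar>"
      using lip[of "\<lambda>p. fst (Xm (clamp3 d p))" "(0, 0, z)" "(0, 0, z')"] z_in(1) by (simp add: fold_AB(1) n[unfolded diff_Pair])
  qed
  have "continuous_on {za..zb} (\<lambda>z. fold_B Xp z)"
  proof (rule lipschitz_imp_continuous_on_real[OF M0])
    fix z z' assume "z \<in> {za..zb}" "z' \<in> {za..zb}"
    then show "\<bar>fold_B Xp z - fold_B Xp z'\<bar> \<le> M * \<bar>z - z'\<bar>"
      using lip[of "\<lambda>p. fst (snd (Xp (clamp3 d p)))" "(0, 0, z)" "(0, 0, z')"] z_in(1) by (simp add: fold_AB(2) n[unfolded diff_Pair])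
  qed
  then show "continuous_on {za..zb} qq" unfolding qq_def by (intro continuous_intros)
  show "continuous_on {za..zb} (\<lambda>z. fold_G Xm z)"
    by (rule lipschitz_imp_continuous_on_real[OF M0]) (intro G_lip z_in)
qed

lemma lam_pos: "z \<in> {za..zb} \<Longrightarrow> 0 < lam z" "z \<in> {za..zb} \<Longrightarrow> 0 < mus z"
  unfolding lam_def mus_def by (intro scale_positive coeff_pos; assumption)+

lemma lam_bounds: obtains l u where "0 < l" "0 < u" "\<And>z. z \<in> {za..zb} \<Longrightarrow> l \<le> lam z \<and> lam z \<le> u"
proof -
  have ne: "\<forall>z\<in>{za..zb}. 2 * fold_A Xm z \<noteq> 0" "\<forall>z\<in>{za..zb}. qq z \<noteq> 0" "\<forall>z\<in>{za..zb}. 2 * fold_G Xm z \<noteq> 0"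
    using coeff_pos by fastforce+
  have "continuous_on {za..zb} lam"
    unfolding lam_def scale_x_def
    by (intro continuous_on_mult continuous_on_powr continuous_on_const coeff_continuous ne)
  then show ?thesis using positive_continuous_bounds[of za zb lam] zz lam_pos(1) that by (metis less_imp_le)
qed

lemma mus_bounds: obtains l u where "0 < l" "0 < u" "\<And>z. z \<in> {za..zb} \<Longrightarrow> l \<le> mus z \<and> mus z \<le> u"
proof -
  have ne: "\<forall>z\<in>{za..zb}. 2 * fold_A Xm z \<noteq> 0" "\<forall>z\<in>{za..zb}. qq z \<noteq> 0" "\<forall>z\<in>{za..zb}. 2 * fold_G Xm z \<noteq> 0" "\<forall>z\<in>{za..zb}. fold_A Xm z \<noteq> 0"
    using coeff_pos by fastforce+
  have "continuous_on {za..zb} mus"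
    unfolding mus_def scale_y_def scale_x_def
    by (intro continuous_on_mult continuous_on_powr continuous_on_power continuous_on_divide continuous_on_const coeff_continuous ne)
  then show ?thesis using positive_continuous_bounds[of za zb mus] zz lam_pos(2) that by (metis less_imp_le)
qed

lemma lam_mus:
  assumes "z \<in> {za..zb}"
  shows "mus z / lam z * (2 * fold_A Xm z) = qq z * mus z ^ k" "2 * fold_A Xm z * mus z / (lam z)\<^sup>2 = 2 * fold_G Xm z"
proof -
  note e = scale_equations[OF k coeff_pos[OF assms], folded lam_def mus_def]
  note p = coeff_pos[OF assms] lam_pos[OF assms]
  have "mus z = qq z / (2 * fold_A Xm z) * lam z * mus z ^ k" using e(1) by simp
  then have "mus z / lam z * (2 * fold_A Xm z) = (qq z / (2 * fold_A Xm z) * lam z * mus z ^ k) / lam z * (2 * fold_A Xm z)" by simp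
  also have "\<dots> = qq z * mus z ^ k" using p by simp
  finally show "mus z / lam z * (2 * fold_A Xm z) = qq z * mus z ^ k" .
  have "2 * fold_A Xm z * mus z / (lam z)\<^sup>2 = 2 * fold_A Xm z * (2 * fold_G Xm z / (2 * fold_A Xm z) * (lam z)\<^sup>2) / (lam z)\<^sup>2"
    using e(2) by simp
  also have "\<dots> = 2 * fold_G Xm z" using p by simp
  finally show "2 * fold_A Xm z * mus z / (lam z)\<^sup>2 = 2 * fold_G Xm z" .
qed

text \<open>The limit orbit with parameter z is the rescaled unit solution traversed at the constant
  speed \<open>2 * fold_A Xm z\<close>. The constants are uniform because the scale factors are
  continuous and positive on the compact z-range.\<close>

lemma section_instance:
  assumes Y: "0 < \<xi>" "tail_solution k 1 1 Y \<xi>" "Y \<xi> = 0"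
    and D: "\<And>x. (Y has_real_derivative - (max 0 (Y x) ^ k) - x) (at x)"
    and pos: "\<And>x. x < \<xi> \<Longrightarrow> 0 < Y x" and right: "\<And>x. \<xi> \<le> x \<Longrightarrow> Y x = (\<xi>\<^sup>2 - x\<^sup>2) / 2"
  obtains K T B c \<eta>0 v where
    "fold_section k \<phi> (phi_lead k \<phi>) d M g0 b1
      (\<lambda>p. fst (Xp (clamp3 d p))) (\<lambda>p. fst (snd (Xp (clamp3 d p)))) (\<lambda>p. snd (snd (Xp (clamp3 d p))))
      (\<lambda>p. fst (Xm (clamp3 d p))) (\<lambda>p. fst (snd (Xm (clamp3 d p)))) (\<lambda>p. snd (snd (Xm (clamp3 d p)))) (fold_G Xm)
      za zb (\<kappa> ^ (2 * k)) K (rmax / \<kappa>) T B c \<eta>0 (\<lambda>r z. \<kappa>\<^sup>2 * m (\<kappa> * r, z, emax)) v (\<lambda>z. lam z * \<xi>)"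
proof -
  obtain l1 l2 where l: "0 < l1" "0 < l2" "\<And>z. z \<in> {za..zb} \<Longrightarrow> l1 \<le> lam z \<and> lam z \<le> l2" using lam_bounds by blast
  obtain m1 m2 where mm: "0 < m1" "0 < m2" "\<And>z. z \<in> {za..zb} \<Longrightarrow> m1 \<le> mus z \<and> mus z \<le> m2" using mus_bounds by blast
  define x0 where "x0 = \<kappa> ^ (2 * k)"
  have x0: "0 < x0" using \<kappa>(1) by (simp add: x0_def)
  \<comment> \<open>The speed \<open>2 * fold_A Xm z\<close> is at least 1, so this time carries x
    from -x0 past the crossing by at least 1 for every z.\<close>
  define T where "T = x0 + l2 * \<xi> + 1"
  have T: "0 < T" using x0 l Y(1) by (auto simp: T_def intro!: add_pos_pos)
  obtain L where L: "0 < L" "\<And>p q. p \<in> box \<Longrightarrow> q \<in> box \<Longrightarrow> \<bar>m p - m q\<bar> \<le> L * norm (p - q)" using m_lipschitz by blast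
  define K where "K = \<kappa>\<^sup>2 * (L * (\<kappa> + 1))"
  obtain c0 where c0: "0 < c0" "\<And>x. - (x0 / l1) \<le> x \<Longrightarrow> x \<le> \<xi> \<Longrightarrow> c0 * (\<xi> - x) \<le> Y x"
    "\<And>x. \<xi> \<le> x \<Longrightarrow> Y x \<le> - c0 * (x - \<xi>)"
    using unit_tail_linear_bound[where Y = Y and N = "x0 / l1", OF Y(1,3) D pos right] by blast
  have A2: "fold_A Xm z \<le> M" if "z \<in> {za..zb}" for z
    unfolding fold_AB(1)[OF z_in(1)[OF that]] by (rule order_trans[OF abs_ge_self]) (rule bound, simp)
  have A1: "1 / 2 \<le> fold_A Xm z" if "z \<in> {za..zb}" for z by (rule A_ge[OF z_in(1)[OF that]])
  \<comment> \<open>Contains every rescaled abscissa reached up to time \<open>T\<close>, so that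
    one bound for \<open>Y\<close> on it serves all z.\<close>
  define S where "S = {- (x0 / l1)..2 * M * T / l1}"
  have "continuous_on S Y" by (rule DERIV_continuous_on) (rule DERIV_subset[OF D], simp)
  then have "bounded (Y ` S)" unfolding S_def by (intro compact_imp_bounded compact_continuous_image) auto
  then obtain YB where YB: "0 < YB" "\<And>s. s \<in> S \<Longrightarrow> \<bar>Y s\<bar> \<le> YB" unfolding bounded_pos by auto
  define xx where "xx z t = - x0 + 2 * fold_A Xm z * t" for z t
  define v where "v z t = (xx z t, mus z * Y (xx z t / lam z), z)" for z t
  define B where "B = 1 + x0 + 2 * M * T + m2 * YB"
  have xx_b: "- x0 \<le> xx z t" "xx z t \<le> 2 * M * T" if "z \<in> {za..zb}" "t \<in> {0..T}" for z t
  proof -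
    have "0 \<le> 2 * fold_A Xm z * t" using A1[OF that(1)] that by (intro mult_nonneg_nonneg) auto
    then show "- x0 \<le> xx z t" by (simp add: xx_def)
    have "2 * fold_A Xm z * t \<le> 2 * M * T" using A1[OF that(1)] A2[OF that(1)] that M T by (intro mult_mono) auto
    then show "xx z t \<le> 2 * M * T" using x0 by (simp add: xx_def)
  qed
  have s_in: "xx z t / lam z \<in> S" if "z \<in> {za..zb}" "t \<in> {0..T}" for z t
  proof -
    have lz: "l1 \<le> lam z" "0 < lam z" using l(3)[OF that(1)] lam_pos(1)[OF that(1)] by simp_all
    have "x0 / lam z \<le> x0 / l1" using lz l x0 by (intro divide_left_mono) auto
    moreover have "- x0 / lam z \<le> xx z t / lam z" using xx_b[OF that] lz by (intro divide_right_mono) auto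
    moreover have "xx z t / lam z \<le> 2 * M * T / lam z" using xx_b[OF that] lz by (intro divide_right_mono) auto
    moreover have "2 * M * T / lam z \<le> 2 * M * T / l1" using lz l M T by (intro divide_left_mono) auto
    ultimately show ?thesis by (simp add: S_def)
  qed
  have main: "fold_section k \<phi> (phi_lead k \<phi>) d M g0 b1
      (\<lambda>p. fst (Xp (clamp3 d p))) (\<lambda>p. fst (snd (Xp (clamp3 d p)))) (\<lambda>p. snd (snd (Xp (clamp3 d p))))
      (\<lambda>p. fst (Xm (clamp3 d p))) (\<lambda>p. fst (snd (Xm (clamp3 d p)))) (\<lambda>p. snd (snd (Xm (clamp3 d p)))) (fold_G Xm)
      za zb (\<kappa> ^ (2 * k)) K (rmax / \<kappa>) T B (m1 * c0 / l2) (l1 * \<xi>) (\<lambda>r z. \<kappa>\<^sup>2 * m (\<kappa> * r, z, emax)) v (\<lambda>z. lam z * \<xi>)"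
    unfolding x0_def[symmetric]
  proof unfold_locales
    show "- d < za" "za \<le> zb" "zb < 0" using zz by auto
    show "0 < x0" "0 < T" by fact+
    show "0 \<le> K" using L \<kappa>(1) by (simp add: K_def)
    show "0 < rmax / \<kappa>" using rpos \<kappa>(1) by simp
    show "1 \<le> B" using x0 M T mm YB by (simp add: B_def)
    show "0 < m1 * c0 / l2" using mm c0 l by simp
    show "0 < l1 * \<xi>" using l Y by simp
  next
    fix r r' \<zeta> \<zeta>' assume r: "r \<in> {0..rmax / \<kappa>}" "r' \<in> {0..rmax / \<kappa>}" and z: "\<zeta> \<in> {za..zb}" "\<zeta>' \<in> {za..zb}"
    have in': "(\<kappa> * r, \<zeta>, emax) \<in> box" if "r \<in> {0..rmax / \<kappa>}" "\<zeta> \<in> {za..zb}" for r \<zeta>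
      using that \<kappa>(1) epos by (auto simp: field_simps)
    have "\<bar>m (\<kappa> * r, \<zeta>, emax) - m (\<kappa> * r', \<zeta>', emax)\<bar> \<le> L * norm ((\<kappa> * r, \<zeta>, emax) - (\<kappa> * r', \<zeta>', emax))"
      by (rule L(2)[OF in' in']) fact+
    also have "\<dots> \<le> L * (\<kappa> * \<bar>r - r'\<bar> + \<bar>\<zeta> - \<zeta>'\<bar>)"
      using norm_r3_le[of "\<kappa> * r - \<kappa> * r'" "\<zeta> - \<zeta>'" 0] L \<kappa>(1)
      by (intro mult_left_mono) (auto simp: right_diff_distrib[symmetric] abs_mult)
    also have "\<dots> \<le> L * ((\<kappa> + 1) * (\<bar>r - r'\<bar> + \<bar>\<zeta> - \<zeta>'\<bar>))"
      using L \<kappa>(1) by (intro mult_left_mono) (auto simp: algebra_simps)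
    finally have "\<kappa>\<^sup>2 * \<bar>m (\<kappa> * r, \<zeta>, emax) - m (\<kappa> * r', \<zeta>', emax)\<bar> \<le> \<kappa>\<^sup>2 * (L * ((\<kappa> + 1) * (\<bar>r - r'\<bar> + \<bar>\<zeta> - \<zeta>'\<bar>)))"
      by (rule mult_left_mono) simp
    then show "\<bar>\<kappa>\<^sup>2 * m (\<kappa> * r, \<zeta>, emax) - \<kappa>\<^sup>2 * m (\<kappa> * r', \<zeta>', emax)\<bar> \<le> K * (\<bar>r - r'\<bar> + \<bar>\<zeta> - \<zeta>'\<bar>)"
      by (simp add: right_diff_distrib[symmetric] abs_mult K_def mult.assoc)
  next
    fix z assume z: "z \<in> {za..zb}"
    show "v z 0 = (- x0, \<kappa>\<^sup>2 * m (\<kappa> * 0, z, emax), z)"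
      using section_matching[OF z Y(2,1)] by (simp add: v_def xx_def lam_def mus_def x0_def)
    show "lam z * \<xi> + 1 \<le> fst (v z T)"
    proof -
      have "1 * T \<le> 2 * fold_A Xm z * T" using A1[OF z] T by (intro mult_right_mono) auto
      moreover have "lam z * \<xi> \<le> l2 * \<xi>" using l(3)[OF z] Y(1) by (intro mult_right_mono) auto
      ultimately show ?thesis by (simp add: v_def xx_def T_def)
    qed
    show "l1 * \<xi> \<le> lam z * \<xi>" using l(3)[OF z] Y(1) by (intro mult_right_mono) auto
    note lp = lam_pos[OF z]
    fix t assume t: "t \<in> {0..T}"
    let ?s = "xx z t / lam z"
    have sS: "?s \<in> S" by (rule s_in[OF z t])
    show "(v z has_vector_derivative V0 (v z t)) (at t within {0..T})"
    proof -
      have xD: "(xx z has_real_derivative 2 * fold_A Xm z) (at t within {0..T})"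
        unfolding xx_def by (auto intro!: derivative_eq_intros)
      have "((\<lambda>t. Y (xx z t / lam z)) has_real_derivative (- (max 0 (Y ?s) ^ k) - ?s) * (2 * fold_A Xm z / lam z)) (at t within {0..T})"
        by (rule DERIV_chain2[OF D]) (rule DERIV_cdivide[OF xD])
      then have "((\<lambda>t. mus z * Y (xx z t / lam z)) has_real_derivative mus z * ((- (max 0 (Y ?s) ^ k) - ?s) * (2 * fold_A Xm z / lam z))) (at t within {0..T})"
        by (rule DERIV_cmult)
      moreover have "mus z * ((- (max 0 (Y ?s) ^ k) - ?s) * (2 * fold_A Xm z / lam z)) =
        phi_lead k \<phi> * fold_B Xp z * max 0 (mus z * Y ?s) ^ k - 2 * fold_G Xm z * xx z t"
      proof -
        have mx: "max 0 (mus z * Y ?s) = mus z * max 0 (Y ?s)" using lp by (simp add: max_mult_distrib_left)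
        have "mus z * ((- (max 0 (Y ?s) ^ k) - ?s) * (2 * fold_A Xm z / lam z)) =
          - (mus z / lam z * (2 * fold_A Xm z)) * max 0 (Y ?s) ^ k - (2 * fold_A Xm z * mus z / (lam z)\<^sup>2) * xx z t"
          using lp by (simp add: field_simps power2_eq_square)
        also have "\<dots> = - (qq z * mus z ^ k) * max 0 (Y ?s) ^ k - 2 * fold_G Xm z * xx z t"
          unfolding lam_mus[OF z] ..
        finally show ?thesis unfolding mx power_mult_distrib by (simp add: qq_def)
      qed
      ultimately have yD: "((\<lambda>t. mus z * Y (xx z t / lam z)) has_real_derivative
        phi_lead k \<phi> * fold_B Xp z * max 0 (mus z * Y ?s) ^ k - 2 * fold_G Xm z * xx z t) (at t within {0..T})" by simp
      have V0: "V0 (v z t) = (2 * fold_A Xm z, phi_lead k \<phi> * fold_B Xp z * max 0 (mus z * Y ?s) ^ k - 2 * fold_G Xm z * xx z t, 0)"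
        using fold_AB[OF z_in(1)[OF z]] by (simp add: V0_def v_def)
      show ?thesis unfolding V0 unfolding v_def[abs_def]
        by (intro has_vector_derivative_Pair has_real_derivative_iff_has_vector_derivative[THEN iffD1] xD yD has_vector_derivative_const)
    qed
    show "\<bar>fst (v z t)\<bar> \<le> B \<and> \<bar>fst (snd (v z t))\<bar> \<le> B \<and> snd (snd (v z t)) = z"
    proof -
      have p: "0 \<le> 2 * M * T" "0 \<le> m2 * YB" using M T mm YB by auto
      have "\<bar>mus z * Y ?s\<bar> \<le> m2 * YB" unfolding abs_mult using mm(3)[OF z] lp YB(2)[OF sS] by (intro mult_mono) auto
      then show ?thesis using xx_b[OF z t] x0 p by (auto simp: v_def B_def)
    qed
    have Yl: "mus z * (c0 * (\<xi> - ?s)) = mus z * c0 / lam z * (lam z * \<xi> - xx z t)" using lp by (simp add: field_simps)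
    \<comment> \<open>Rescaling multiplies slopes by \<open>mus z / lam z\<close>; the smallest
      possible value gives the common transversality constant.\<close>
    have cle: "m1 * c0 / l2 \<le> mus z * c0 / lam z" using mm(3)[OF z] l(3)[OF z] lp mm c0 by (intro frac_le mult_right_mono) auto
    show "fst (v z t) \<le> lam z * \<xi> \<Longrightarrow> m1 * c0 / l2 * (lam z * \<xi> - fst (v z t)) \<le> fst (snd (v z t))"
    proof -
      assume "fst (v z t) \<le> lam z * \<xi>"
      then have le: "xx z t \<le> lam z * \<xi>" by (simp add: v_def)
      then have "?s \<le> \<xi>" using lp by (simp add: field_simps)
      then have "c0 * (\<xi> - ?s) \<le> Y ?s" using sS by (intro c0(2)) (auto simp: S_def)
      then have "mus z * (c0 * (\<xi> - ?s)) \<le> mus z * Y ?s" using lp by (intro mult_left_mono) auto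
      moreover have "m1 * c0 / l2 * (lam z * \<xi> - xx z t) \<le> mus z * c0 / lam z * (lam z * \<xi> - xx z t)"
        using cle le by (intro mult_right_mono) auto
      ultimately show ?thesis unfolding Yl by (simp add: v_def)
    qed
    show "lam z * \<xi> \<le> fst (v z t) \<Longrightarrow> fst (snd (v z t)) \<le> - (m1 * c0 / l2) * (fst (v z t) - lam z * \<xi>)"
    proof -
      assume "lam z * \<xi> \<le> fst (v z t)"
      then have le: "lam z * \<xi> \<le> xx z t" by (simp add: v_def)
      then have "\<xi> \<le> ?s" using lp by (simp add: field_simps)
      then have "Y ?s \<le> - c0 * (?s - \<xi>)" by (rule c0(3))
      then have "mus z * Y ?s \<le> mus z * (c0 * (\<xi> - ?s))" using lp by (intro mult_left_mono) (auto simp: algebra_simps)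
      moreover have "m1 * c0 / l2 * (xx z t - lam z * \<xi>) \<le> mus z * c0 / lam z * (xx z t - lam z * \<xi>)"
        using cle le by (intro mult_right_mono) auto
      moreover have "mus z * c0 / lam z * (lam z * \<xi> - xx z t) = - (mus z * c0 / lam z * (xx z t - lam z * \<xi>))"
        by (simp only: minus_mult_right minus_diff_eq)
      ultimately have "mus z * Y ?s \<le> - (m1 * c0 / l2 * (xx z t - lam z * \<xi>))" unfolding Yl by linarith
      then show ?thesis by (simp add: v_def)
    qed
  qed
  show ?thesis by (rule that[OF main])
qed

end

section \<open>The crossing curve\<close>

context fold_chart begin

text \<open>Uniqueness of orbits at fixed r identifies the given orbit with \<open>u\<close>, so
  \<open>t1\<close> cannot precede the first zero \<open>\<tau>\<close>. A later zero is excluded by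
  the barrier lemma for y. There x is only known to be at most \<open>\<rho>\<close>, not small with
  r, and \<open>M * \<rho> \<le> g0 / 2\<close> controls the quadratic term in x.\<close>

lemma crossing_unique:
  assumes r: "0 < r" "r \<le> 1" and \<rho>: "0 < \<rho>" "\<rho> \<le> d" "M * \<rho> \<le> g0 / 2" and xm: "0 < xm" "M * r\<^sup>2 < g0 / 2 * xm"
    and \<epsilon>: "r ^ (2 * (2 * k - 1)) \<le> d" and \<tau>: "0 \<le> \<tau>"
    and u: "\<And>s. s \<in> {0..\<tau>} \<Longrightarrow> (u has_vector_derivative V r (u s)) (at s within {0..\<tau>})"
    and ypos: "\<And>s. s \<in> {0..<\<tau>} \<Longrightarrow> 0 < fst (snd (u s))" and y0: "fst (snd (u \<tau>)) = 0" and x\<tau>: "xm \<le> fst (u \<tau>)"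
    and t01: "t0 \<le> t1"
    and w: "\<And>t. t \<in> {t0..t1} \<Longrightarrow> (w has_vector_derivative SF (r ^ (2 * (2 * k - 1))) (w t)) (at t within {t0..t1})"
    and wb: "\<And>t. t \<in> {t0..t1} \<Longrightarrow> \<bar>fst (w t)\<bar> \<le> \<rho> \<and> \<bar>snd (snd (w t))\<bar> \<le> d"
    and w0: "w t0 = chart2 r (u 0)" and w1: "fst (snd (w t1)) = 0"
  shows "w t1 = chart2 r (u \<tau>)"
proof -
  define c where "c = r ^ (2 * (k - 1))"
  have c: "0 < c" using r by (simp add: c_def)
  define s1 where "s1 = c * (t1 - t0)"
  have s1: "0 \<le> s1" using c t01 by (simp add: s1_def)
  define q where "q s = chart2_inv r (w (t0 + s / c))" for s
  have im: "t0 + s / c \<in> {t0..t1}" if "s \<in> {0..s1}" for s using that c by (auto simp: s1_def field_simps)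
  have qw: "w (t0 + s / c) = chart2 r (q s)" for s using r by (simp add: q_def chart2_inverse)
  have qD: "(q has_vector_derivative V r (q s)) (at s within {0..s1})" if "s \<in> {0..s1}" for s
    using solution_to_chart2[OF r(1) w, of s] that unfolding q_def[abs_def] c_def s1_def by simp
  have q1: "w t1 = chart2 r (q s1)" using qw[of s1] c by (simp add: s1_def)
  have q0: "q 0 = u 0" using r by (simp add: q_def w0 chart2_inverse)
  have yq1: "fst (snd (q s1)) = 0" using w1 r unfolding q1 by (simp add: chart2_def split_beta)
  obtain L where L: "0 < L" "\<And>u v. norm (V r u - V r v) \<le> L * norm (u - v)" using V_lipschitz[OF r] by blast
  have agree: "q s = u s" if "s \<in> {0..min s1 \<tau>}" for s
  proof (rule ode_unique[where u = q and v = u and u' = "\<lambda>s. V r (q s)" and v' = "\<lambda>s. V r (u s)" and a = 0 and b = "min s1 \<tau>" and L = L])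
    show "0 \<le> L" using L(1) by simp
    show "norm (V r (q t) - V r (u t)) \<le> L * norm (q t - u t)" for t by (rule L(2))
    show "q 0 = u 0" by (rule q0)
    show "s \<in> {0..min s1 \<tau>}" by fact
    fix t assume t: "t \<in> {0..min s1 \<tau>}"
    show "(q has_vector_derivative V r (q t)) (at t within {0..min s1 \<tau>})"
      by (rule has_vector_derivative_within_subset[OF qD]) (use t in auto)
    show "(u has_vector_derivative V r (u t)) (at t within {0..min s1 \<tau>})"
      by (rule has_vector_derivative_within_subset[OF u]) (use t in auto)
  qed
  have ge: "\<tau> \<le> s1"
  proof (rule ccontr)
    assume "\<not> \<tau> \<le> s1"
    then have "q s1 = u s1" "0 < fst (snd (u s1))" using agree[of s1] ypos[of s1] s1 by auto
    then show False using yq1 by simp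
  qed
  have q\<tau>: "q \<tau> = u \<tau>" using agree[of \<tau>] ge \<tau> by simp
  have "s1 = \<tau>"
  proof (rule ccontr)
    assume "s1 \<noteq> \<tau>"
    then have lt: "\<tau> < s1" using ge by simp
    have qD': "(q has_vector_derivative V r (q s)) (at s within {\<tau>..t})" if "s \<in> {\<tau>..t}" "t \<le> s1" for s t
      by (rule has_vector_derivative_within_subset[OF qD]) (use that \<tau> in auto)
    have "fst (snd (q s1)) < 0"
    proof (rule derivative_neg_at_zeros_imp_neg[where f = "\<lambda>s. fst (snd (q s))" and f' = "\<lambda>s. fst (snd (V r (q s)))" and a = \<tau> and b = s1])
      show "((\<lambda>s. fst (snd (q s))) has_real_derivative fst (snd (V r (q t)))) (at t within {\<tau>..s1})" if "t \<in> {\<tau>..s1}" for t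
        by (rule r3_has_derivative_components(2)[OF qD']) (use that in auto)
      show "fst (snd (q \<tau>)) \<le> 0" using q\<tau> y0 by simp
      show "s1 \<in> {\<tau><..s1}" using lt by simp
      fix t assume t: "t \<in> {\<tau>..s1}" and yt: "fst (snd (q t)) = 0" and past: "\<And>s. s \<in> {\<tau>..t} \<Longrightarrow> fst (snd (q s)) \<le> 0"
      \<comment> \<open>The history y \<le> 0 means \<phi> = -1, so x has not decreased since
        \<open>\<tau>\<close> and is still at least \<open>xm\<close>.\<close>
      have "(\<lambda>s. - fst (q s)) t \<le> (\<lambda>s. - fst (q s)) \<tau>"
      proof (rule derivative_nonpos_within_imp_le[where f = "\<lambda>s. - fst (q s)" and f' = "\<lambda>s. - fst (V r (q s))" and a = \<tau> and b = t])
        show "\<tau> \<le> t" using t by simp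
        fix s assume s: "s \<in> {\<tau>..t}"
        show "((\<lambda>s. - fst (q s)) has_real_derivative - fst (V r (q s))) (at s within {\<tau>..t})"
          by (rule DERIV_minus[OF r3_has_derivative_components(1)[OF qD']]) (use s t in auto)
        obtain x y z where q: "q s = (x, y, z)" by (cases "q s")
        have "r\<^sup>2 * y \<le> 0" using past[OF s] by (simp add: q mult_nonneg_nonpos)
        then have "fst (V r (q s)) = 2 * fst (Xm (clamp3 d (arg r (q s))))" by (simp add: V_def q phi_shift_low)
        then show "- fst (V r (q s)) \<le> 0" using g1_ge[of "arg r (q s)"] by simp
      qed
      then have xt: "xm \<le> fst (q t)" using x\<tau> q\<tau> by simp
      obtain x z where q: "q t = (x, 0, z)" using yt by (metis prod.collapse)
      have x: "xm \<le> x" using xt q by simp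
      define X where "X = r ^ (2 * k) * x"
      define e where "e = r ^ (2 * (2 * k - 1))"
      have wt: "w (t0 + t / c) = (X, 0, z)" using qw[of t] by (simp add: q chart2_def X_def)
      have b: "\<bar>X\<bar> \<le> \<rho>" "\<bar>z\<bar> \<le> d" using wb[OF im[of t]] t \<tau> wt by auto
      have rk: "0 < r ^ (2 * k)" using r by simp
      have X0: "r ^ (2 * k) * xm \<le> X" unfolding X_def using x rk by simp
      have e0: "0 \<le> e" using r by (simp add: e_def)
      have ee: "e \<le> r ^ (2 * k) * r\<^sup>2" unfolding e_def using r by (intro eps_le) auto
      have Xp: "0 < X" using X0 rk xm(1) by (meson less_le_trans mult_pos_pos)
      define g where "g = fst (snd (Xm (clamp3 d (X, - e, z))))"
      have "\<bar>g + fold_G Xm z * X\<bar> \<le> M * (X\<^sup>2 + \<bar>- e\<bar>)"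
        unfolding g_def using b \<rho> \<epsilon> e0 by (intro g2_approx) (auto simp: e_def)
      then have "g \<le> M * (X\<^sup>2 + e) - fold_G Xm z * X" using e0 by simp
      moreover have "g0 * X \<le> fold_G Xm z * X" using G_ge[OF b(2)] Xp by (intro mult_right_mono) auto
      moreover have "M * X\<^sup>2 \<le> g0 / 2 * X"
      proof -
        have "M * X \<le> M * \<rho>" using b M by (intro mult_left_mono) auto
        then have "M * X * X \<le> g0 / 2 * X" using \<rho>(3) Xp by (intro mult_right_mono) auto
        then show ?thesis by (simp add: power2_eq_square mult.assoc)
      qed
      \<comment> \<open>The term from \<open>\<epsilon> * (y - 1)\<close> is smaller than the
        x-scale by a factor \<open>r\<^sup>2\<close>, hence smaller than half of the linear term as
        soon as \<open>M * r\<^sup>2 < g0 / 2 * xm\<close>.\<close>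
      moreover have "M * e < g0 / 2 * X"
      proof -
        have "M * e \<le> M * (r ^ (2 * k) * r\<^sup>2)" using ee M by (intro mult_left_mono) auto
        also have "\<dots> = r ^ (2 * k) * (M * r\<^sup>2)" by simp
        also have "\<dots> < r ^ (2 * k) * (g0 / 2 * xm)" using rk xm(2) by (intro mult_strict_left_mono)
        also have "\<dots> = g0 / 2 * (r ^ (2 * k) * xm)" by simp
        also have "\<dots> \<le> g0 / 2 * X" using X0 g0 by (intro mult_left_mono) auto
        finally show ?thesis .
      qed
      ultimately have "g < 0" by (simp add: distrib_left)
      moreover have "fst (snd (V r (q t))) = 2 * g / r ^ (2 * k)"
        by (simp add: V_def q arg_def phi_shift_low g_def X_def e_def phi_low)
      ultimately show "fst (snd (V r (q t))) < 0" using rk by (simp add: divide_neg_pos)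
    qed
    then show False using yq1 by simp
  qed
  then show ?thesis using q1 q\<tau> by simp
qed

end

section \<open>Continuation of the leaf beyond the section\<close>

context fold_center begin

abbreviation sec :: "real \<Rightarrow> real \<Rightarrow> r3" where
  "sec r \<zeta> \<equiv> (- (\<kappa> ^ (2 * k)), \<kappa>\<^sup>2 * m (\<kappa> * r, \<zeta>, emax), \<zeta>)"

lemma chart2_sec: "chart2 r (sec r \<zeta>) = (- ((\<kappa> * r) ^ (2 * k)), (\<kappa> * r)\<^sup>2 * m (\<kappa> * r, \<zeta>, emax), \<zeta>)"
  by (simp add: chart2_def power_mult_distrib)

lemma kr_power: "(\<kappa> * r) ^ (2 * (2 * k - 1)) * emax = r ^ (2 * (2 * k - 1))"
proof -
  have "(\<kappa> * r) ^ (2 * (2 * k - 1)) * emax = (\<kappa> ^ (2 * (2 * k - 1)) * emax) * r ^ (2 * (2 * k - 1))"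
    unfolding power_mult_distrib by simp
  then show ?thesis unfolding \<kappa>(2) by simp
qed

lemma region_subset:
  assumes "\<rho> \<le> d" "case p of (x, y, z) \<Rightarrow> \<bar>x\<bar> \<le> \<rho> \<and> \<bar>\<epsilon> * (y - 1)\<bar> \<le> \<rho> \<and> z \<in> {za..zb}"
  shows "p \<in> region \<epsilon>"
  using assms zz by (auto simp: region_def)

text \<open>Points of the section e = emax belong to the slow manifold itself, so orbits that start
  there lie in its continuation as long as they remain in the neighbourhood.\<close>

lemma forward_continuation_sec:
  assumes r: "0 < r" "\<kappa> * r \<le> rmax" and \<rho>: "\<rho> \<le> d" and \<tau>: "0 \<le> \<tau>" and \<zeta>: "\<zeta> \<in> {za..zb}"
    and u: "\<And>s. s \<in> {0..\<tau>} \<Longrightarrow> (u has_vector_derivative V r (u s)) (at s within {0..\<tau>})" and u0: "u 0 = sec r \<zeta>"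
    and bd: "\<And>s. s \<in> {0..\<tau>} \<Longrightarrow> r ^ (2 * k) * \<bar>fst (u s)\<bar> \<le> \<rho> \<and>
      \<bar>r ^ (2 * (2 * k - 1)) * (r\<^sup>2 * fst (snd (u s)) - 1)\<bar> \<le> \<rho> \<and> snd (snd (u s)) \<in> {za..zb}"
  shows "chart2 r (u \<tau>) \<in> forward_continuation \<phi> Xp Xm {za..zb} \<rho> (r ^ (2 * (2 * k - 1)))
    (slow_manifold k {za..zb} rmax emax m (r ^ (2 * (2 * k - 1))))"
proof -
  define e where "e = r ^ (2 * (2 * k - 1))"
  define c where "c = r ^ (2 * (k - 1))"
  have c: "0 < c" using r by (simp add: c_def)
  define w where "w t = chart2 r (u (c * t))" for t
  have con: "case w t of (x, y, z) \<Rightarrow> \<bar>x\<bar> \<le> \<rho> \<and> \<bar>e * (y - 1)\<bar> \<le> \<rho> \<and> z \<in> {za..zb}" if "t \<in> {0..\<tau> / c}" for t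
  proof -
    have "c * t \<in> {0..\<tau>}" using that c by (auto simp: field_simps)
    from bd[OF this] show ?thesis using r by (auto simp: w_def chart2_def e_def abs_mult split: prod.splits)
  qed
  have wD: "(w has_vector_derivative slow_fast_field \<phi> Xp Xm e (w t)) (at t within {0..\<tau> / c})" if t: "t \<in> {0..\<tau> / c}" for t
    unfolding regularized_field_region(2)[OF region_subset[OF \<rho> con[OF t]]]
    using solution_from_chart2[OF r(1) u, of t] t unfolding w_def[abs_def] c_def e_def by simp
  have "w 0 \<in> slow_manifold k {za..zb} rmax emax m e"
    unfolding slow_manifold_def
  proof (intro CollectI exI conjI)
    show "w 0 = (- ((\<kappa> * r) ^ (2 * k)), (\<kappa> * r)\<^sup>2 * m (\<kappa> * r, \<zeta>, emax), \<zeta>)"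
      using u0 chart2_sec by (simp add: w_def)
    show "\<kappa> * r \<in> {0<..rmax}" using r \<kappa>(1) by simp
    show "\<zeta> \<in> {za..zb}" by fact
    show "emax \<in> {0..emax}" using epos by simp
    show "(\<kappa> * r) ^ (2 * (2 * k - 1)) * emax = e" unfolding e_def by (rule kr_power)
  qed
  moreover have "w (\<tau> / c) = chart2 r (u \<tau>)" using c by (simp add: w_def)
  moreover have "0 \<le> \<tau> / c" using \<tau> c by simp
  ultimately show ?thesis
    unfolding forward_continuation_def e_def[symmetric] using wD con
    by (intro CollectI exI[of _ w] exI[of _ "\<tau> / c"]) auto
qed

text \<open>The converse direction: every way of reaching y = 0 from any point of the leaf passes
  through the section, so crossings are described by orbits starting there.\<close>

lemma forward_continuation_reaches_sec:
  assumes r: "0 < r" "\<kappa> * r \<le> rmax" and \<rho>: "\<rho> \<le> d"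
    and mb: "0 < Bm" "\<And>p. p \<in> box \<Longrightarrow> \<bar>m p\<bar> \<le> Bm" and eB: "r ^ (2 * (2 * k - 1)) * (1 + Bm) \<le> d"
    and pos: "\<And>r' z e. (r', z, e) \<in> box \<Longrightarrow> r' ^ (2 * (2 * k - 1)) * e = r ^ (2 * (2 * k - 1)) \<Longrightarrow>
       0 < m (r', z, e) \<and> 0 < F1 (r ^ (2 * (2 * k - 1))) (- (r' ^ (2 * k)), r'\<^sup>2 * m (r', z, e), z)"
    and p: "p \<in> forward_continuation \<phi> Xp Xm {za..zb} \<rho> (r ^ (2 * (2 * k - 1)))
      (slow_manifold k {za..zb} rmax emax m (r ^ (2 * (2 * k - 1))))" "fst (snd p) = 0"
  obtains w t0 t1 \<zeta> where "\<zeta> \<in> {za..zb}" "t0 \<le> t1" "w t1 = p" "w t0 = chart2 r (sec r \<zeta>)"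
    "\<And>t. t \<in> {t0..t1} \<Longrightarrow> (w has_vector_derivative SF (r ^ (2 * (2 * k - 1))) (w t)) (at t within {t0..t1})"
    "\<And>t. t \<in> {t0..t1} \<Longrightarrow> \<bar>fst (w t)\<bar> \<le> \<rho> \<and> \<bar>snd (snd (w t))\<bar> \<le> d"
proof -
  define e where "e = r ^ (2 * (2 * k - 1))"
  have e: "0 < e" using r by (simp add: e_def)
  obtain w t1 where w: "p = w t1" "0 \<le> t1" "w 0 \<in> slow_manifold k {za..zb} rmax emax m e"
    "\<And>t. t \<in> {0..t1} \<Longrightarrow> (w has_vector_derivative slow_fast_field \<phi> Xp Xm e (w t)) (at t within {0..t1})"
    "\<And>t. t \<in> {0..t1} \<Longrightarrow> (case w t of (x, y, z) \<Rightarrow> \<bar>x\<bar> \<le> \<rho> \<and> \<bar>e * (y - 1)\<bar> \<le> \<rho> \<and> z \<in> {za..zb})"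
    using p(1) unfolding forward_continuation_def e_def[symmetric] by auto
  have wD: "(w has_vector_derivative SF e (w t)) (at t within {0..t1})" if t: "t \<in> {0..t1}" for t
    using w(4)[OF t] unfolding regularized_field_region(2)[OF region_subset[OF \<rho> w(5)[OF t]]] .
  have wz: "snd (snd (w t)) \<in> {za..zb}" "\<bar>fst (w t)\<bar> \<le> \<rho>" if t: "t \<in> {0..t1}" for t
    using w(5)[OF t] by (auto split: prod.splits)
  have yT: "fst (snd (w t1)) = 0" using p(2) w(1) by simp
  have rs: "0 < \<kappa> * r" "(\<kappa> * r) ^ (2 * (2 * k - 1)) * emax = e"
    using r \<kappa>(1) kr_power by (auto simp: e_def)
  obtain t0 where t0: "t0 \<in> {0..t1}"
    "w t0 = (- ((\<kappa> * r) ^ (2 * k)), (\<kappa> * r)\<^sup>2 * m (\<kappa> * r, snd (snd (w t0)), emax), snd (snd (w t0)))"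
    by (rule leaf_reaches_section[OF e mb eB[folded e_def] rs(1) r(2) rs(2) pos[folded e_def] w(2) wD wz(1) w(3) yT])
  show ?thesis
  proof (rule that[of "snd (snd (w t0))" t0 t1 w])
    show "snd (snd (w t0)) \<in> {za..zb}" by (rule wz(1)[OF t0(1)])
    show "t0 \<le> t1" using t0 by simp
    show "w t1 = p" using w by simp
    show "w t0 = chart2 r (sec r (snd (snd (w t0))))" using t0(2) unfolding chart2_sec .
    fix t assume t: "t \<in> {t0..t1}"
    then have t': "t \<in> {0..t1}" using t0 by auto
    show "(w has_vector_derivative SF (r ^ (2 * (2 * k - 1))) (w t)) (at t within {t0..t1})"
      unfolding e_def[symmetric] by (rule has_vector_derivative_within_subset[OF wD[OF t']]) (use t0 in auto)
    show "\<bar>fst (w t)\<bar> \<le> \<rho> \<and> \<bar>snd (snd (w t))\<bar> \<le> d" using wz[OF t'] z_in(1) by auto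
  qed
qed

text \<open>The map \<open>zc\<close> from the starting parameter to z at the crossing differs from
  the identity by a function with Lipschitz constant 1/2, so it is injective with Lipschitz inverse.
  It moves the ends of the z-range by at most r, so by the intermediate value theorem it covers the
  interval from \<open>z1\<close> to \<open>z2\<close>.\<close>

lemma crossing_curve_chart2:
  assumes \<rho>: "0 < \<rho>" "\<rho> \<le> d" "M * \<rho> \<le> g0 / 2" and z12: "za < z1" "z1 \<le> z2" "z2 < zb"
  obtains C r0 where "0 \<le> C" "0 < r0" "r0 \<le> 1"
    "\<And>r. \<lbrakk>0 < r; r \<le> r0\<rbrakk> \<Longrightarrow> \<exists>X. continuous_on {z1..z2} X \<and>
      forward_continuation \<phi> Xp Xm {za..zb} \<rho> (r ^ (2 * (2 * k - 1)))
          (slow_manifold k {za..zb} rmax emax m (r ^ (2 * (2 * k - 1))))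
        \<inter> {(x, y, z). y = 0 \<and> z \<in> {z1..z2}} = (\<lambda>z. (X z, 0, z)) ` {z1..z2} \<and>
      (\<forall>z\<in>{z1..z2}. \<bar>X z - r ^ (2 * k) * eta k \<phi> Xp Xm z\<bar> \<le> r ^ (2 * k) * (C * r))"
proof -
  obtain Y and \<xi> :: real where Y: "0 < \<xi>" "tail_solution k 1 1 Y \<xi>" "Y \<xi> = 0"
    "\<And>x. (Y has_real_derivative - (max 0 (Y x) ^ k) - x) (at x)"
    "\<And>x. x < \<xi> \<Longrightarrow> 0 < Y x" "\<And>x. \<xi> \<le> x \<Longrightarrow> Y x = (\<xi>\<^sup>2 - x\<^sup>2) / 2"
    by (rule unit_tail_solution_exists[OF k]; (rule that)?; assumption)
  have eta_eq: "eta k \<phi> Xp Xm z = lam z * \<xi>" if "z \<in> {za..zb}" for z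
    using crossing_value_scale(2)[OF k coeff_pos[OF that] Y(2,3)] by (simp add: eta_def lam_def qq_def)
  obtain K T B c \<eta>0 v where sect: "fold_section k \<phi> (phi_lead k \<phi>) d M g0 b1
      (\<lambda>p. fst (Xp (clamp3 d p))) (\<lambda>p. fst (snd (Xp (clamp3 d p)))) (\<lambda>p. snd (snd (Xp (clamp3 d p))))
      (\<lambda>p. fst (Xm (clamp3 d p))) (\<lambda>p. fst (snd (Xm (clamp3 d p)))) (\<lambda>p. snd (snd (Xm (clamp3 d p)))) (fold_G Xm)
      za zb (\<kappa> ^ (2 * k)) K (rmax / \<kappa>) T B c \<eta>0 (\<lambda>r z. \<kappa>\<^sup>2 * m (\<kappa> * r, z, emax)) v (\<lambda>z. lam z * \<xi>)"
    by (rule section_instance[OF Y(1-3) Y(4) Y(5) Y(6)]; (rule that)?; assumption)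
  interpret S: fold_section k \<phi> "phi_lead k \<phi>" d M g0 b1
      "\<lambda>p. fst (Xp (clamp3 d p))" "\<lambda>p. fst (snd (Xp (clamp3 d p)))" "\<lambda>p. snd (snd (Xp (clamp3 d p)))"
      "\<lambda>p. fst (Xm (clamp3 d p))" "\<lambda>p. fst (snd (Xm (clamp3 d p)))" "\<lambda>p. snd (snd (Xm (clamp3 d p)))" "fold_G Xm"
      za zb "\<kappa> ^ (2 * k)" K "rmax / \<kappa>" T B c \<eta>0 "\<lambda>r z. \<kappa>\<^sup>2 * m (\<kappa> * r, z, emax)" v "\<lambda>z. lam z * \<xi>"
    by (rule sect)
  obtain Cx rx where cx: "0 \<le> Cx" "0 < rx" "rx \<le> 1" "rx \<le> rmax / \<kappa>"
    "\<And>r \<zeta> u. \<lbrakk>0 < r; r \<le> rx; \<zeta> \<in> {za..zb}; S.sol r \<zeta> u\<rbrakk> \<Longrightarrow> \<exists>\<tau>. S.crossing r u \<tau>"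
    "\<And>r \<zeta> \<zeta>' u \<tau>. \<lbrakk>0 < r; r \<le> rx; \<zeta> \<in> {za..zb}; \<zeta>' \<in> {za..zb}; \<bar>\<zeta> - \<zeta>'\<bar> \<le> r; S.sol r \<zeta> u; S.crossing r u \<tau>\<rbrakk> \<Longrightarrow>
      \<bar>fst (u \<tau>) - lam \<zeta>' * \<xi>\<bar> \<le> Cx * r \<and> \<eta>0 / 2 \<le> fst (u \<tau>)"
    "\<And>r \<zeta> u t. \<lbrakk>0 < r; r \<le> rx; \<zeta> \<in> {za..zb}; S.sol r \<zeta> u; t \<in> {0..T}\<rbrakk> \<Longrightarrow>
      \<bar>fst (u t)\<bar> \<le> B + 1 \<and> \<bar>fst (snd (u t))\<bar> \<le> B + 1 \<and>
      \<bar>snd (snd (u t)) - \<zeta>\<bar> \<le> r \<and> - d \<le> snd (snd (u t)) \<and> snd (snd (u t)) \<le> zb / 2"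
    by (rule S.crossing_exists; (rule that)?; assumption)
  obtain Cl rl where cl: "0 \<le> Cl" "0 < rl" "rl \<le> 1" "rl \<le> rmax / \<kappa>"
    "\<And>r \<zeta> \<zeta>' u u' \<tau> \<tau>'. \<lbrakk>0 < r; r \<le> rl; \<zeta> \<in> {za..zb}; \<zeta>' \<in> {za..zb}; S.sol r \<zeta> u; S.sol r \<zeta>' u'; S.crossing r u \<tau>; S.crossing r u' \<tau>'\<rbrakk> \<Longrightarrow>
      \<bar>fst (u \<tau>) - fst (u' \<tau>')\<bar> \<le> Cl * \<bar>\<zeta> - \<zeta>'\<bar> \<and>
      \<bar>(snd (snd (u \<tau>)) - snd (snd (u' \<tau>'))) - (\<zeta> - \<zeta>')\<bar> \<le> Cl * r * \<bar>\<zeta> - \<zeta>'\<bar>"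
    by (rule S.crossing_lipschitz; (rule that)?; assumption)
  obtain e0 where e0: "0 < e0" "\<And>r z e. (r, z, e) \<in> box \<Longrightarrow> r ^ (2 * (2 * k - 1)) * e < e0 \<Longrightarrow>
       0 < m (r, z, e) \<and> 0 < F1 (r ^ (2 * (2 * k - 1)) * e) (- (r ^ (2 * k)), r\<^sup>2 * m (r, z, e), z)"
    by (rule leaf_positive; (rule that)?; assumption)
  obtain Bm where Bm: "0 < Bm" "\<And>p. p \<in> box \<Longrightarrow> \<bar>m p\<bar> \<le> Bm" by (rule m_bounded; (rule that)?; assumption)
  \<comment> \<open>The entry with \<open>Cl\<close> gives the Lipschitz constant 1/2; those with
    \<open>z1\<close>, \<open>z2\<close> leave room for two drifts of size r; \<open>e0\<close> and
    \<open>Bm\<close> serve the arrival at the section; \<open>\<rho> / (B + 2)\<close> keeps the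
    orbits in the neighbourhood; the last one excludes a second crossing.\<close>
  define r0 where "r0 = Min {rx, rl, 1 / (2 * (Cl + 1)), (z1 - za) / 2, (zb - z2) / 2, e0 / 2, d / (1 + Bm), \<rho> / (B + 2),
    g0 * \<eta>0 / (8 * M)}"
  note B1 = S.B and h0 = S.\<eta>0
  have r0_le: "r0 \<le> rx" "r0 \<le> rl" "r0 \<le> 1 / (2 * (Cl + 1))" "r0 \<le> (z1 - za) / 2" "r0 \<le> (zb - z2) / 2" "r0 \<le> e0 / 2"
      "r0 \<le> d / (1 + Bm)" "r0 \<le> \<rho> / (B + 2)" "r0 \<le> g0 * \<eta>0 / (8 * M)"
    unfolding r0_def by (rule Min_le; simp)+
  have r0_pos: "0 < r0"
  proof -
    have "0 < Cl + 1" "0 < B + 2" "0 < M" "0 < g0 * \<eta>0" "0 < d / (1 + Bm)" using cl(1) B1 M g0 h0 d(1) Bm(1) by simp_all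
    moreover have "0 < (z1 - za) / 2" "0 < (zb - z2) / 2" "0 < e0 / 2" using z12(1,3) e0(1) by simp_all
    moreover have "0 < 1 / (2 * (Cl + 1))" using calculation(1) by simp
    moreover have "0 < \<rho> / (B + 2)" by (rule divide_pos_pos[OF \<rho>(1) calculation(2)])
    moreover have "0 < g0 * \<eta>0 / (8 * M)" by (rule divide_pos_pos[OF calculation(4)]) (use calculation(3) in simp)
    ultimately show ?thesis unfolding r0_def using cx(2) cl(2) by (simp only: Min_gr_iff finite_insert finite.emptyI insert_not_empty ball_simps simp_thms not_False_eq_True)
  qed
  have main: "\<exists>X. continuous_on {z1..z2} X \<and>
      forward_continuation \<phi> Xp Xm {za..zb} \<rho> (r ^ (2 * (2 * k - 1)))
          (slow_manifold k {za..zb} rmax emax m (r ^ (2 * (2 * k - 1))))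
        \<inter> {(x, y, z). y = 0 \<and> z \<in> {z1..z2}} = (\<lambda>z. (X z, 0, z)) ` {z1..z2} \<and>
      (\<forall>z\<in>{z1..z2}. \<bar>X z - r ^ (2 * k) * eta k \<phi> Xp Xm z\<bar> \<le> r ^ (2 * k) * (Cx * r))"
    if r: "0 < r" "r \<le> r0" for r
  proof -
    define e where "e = r ^ (2 * (2 * k - 1))"
    have rle: "r \<le> rx" "r \<le> rl" "r \<le> 1" "2 * r \<le> z1 - za" "2 * r \<le> zb - z2" "r < e0"
      using r(2) r0_le(1) r0_le(2) r0_le(4) r0_le(5) r0_le(6) cx(3) e0(1) by simp_all
    have r_mult: "r * (2 * (Cl + 1)) \<le> 1" "r * (1 + Bm) \<le> d" "r * (B + 2) \<le> \<rho>" "r * (8 * M) \<le> g0 * \<eta>0"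
      using r(2) r0_le(3,7,8,9) cl(1) Bm(1) B1 M by (simp_all add: pos_le_divide_eq[symmetric])
    have kr: "\<kappa> * r \<le> rmax"
      using mult_left_mono[OF order_trans[OF rle(1) cx(4)], of \<kappa>] \<kappa>(1) by simp
    have pw_le: "r ^ n \<le> r" if "0 < n" for n using power_decreasing[of 1 n r] that r(1) rle(3) by simp
    have e_pos: "0 < e" and e_le: "e \<le> r" using r k pw_le[of "2 * (2 * k - 1)"] by (auto simp: e_def)
    have rk_le: "r ^ (2 * k) \<le> r" using k by (intro pw_le) auto
    have r2: "r\<^sup>2 \<le> r" by (intro pw_le) auto
    have Tpos: "0 \<le> T" using S.T by simp
    define W where "W \<zeta> = (SOME u. S.sol r \<zeta> u)" for \<zeta>
    have W: "S.sol r \<zeta> (W \<zeta>)" for \<zeta>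
    proof -
      obtain u where "u 0 = sec r \<zeta>" "\<And>t. t \<in> {0..T} \<Longrightarrow> (u has_vector_derivative V r (u t)) (at t within {0..T})"
        by (rule V_flow_exists[OF r(1) rle(3) Tpos]; (rule that)?; assumption)
      then have "S.sol r \<zeta> u" unfolding S.sol_def by (intro conjI ballI)
      then show ?thesis unfolding W_def by (rule someI[where P = "S.sol r \<zeta>"])
    qed
    define \<tau> where "\<tau> \<zeta> = (SOME t. S.crossing r (W \<zeta>) t)" for \<zeta>
    have \<tau>: "S.crossing r (W \<zeta>) (\<tau> \<zeta>)" if "\<zeta> \<in> {za..zb}" for \<zeta>
      unfolding \<tau>_def by (rule someI_ex) (rule cx(5)[OF r(1) rle(1) that W])
    define xc where "xc \<zeta> = fst (W \<zeta> (\<tau> \<zeta>))" for \<zeta>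
    define zc where "zc \<zeta> = snd (snd (W \<zeta> (\<tau> \<zeta>)))" for \<zeta>
    have W\<tau>: "W \<zeta> (\<tau> \<zeta>) = (xc \<zeta>, 0, zc \<zeta>)" if "\<zeta> \<in> {za..zb}" for \<zeta>
      using \<tau>[OF that] by (simp add: S.crossing_def xc_def zc_def prod_eq_iff)
    have \<tau>T: "\<tau> \<zeta> \<in> {0..T}" if "\<zeta> \<in> {za..zb}" for \<zeta> using \<tau>[OF that] by (simp add: S.crossing_def)
    have zc_near: "\<bar>zc \<zeta> - \<zeta>\<bar> \<le> r" if "\<zeta> \<in> {za..zb}" for \<zeta>
      using cx(7)[OF r(1) rle(1) that W \<tau>T[OF that]] unfolding zc_def by (elim conjE)
    have xc_lip: "\<bar>xc \<zeta> - xc \<zeta>'\<bar> \<le> Cl * \<bar>\<zeta> - \<zeta>'\<bar>" "\<bar>(zc \<zeta> - zc \<zeta>') - (\<zeta> - \<zeta>')\<bar> \<le> \<bar>\<zeta> - \<zeta>'\<bar> / 2"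
      if "\<zeta> \<in> {za..zb}" "\<zeta>' \<in> {za..zb}" for \<zeta> \<zeta>'
    proof -
      note * = cl(5)[OF r(1) rle(2) that W W \<tau>[OF that(1)] \<tau>[OF that(2)]]
      show "\<bar>xc \<zeta> - xc \<zeta>'\<bar> \<le> Cl * \<bar>\<zeta> - \<zeta>'\<bar>" using conjunct1[OF *] unfolding xc_def .
      have "Cl * r \<le> 1 / 2" using r_mult(1) r(1) by (simp add: algebra_simps)
      then have "Cl * r * \<bar>\<zeta> - \<zeta>'\<bar> \<le> 1 / 2 * \<bar>\<zeta> - \<zeta>'\<bar>" by (rule mult_right_mono) simp
      then show "\<bar>(zc \<zeta> - zc \<zeta>') - (\<zeta> - \<zeta>')\<bar> \<le> \<bar>\<zeta> - \<zeta>'\<bar> / 2" using conjunct2[OF *] unfolding zc_def by linarith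
    qed
    have zc_expand: "\<bar>\<zeta> - \<zeta>'\<bar> \<le> 2 * \<bar>zc \<zeta> - zc \<zeta>'\<bar>" "\<bar>zc \<zeta> - zc \<zeta>'\<bar> \<le> 2 * \<bar>\<zeta> - \<zeta>'\<bar>"
      if "\<zeta> \<in> {za..zb}" "\<zeta>' \<in> {za..zb}" for \<zeta> \<zeta>'
    proof -
      have "\<bar>b\<bar> \<le> 2 * \<bar>a\<bar> \<and> \<bar>a\<bar> \<le> 2 * \<bar>b\<bar>" if "\<bar>a - b\<bar> \<le> \<bar>b\<bar> / 2" for a b :: real
        using that by (auto simp: abs_if field_simps split: if_splits)
      from this[OF xc_lip(2)[OF that]]
      show "\<bar>\<zeta> - \<zeta>'\<bar> \<le> 2 * \<bar>zc \<zeta> - zc \<zeta>'\<bar>" "\<bar>zc \<zeta> - zc \<zeta>'\<bar> \<le> 2 * \<bar>\<zeta> - \<zeta>'\<bar>" by simp_all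
    qed
    have cont: "continuous_on {za..zb} zc"
      by (rule lipschitz_imp_continuous_on_real[of 2]) (use zc_expand(2) in auto)
    have ends: "za \<in> {za..zb}" "zb \<in> {za..zb}" using zz by auto
    have ex: "\<exists>\<zeta>. \<zeta> \<in> {za..zb} \<and> zc \<zeta> = z" if "z \<in> {z1..z2}" for z
    proof -
      have "zc za \<le> z" "z \<le> zc zb" using zc_near[OF ends(1)] zc_near[OF ends(2)] rle(4,5) that by auto
      then have "\<exists>\<zeta>\<ge>za. \<zeta> \<le> zb \<and> zc \<zeta> = z" using zz cont by (intro IVT') auto
      then show ?thesis by auto
    qed
    define zi where "zi z = (SOME \<zeta>. \<zeta> \<in> {za..zb} \<and> zc \<zeta> = z)" for z
    have zi: "zi z \<in> {za..zb}" "zc (zi z) = z" if "z \<in> {z1..z2}" for z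
      using someI_ex[OF ex[OF that], folded zi_def] by simp_all
    have zi_eq: "zi z = \<zeta>" if "\<zeta> \<in> {za..zb}" "zc \<zeta> = z" "z \<in> {z1..z2}" for z \<zeta>
      using zc_expand(1)[OF zi(1)[OF that(3)] that(1)] zi(2)[OF that(3)] that(2) by simp
    have zi_near: "\<bar>zi z - z\<bar> \<le> r" if "z \<in> {z1..z2}" for z
      using zc_near[OF zi(1)[OF that]] zi(2)[OF that] by linarith
    define X where "X z = r ^ (2 * k) * xc (zi z)" for z
    have sub: "z \<in> {za..zb}" if "z \<in> {z1..z2}" for z using that z12 by auto
    have contX: "continuous_on {z1..z2} X"
      unfolding X_def
    proof (intro continuous_on_mult continuous_on_const lipschitz_imp_continuous_on_real[of "2 * Cl"])
      show "0 \<le> 2 * Cl" using cl by simp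
      fix z z' assume z: "z \<in> {z1..z2}" "z' \<in> {z1..z2}"
      have "\<bar>xc (zi z) - xc (zi z')\<bar> \<le> Cl * \<bar>zi z - zi z'\<bar>" by (rule xc_lip(1)) (use zi(1) z in auto)
      also have "\<dots> \<le> Cl * (2 * \<bar>z - z'\<bar>)"
        using zc_expand(1)[OF zi(1)[OF z(1)] zi(1)[OF z(2)]] zi(2)[OF z(1)] zi(2)[OF z(2)] cl(1) by (intro mult_left_mono) auto
      finally show "\<bar>xc (zi z) - xc (zi z')\<bar> \<le> 2 * Cl * \<bar>z - z'\<bar>" by simp
    qed
    \<comment> \<open>The orbit started at \<open>zi z\<close> but is compared with the limit orbit
      at z itself, within the distance r that \<open>sol_close\<close> admits.\<close>
    have est: "\<bar>X z - r ^ (2 * k) * eta k \<phi> Xp Xm z\<bar> \<le> r ^ (2 * k) * (Cx * r)" if z: "z \<in> {z1..z2}" for z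
    proof -
      have "\<bar>xc (zi z) - lam z * \<xi>\<bar> \<le> Cx * r"
        using cx(6)[OF r(1) rle(1) zi(1)[OF z] sub[OF z] zi_near[OF z] W \<tau>[OF zi(1)[OF z]]] unfolding xc_def by (elim conjE)
      then have "r ^ (2 * k) * \<bar>xc (zi z) - lam z * \<xi>\<bar> \<le> r ^ (2 * k) * (Cx * r)" using r by (intro mult_left_mono) auto
      then show ?thesis using r by (simp add: X_def eta_eq[OF sub[OF z]] right_diff_distrib[symmetric] abs_mult)
    qed
    have Wu: "(W \<zeta> has_vector_derivative V r (W \<zeta> s)) (at s within {0..\<tau> \<zeta>})" if "\<zeta> \<in> {za..zb}" "s \<in> {0..\<tau> \<zeta>}" for \<zeta> s
      by (rule S.sol_DERIV(1)[OF W]) (use that \<tau>T[OF that(1)] in auto)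
    have W0: "W \<zeta> 0 = sec r \<zeta>" for \<zeta> using W[of \<zeta>] by (simp add: S.sol_def)
    have "forward_continuation \<phi> Xp Xm {za..zb} \<rho> e (slow_manifold k {za..zb} rmax emax m e)
        \<inter> {(x, y, z). y = 0 \<and> z \<in> {z1..z2}} = (\<lambda>z. (X z, 0, z)) ` {z1..z2}" (is "?L = ?R")
    proof (intro equalityI subsetI)
      fix p assume p: "p \<in> ?L"
      then have py: "fst (snd p) = 0" and pz: "snd (snd p) \<in> {z1..z2}" by auto
      have eB: "e * (1 + Bm) \<le> d"
      proof -
        have "e * (1 + Bm) \<le> r * (1 + Bm)" using e_le Bm(1) by (intro mult_right_mono) auto
        then show ?thesis using r_mult(2) by linarith
      qed
      have pos: "0 < m (r', z, e') \<and> 0 < F1 e (- (r' ^ (2 * k)), r'\<^sup>2 * m (r', z, e'), z)"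
        if "(r', z, e') \<in> box" "r' ^ (2 * (2 * k - 1)) * e' = e" for r' z e'
        using e0(2)[OF that(1)] that(2) e_le rle(6) by simp
      obtain w t0 t1 \<zeta> where w: "\<zeta> \<in> {za..zb}" "t0 \<le> t1" "w t1 = p" "w t0 = chart2 r (sec r \<zeta>)"
        "\<And>t. t \<in> {t0..t1} \<Longrightarrow> (w has_vector_derivative SF e (w t)) (at t within {t0..t1})"
        "\<And>t. t \<in> {t0..t1} \<Longrightarrow> \<bar>fst (w t)\<bar> \<le> \<rho> \<and> \<bar>snd (snd (w t))\<bar> \<le> d"
        by (rule forward_continuation_reaches_sec[where r = r and Bm = Bm and p = p and \<rho> = \<rho>, folded e_def]; (rule that)?;
          (assumption | rule r(1) kr \<rho>(2) Bm(1) eB IntD1[OF p] py | (rule Bm(2) pos; assumption)))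
      have "w t1 = chart2 r (W \<zeta> (\<tau> \<zeta>))"
      proof (rule crossing_unique[where xm = "\<eta>0 / 2" and \<rho> = \<rho> and ?t0.0 = t0 and u = "W \<zeta>" and \<tau> = "\<tau> \<zeta>"])
        show "0 < r" "r \<le> 1" "0 < \<rho>" "\<rho> \<le> d" "M * \<rho> \<le> g0 / 2" "0 < \<eta>0 / 2" "t0 \<le> t1" using r rle \<rho> h0 w(2) by auto
        have "M * r\<^sup>2 \<le> M * r" using r2 M by (intro mult_left_mono) auto
        moreover have "0 < g0 * \<eta>0" using g0 h0 by simp
        moreover have "8 * (M * r) \<le> g0 * \<eta>0" using r_mult(4) by (simp only: mult_ac)
        moreover have "g0 / 2 * (\<eta>0 / 2) = (g0 * \<eta>0) / 4" by simp
        ultimately show "M * r\<^sup>2 < g0 / 2 * (\<eta>0 / 2)" by linarith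
        have "r * 1 \<le> r * (1 + Bm)" using r Bm(1) by (intro mult_left_mono) auto
        then show "r ^ (2 * (2 * k - 1)) \<le> d" using e_le r_mult(2) unfolding e_def by linarith
        show "0 \<le> \<tau> \<zeta>" using \<tau>T[OF w(1)] by simp
        show "(W \<zeta> has_vector_derivative V r (W \<zeta> s)) (at s within {0..\<tau> \<zeta>})" if "s \<in> {0..\<tau> \<zeta>}" for s
          by (rule Wu[OF w(1) that])
        show "0 < fst (snd (W \<zeta> s))" if "s \<in> {0..<\<tau> \<zeta>}" for s using \<tau>[OF w(1)] that by (simp add: S.crossing_def)
        show "fst (snd (W \<zeta> (\<tau> \<zeta>))) = 0" using W\<tau>[OF w(1)] by simp
        show "\<eta>0 / 2 \<le> fst (W \<zeta> (\<tau> \<zeta>))"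
          using cx(6)[OF r(1) rle(1) w(1) w(1) _ W \<tau>[OF w(1)]] r(1) by simp
        show "(w has_vector_derivative SF (r ^ (2 * (2 * k - 1))) (w t)) (at t within {t0..t1})" if "t \<in> {t0..t1}" for t
          using w(5)[OF that] unfolding e_def .
        show "\<bar>fst (w t)\<bar> \<le> \<rho> \<and> \<bar>snd (snd (w t))\<bar> \<le> d" if "t \<in> {t0..t1}" for t by (rule w(6)[OF that])
        show "w t0 = chart2 r (W \<zeta> 0)" using w(4) W0 by simp
        show "fst (snd (w t1)) = 0" using w(3) py by simp
      qed
      then have pe: "p = (r ^ (2 * k) * xc \<zeta>, 0, zc \<zeta>)" using w(3) by (simp add: W\<tau>[OF w(1)] chart2_def)
      then have "zc \<zeta> \<in> {z1..z2}" using pz by simp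
      moreover from this have "zi (zc \<zeta>) = \<zeta>" using w(1) by (intro zi_eq) auto
      ultimately show "p \<in> ?R" unfolding pe by (intro image_eqI[of _ _ "zc \<zeta>"]) (simp_all add: X_def)
    next
      fix p assume "p \<in> ?R"
      then obtain z where z: "z \<in> {z1..z2}" "p = (X z, 0, z)" by auto
      define \<zeta> where "\<zeta> = zi z"
      have \<zeta>: "\<zeta> \<in> {za..zb}" "zc \<zeta> = z" using zi[OF z(1)] by (auto simp: \<zeta>_def)
      have near: "\<bar>zc \<zeta> - \<zeta>\<bar> \<le> r" by (rule zc_near[OF \<zeta>(1)])
      have "chart2 r (W \<zeta> (\<tau> \<zeta>)) \<in> forward_continuation \<phi> Xp Xm {za..zb} \<rho> e (slow_manifold k {za..zb} rmax emax m e)"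
        unfolding e_def
      proof (rule forward_continuation_sec[OF r(1) kr \<rho>(2) _ \<zeta>(1) Wu[OF \<zeta>(1)] W0])
        show "0 \<le> \<tau> \<zeta>" using \<tau>T[OF \<zeta>(1)] by simp
        fix s assume s: "s \<in> {0..\<tau> \<zeta>}"
        then have "s \<in> {0..T}" using \<tau>T[OF \<zeta>(1)] by auto
        note b = cx(7)[OF r(1) rle(1) \<zeta>(1) W this]
        have 1: "r ^ (2 * k) * \<bar>fst (W \<zeta> s)\<bar> \<le> r * (B + 2)" using b r rk_le by (intro mult_mono) auto
        have "r\<^sup>2 * \<bar>fst (snd (W \<zeta> s))\<bar> \<le> 1 * (B + 1)" using b r2 rle(3) by (intro mult_mono) auto
        then have "\<bar>r\<^sup>2 * fst (snd (W \<zeta> s))\<bar> \<le> B + 1" using r(1) by (simp add: abs_mult)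
        then have "\<bar>r\<^sup>2 * fst (snd (W \<zeta> s)) - 1\<bar> \<le> B + 2" by linarith
        then have "e * \<bar>r\<^sup>2 * fst (snd (W \<zeta> s)) - 1\<bar> \<le> r * (B + 2)" using e_le r(1) by (intro mult_mono) auto
        then have 2: "\<bar>e * (r\<^sup>2 * fst (snd (W \<zeta> s)) - 1)\<bar> \<le> r * (B + 2)" using e_pos by (simp add: abs_mult)
        \<comment> \<open>The starting parameter is within r of z, and the orbit within r of its
          starting parameter; hence the margin 2r.\<close>
        have 3: "snd (snd (W \<zeta> s)) \<in> {za..zb}" if bb: "za + 2 * r \<le> z" "z \<le> zb - 2 * r"
          using b near \<zeta>(2) bb by auto
        show "r ^ (2 * k) * \<bar>fst (W \<zeta> s)\<bar> \<le> \<rho> \<and>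
          \<bar>r ^ (2 * (2 * k - 1)) * (r\<^sup>2 * fst (snd (W \<zeta> s)) - 1)\<bar> \<le> \<rho> \<and> snd (snd (W \<zeta> s)) \<in> {za..zb}"
          using 1 2 3 r_mult(3) rle(4,5) z(1) unfolding e_def by auto
      qed
      moreover have "chart2 r (W \<zeta> (\<tau> \<zeta>)) = p" unfolding W\<tau>[OF \<zeta>(1)] z(2) by (simp add: chart2_def X_def \<zeta>(2) \<zeta>_def[symmetric])
      ultimately show "p \<in> ?L" using z by simp
    qed
    then show ?thesis unfolding e_def[symmetric]
      by (intro exI[of _ X] conjI contX ballI est)
  qed
  show ?thesis
    by (rule that[OF cx(1) r0_pos _ main]) (use r0_le(1) cx(3) in auto)
qed

text \<open>Passes from r to \<open>\<epsilon>\<close> by r = \<epsilon>^(1/(2(2k-1))), which turns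
  \<open>r ^ (2 * k)\<close> into the leading power. \<open>E\<close> is defined as the remainder.
  For small \<open>\<epsilon>\<close> its bound \<open>C * r\<close> is below the singular power of
  z, which costs the \<open>+ 1\<close> in \<open>K + 1\<close>.\<close>

lemma crossing_curve:
  assumes \<rho>: "0 < \<rho>" "\<rho> \<le> d" "M * \<rho> \<le> g0 / 2" and z12: "za < z1" "z1 \<le> z2" "z2 < zb"
    and eta: "\<And>z. z \<in> {za..zb} \<Longrightarrow> \<bar>eta k \<phi> Xp Xm z\<bar> \<le> K * (- phi_lead k \<phi> * z) powr (- 1 / (2 * real k - 1))"
  shows "\<exists>\<epsilon>0>0. \<exists>K1. \<exists>X E :: real \<Rightarrow> real \<Rightarrow> real. \<forall>\<epsilon>\<in>{0<..<\<epsilon>0}.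
            continuous_on {z1..z2} (X \<epsilon>) \<and>
            forward_continuation \<phi> Xp Xm {za..zb} \<rho> \<epsilon> (slow_manifold k {za..zb} rmax emax m \<epsilon>)
              \<inter> {(x, y, z). y = 0 \<and> z \<in> {z1..z2}} = (\<lambda>z. (X \<epsilon> z, 0, z)) ` {z1..z2} \<and>
            (\<forall>z\<in>{z1..z2}.
               X \<epsilon> z = \<epsilon> powr (real k / (2 * real k - 1)) * (eta k \<phi> Xp Xm z + E \<epsilon> z) \<and>
               \<bar>E \<epsilon> z\<bar> \<le> K1 * \<epsilon> powr (1 / (2 * (2 * real k - 1))) \<and>
               \<bar>X \<epsilon> z\<bar> \<le> (K + 1) * (\<epsilon> powr (real k / (2 * real k - 1)) *
                 (- phi_lead k \<phi> * z) powr (- 1 / (2 * real k - 1))))"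
proof -
  define pw where "pw z = (- phi_lead k \<phi> * z) powr (- 1 / (2 * real k - 1))" for z
  define n where "n = 2 * (2 * k - 1)"
  have n: "0 < n" "real n = 2 * (2 * real k - 1)" using k by (auto simp: n_def of_nat_diff)
  obtain C r0 where C: "0 \<le> C" "0 < r0" "r0 \<le> 1"
    "\<And>r. \<lbrakk>0 < r; r \<le> r0\<rbrakk> \<Longrightarrow> \<exists>X. continuous_on {z1..z2} X \<and>
      forward_continuation \<phi> Xp Xm {za..zb} \<rho> (r ^ n) (slow_manifold k {za..zb} rmax emax m (r ^ n))
        \<inter> {(x, y, z). y = 0 \<and> z \<in> {z1..z2}} = (\<lambda>z. (X z, 0, z)) ` {z1..z2} \<and>
      (\<forall>z\<in>{z1..z2}. \<bar>X z - r ^ (2 * k) * eta k \<phi> Xp Xm z\<bar> \<le> r ^ (2 * k) * (C * r))"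
    by (rule crossing_curve_chart2[OF \<rho> z12, folded n_def]; (rule that)?; assumption)
  have za: "za < 0" using zz by simp
  have pa: "0 < - phi_lead k \<phi> * za" using a za by (simp add: mult_pos_neg)
  \<comment> \<open>The exponent is negative, so the power is smallest at the end of the range
    farthest from the origin.\<close>
  have pw_ge: "pw za \<le> pw z" if z: "z \<in> {z1..z2}" for z
    unfolding pw_def
  proof (rule powr_mono2')
    show "- 1 / (2 * real k - 1) \<le> 0" using k by (simp add: divide_nonpos_pos)
    show "0 < - phi_lead k \<phi> * z" using z z12 zz a by (simp add: mult_pos_neg)
    show "- phi_lead k \<phi> * z \<le> - phi_lead k \<phi> * za" using z z12 a by simp
  qed
  have pw0: "0 < pw za" unfolding pw_def powr_gt_zero by (rule less_imp_neq[OF pa, symmetric])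
  define r1 where "r1 = min r0 (pw za / (C + 1))"
  have r1: "0 < r1" "r1 \<le> r0" "C * r1 \<le> pw za"
  proof -
    show "0 < r1" "r1 \<le> r0" using C pw0 by (auto simp: r1_def)
    have "r1 \<le> pw za / (C + 1)" by (simp add: r1_def)
    then have "r1 * (C + 1) \<le> pw za" using C(1) by (simp add: pos_le_divide_eq)
    then show "C * r1 \<le> pw za" using \<open>0 < r1\<close> by (simp add: algebra_simps)
  qed
  define r where "r \<epsilon> = \<epsilon> powr (1 / (2 * (2 * real k - 1)))" for \<epsilon> :: real
  have k1: "2 * real k - 1 \<noteq> 0" using k by simp
  have r: "0 < r \<epsilon>" "r \<epsilon> ^ n = \<epsilon>" "r \<epsilon> ^ (2 * k) = \<epsilon> powr (real k / (2 * real k - 1))" if "0 < \<epsilon>" for \<epsilon>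
  proof -
    show "0 < r \<epsilon>" using that by (simp add: r_def)
    have *: "r \<epsilon> ^ j = \<epsilon> powr (real j / (2 * (2 * real k - 1)))" for j :: nat
      using that unfolding r_def by (subst powr_realpow[symmetric]) (auto simp: powr_powr)
    show "r \<epsilon> ^ n = \<epsilon>" unfolding * n(2) using that k1 by simp
    have "real (2 * k) / (2 * (2 * real k - 1)) = real k / (2 * real k - 1)"
      by (simp only: of_nat_mult of_nat_numeral mult_divide_mult_cancel_left_if) simp
    then show "r \<epsilon> ^ (2 * k) = \<epsilon> powr (real k / (2 * real k - 1))" unfolding * by (rule arg_cong)
  qed
  define good where "good \<epsilon> X \<longleftrightarrow> continuous_on {z1..z2} X \<and>
      forward_continuation \<phi> Xp Xm {za..zb} \<rho> \<epsilon> (slow_manifold k {za..zb} rmax emax m \<epsilon>)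
        \<inter> {(x, y, z). y = 0 \<and> z \<in> {z1..z2}} = (\<lambda>z. (X z, 0, z)) ` {z1..z2} \<and>
      (\<forall>z\<in>{z1..z2}. \<bar>X z - r \<epsilon> ^ (2 * k) * eta k \<phi> Xp Xm z\<bar> \<le> r \<epsilon> ^ (2 * k) * (C * r \<epsilon>))" for \<epsilon> and X :: "real \<Rightarrow> real"
  define X where "X \<epsilon> = (SOME X. good \<epsilon> X)" for \<epsilon>
  define E where "E \<epsilon> z = X \<epsilon> z / r \<epsilon> ^ (2 * k) - eta k \<phi> Xp Xm z" for \<epsilon> z
  have main: "continuous_on {z1..z2} (X \<epsilon>) \<and>
            forward_continuation \<phi> Xp Xm {za..zb} \<rho> \<epsilon> (slow_manifold k {za..zb} rmax emax m \<epsilon>)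
              \<inter> {(x, y, z). y = 0 \<and> z \<in> {z1..z2}} = (\<lambda>z. (X \<epsilon> z, 0, z)) ` {z1..z2} \<and>
            (\<forall>z\<in>{z1..z2}.
               X \<epsilon> z = \<epsilon> powr (real k / (2 * real k - 1)) * (eta k \<phi> Xp Xm z + E \<epsilon> z) \<and>
               \<bar>E \<epsilon> z\<bar> \<le> C * \<epsilon> powr (1 / (2 * (2 * real k - 1))) \<and>
               \<bar>X \<epsilon> z\<bar> \<le> (K + 1) * (\<epsilon> powr (real k / (2 * real k - 1)) * pw z))"
    if \<epsilon>: "\<epsilon> \<in> {0<..<r1 ^ n}" for \<epsilon>
  proof -
    have e0: "0 < \<epsilon>" using \<epsilon> by simp
    note re = r[OF e0]
    have "r \<epsilon> < r1"
      by (rule power_less_imp_less_base[of _ n]) (use \<epsilon> re r1 in auto)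
    then have le: "r \<epsilon> \<le> r0" "C * r \<epsilon> \<le> pw za"
      using r1(2) order_trans[OF mult_left_mono[OF less_imp_le C(1)] r1(3)] by auto
    have "\<exists>X. good \<epsilon> X" using C(4)[OF re(1) le(1)] unfolding re(2) good_def .
    then have g: "good \<epsilon> (X \<epsilon>)" unfolding X_def by (rule someI_ex)
    define q where "q = r \<epsilon> ^ (2 * k)"
    have q: "0 < q" using re(1) by (simp add: q_def)
    have est: "X \<epsilon> z = q * (eta k \<phi> Xp Xm z + E \<epsilon> z) \<and> \<bar>E \<epsilon> z\<bar> \<le> C * r \<epsilon> \<and> \<bar>X \<epsilon> z\<bar> \<le> (K + 1) * (q * pw z)"
      if z: "z \<in> {z1..z2}" for z
    proof -
      have Xq: "X \<epsilon> z = q * (eta k \<phi> Xp Xm z + E \<epsilon> z)" using q by (simp add: E_def q_def[symmetric])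
      have "\<bar>X \<epsilon> z - q * eta k \<phi> Xp Xm z\<bar> \<le> q * (C * r \<epsilon>)" using g z unfolding good_def q_def by blast
      then have "q * \<bar>E \<epsilon> z\<bar> \<le> q * (C * r \<epsilon>)" using q unfolding Xq by (simp add: distrib_left abs_mult)
      then have E: "\<bar>E \<epsilon> z\<bar> \<le> C * r \<epsilon>" using q by simp
      have zi: "z \<in> {za..zb}" using z z12 by auto
      have "\<bar>eta k \<phi> Xp Xm z + E \<epsilon> z\<bar> \<le> K * pw z + pw z"
        using eta[OF zi, folded pw_def] E le(2) pw_ge[OF z] by linarith
      then have "q * \<bar>eta k \<phi> Xp Xm z + E \<epsilon> z\<bar> \<le> q * (K * pw z + pw z)" using q by (intro mult_left_mono) auto
      moreover have "q * (K * pw z + pw z) = (K + 1) * (q * pw z)" by (simp add: algebra_simps)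
      moreover have "\<bar>X \<epsilon> z\<bar> = q * \<bar>eta k \<phi> Xp Xm z + E \<epsilon> z\<bar>" using q unfolding Xq by (simp add: abs_mult)
      ultimately show ?thesis using Xq E by simp
    qed
    note g' = g[unfolded good_def]
    show ?thesis unfolding re(3)[symmetric] q_def[symmetric] r_def[symmetric]
      by (rule conjI[OF conjunct1[OF g'] conjI[OF conjunct1[OF conjunct2[OF g']] ballI[OF est]]])
  qed
  show ?thesis unfolding pw_def[symmetric]
    by (rule exI[of _ "r1 ^ n"], rule conjI, use r1(1) in simp, rule exI[of _ C], rule exI[of _ X], rule exI[of _ E], rule ballI, rule main)
qed

end

theorem theorem6p2:
  fixes k :: nat
    and a b c \<alpha> \<beta> \<gamma> :: real
    and \<phi> :: "real \<Rightarrow> real"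
    and Xp Xm :: "real \<times> real \<times> real \<Rightarrow> real \<times> real \<times> real"
  assumes k: "2 \<le> k"
    and b: "b \<noteq> 0"
    and visible: "\<beta> > 0"
    and reg: "regularizing_function k \<phi>"
    and normal_form: "two_fold_normal_form a b c \<alpha> \<beta> \<gamma> Xp Xm"
  shows "\<exists>\<rho>0>0. \<exists>K.
    (\<exists>R :: real \<Rightarrow> real. \<forall>z\<in>{-\<rho>0..<0}.
       \<bar>R z\<bar> \<le> K * \<bar>z\<bar> \<and>
       eta k \<phi> Xp Xm z =
         2 powr (1 / (2 * real k - 1)) *
         (\<bar>b\<bar> powr (- 1 / (2 * real k - 1)) * \<bar>\<beta>\<bar> powr (- (real k - 1) / (2 * real k - 1)) + R z) *
         (- phi_lead k \<phi> * z) powr (- 1 / (2 * real k - 1)) * eta_tilde k) \<and>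
    (\<forall>\<rho> C. 0 < \<rho> \<and> \<rho> \<le> \<rho>0 \<and> 1 / \<rho> < C \<longrightarrow>
      (\<exists>\<sigma>>0. \<forall>rmax emax m.
        0 < rmax \<and> rmax \<le> \<sigma> \<and> 0 < emax \<and> emax \<le> \<sigma> \<and>
        center_manifold k \<phi> Xp Xm {-\<rho>..-1/C} rmax emax m \<longrightarrow>
        (\<forall>z1 z2. -\<rho> < z1 \<and> z1 \<le> z2 \<and> z2 < -1/C \<longrightarrow>
          (\<exists>\<epsilon>0>0. \<exists>K1. \<exists>X E :: real \<Rightarrow> real \<Rightarrow> real. \<forall>\<epsilon>\<in>{0<..<\<epsilon>0}.
            continuous_on {z1..z2} (X \<epsilon>) \<and>
            forward_continuation \<phi> Xp Xm {-\<rho>..-1/C} \<rho> \<epsilon>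
                (slow_manifold k {-\<rho>..-1/C} rmax emax m \<epsilon>)
              \<inter> {(x, y, z). y = 0 \<and> z \<in> {z1..z2}} = (\<lambda>z. (X \<epsilon> z, 0, z)) ` {z1..z2} \<and>
            (\<forall>z\<in>{z1..z2}.
               X \<epsilon> z = \<epsilon> powr (real k / (2 * real k - 1)) * (eta k \<phi> Xp Xm z + E \<epsilon> z) \<and>
               \<bar>E \<epsilon> z\<bar> \<le> K1 * \<epsilon> powr (1 / (2 * (2 * real k - 1))) \<and>
               \<bar>X \<epsilon> z\<bar> \<le> K * (\<epsilon> powr (real k / (2 * real k - 1)) *
                 (- phi_lead k \<phi> * z) powr (- 1 / (2 * real k - 1))))))))"
proof -
  obtain d M where fs: "fold_system k \<phi> (phi_lead k \<phi>) d M (\<beta> / 2) (\<bar>b\<bar> / 2)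
      (\<lambda>p. fst (Xp (clamp3 d p))) (\<lambda>p. fst (snd (Xp (clamp3 d p)))) (\<lambda>p. snd (snd (Xp (clamp3 d p))))
      (\<lambda>p. fst (Xm (clamp3 d p))) (\<lambda>p. fst (snd (Xm (clamp3 d p)))) (\<lambda>p. snd (snd (Xm (clamp3 d p)))) (fold_G Xm)"
    and co: "\<And>z. \<bar>z\<bar> \<le> d \<Longrightarrow> \<bar>fold_A Xm z - 1\<bar> \<le> M * \<bar>z\<bar>"
    "\<And>z. \<bar>z\<bar> \<le> d \<Longrightarrow> \<bar>fold_B Xp z - \<bar>b\<bar> * z\<bar> \<le> M * z\<^sup>2"
    "\<And>z. \<bar>z\<bar> \<le> d \<Longrightarrow> \<bar>fold_G Xm z - \<beta>\<bar> \<le> M * \<bar>z\<bar>"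
    by (rule two_fold_normal_form_fold_system[OF k b visible reg normal_form]; (rule that)?; assumption)
  have dM: "0 < d" "d \<le> 1" "1 \<le> M" "0 < phi_lead k \<phi>"
    using fs by (simp_all add: fold_system_def)
  have M0: "0 \<le> M" using dM by simp
  obtain \<delta> K R where \<delta>: "0 < \<delta>" "\<delta> \<le> d" "0 < K"
    and R: "\<And>z. z \<in> {-\<delta>..<0} \<Longrightarrow> \<bar>R z\<bar> \<le> K * \<bar>z\<bar> \<and>
       eta k \<phi> Xp Xm z = 2 powr (1 / (2 * real k - 1)) *
         (\<bar>b\<bar> powr (- 1 / (2 * real k - 1)) * \<bar>\<beta>\<bar> powr (- (real k - 1) / (2 * real k - 1)) + R z) *
         (- phi_lead k \<phi> * z) powr (- 1 / (2 * real k - 1)) * eta_tilde k \<and>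
       \<bar>eta k \<phi> Xp Xm z\<bar> \<le> K * (- phi_lead k \<phi> * z) powr (- 1 / (2 * real k - 1))"
    by (rule eta_expansion[OF k dM(4) b visible dM(1) M0 co]; (rule that)?; assumption)
  \<comment> \<open>\<open>\<delta>\<close> is the range of the expansion of \<open>\<eta>\<close>,
    \<open>d / 2\<close> keeps the z-range strictly inside the cube, and the last entry is the
    condition \<open>M * \<rho> \<le> g0 / 2\<close> of the crossing argument with g0 =
    \<beta>/2.\<close>
  define \<rho>0 where "\<rho>0 = min \<delta> (min (d / 2) (\<beta> / 2 / (2 * M)))"
  have \<rho>0: "0 < \<rho>0" "\<rho>0 \<le> \<delta>" "\<rho>0 \<le> d / 2" "\<rho>0 \<le> \<beta> / 2 / (2 * M)"
    using \<delta> dM visible by (auto simp: \<rho>0_def)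
  have curve: "\<exists>\<epsilon>0>0. \<exists>K1. \<exists>X E :: real \<Rightarrow> real \<Rightarrow> real. \<forall>\<epsilon>\<in>{0<..<\<epsilon>0}.
            continuous_on {z1..z2} (X \<epsilon>) \<and>
            forward_continuation \<phi> Xp Xm {-\<rho>..-1/C} \<rho> \<epsilon>
                (slow_manifold k {-\<rho>..-1/C} rmax emax m \<epsilon>)
              \<inter> {(x, y, z). y = 0 \<and> z \<in> {z1..z2}} = (\<lambda>z. (X \<epsilon> z, 0, z)) ` {z1..z2} \<and>
            (\<forall>z\<in>{z1..z2}.
               X \<epsilon> z = \<epsilon> powr (real k / (2 * real k - 1)) * (eta k \<phi> Xp Xm z + E \<epsilon> z) \<and>
               \<bar>E \<epsilon> z\<bar> \<le> K1 * \<epsilon> powr (1 / (2 * (2 * real k - 1))) \<and>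
               \<bar>X \<epsilon> z\<bar> \<le> (K + 1) * (\<epsilon> powr (real k / (2 * real k - 1)) *
                 (- phi_lead k \<phi> * z) powr (- 1 / (2 * real k - 1))))"
    if \<rho>: "0 < \<rho>" "\<rho> \<le> \<rho>0" "1 / \<rho> < C" and r: "0 < rmax" "rmax \<le> min 1 (min d (\<bar>b\<bar> / 2 * (1 / C) / (8 * M * (M + 1))))"
      and e: "0 < emax" and cm: "center_manifold k \<phi> Xp Xm {-\<rho>..-1/C} rmax emax m"
      and z: "-\<rho> < z1" "z1 \<le> z2" "z2 < -1/C" for \<rho> C rmax emax m z1 z2
  proof -
    have C0: "0 < C" using \<rho>(1,3) by (meson less_trans zero_less_divide_1_iff)
    have "1 / C < \<rho>" using \<rho>(1,3) C0 by (simp add: field_simps)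
    then have zC: "- \<rho> < - 1 / C" "- 1 / C < 0" using C0 by auto
    have rr: "rmax \<le> 1" "rmax \<le> d" "rmax \<le> \<bar>b\<bar> / 2 * (1 / C) / (8 * M * (M + 1))" using r(2) by simp_all
    have "rmax ^ (2 * k) \<le> rmax ^ 1" using r(1) rr(1) k by (intro power_decreasing) auto
    then have rk: "rmax ^ (2 * k) \<le> rmax" by simp
    interpret fold_center k \<phi> d M "\<beta> / 2" "\<bar>b\<bar> / 2" Xp Xm "- \<rho>" "- 1 / C" rmax emax m
    proof (intro fold_center.intro fold_chart.intro fs fold_center_axioms.intro)
      show "- d < - \<rho>" using \<rho>(2) \<rho>0(3) dM(1) by linarith
      show "rmax ^ (2 * k) \<le> d" using rk rr(2) by simp
      have p: "0 < 8 * M * (M + 1)" using dM(3) by simp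
      have "rmax ^ (2 * k) \<le> \<bar>b\<bar> / 2 * (1 / C) / (8 * M * (M + 1))" using rk rr(3) by simp
      then have "rmax ^ (2 * k) * (8 * M * (M + 1)) \<le> \<bar>b\<bar> / 2 * (1 / C)" using p by (simp only: pos_le_divide_eq)
      then show "8 * M * (M + 1) * rmax ^ (2 * k) \<le> \<bar>b\<bar> / 2 * (- (- 1 / C))" by (simp add: mult.commute)
    qed (use zC r(1) rr(1) e cm in auto)
    show ?thesis
    proof (rule crossing_curve)
      show "0 < \<rho>" by fact
      show "\<rho> \<le> d" using \<rho>(2) \<rho>0(3) dM(1) by linarith
      have "\<rho> \<le> \<beta> / 2 / (2 * M)" using \<rho>(2) \<rho>0(4) by simp
      then show "M * \<rho> \<le> \<beta> / 2 / 2" using dM(3) by (simp add: field_simps)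
      show "\<bar>eta k \<phi> Xp Xm z\<bar> \<le> K * (- phi_lead k \<phi> * z) powr (- 1 / (2 * real k - 1))" if "z \<in> {- \<rho>..- 1 / C}" for z
      proof -
        have "- \<rho> \<le> z" "z \<le> - 1 / C" using that by (simp_all only: atLeastAtMost_iff)
        then have "- \<delta> \<le> z" using \<rho>(2) \<rho>0(2) by linarith
        moreover have "z < 0" by (rule order.strict_trans1[OF \<open>z \<le> - 1 / C\<close> zC(2)])
        ultimately have "z \<in> {-\<delta>..<0}" by simp
        from R[OF this] show ?thesis by (elim conjE)
      qed
    qed fact+
  qed
  have expansion: "\<bar>R z\<bar> \<le> (K + 1) * \<bar>z\<bar> \<and>
       eta k \<phi> Xp Xm z =
         2 powr (1 / (2 * real k - 1)) *
         (\<bar>b\<bar> powr (- 1 / (2 * real k - 1)) * \<bar>\<beta>\<bar> powr (- (real k - 1) / (2 * real k - 1)) + R z) *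
         (- phi_lead k \<phi> * z) powr (- 1 / (2 * real k - 1)) * eta_tilde k"
    if z: "z \<in> {-\<rho>0..<0}" for z
  proof -
    have "z \<in> {-\<delta>..<0}" using z \<rho>0(2) by auto
    note * = R[OF this]
    have "\<bar>R z\<bar> \<le> (K + 1) * \<bar>z\<bar>" using conjunct1[OF *] by (simp add: distrib_right)
    then show ?thesis using conjunct1[OF conjunct2[OF *]] by (rule conjI)
  qed
  \<comment> \<open>The bound on \<open>rmax\<close> depends on C: at z = -1/C, the end of the range
    nearest the origin, the guaranteed size of \<open>fold_B\<close> is smallest, and
    \<open>rmax\<close> has to be small against it.\<close>
  have \<sigma>: "0 < min 1 (min d (\<bar>b\<bar> / 2 * (1 / C) / (8 * M * (M + 1))))" if "0 < \<rho>" "1 / \<rho> < C" for \<rho> C :: real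
  proof -
    have "0 < C" using that by (meson less_trans zero_less_divide_1_iff)
    then have "0 < \<bar>b\<bar> / 2 * (1 / C) / (8 * M * (M + 1))" using b dM(3) by (intro divide_pos_pos mult_pos_pos) auto
    then show ?thesis using dM(1) by simp
  qed
  show ?thesis
  \<comment> \<open>One constant serves both claims: \<open>K + 1\<close> is needed for the curve
    and also dominates the \<open>K\<close> of the expansion.\<close>
  proof (rule exI[of _ \<rho>0], rule conjI[OF \<rho>0(1)], rule exI[of _ "K + 1"], rule conjI)
    show "\<exists>R :: real \<Rightarrow> real. \<forall>z\<in>{-\<rho>0..<0}.
       \<bar>R z\<bar> \<le> (K + 1) * \<bar>z\<bar> \<and>
       eta k \<phi> Xp Xm z =
         2 powr (1 / (2 * real k - 1)) *
         (\<bar>b\<bar> powr (- 1 / (2 * real k - 1)) * \<bar>\<beta>\<bar> powr (- (real k - 1) / (2 * real k - 1)) + R z) *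
         (- phi_lead k \<phi> * z) powr (- 1 / (2 * real k - 1)) * eta_tilde k"
      by (rule exI[of _ R], rule ballI, rule expansion)
  qed (rule allI, rule allI, rule impI, (erule conjE)+, rule exI, rule conjI, rule \<sigma>, assumption+,
      (rule allI)+, rule impI, (erule conjE)+, (rule allI)+, rule impI, (erule conjE)+, rule curve; assumption)
qed

end
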